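(* Let $X$ be an algebra for the operad $\mathcal{C}_1$ of little 1-cubes. Then the fundamental 2-groupoid $\Pi_2X$ has the structure of a monoidal bicategory.
   Context: Let $J=(0,1)$. The little 1-cubes operad $\mathcal{C}_1$ has as $\mathcal{C}_1(k)$ the space of $k$-tuples of maps $J\to J$ of the form $t\mapsto(y-x)t+x$, $0\le x<y\le1$, with pairwise disjoint images; $\mathcal{C}_1(0)$ is a point; operad multiplication is composition of maps and $\Sigma_k$ permutes the entries. Algebras are in (based) spaces in the usual sense: compatible maps $\mathcal{C}_1(k)\times X^k\to X$, the basepoint being given by $\mathcal{C}_1(0)$. For a space $X$, $\Pi_2X$ is the bicategory with objects the points of $X$, 1-cells the paths $[0,1]\to X$ (composed by concatenation at double speed, identities constant paths), 2-cells the homotopy classes, rel boundary, of endpoint-fixing homotopies between paths, with the usual reparametrization constraints. A monoidal bicategory is a one-object tricategory in algebraic form: a bicategory with a weak functor $\otimes$, a unit object, associativity and unit pseudonatural adjoint equivalences, and invertible modifications $\pi,\mu,\lambda,\rho$ satisfying the tricategory axioms. *)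

theory Defs
  imports "HOL-Analysis.Analysis"
begin

section \<open>Bicategories\<close>

text \<open>
  The operations are total functions that are only constrained on the carriers. Compositions are
  written in functional order: in \<open>g \<odot> f\<close>, \<open>\<beta> \<cdot> \<alpha>\<close> and \<open>\<beta> \<star> \<alpha>\<close> the right factor comes first. The
  constraint cells are \<open>asc h g f : (h \<odot> g) \<odot> f \<Rightarrow> h \<odot> (g \<odot> f)\<close>, \<open>lun f : 1 \<odot> f \<Rightarrow> f\<close> and
  \<open>run f : f \<odot> 1 \<Rightarrow> f\<close>.
\<close>

record ('o, 'f, 't) bicat =
  Ob :: "'o set"
  Arr :: "'f set"
  Cell :: "'t set"
  src :: "'f \<Rightarrow> 'o"
  trg :: "'f \<Rightarrow> 'o"
  dom2 :: "'t \<Rightarrow> 'f"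
  cod2 :: "'t \<Rightarrow> 'f"
  id1 :: "'o \<Rightarrow> 'f"
  cmp1 :: "'f \<Rightarrow> 'f \<Rightarrow> 'f"  (infixr "\<odot>\<index>" 75)
  id2 :: "'f \<Rightarrow> 't"
  vcmp :: "'t \<Rightarrow> 't \<Rightarrow> 't"  (infixl "\<cdot>\<index>" 65)
  hcmp :: "'t \<Rightarrow> 't \<Rightarrow> 't"  (infixr "\<star>\<index>" 70)
  asc :: "'f \<Rightarrow> 'f \<Rightarrow> 'f \<Rightarrow> 't"
  lun :: "'f \<Rightarrow> 't"
  run :: "'f \<Rightarrow> 't"

definition hom1 :: "('o, 'f, 't) bicat \<Rightarrow> 'o \<Rightarrow> 'o \<Rightarrow> 'f set" where
  "hom1 B a b = {f \<in> Arr B. src B f = a \<and> trg B f = b}"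

definition hom2 :: "('o, 'f, 't) bicat \<Rightarrow> 'f \<Rightarrow> 'f \<Rightarrow> 't set" where
  "hom2 B f g = {\<alpha> \<in> Cell B. dom2 B \<alpha> = f \<and> cod2 B \<alpha> = g}"

definition inverse2 :: "('o, 'f, 't) bicat \<Rightarrow> 't \<Rightarrow> 't \<Rightarrow> bool" where
  "inverse2 B \<alpha> \<beta> \<longleftrightarrow>
     \<alpha> \<in> Cell B \<and> \<beta> \<in> hom2 B (cod2 B \<alpha>) (dom2 B \<alpha>) \<and>
     \<beta> \<cdot>\<^bsub>B\<^esub> \<alpha> = id2 B (dom2 B \<alpha>) \<and> \<alpha> \<cdot>\<^bsub>B\<^esub> \<beta> = id2 B (cod2 B \<alpha>)"

definition iso2 :: "('o, 'f, 't) bicat \<Rightarrow> 't \<Rightarrow> bool" where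
  "iso2 B \<alpha> \<longleftrightarrow> (\<exists>\<beta>. inverse2 B \<alpha> \<beta>)"

definition inv2 :: "('o, 'f, 't) bicat \<Rightarrow> 't \<Rightarrow> 't" where
  "inv2 B \<alpha> = (THE \<beta>. inverse2 B \<alpha> \<beta>)"

definition wl :: "('o, 'f, 't) bicat \<Rightarrow> 'f \<Rightarrow> 't \<Rightarrow> 't"  (infixr "\<rhd>\<index>" 70) where
  "f \<rhd>\<^bsub>B\<^esub> \<alpha> = id2 B f \<star>\<^bsub>B\<^esub> \<alpha>"

definition wr :: "('o, 'f, 't) bicat \<Rightarrow> 't \<Rightarrow> 'f \<Rightarrow> 't"  (infixl "\<lhd>\<index>" 70) where
  "\<alpha> \<lhd>\<^bsub>B\<^esub> f = \<alpha> \<star>\<^bsub>B\<^esub> id2 B f"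

locale bicategory =
  fixes B :: "('o, 'f, 't) bicat" (structure)
  assumes src_Ob: "f \<in> Arr B \<Longrightarrow> src B f \<in> Ob B"
    and trg_Ob: "f \<in> Arr B \<Longrightarrow> trg B f \<in> Ob B"
    and dom2_Arr: "\<alpha> \<in> Cell B \<Longrightarrow> dom2 B \<alpha> \<in> Arr B"
    and cod2_Arr: "\<alpha> \<in> Cell B \<Longrightarrow> cod2 B \<alpha> \<in> Arr B"
    and parallel_src: "\<alpha> \<in> Cell B \<Longrightarrow> src B (dom2 B \<alpha>) = src B (cod2 B \<alpha>)"
    and parallel_trg: "\<alpha> \<in> Cell B \<Longrightarrow> trg B (dom2 B \<alpha>) = trg B (cod2 B \<alpha>)"
    and id1_hom: "a \<in> Ob B \<Longrightarrow> id1 B a \<in> hom1 B a a"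
    and cmp1_hom: "\<lbrakk>f \<in> hom1 B a b; g \<in> hom1 B b c\<rbrakk> \<Longrightarrow> g \<odot> f \<in> hom1 B a c"
    and id2_hom: "f \<in> Arr B \<Longrightarrow> id2 B f \<in> hom2 B f f"
    and vcmp_hom: "\<lbrakk>\<alpha> \<in> hom2 B f g; \<beta> \<in> hom2 B g h\<rbrakk> \<Longrightarrow> \<beta> \<cdot> \<alpha> \<in> hom2 B f h"
    and hcmp_hom: "\<lbrakk>\<alpha> \<in> hom2 B f f'; \<beta> \<in> hom2 B g g'; trg B f = src B g\<rbrakk>
          \<Longrightarrow> \<beta> \<star> \<alpha> \<in> hom2 B (g \<odot> f) (g' \<odot> f')"
    and vcmp_id_left: "\<alpha> \<in> hom2 B f g \<Longrightarrow> id2 B g \<cdot> \<alpha> = \<alpha>"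
    and vcmp_id_right: "\<alpha> \<in> hom2 B f g \<Longrightarrow> \<alpha> \<cdot> id2 B f = \<alpha>"
    and vcmp_assoc: "\<lbrakk>\<alpha> \<in> hom2 B f g; \<beta> \<in> hom2 B g h; \<gamma> \<in> hom2 B h k\<rbrakk>
          \<Longrightarrow> (\<gamma> \<cdot> \<beta>) \<cdot> \<alpha> = \<gamma> \<cdot> (\<beta> \<cdot> \<alpha>)"
    and hcmp_id: "\<lbrakk>f \<in> hom1 B a b; g \<in> hom1 B b c\<rbrakk> \<Longrightarrow> id2 B g \<star> id2 B f = id2 B (g \<odot> f)"
    and interchange: "\<lbrakk>\<alpha> \<in> hom2 B f f'; \<alpha>' \<in> hom2 B f' f''; \<beta> \<in> hom2 B g g'; \<beta>' \<in> hom2 B g' g'';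
            trg B f = src B g\<rbrakk>
          \<Longrightarrow> (\<beta>' \<cdot> \<beta>) \<star> (\<alpha>' \<cdot> \<alpha>) = (\<beta>' \<star> \<alpha>') \<cdot> (\<beta> \<star> \<alpha>)"
    and asc_hom: "\<lbrakk>f \<in> hom1 B a b; g \<in> hom1 B b c; h \<in> hom1 B c d\<rbrakk>
          \<Longrightarrow> asc B h g f \<in> hom2 B ((h \<odot> g) \<odot> f) (h \<odot> (g \<odot> f))"
    and asc_iso: "\<lbrakk>f \<in> hom1 B a b; g \<in> hom1 B b c; h \<in> hom1 B c d\<rbrakk> \<Longrightarrow> iso2 B (asc B h g f)"
    and asc_natural: "\<lbrakk>\<alpha> \<in> hom2 B f f'; \<beta> \<in> hom2 B g g'; \<gamma> \<in> hom2 B h h';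
            trg B f = src B g; trg B g = src B h\<rbrakk>
          \<Longrightarrow> asc B h' g' f' \<cdot> ((\<gamma> \<star> \<beta>) \<star> \<alpha>) = (\<gamma> \<star> (\<beta> \<star> \<alpha>)) \<cdot> asc B h g f"
    and lun_hom: "f \<in> hom1 B a b \<Longrightarrow> lun B f \<in> hom2 B (id1 B b \<odot> f) f"
    and lun_iso: "f \<in> Arr B \<Longrightarrow> iso2 B (lun B f)"
    and lun_natural: "\<lbrakk>\<alpha> \<in> hom2 B f g; f \<in> hom1 B a b\<rbrakk>
          \<Longrightarrow> lun B g \<cdot> (id1 B b \<rhd> \<alpha>) = \<alpha> \<cdot> lun B f"
    and run_hom: "f \<in> hom1 B a b \<Longrightarrow> run B f \<in> hom2 B (f \<odot> id1 B a) f"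
    and run_iso: "f \<in> Arr B \<Longrightarrow> iso2 B (run B f)"
    and run_natural: "\<lbrakk>\<alpha> \<in> hom2 B f g; f \<in> hom1 B a b\<rbrakk>
          \<Longrightarrow> run B g \<cdot> (\<alpha> \<lhd> id1 B a) = \<alpha> \<cdot> run B f"
    and pentagon: "\<lbrakk>f \<in> hom1 B a b; g \<in> hom1 B b c; h \<in> hom1 B c d; k \<in> hom1 B d e\<rbrakk>
          \<Longrightarrow> asc B k h (g \<odot> f) \<cdot> asc B (k \<odot> h) g f
              = (k \<rhd> asc B h g f) \<cdot> asc B k (h \<odot> g) f \<cdot> (asc B k h g \<lhd> f)"
    and triangle: "\<lbrakk>f \<in> hom1 B a b; g \<in> hom1 B b c\<rbrakk>
          \<Longrightarrow> (g \<rhd> lun B f) \<cdot> asc B g (id1 B b) f = run B g \<lhd> f"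

definition prod_bicat ::
  "('o, 'f, 't) bicat \<Rightarrow> ('p, 'g, 'u) bicat \<Rightarrow> ('o \<times> 'p, 'f \<times> 'g, 't \<times> 'u) bicat"
  (infixr "\<times>\<^sub>B" 80) where
  "B \<times>\<^sub>B C = \<lparr>
     Ob = Ob B \<times> Ob C, Arr = Arr B \<times> Arr C, Cell = Cell B \<times> Cell C,
     src = map_prod (src B) (src C), trg = map_prod (trg B) (trg C),
     dom2 = map_prod (dom2 B) (dom2 C), cod2 = map_prod (cod2 B) (cod2 C),
     id1 = map_prod (id1 B) (id1 C),
     cmp1 = (\<lambda>(g, g') (f, f'). (g \<odot>\<^bsub>B\<^esub> f, g' \<odot>\<^bsub>C\<^esub> f')),
     id2 = map_prod (id2 B) (id2 C),
     vcmp = (\<lambda>(\<beta>, \<beta>') (\<alpha>, \<alpha>'). (\<beta> \<cdot>\<^bsub>B\<^esub> \<alpha>, \<beta>' \<cdot>\<^bsub>C\<^esub> \<alpha>')),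
     hcmp = (\<lambda>(\<beta>, \<beta>') (\<alpha>, \<alpha>'). (\<beta> \<star>\<^bsub>B\<^esub> \<alpha>, \<beta>' \<star>\<^bsub>C\<^esub> \<alpha>')),
     asc = (\<lambda>(h, h') (g, g') (f, f'). (asc B h g f, asc C h' g' f')),
     lun = map_prod (lun B) (lun C), run = map_prod (run B) (run C) \<rparr>"


section \<open>Weak functors\<close>

text \<open>
  The constraints point as \<open>cmpc F g f : F g \<odot> F f \<Rightarrow> F (g \<odot> f)\<close> and \<open>unitc F a : 1 \<Rightarrow> F 1\<close>. The
  locales for functors, transformations and modifications state only the conditions on the new datum:
  that \<open>B\<close> and \<open>C\<close> are bicategories, that \<open>F\<close> and \<open>G\<close> are weak functors, and so on, is not repeated.
\<close>

record ('o, 'f, 't, 'p, 'g, 'u) psfun =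
  map0 :: "'o \<Rightarrow> 'p"
  map1 :: "'f \<Rightarrow> 'g"
  map2 :: "'t \<Rightarrow> 'u"
  cmpc :: "'f \<Rightarrow> 'f \<Rightarrow> 'u"
  unitc :: "'o \<Rightarrow> 'u"

locale pseudofunctor =
  fixes B :: "('o, 'f, 't) bicat" and C :: "('p, 'g, 'u) bicat" (structure)
    and F :: "('o, 'f, 't, 'p, 'g, 'u) psfun"
  assumes map0_Ob: "a \<in> Ob B \<Longrightarrow> map0 F a \<in> Ob C"
    and map1_hom: "f \<in> hom1 B a b \<Longrightarrow> map1 F f \<in> hom1 C (map0 F a) (map0 F b)"
    and map2_hom: "\<alpha> \<in> hom2 B f g \<Longrightarrow> map2 F \<alpha> \<in> hom2 C (map1 F f) (map1 F g)"
    and map2_id: "f \<in> Arr B \<Longrightarrow> map2 F (id2 B f) = id2 C (map1 F f)"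
    and map2_vcmp: "\<lbrakk>\<alpha> \<in> hom2 B f g; \<beta> \<in> hom2 B g h\<rbrakk>
          \<Longrightarrow> map2 F (\<beta> \<cdot>\<^bsub>B\<^esub> \<alpha>) = map2 F \<beta> \<cdot> map2 F \<alpha>"
    and cmpc_hom: "\<lbrakk>f \<in> hom1 B a b; g \<in> hom1 B b c\<rbrakk>
          \<Longrightarrow> cmpc F g f \<in> hom2 C (map1 F g \<odot> map1 F f) (map1 F (g \<odot>\<^bsub>B\<^esub> f))"
    and cmpc_iso: "\<lbrakk>f \<in> hom1 B a b; g \<in> hom1 B b c\<rbrakk> \<Longrightarrow> iso2 C (cmpc F g f)"
    and cmpc_natural: "\<lbrakk>\<alpha> \<in> hom2 B f f'; \<beta> \<in> hom2 B g g'; trg B f = src B g\<rbrakk>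
          \<Longrightarrow> map2 F (\<beta> \<star>\<^bsub>B\<^esub> \<alpha>) \<cdot> cmpc F g f = cmpc F g' f' \<cdot> (map2 F \<beta> \<star> map2 F \<alpha>)"
    and unitc_hom: "a \<in> Ob B \<Longrightarrow> unitc F a \<in> hom2 C (id1 C (map0 F a)) (map1 F (id1 B a))"
    and unitc_iso: "a \<in> Ob B \<Longrightarrow> iso2 C (unitc F a)"
    and cmpc_asc: "\<lbrakk>f \<in> hom1 B a b; g \<in> hom1 B b c; h \<in> hom1 B c d\<rbrakk>
          \<Longrightarrow> map2 F (asc B h g f) \<cdot> cmpc F (h \<odot>\<^bsub>B\<^esub> g) f \<cdot> (cmpc F h g \<lhd> map1 F f)
              = cmpc F h (g \<odot>\<^bsub>B\<^esub> f) \<cdot> (map1 F h \<rhd> cmpc F g f)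
                \<cdot> asc C (map1 F h) (map1 F g) (map1 F f)"
    and cmpc_lun: "f \<in> hom1 B a b
          \<Longrightarrow> map2 F (lun B f) \<cdot> cmpc F (id1 B b) f \<cdot> (unitc F b \<lhd> map1 F f) = lun C (map1 F f)"
    and cmpc_run: "f \<in> hom1 B a b
          \<Longrightarrow> map2 F (run B f) \<cdot> cmpc F f (id1 B a) \<cdot> (map1 F f \<rhd> unitc F a) = run C (map1 F f)"

definition comp_psfun ::
  "('q, 'h, 'v) bicat \<Rightarrow> ('p, 'g, 'u, 'q, 'h, 'v) psfun \<Rightarrow> ('o, 'f, 't, 'p, 'g, 'u) psfun
    \<Rightarrow> ('o, 'f, 't, 'q, 'h, 'v) psfun" where
  "comp_psfun D G F = \<lparr>
     map0 = map0 G \<circ> map0 F, map1 = map1 G \<circ> map1 F, map2 = map2 G \<circ> map2 F,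
     cmpc = (\<lambda>g f. map2 G (cmpc F g f) \<cdot>\<^bsub>D\<^esub> cmpc G (map1 F g) (map1 F f)),
     unitc = (\<lambda>a. map2 G (unitc F a) \<cdot>\<^bsub>D\<^esub> unitc G (map0 F a)) \<rparr>"

definition pair_psfun ::
  "('o, 'f, 't, 'p, 'g, 'u) psfun \<Rightarrow> ('o, 'f, 't, 'q, 'h, 'v) psfun
    \<Rightarrow> ('o, 'f, 't, 'p \<times> 'q, 'g \<times> 'h, 'u \<times> 'v) psfun" where
  "pair_psfun F G = \<lparr>
     map0 = (\<lambda>a. (map0 F a, map0 G a)), map1 = (\<lambda>f. (map1 F f, map1 G f)),
     map2 = (\<lambda>\<alpha>. (map2 F \<alpha>, map2 G \<alpha>)),
     cmpc = (\<lambda>g f. (cmpc F g f, cmpc G g f)), unitc = (\<lambda>a. (unitc F a, unitc G a)) \<rparr>"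

text \<open>The strict functor with the given underlying maps: its constraints are identities.\<close>

definition strict_psfun ::
  "('p, 'g, 'u) bicat \<Rightarrow> ('o \<Rightarrow> 'p) \<Rightarrow> ('f \<Rightarrow> 'g) \<Rightarrow> ('t \<Rightarrow> 'u)
    \<Rightarrow> ('o, 'f, 't, 'p, 'g, 'u) psfun" where
  "strict_psfun C F0 F1 F2 = \<lparr>
     map0 = F0, map1 = F1, map2 = F2,
     cmpc = (\<lambda>g f. id2 C (F1 g \<odot>\<^bsub>C\<^esub> F1 f)), unitc = (\<lambda>a. id2 C (id1 C (F0 a))) \<rparr>"

definition id_psfun :: "('o, 'f, 't) bicat \<Rightarrow> ('o, 'f, 't, 'o, 'f, 't) psfun" where
  "id_psfun B = strict_psfun B (\<lambda>x. x) (\<lambda>x. x) (\<lambda>x. x)"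

definition const_psfun :: "('p, 'g, 'u) bicat \<Rightarrow> 'p \<Rightarrow> ('o, 'f, 't, 'p, 'g, 'u) psfun" where
  "const_psfun C c = \<lparr>
     map0 = (\<lambda>_. c), map1 = (\<lambda>_. id1 C c), map2 = (\<lambda>_. id2 C (id1 C c)),
     cmpc = (\<lambda>_ _. lun C (id1 C c)), unitc = (\<lambda>_. id2 C (id1 C c)) \<rparr>"


section \<open>Pseudonatural transformations and modifications\<close>

text \<open>
  A transformation \<open>\<sigma> : F \<Rightarrow> G\<close> has components \<open>cpt \<sigma> a : F a \<rightarrow> G a\<close> and, for \<open>f : a \<rightarrow> b\<close>, naturality
  cells \<open>natc \<sigma> f : G f \<odot> cpt \<sigma> a \<Rightarrow> cpt \<sigma> b \<odot> F f\<close>.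
\<close>

record ('o, 'f, 'g, 'u) pstrans =
  cpt :: "'o \<Rightarrow> 'g"
  natc :: "'f \<Rightarrow> 'u"

locale pseudonatural =
  fixes B :: "('o, 'f, 't) bicat" and C :: "('p, 'g, 'u) bicat" (structure)
    and F G :: "('o, 'f, 't, 'p, 'g, 'u) psfun"
    and \<sigma> :: "('o, 'f, 'g, 'u) pstrans"
  assumes at_hom: "a \<in> Ob B \<Longrightarrow> cpt \<sigma> a \<in> hom1 C (map0 F a) (map0 G a)"
    and natc_hom: "f \<in> hom1 B a b
          \<Longrightarrow> natc \<sigma> f \<in> hom2 C (map1 G f \<odot> cpt \<sigma> a) (cpt \<sigma> b \<odot> map1 F f)"
    and natc_iso: "f \<in> Arr B \<Longrightarrow> iso2 C (natc \<sigma> f)"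
    and natc_natural: "\<lbrakk>f \<in> hom1 B a b; \<alpha> \<in> hom2 B f g\<rbrakk>
          \<Longrightarrow> (cpt \<sigma> b \<rhd> map2 F \<alpha>) \<cdot> natc \<sigma> f = natc \<sigma> g \<cdot> (map2 G \<alpha> \<lhd> cpt \<sigma> a)"
    and natc_cmp: "\<lbrakk>f \<in> hom1 B a b; g \<in> hom1 B b c\<rbrakk>
          \<Longrightarrow> natc \<sigma> (g \<odot>\<^bsub>B\<^esub> f) \<cdot> (cmpc G g f \<lhd> cpt \<sigma> a)
              = (cpt \<sigma> c \<rhd> cmpc F g f) \<cdot> asc C (cpt \<sigma> c) (map1 F g) (map1 F f)
                \<cdot> (natc \<sigma> g \<lhd> map1 F f) \<cdot> inv2 C (asc C (map1 G g) (cpt \<sigma> b) (map1 F f))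
                \<cdot> (map1 G g \<rhd> natc \<sigma> f) \<cdot> asc C (map1 G g) (map1 G f) (cpt \<sigma> a)"
    and natc_id: "a \<in> Ob B
          \<Longrightarrow> natc \<sigma> (id1 B a) \<cdot> (unitc G a \<lhd> cpt \<sigma> a)
              = (cpt \<sigma> a \<rhd> unitc F a) \<cdot> inv2 C (run C (cpt \<sigma> a)) \<cdot> lun C (cpt \<sigma> a)"

definition id_pstrans ::
  "('p, 'g, 'u) bicat \<Rightarrow> ('o, 'f, 't, 'p, 'g, 'u) psfun \<Rightarrow> ('o, 'f, 'g, 'u) pstrans" where
  "id_pstrans C F = \<lparr>
     cpt = (\<lambda>a. id1 C (map0 F a)),
     natc = (\<lambda>f. inv2 C (lun C (map1 F f)) \<cdot>\<^bsub>C\<^esub> run C (map1 F f)) \<rparr>"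

text \<open>
  The composite \<open>\<tau> \<sigma>\<close> of \<open>\<sigma> : F \<Rightarrow> G\<close> and \<open>\<tau> : G \<Rightarrow> H\<close>. The naturality cells involve \<open>F\<close>, \<open>G\<close>, \<open>H\<close> and
  the source and target of a 1-cell, hence these parameters.
\<close>

definition comp_pstrans ::
  "('o, 'f, 't) bicat \<Rightarrow> ('p, 'g, 'u) bicat
    \<Rightarrow> ('o, 'f, 't, 'p, 'g, 'u) psfun \<Rightarrow> ('o, 'f, 't, 'p, 'g, 'u) psfun
    \<Rightarrow> ('o, 'f, 't, 'p, 'g, 'u) psfun
    \<Rightarrow> ('o, 'f, 'g, 'u) pstrans \<Rightarrow> ('o, 'f, 'g, 'u) pstrans \<Rightarrow> ('o, 'f, 'g, 'u) pstrans" where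
  "comp_pstrans B C F G H \<tau> \<sigma> = \<lparr>
     cpt = (\<lambda>a. cpt \<tau> a \<odot>\<^bsub>C\<^esub> cpt \<sigma> a),
     natc = (\<lambda>f. let a = src B f; b = trg B f in
         inv2 C (asc C (cpt \<tau> b) (cpt \<sigma> b) (map1 F f))
         \<cdot>\<^bsub>C\<^esub> (cpt \<tau> b \<rhd>\<^bsub>C\<^esub> natc \<sigma> f)
         \<cdot>\<^bsub>C\<^esub> asc C (cpt \<tau> b) (map1 G f) (cpt \<sigma> a)
         \<cdot>\<^bsub>C\<^esub> (natc \<tau> f \<lhd>\<^bsub>C\<^esub> cpt \<sigma> a)
         \<cdot>\<^bsub>C\<^esub> inv2 C (asc C (map1 H f) (cpt \<tau> a) (cpt \<sigma> a))) \<rparr>"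

definition pre_whisker ::
  "('p, 'g, 'h, 'v) pstrans \<Rightarrow> ('o, 'f, 't, 'p, 'g, 'u) psfun \<Rightarrow> ('o, 'f, 'h, 'v) pstrans" where
  "pre_whisker \<sigma> K = \<lparr> cpt = cpt \<sigma> \<circ> map0 K, natc = natc \<sigma> \<circ> map1 K \<rparr>"

text \<open>The whiskering \<open>H \<sigma>\<close> of \<open>\<sigma> : F \<Rightarrow> G : B \<rightarrow> C\<close> by \<open>H : C \<rightarrow> D\<close>.\<close>

definition post_whisker ::
  "('o, 'f, 't) bicat \<Rightarrow> ('q, 'h, 'v) bicat
    \<Rightarrow> ('o, 'f, 't, 'p, 'g, 'u) psfun \<Rightarrow> ('o, 'f, 't, 'p, 'g, 'u) psfun
    \<Rightarrow> ('p, 'g, 'u, 'q, 'h, 'v) psfun \<Rightarrow> ('o, 'f, 'g, 'u) pstrans \<Rightarrow> ('o, 'f, 'h, 'v) pstrans" where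
  "post_whisker B D F G H \<sigma> = \<lparr>
     cpt = map1 H \<circ> cpt \<sigma>,
     natc = (\<lambda>f. let a = src B f; b = trg B f in
         inv2 D (cmpc H (cpt \<sigma> b) (map1 F f))
         \<cdot>\<^bsub>D\<^esub> map2 H (natc \<sigma> f)
         \<cdot>\<^bsub>D\<^esub> cmpc H (map1 G f) (cpt \<sigma> a)) \<rparr>"

definition pair_pstrans ::
  "('o, 'f, 'g, 'u) pstrans \<Rightarrow> ('o, 'f, 'h, 'v) pstrans
    \<Rightarrow> ('o, 'f, 'g \<times> 'h, 'u \<times> 'v) pstrans" where
  "pair_pstrans \<sigma> \<tau> = \<lparr> cpt = (\<lambda>a. (cpt \<sigma> a, cpt \<tau> a)), natc = (\<lambda>f. (natc \<sigma> f, natc \<tau> f)) \<rparr>"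

text \<open>Invertible modifications \<open>m : \<sigma> \<Rightarrow> \<tau>\<close> between transformations \<open>\<sigma>, \<tau> : F \<Rightarrow> G\<close>.\<close>

locale invertible_modification =
  fixes B :: "('o, 'f, 't) bicat" and C :: "('p, 'g, 'u) bicat" (structure)
    and F G :: "('o, 'f, 't, 'p, 'g, 'u) psfun"
    and \<sigma> \<tau> :: "('o, 'f, 'g, 'u) pstrans"
    and m :: "'o \<Rightarrow> 'u"
  assumes mod_hom: "a \<in> Ob B \<Longrightarrow> m a \<in> hom2 C (cpt \<sigma> a) (cpt \<tau> a)"
    and mod_iso: "a \<in> Ob B \<Longrightarrow> iso2 C (m a)"
    and mod_natural: "f \<in> hom1 B a b
          \<Longrightarrow> (m b \<lhd> map1 F f) \<cdot> natc \<sigma> f = natc \<tau> f \<cdot> (map1 G f \<rhd> m a)"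

text \<open>
  Adjoint equivalences \<open>fwd \<stileturn> bwd\<close> in the bicategory of weak functors \<open>B \<rightarrow> C\<close>, with unit
  \<open>aun : 1 \<Rightarrow> bwd \<odot> fwd\<close> and counit \<open>acu : fwd \<odot> bwd \<Rightarrow> 1\<close>. The constraint cells of that bicategory
  and the composition of modifications are componentwise, so the triangle identities are stated at
  each object.
\<close>

record ('o, 'f, 'g, 'u) adjeq =
  fwd :: "('o, 'f, 'g, 'u) pstrans"
  bwd :: "('o, 'f, 'g, 'u) pstrans"
  aun :: "'o \<Rightarrow> 'u"
  acu :: "'o \<Rightarrow> 'u"

locale adjoint_equivalence =
  fixes B :: "('o, 'f, 't) bicat" and C :: "('p, 'g, 'u) bicat" (structure)
    and F G :: "('o, 'f, 't, 'p, 'g, 'u) psfun"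
    and e :: "('o, 'f, 'g, 'u) adjeq"
  assumes fwd_pseudonatural: "pseudonatural B C F G (fwd e)"
    and bwd_pseudonatural: "pseudonatural B C G F (bwd e)"
    and aun_modification: "invertible_modification B C F F
          (id_pstrans C F) (comp_pstrans B C F G F (bwd e) (fwd e)) (aun e)"
    and acu_modification: "invertible_modification B C G G
          (comp_pstrans B C G F G (fwd e) (bwd e)) (id_pstrans C G) (acu e)"
    and triangle_fwd: "a \<in> Ob B
          \<Longrightarrow> lun C (cpt (fwd e) a) \<cdot> (acu e a \<lhd> cpt (fwd e) a)
                \<cdot> inv2 C (asc C (cpt (fwd e) a) (cpt (bwd e) a) (cpt (fwd e) a))
                \<cdot> (cpt (fwd e) a \<rhd> aun e a) \<cdot> inv2 C (run C (cpt (fwd e) a))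
              = id2 C (cpt (fwd e) a)"
    and triangle_bwd: "a \<in> Ob B
          \<Longrightarrow> run C (cpt (bwd e) a) \<cdot> (cpt (bwd e) a \<rhd> acu e a)
                \<cdot> asc C (cpt (bwd e) a) (cpt (fwd e) a) (cpt (bwd e) a)
                \<cdot> (aun e a \<lhd> cpt (bwd e) a) \<cdot> inv2 C (lun C (cpt (bwd e) a))
              = id2 C (cpt (bwd e) a)"


section \<open>Pasting\<close>

text \<open>
  Chains of 1-cells are bracketed to the right. \<open>paste2\<close> and \<open>paste3\<close> apply a 2-cell
  \<open>\<theta> : k2 \<odot> k1 \<Rightarrow> h2 \<odot> h1\<close> (respectively \<open>\<theta> : k3 \<odot> k2 \<odot> k1 \<Rightarrow> h2 \<odot> h1\<close>) to a chain in which the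
  1-cells \<open>k\<close> are followed on the right by \<open>e\<close>; \<open>collapse_left\<close> applies \<open>\<theta> : k3 \<odot> k2 \<odot> k1 \<Rightarrow> 1\<close> to
  \<open>k3 \<odot> k2 \<odot> k1 \<odot> e\<close>, and \<open>collapse_right\<close> applies \<open>\<theta> : k \<Rightarrow> 1\<close> to \<open>e \<odot> k\<close>.
\<close>

context
  fixes B :: "('o, 'f, 't) bicat" (structure)
begin

definition paste2 :: "'f \<Rightarrow> 'f \<Rightarrow> 't \<Rightarrow> 'f \<Rightarrow> 'f \<Rightarrow> 'f \<Rightarrow> 't" where
  "paste2 k2 k1 \<theta> h2 h1 e = asc B h2 h1 e \<cdot> (\<theta> \<lhd> e) \<cdot> inv2 B (asc B k2 k1 e)"

definition unbracket3 :: "'f \<Rightarrow> 'f \<Rightarrow> 'f \<Rightarrow> 'f \<Rightarrow> 't" where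
  "unbracket3 k3 k2 k1 e = inv2 B (asc B k3 (k2 \<odot> k1) e) \<cdot> (k3 \<rhd> inv2 B (asc B k2 k1 e))"

definition paste3 :: "'f \<Rightarrow> 'f \<Rightarrow> 'f \<Rightarrow> 't \<Rightarrow> 'f \<Rightarrow> 'f \<Rightarrow> 'f \<Rightarrow> 't" where
  "paste3 k3 k2 k1 \<theta> h2 h1 e = asc B h2 h1 e \<cdot> (\<theta> \<lhd> e) \<cdot> unbracket3 k3 k2 k1 e"

definition collapse_left :: "'f \<Rightarrow> 'f \<Rightarrow> 'f \<Rightarrow> 't \<Rightarrow> 'f \<Rightarrow> 't" where
  "collapse_left k3 k2 k1 \<theta> e = lun B e \<cdot> (\<theta> \<lhd> e) \<cdot> unbracket3 k3 k2 k1 e"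

definition collapse_right :: "'f \<Rightarrow> 't \<Rightarrow> 't" where
  "collapse_right e \<theta> = run B e \<cdot> (e \<rhd> \<theta>)"

text \<open>
  The image of a 2-cell under a weak functor \<open>F\<close>, conjugated by the constraints of \<open>F\<close>: for
  \<open>\<theta> : k3 \<odot> k2 \<odot> k1 \<Rightarrow> h2 \<odot> h1\<close>, for \<open>\<theta> : k \<Rightarrow> h2 \<odot> h1\<close>, and for \<open>\<theta> : k3 \<odot> k2 \<odot> k1 \<Rightarrow> id1 B x\<close>.
\<close>

definition image32 :: "('o, 'f, 't, 'o, 'f, 't) psfun \<Rightarrow> 'f \<Rightarrow> 'f \<Rightarrow> 'f \<Rightarrow> 't \<Rightarrow> 'f \<Rightarrow> 'f \<Rightarrow> 't" where
  "image32 F k3 k2 k1 \<theta> h2 h1 =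
     inv2 B (cmpc F h2 h1) \<cdot> map2 F \<theta> \<cdot> cmpc F k3 (k2 \<odot> k1) \<cdot> (map1 F k3 \<rhd> cmpc F k2 k1)"

definition image12 :: "('o, 'f, 't, 'o, 'f, 't) psfun \<Rightarrow> 't \<Rightarrow> 'f \<Rightarrow> 'f \<Rightarrow> 't" where
  "image12 F \<theta> h2 h1 = inv2 B (cmpc F h2 h1) \<cdot> map2 F \<theta>"

definition image30 :: "('o, 'f, 't, 'o, 'f, 't) psfun \<Rightarrow> 'f \<Rightarrow> 'f \<Rightarrow> 'f \<Rightarrow> 't \<Rightarrow> 'o \<Rightarrow> 't" where
  "image30 F k3 k2 k1 \<theta> x =
     inv2 B (unitc F x) \<cdot> map2 F \<theta> \<cdot> cmpc F k3 (k2 \<odot> k1) \<cdot> (map1 F k3 \<rhd> cmpc F k2 k1)"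

end


section \<open>Monoidal bicategories\<close>

text \<open>
  \<open>ten\<close> is the tensor product \<open>B \<times> B \<rightarrow> B\<close>, \<open>one\<close> the unit object and \<open>asq\<close>, \<open>luq\<close>, \<open>ruq\<close> the
  adjoint equivalences with components \<open>(a b) c \<rightarrow> a (b c)\<close>, \<open>1 a \<rightarrow> a\<close> and \<open>a 1 \<rightarrow> a\<close>. The components
  of the modifications point as follows, where juxtaposition of objects is the tensor product,
  \<open>a\<close>, \<open>l\<close> and \<open>r\<close> are the left adjoints in \<open>asq\<close>, \<open>luq\<close> and \<open>ruq\<close>, and \<open>r'\<close> is the right adjoint
  in \<open>ruq\<close>:
    \<open>pim : (1 \<otimes> a) \<odot> a \<odot> (a \<otimes> 1) \<Rightarrow> a \<odot> a\<close>,
    \<open>mum : (1 \<otimes> l) \<odot> a \<odot> (r' \<otimes> 1) \<Rightarrow> 1\<close>,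
    \<open>lam : l \<otimes> 1 \<Rightarrow> l \<odot> a\<close>,
    \<open>rhm : 1 \<otimes> r' \<Rightarrow> a \<odot> r'\<close>.
  These are the conventions of Gurski's algebraic tricategories, for one object. The functor
  \<open>1 \<rightarrow> B\<close> picking out the unit object is the constant one.
\<close>

record ('o, 'f, 't) monoidal_structure =
  ten :: "('o \<times> 'o, 'f \<times> 'f, 't \<times> 't, 'o, 'f, 't) psfun"
  one :: "'o"
  asq :: "('o \<times> 'o \<times> 'o, 'f \<times> 'f \<times> 'f, 'f, 't) adjeq"
  luq :: "('o, 'f, 'f, 't) adjeq"
  ruq :: "('o, 'f, 'f, 't) adjeq"
  pim :: "'o \<times> 'o \<times> 'o \<times> 'o \<Rightarrow> 't"
  mum :: "'o \<times> 'o \<Rightarrow> 't"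
  lam :: "'o \<times> 'o \<Rightarrow> 't"
  rhm :: "'o \<times> 'o \<Rightarrow> 't"

locale monoidal_data =
  fixes B :: "('o, 'f, 't) bicat" (structure)
    and M :: "('o, 'f, 't) monoidal_structure"
begin

abbreviation tensor0 :: "'o \<Rightarrow> 'o \<Rightarrow> 'o"  (infixr "\<otimes>" 80) where
  "x \<otimes> y \<equiv> map0 (ten M) (x, y)"

abbreviation \<I> :: 'o where "\<I> \<equiv> one M"

abbreviation \<aa> :: "'o \<Rightarrow> 'o \<Rightarrow> 'o \<Rightarrow> 'f" where "\<aa> x y z \<equiv> cpt (fwd (asq M)) (x, y, z)"
abbreviation \<ll> :: "'o \<Rightarrow> 'f" where "\<ll> \<equiv> cpt (fwd (luq M))"
abbreviation \<rr>' :: "'o \<Rightarrow> 'f" where "\<rr>' \<equiv> cpt (bwd (ruq M))"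

text \<open>The tensor product of two functors with common source, and of two transformations.\<close>

definition tensor_psfun ::
  "('p, 'g, 'u, 'o, 'f, 't) psfun \<Rightarrow> ('p, 'g, 'u, 'o, 'f, 't) psfun \<Rightarrow> ('p, 'g, 'u, 'o, 'f, 't) psfun"
  (infixr "\<boxtimes>" 80) where
  "F \<boxtimes> G = comp_psfun B (ten M) (pair_psfun F G)"

definition tensor_pstrans ::
  "('p, 'g, 'u) bicat
    \<Rightarrow> ('p, 'g, 'u, 'o, 'f, 't) psfun \<Rightarrow> ('p, 'g, 'u, 'o, 'f, 't) psfun
    \<Rightarrow> ('p, 'g, 'u, 'o, 'f, 't) psfun \<Rightarrow> ('p, 'g, 'u, 'o, 'f, 't) psfun
    \<Rightarrow> ('p, 'g, 'f, 't) pstrans \<Rightarrow> ('p, 'g, 'f, 't) pstrans \<Rightarrow> ('p, 'g, 'f, 't) pstrans" where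
  "tensor_pstrans A F F' G G' \<sigma> \<tau> =
     post_whisker A B (pair_psfun F G) (pair_psfun F' G') (ten M) (pair_pstrans \<sigma> \<tau>)"

text \<open>The functors \<open>k \<otimes> -\<close> and \<open>- \<otimes> k\<close>.\<close>

definition \<L> :: "'o \<Rightarrow> ('o, 'f, 't, 'o, 'f, 't) psfun" where
  "\<L> k = const_psfun B k \<boxtimes> id_psfun B"

definition \<R> :: "'o \<Rightarrow> ('o, 'f, 't, 'o, 'f, 't) psfun" where
  "\<R> k = id_psfun B \<boxtimes> const_psfun B k"

abbreviation B2 :: "('o \<times> 'o, 'f \<times> 'f, 't \<times> 't) bicat" where
  "B2 \<equiv> B \<times>\<^sub>B B"
abbreviation B3 :: "('o \<times> 'o \<times> 'o, 'f \<times> 'f \<times> 'f, 't \<times> 't \<times> 't) bicat" where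
  "B3 \<equiv> B \<times>\<^sub>B B \<times>\<^sub>B B"
abbreviation B4 :: "('o \<times> 'o \<times> 'o \<times> 'o, 'f \<times> 'f \<times> 'f \<times> 'f, 't \<times> 't \<times> 't \<times> 't) bicat" where
  "B4 \<equiv> B \<times>\<^sub>B B \<times>\<^sub>B B \<times>\<^sub>B B"

text \<open>\<open>Pni\<close> is the \<open>i\<close>-th projection from the \<open>n\<close>-fold product.\<close>

definition P21 :: "('o \<times> 'o, 'f \<times> 'f, 't \<times> 't, 'o, 'f, 't) psfun" where
  "P21 = strict_psfun B fst fst fst"
definition P22 :: "('o \<times> 'o, 'f \<times> 'f, 't \<times> 't, 'o, 'f, 't) psfun" where
  "P22 = strict_psfun B snd snd snd"

definition P31 :: "('o \<times> 'o \<times> 'o, 'f \<times> 'f \<times> 'f, 't \<times> 't \<times> 't, 'o, 'f, 't) psfun" where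
  "P31 = strict_psfun B fst fst fst"
definition P32 :: "('o \<times> 'o \<times> 'o, 'f \<times> 'f \<times> 'f, 't \<times> 't \<times> 't, 'o, 'f, 't) psfun" where
  "P32 = strict_psfun B (fst \<circ> snd) (fst \<circ> snd) (fst \<circ> snd)"
definition P33 :: "('o \<times> 'o \<times> 'o, 'f \<times> 'f \<times> 'f, 't \<times> 't \<times> 't, 'o, 'f, 't) psfun" where
  "P33 = strict_psfun B (snd \<circ> snd) (snd \<circ> snd) (snd \<circ> snd)"

definition P41 ::
  "('o \<times> 'o \<times> 'o \<times> 'o, 'f \<times> 'f \<times> 'f \<times> 'f, 't \<times> 't \<times> 't \<times> 't, 'o, 'f, 't) psfun" where
  "P41 = strict_psfun B fst fst fst"
definition P42 ::
  "('o \<times> 'o \<times> 'o \<times> 'o, 'f \<times> 'f \<times> 'f \<times> 'f, 't \<times> 't \<times> 't \<times> 't, 'o, 'f, 't) psfun" where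
  "P42 = strict_psfun B (fst \<circ> snd) (fst \<circ> snd) (fst \<circ> snd)"
definition P43 ::
  "('o \<times> 'o \<times> 'o \<times> 'o, 'f \<times> 'f \<times> 'f \<times> 'f, 't \<times> 't \<times> 't \<times> 't, 'o, 'f, 't) psfun" where
  "P43 = strict_psfun B (fst \<circ> snd \<circ> snd) (fst \<circ> snd \<circ> snd) (fst \<circ> snd \<circ> snd)"
definition P44 ::
  "('o \<times> 'o \<times> 'o \<times> 'o, 'f \<times> 'f \<times> 'f \<times> 'f, 't \<times> 't \<times> 't \<times> 't, 'o, 'f, 't) psfun" where
  "P44 = strict_psfun B (snd \<circ> snd \<circ> snd) (snd \<circ> snd \<circ> snd) (snd \<circ> snd \<circ> snd)"

abbreviation tuple3 ::
  "('p, 'g, 'u, 'o, 'f, 't) psfun \<Rightarrow> ('p, 'g, 'u, 'o, 'f, 't) psfun \<Rightarrow> ('p, 'g, 'u, 'o, 'f, 't) psfun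
    \<Rightarrow> ('p, 'g, 'u, 'o \<times> 'o \<times> 'o, 'f \<times> 'f \<times> 'f, 't \<times> 't \<times> 't) psfun" where
  "tuple3 F G H \<equiv> pair_psfun F (pair_psfun G H)"

abbreviation a_at ::
  "('p, 'g, 'u, 'o, 'f, 't) psfun \<Rightarrow> ('p, 'g, 'u, 'o, 'f, 't) psfun \<Rightarrow> ('p, 'g, 'u, 'o, 'f, 't) psfun
    \<Rightarrow> ('p, 'g, 'f, 't) pstrans" where
  "a_at F G H \<equiv> pre_whisker (fwd (asq M)) (tuple3 F G H)"

text \<open>
  The source and target transformations of \<open>pim\<close>, between functors \<open>B4 \<rightarrow> B\<close>, along
  \<open>((w x) y) z \<rightarrow> (w (x y)) z \<rightarrow> w ((x y) z) \<rightarrow> w (x (y z))\<close> and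
  \<open>((w x) y) z \<rightarrow> (w x) (y z) \<rightarrow> w (x (y z))\<close>.
\<close>

definition pi_source :: "('o \<times> 'o \<times> 'o \<times> 'o, 'f \<times> 'f \<times> 'f \<times> 'f, 'f, 't) pstrans" where
  "pi_source =
     comp_pstrans B4 B
       (((P41 \<boxtimes> P42) \<boxtimes> P43) \<boxtimes> P44) (P41 \<boxtimes> ((P42 \<boxtimes> P43) \<boxtimes> P44)) (P41 \<boxtimes> (P42 \<boxtimes> (P43 \<boxtimes> P44)))
       (tensor_pstrans B4 P41 P41 ((P42 \<boxtimes> P43) \<boxtimes> P44) (P42 \<boxtimes> (P43 \<boxtimes> P44))
          (id_pstrans B P41) (a_at P42 P43 P44))
       (comp_pstrans B4 B
          (((P41 \<boxtimes> P42) \<boxtimes> P43) \<boxtimes> P44) ((P41 \<boxtimes> (P42 \<boxtimes> P43)) \<boxtimes> P44) (P41 \<boxtimes> ((P42 \<boxtimes> P43) \<boxtimes> P44))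
          (a_at P41 (P42 \<boxtimes> P43) P44)
          (tensor_pstrans B4 ((P41 \<boxtimes> P42) \<boxtimes> P43) (P41 \<boxtimes> (P42 \<boxtimes> P43)) P44 P44
             (a_at P41 P42 P43) (id_pstrans B P44)))"

definition pi_target :: "('o \<times> 'o \<times> 'o \<times> 'o, 'f \<times> 'f \<times> 'f \<times> 'f, 'f, 't) pstrans" where
  "pi_target =
     comp_pstrans B4 B
       (((P41 \<boxtimes> P42) \<boxtimes> P43) \<boxtimes> P44) ((P41 \<boxtimes> P42) \<boxtimes> (P43 \<boxtimes> P44)) (P41 \<boxtimes> (P42 \<boxtimes> (P43 \<boxtimes> P44)))
       (a_at P41 P42 (P43 \<boxtimes> P44))
       (a_at (P41 \<boxtimes> P42) P43 P44)"

text \<open>The source of \<open>mum\<close>, along \<open>x y \<rightarrow> (x \<I>) y \<rightarrow> x (\<I> y) \<rightarrow> x y\<close>.\<close>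

definition mu_source :: "('o \<times> 'o, 'f \<times> 'f, 'f, 't) pstrans" where
  "mu_source =
     (let K = const_psfun B \<I> in
      comp_pstrans B2 B (P21 \<boxtimes> P22) (P21 \<boxtimes> (K \<boxtimes> P22)) (P21 \<boxtimes> P22)
        (tensor_pstrans B2 P21 P21 (K \<boxtimes> P22) P22
           (id_pstrans B P21) (pre_whisker (fwd (luq M)) P22))
        (comp_pstrans B2 B (P21 \<boxtimes> P22) ((P21 \<boxtimes> K) \<boxtimes> P22) (P21 \<boxtimes> (K \<boxtimes> P22))
           (a_at P21 K P22)
           (tensor_pstrans B2 P21 (P21 \<boxtimes> K) P22 P22
              (pre_whisker (bwd (ruq M)) P21) (id_pstrans B P22))))"

text \<open>The source and target of \<open>lam\<close>, along \<open>(\<I> x) y \<rightarrow> x y\<close> and \<open>(\<I> x) y \<rightarrow> \<I> (x y) \<rightarrow> x y\<close>.\<close>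

definition lambda_source :: "('o \<times> 'o, 'f \<times> 'f, 'f, 't) pstrans" where
  "lambda_source =
     tensor_pstrans B2 (const_psfun B \<I> \<boxtimes> P21) P21 P22 P22
       (pre_whisker (fwd (luq M)) P21) (id_pstrans B P22)"

definition lambda_target :: "('o \<times> 'o, 'f \<times> 'f, 'f, 't) pstrans" where
  "lambda_target =
     (let K = const_psfun B \<I> in
      comp_pstrans B2 B ((K \<boxtimes> P21) \<boxtimes> P22) (K \<boxtimes> (P21 \<boxtimes> P22)) (P21 \<boxtimes> P22)
        (pre_whisker (fwd (luq M)) (P21 \<boxtimes> P22))
        (a_at K P21 P22))"

text \<open>The source and target of \<open>rhm\<close>, along \<open>x y \<rightarrow> x (y \<I>)\<close> and \<open>x y \<rightarrow> (x y) \<I> \<rightarrow> x (y \<I>)\<close>.\<close>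

definition rho_source :: "('o \<times> 'o, 'f \<times> 'f, 'f, 't) pstrans" where
  "rho_source =
     tensor_pstrans B2 P21 P21 P22 (P22 \<boxtimes> const_psfun B \<I>)
       (id_pstrans B P21) (pre_whisker (bwd (ruq M)) P22)"

definition rho_target :: "('o \<times> 'o, 'f \<times> 'f, 'f, 't) pstrans" where
  "rho_target =
     (let K = const_psfun B \<I> in
      comp_pstrans B2 B (P21 \<boxtimes> P22) ((P21 \<boxtimes> P22) \<boxtimes> K) (P21 \<boxtimes> (P22 \<boxtimes> K))
        (a_at P21 P22 K)
        (pre_whisker (bwd (ruq M)) (P21 \<boxtimes> P22)))"

text \<open>
  The naturality of the associativity in one variable, combined with the unit constraint
  \<open>1 \<otimes> 1 \<cong> 1\<close> of the tensor product. For \<open>u : x \<rightarrow> y\<close>,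
    \<open>slide_left k j u : (1 \<otimes> (1 \<otimes> u)) \<odot> \<aa> k j x \<Rightarrow> \<aa> k j y \<odot> (1 \<otimes> u)\<close> and
    \<open>slide_right u g f : \<aa> y g f \<odot> ((u \<otimes> 1) \<otimes> 1) \<Rightarrow> (u \<otimes> 1) \<odot> \<aa> x g f\<close>;
  \<open>slide_mid\<close> is the middle case, which needs no unit constraint.
\<close>

definition slide_left :: "'o \<Rightarrow> 'o \<Rightarrow> 'f \<Rightarrow> 't" where
  "slide_left k j u =
     (\<aa> k j (trg B u) \<rhd> map2 (ten M) (inv2 B (unitc (ten M) (k, j)), id2 B u))
     \<cdot> natc (fwd (asq M)) (id1 B k, id1 B j, u)"

definition slide_right :: "'f \<Rightarrow> 'o \<Rightarrow> 'o \<Rightarrow> 't" where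
  "slide_right u g f =
     (map2 (ten M) (id2 B u, inv2 B (unitc (ten M) (g, f))) \<lhd> \<aa> (src B u) g f)
     \<cdot> inv2 B (natc (fwd (asq M)) (u, id1 B g, id1 B f))"

definition slide_mid :: "'o \<Rightarrow> 'f \<Rightarrow> 'o \<Rightarrow> 't" where
  "slide_mid k u f = natc (fwd (asq M)) (id1 B k, u, id1 B f)"

text \<open>
  The axiom on five-fold tensor products: both sides are 2-cells from the six-step path
  \<open>(((k j) h) g) f \<rightarrow> ((k (j h)) g) f \<rightarrow> (k ((j h) g)) f \<rightarrow> (k (j (h g))) f \<rightarrow> k ((j (h g)) f)
    \<rightarrow> k (j ((h g) f)) \<rightarrow> k (j (h (g f)))\<close>
  to the three-step path
  \<open>(((k j) h) g) f \<rightarrow> ((k j) h) (g f) \<rightarrow> (k j) (h (g f)) \<rightarrow> k (j (h (g f)))\<close>.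
\<close>

definition cocycle_left :: "'o \<Rightarrow> 'o \<Rightarrow> 'o \<Rightarrow> 'o \<Rightarrow> 'o \<Rightarrow> 't" where
  "cocycle_left k j h g f =
     (let a1 = \<aa> k j h; a2 = \<aa> k (j \<otimes> h) g; a3 = map1 (\<L> k) (\<aa> j h g);
          e4 = \<aa> k (j \<otimes> h \<otimes> g) f;
          e5 = map1 (\<L> k) (\<aa> j (h \<otimes> g) f);
          e6 = map1 (\<L> k) (map1 (\<L> j) (\<aa> h g f));
          b1 = \<aa> (k \<otimes> j) h g; b2 = \<aa> k j (h \<otimes> g);
          f1 = map1 (\<R> f) b1; f2 = map1 (\<R> f) b2;
          g1 = \<aa> (k \<otimes> j) (h \<otimes> g) f; g2 = \<aa> k j ((h \<otimes> g) \<otimes> f);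
          h2 = map1 (\<L> (k \<otimes> j)) (\<aa> h g f); h3 = \<aa> k j (h \<otimes> g \<otimes> f)
      in (h3 \<rhd> pim M (k \<otimes> j, h, g, f))
         \<cdot> paste2 B e6 g2 (slide_left k j (\<aa> h g f)) h3 h2 (g1 \<odot> f1)
         \<cdot> (e6 \<rhd> paste3 B e5 e4 f2 (pim M (k, j, h \<otimes> g, f)) g2 g1 f1)
         \<cdot> (e6 \<rhd> e5 \<rhd> e4 \<rhd> image32 B (\<R> f) a3 a2 (map1 (\<R> g) a1) (pim M (k, j, h, g)) b2 b1))"

definition cocycle_right :: "'o \<Rightarrow> 'o \<Rightarrow> 'o \<Rightarrow> 'o \<Rightarrow> 'o \<Rightarrow> 't" where
  "cocycle_right k j h g f =
     (let e1 = map1 (\<R> f) (map1 (\<R> g) (\<aa> k j h));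
          e2 = map1 (\<R> f) (\<aa> k (j \<otimes> h) g);
          e3 = map1 (\<R> f) (map1 (\<L> k) (\<aa> j h g));
          e4 = \<aa> k (j \<otimes> h \<otimes> g) f;
          c1 = map1 (\<R> f) (\<aa> j h g); c2 = \<aa> j (h \<otimes> g) f; c3 = map1 (\<L> j) (\<aa> h g f);
          e5 = map1 (\<L> k) c2; e6 = map1 (\<L> k) c3;
          m1 = \<aa> k ((j \<otimes> h) \<otimes> g) f; m2 = map1 (\<L> k) c1;
          d1 = \<aa> (j \<otimes> h) g f; d2 = \<aa> j h (g \<otimes> f);
          n1 = map1 (\<L> k) d1; n2 = map1 (\<L> k) d2;
          p1 = \<aa> (k \<otimes> j \<otimes> h) g f; p2 = \<aa> k (j \<otimes> h) (g \<otimes> f);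
          q = map1 (\<R> (g \<otimes> f)) (\<aa> k j h);
          k1 = \<aa> ((k \<otimes> j) \<otimes> h) g f; k2 = \<aa> (k \<otimes> j) h (g \<otimes> f); h3 = \<aa> k j (h \<otimes> g \<otimes> f)
      in paste3 B n2 p2 q (pim M (k, j, h, g \<otimes> f)) h3 k2 k1
         \<cdot> (n2 \<rhd> p2 \<rhd> slide_right (\<aa> k j h) g f)
         \<cdot> (n2 \<rhd> paste3 B n1 m1 e2 (pim M (k, j \<otimes> h, g, f)) p2 p1 e1)
         \<cdot> paste3 B e6 e5 m2 (image32 B (\<L> k) c3 c2 c1 (pim M (j, h, g, f)) d2 d1)
             n2 n1 (m1 \<odot> e2 \<odot> e1)
         \<cdot> (e6 \<rhd> e5 \<rhd> paste2 B e4 e3 (inv2 B (slide_mid k (\<aa> j h g) f)) m2 m1 (e2 \<odot> e1)))"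

text \<open>
  The first unit axiom: both sides are 2-cells from
  \<open>(h g) f \<rightarrow> ((h \<I>) g) f \<rightarrow> (h (\<I> g)) f \<rightarrow> h ((\<I> g) f) \<rightarrow> h (g f)\<close> to \<open>\<aa> h g f\<close>.
\<close>

definition unit_axiom1_left :: "'o \<Rightarrow> 'o \<Rightarrow> 'o \<Rightarrow> 't" where
  "unit_axiom1_left h g f =
     (let e1 = map1 (\<R> f) (map1 (\<R> g) (\<rr>' h)); e2 = map1 (\<R> f) (\<aa> h \<I> g); e3 = \<aa> h (\<I> \<otimes> g) f;
          c4 = \<aa> \<I> g f; c5 = \<ll> (g \<otimes> f);
          f4 = map1 (\<L> h) c4; f5 = map1 (\<L> h) c5;
          g1 = \<aa> (h \<otimes> \<I>) g f; g2 = \<aa> h \<I> (g \<otimes> f);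
          q = map1 (\<R> (g \<otimes> f)) (\<rr>' h); k = \<aa> h g f
      in collapse_left B f5 g2 q (mum M (h, g \<otimes> f)) k
         \<cdot> (f5 \<rhd> g2 \<rhd> slide_right (\<rr>' h) g f)
         \<cdot> (f5 \<rhd> paste3 B f4 e3 e2 (pim M (h, \<I>, g, f)) g2 g1 e1)
         \<cdot> asc B f5 f4 (e3 \<odot> e2 \<odot> e1)
         \<cdot> (image12 B (\<L> h) (lam M (g, f)) c5 c4 \<lhd> (e3 \<odot> e2 \<odot> e1)))"

definition unit_axiom1_right :: "'o \<Rightarrow> 'o \<Rightarrow> 'o \<Rightarrow> 't" where
  "unit_axiom1_right h g f =
     (let c1 = map1 (\<R> g) (\<rr>' h); c2 = \<aa> h \<I> g; c3 = map1 (\<L> h) (\<ll> g);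
          e1 = map1 (\<R> f) c1; e2 = map1 (\<R> f) c2; e3 = \<aa> h (\<I> \<otimes> g) f;
          e4 = map1 (\<L> h) (map1 (\<R> f) (\<ll> g));
          m = map1 (\<R> f) c3; k = \<aa> h g f
      in collapse_right B k (image30 B (\<R> f) c3 c2 c1 (mum M (h, g)) (h \<otimes> g))
         \<cdot> paste2 B e4 e3 (slide_mid h (\<ll> g) f) k m (e2 \<odot> e1))"

text \<open>
  The second unit axiom: both sides are 2-cells from
  \<open>(h g) f \<rightarrow> (h (g \<I>)) f \<rightarrow> h ((g \<I>) f) \<rightarrow> h (g (\<I> f)) \<rightarrow> h (g f)\<close> to \<open>\<aa> h g f\<close>.
\<close>

definition unit_axiom2_left :: "'o \<Rightarrow> 'o \<Rightarrow> 'o \<Rightarrow> 't" where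
  "unit_axiom2_left h g f =
     (let e2 = \<aa> h (g \<otimes> \<I>) f; e3 = map1 (\<L> h) (\<aa> g \<I> f); e4 = map1 (\<L> h) (map1 (\<L> g) (\<ll> f));
          c1 = \<rr>' (h \<otimes> g); c2 = \<aa> h g \<I>;
          f1 = map1 (\<R> f) c1; f2 = map1 (\<R> f) c2;
          g1 = \<aa> (h \<otimes> g) \<I> f; g2 = \<aa> h g (\<I> \<otimes> f);
          q = map1 (\<L> (h \<otimes> g)) (\<ll> f); k = \<aa> h g f
      in collapse_right B k (mum M (h \<otimes> g, f))
         \<cdot> paste2 B e4 g2 (slide_left h g (\<ll> f)) k q (g1 \<odot> f1)
         \<cdot> (e4 \<rhd> paste3 B e3 e2 f2 (pim M (h, g, \<I>, f)) g2 g1 f1)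
         \<cdot> (e4 \<rhd> e3 \<rhd> e2 \<rhd> image12 B (\<R> f) (rhm M (h, g)) c2 c1))"

definition unit_axiom2_right :: "'o \<Rightarrow> 'o \<Rightarrow> 'o \<Rightarrow> 't" where
  "unit_axiom2_right h g f =
     (let c1 = map1 (\<R> f) (\<rr>' g); c2 = \<aa> g \<I> f; c3 = map1 (\<L> g) (\<ll> f);
          e3 = map1 (\<L> h) c2; e4 = map1 (\<L> h) c3;
          m = map1 (\<L> h) c1; k = \<aa> h g f
      in collapse_left B e4 e3 m (image30 B (\<L> h) c3 c2 c1 (mum M (g, f)) (g \<otimes> f)) k
         \<cdot> (e4 \<rhd> e3 \<rhd> inv2 B (slide_mid h (\<rr>' g) f)))"

end

locale monoidal_bicategory = monoidal_data B M + bicategory B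
  for B :: "('o, 'f, 't) bicat" (structure) and M :: "('o, 'f, 't) monoidal_structure" +
  assumes tensor_pseudofunctor: "pseudofunctor B2 B (ten M)"
    and unit_Ob: "\<I> \<in> Ob B"
    and associativity: "adjoint_equivalence B3 B
          ((P31 \<boxtimes> P32) \<boxtimes> P33) (P31 \<boxtimes> (P32 \<boxtimes> P33)) (asq M)"
    and left_unit: "adjoint_equivalence B B (\<L> \<I>) (id_psfun B) (luq M)"
    and right_unit: "adjoint_equivalence B B (\<R> \<I>) (id_psfun B) (ruq M)"
    and pi_modification: "invertible_modification B4 B
          (((P41 \<boxtimes> P42) \<boxtimes> P43) \<boxtimes> P44) (P41 \<boxtimes> (P42 \<boxtimes> (P43 \<boxtimes> P44))) pi_source pi_target (pim M)"
    and mu_modification: "invertible_modification B2 B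
          (P21 \<boxtimes> P22) (P21 \<boxtimes> P22) mu_source (id_pstrans B (P21 \<boxtimes> P22)) (mum M)"
    and lambda_modification: "invertible_modification B2 B
          ((const_psfun B \<I> \<boxtimes> P21) \<boxtimes> P22) (P21 \<boxtimes> P22) lambda_source lambda_target (lam M)"
    and rho_modification: "invertible_modification B2 B
          (P21 \<boxtimes> P22) (P21 \<boxtimes> (P22 \<boxtimes> const_psfun B \<I>)) rho_source rho_target (rhm M)"
    and cocycle: "\<lbrakk>k \<in> Ob B; j \<in> Ob B; h \<in> Ob B; g \<in> Ob B; f \<in> Ob B\<rbrakk>
          \<Longrightarrow> cocycle_left k j h g f = cocycle_right k j h g f"
    and unit_axiom1: "\<lbrakk>h \<in> Ob B; g \<in> Ob B; f \<in> Ob B\<rbrakk>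
          \<Longrightarrow> unit_axiom1_left h g f = unit_axiom1_right h g f"
    and unit_axiom2: "\<lbrakk>h \<in> Ob B; g \<in> Ob B; f \<in> Ob B\<rbrakk>
          \<Longrightarrow> unit_axiom2_left h g f = unit_axiom2_right h g f"


section \<open>The fundamental 2-groupoid\<close>

text \<open>
  Functions on the unit interval and on the unit square are extensional, so that equality of
  functions is equality of paths, respectively of homotopies. In a homotopy \<open>H (s, t)\<close> the first
  variable is the homotopy parameter.
\<close>

abbreviation unit_square :: "(real \<times> real) set" where
  "unit_square \<equiv> {0..1} \<times> {0..1}"

definition paths :: "'a topology \<Rightarrow> (real \<Rightarrow> 'a) set" where
  "paths X = {p \<in> extensional {0..1}. pathin X p}"

definition path_homotopies :: "'a topology \<Rightarrow> (real \<times> real \<Rightarrow> 'a) set" where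
  "path_homotopies X =
     {H \<in> extensional unit_square. continuous_map (top_of_set unit_square) X H \<and>
        (\<forall>s\<in>{0..1}. H (s, 0) = H (0, 0) \<and> H (s, 1) = H (0, 1))}"

definition homotopy_class ::
  "'a topology \<Rightarrow> (real \<times> real \<Rightarrow> 'a) \<Rightarrow> (real \<times> real \<Rightarrow> 'a) set" where
  "homotopy_class X H =
     {K \<in> path_homotopies X.
        homotopic_with (\<lambda>L. \<forall>z \<in> unit_square - {0<..<1} \<times> {0<..<1}. L z = H z)
          (top_of_set unit_square) X H K}"

definition const_path :: "'a \<Rightarrow> real \<Rightarrow> 'a" where
  "const_path x = (\<lambda>t\<in>{0..1}. x)"

definition concat_path :: "(real \<Rightarrow> 'a) \<Rightarrow> (real \<Rightarrow> 'a) \<Rightarrow> real \<Rightarrow> 'a" where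
  "concat_path g f = (\<lambda>t\<in>{0..1}. if t \<le> 1/2 then f (2 * t) else g (2 * t - 1))"

definition vconcat :: "(real \<times> real \<Rightarrow> 'a) \<Rightarrow> (real \<times> real \<Rightarrow> 'a) \<Rightarrow> real \<times> real \<Rightarrow> 'a" where
  "vconcat K H = (\<lambda>(s, t)\<in>unit_square. if s \<le> 1/2 then H (2 * s, t) else K (2 * s - 1, t))"

definition hconcat :: "(real \<times> real \<Rightarrow> 'a) \<Rightarrow> (real \<times> real \<Rightarrow> 'a) \<Rightarrow> real \<times> real \<Rightarrow> 'a" where
  "hconcat K H = (\<lambda>(s, t)\<in>unit_square. if t \<le> 1/2 then H (s, 2 * t) else K (s, 2 * t - 1))"

text \<open>The linear homotopy from the reparametrization \<open>p \<circ> \<phi>\<close> to \<open>p \<circ> \<psi>\<close>.\<close>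

definition reparam ::
  "(real \<Rightarrow> 'a) \<Rightarrow> (real \<Rightarrow> real) \<Rightarrow> (real \<Rightarrow> real) \<Rightarrow> real \<times> real \<Rightarrow> 'a" where
  "reparam p \<phi> \<psi> = (\<lambda>(s, t)\<in>unit_square. p ((1 - s) * \<phi> t + s * \<psi> t))"

definition fundamental_2groupoid ::
  "'a topology \<Rightarrow> ('a, real \<Rightarrow> 'a, (real \<times> real \<Rightarrow> 'a) set) bicat"  ("\<Pi>\<^sub>2") where
  "\<Pi>\<^sub>2 X = \<lparr>
     Ob = topspace X,
     Arr = paths X,
     Cell = homotopy_class X ` path_homotopies X,
     src = (\<lambda>p. p 0),
     trg = (\<lambda>p. p 1),
     dom2 = (\<lambda>\<alpha>. \<lambda>t\<in>{0..1}. (SOME H. H \<in> \<alpha>) (0, t)),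
     cod2 = (\<lambda>\<alpha>. \<lambda>t\<in>{0..1}. (SOME H. H \<in> \<alpha>) (1, t)),
     id1 = const_path,
     cmp1 = concat_path,
     id2 = (\<lambda>p. homotopy_class X (\<lambda>(s, t)\<in>unit_square. p t)),
     vcmp = (\<lambda>\<beta> \<alpha>. \<Union>K\<in>\<beta>. \<Union>H\<in>\<alpha>. homotopy_class X (vconcat K H)),
     hcmp = (\<lambda>\<beta> \<alpha>. \<Union>K\<in>\<beta>. \<Union>H\<in>\<alpha>. homotopy_class X (hconcat K H)),
     asc = (\<lambda>h g f. homotopy_class X (reparam (concat_path (concat_path h g) f)
              (\<lambda>t. t)
              (\<lambda>t. if t \<le> 1/4 then 2 * t else if t \<le> 1/2 then t + 1/4 else (t + 1) / 2))),
     lun = (\<lambda>f. homotopy_class X (reparam f (\<lambda>t. min (2 * t) 1) (\<lambda>t. t))),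
     run = (\<lambda>f. homotopy_class X (reparam f (\<lambda>t. max (2 * t - 1) 0) (\<lambda>t. t))) \<rparr>"


section \<open>The little 1-cubes operad\<close>

text \<open>
  The map \<open>t \<mapsto> (y - x) * t + x\<close> on \<open>J = (0, 1)\<close> is encoded by the pair \<open>(x, y)\<close>, a \<open>k\<close>-tuple of
  such maps by an extensional function on \<open>{..<k}\<close>, and \<open>C1 k\<close> carries the topology of the endpoints,
  which is the one induced from the compact-open topology on maps \<open>J \<rightarrow> J\<close>.
\<close>

definition lc_map :: "real \<times> real \<Rightarrow> real \<Rightarrow> real" where
  "lc_map = (\<lambda>(x, y) t. (y - x) * t + x)"

definition C1 :: "nat \<Rightarrow> (nat \<Rightarrow> real \<times> real) set" where
  "C1 k = {c \<in> extensional {..<k}.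
     (\<forall>i<k. 0 \<le> fst (c i) \<and> fst (c i) < snd (c i) \<and> snd (c i) \<le> 1) \<and>
     (\<forall>i<k. \<forall>i'<k. i \<noteq> i' \<longrightarrow> lc_map (c i) ` {0<..<1} \<inter> lc_map (c i') ` {0<..<1} = {})}"

definition C1_top :: "nat \<Rightarrow> (nat \<Rightarrow> real \<times> real) topology" where
  "C1_top k = subtopology (product_topology (\<lambda>_. euclidean) {..<k}) (C1 k)"

text \<open>The pair encoding the composite map \<open>lc_map c \<circ> lc_map d\<close>.\<close>

definition lc_comp :: "real \<times> real \<Rightarrow> real \<times> real \<Rightarrow> real \<times> real" where
  "lc_comp c d = (lc_map c (fst d), lc_map c (snd d))"

text \<open>
  Concatenation of tuples of lengths \<open>n 0, \<dots>, n (k - 1)\<close>: position \<open>m\<close> of the concatenation is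
  position \<open>offset n m\<close> of the tuple with index \<open>block n m\<close>.
\<close>

definition block :: "(nat \<Rightarrow> nat) \<Rightarrow> nat \<Rightarrow> nat" where
  "block n m = (LEAST i. m < sum n {..i})"

definition offset :: "(nat \<Rightarrow> nat) \<Rightarrow> nat \<Rightarrow> nat" where
  "offset n m = m - sum n {..<block n m}"

definition concat_tuple :: "nat \<Rightarrow> (nat \<Rightarrow> nat) \<Rightarrow> (nat \<Rightarrow> nat \<Rightarrow> 'b) \<Rightarrow> nat \<Rightarrow> 'b" where
  "concat_tuple k n x = (\<lambda>m\<in>{..<sum n {..<k}}. x (block n m) (offset n m))"

definition C1_unit :: "nat \<Rightarrow> real \<times> real" where
  "C1_unit = (\<lambda>i\<in>{..<1}. (0, 1))"

definition C1_mult ::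
  "nat \<Rightarrow> (nat \<Rightarrow> nat) \<Rightarrow> (nat \<Rightarrow> real \<times> real) \<Rightarrow> (nat \<Rightarrow> nat \<Rightarrow> real \<times> real) \<Rightarrow> nat \<Rightarrow> real \<times> real"
  where
  "C1_mult k n c d = concat_tuple k n (\<lambda>i r. lc_comp (c i) (d i r))"

text \<open>
  The basepoint of the algebra is the value of \<open>\<theta> 0\<close> at the unique point of \<open>C1 0\<close> and the empty
  tuple, so \<open>X\<close> is automatically a based space.
\<close>

locale C1_algebra =
  fixes X :: "'a topology"
    and \<theta> :: "nat \<Rightarrow> (nat \<Rightarrow> real \<times> real) \<Rightarrow> (nat \<Rightarrow> 'a) \<Rightarrow> 'a"
  assumes action_continuous: "continuous_map
          (prod_topology (C1_top k) (product_topology (\<lambda>_. X) {..<k})) X (\<lambda>(c, x). \<theta> k c x)"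
    and action_unit: "p \<in> topspace X \<Longrightarrow> \<theta> 1 C1_unit (\<lambda>i\<in>{..<1}. p) = p"
    and action_mult: "\<lbrakk>c \<in> C1 k; \<And>i. i < k \<Longrightarrow> d i \<in> C1 (n i);
            \<And>i. i < k \<Longrightarrow> x i \<in> {..<n i} \<rightarrow>\<^sub>E topspace X\<rbrakk>
          \<Longrightarrow> \<theta> (sum n {..<k}) (C1_mult k n c d) (concat_tuple k n x)
              = \<theta> k c (\<lambda>i\<in>{..<k}. \<theta> (n i) (d i) (x i))"
    and action_equivariant: "\<lbrakk>\<pi> permutes {..<k}; c \<in> C1 k; y \<in> {..<k} \<rightarrow>\<^sub>E topspace X\<rbrakk>
          \<Longrightarrow> \<theta> k (c \<circ> \<pi>) y = \<theta> k c (y \<circ> inv \<pi>)"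

end

(*
  Every structural cell of the monoidal bicategory is the image, under a continuous map, of a cell in
  a space in which any two homotopies between the same paths agree: ordered configurations of
  intervals, the unit interval and the unit square all admit a continuous mixing of points
  m r a b with m 0 a b = a, m 1 a b = b and m r a a = a, so a 2-cell there is determined by its
  boundary. Units and associators of the 2-groupoid are images of reparametrizations of an interval;
  the associativity and unit 1-cells are images of straight paths between configurations, and the
  modifications are images of the unique 2-cells between such paths. An equation between pastings
  of structural cells then only requires both sides to lift to the same space with the same boundary.
  The exceptions are the naturality equations for arbitrary 2-cells, which are all instances of
  sliding a family of lifted cells along the homotopy parameter.
*)
theory Submission
  imports Defs
begin

section \<open>Homotopy classes of squares\<close>

text \<open>A lifted cell is determined by its boundary, but this helps only if the two sides of an
  axiom have literally the same boundary: 1-cells are paths, not classes of paths. The constructions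
  are therefore chosen to be strict on 1-cells. Composing with a continuous map commutes with
  concatenation on the nose, so the functors involved have identity constraints. The tensor product
  places two configurations in the two halves of the interval; this operation, and operadic
  substitution into a configuration, are affine in the configurations that move, so they send
  straight paths to straight paths with the same parametrization. Hence the associator or unit at a
  compound object, or tensored with an identity, equals a straight path between two bracketings and
  is not merely homotopic to one. Ordering the intervals selects one component of each space of
  little intervals; intervals that could exchange places would not survive convex combination. In an
  axiom all objects become values of the action on appended lists of points, and the bracketing is
  recorded by the configuration alone.\<close>

abbreviation unit_cube :: "(real \<times> real \<times> real) set" where
  "unit_cube \<equiv> {0..1} \<times> unit_square"

abbreviation Itop :: "real topology" where "Itop \<equiv> top_of_set {0..1}"

definition htpy :: "'a topology \<Rightarrow> (real \<Rightarrow> 'a) \<Rightarrow> (real \<Rightarrow> 'a) \<Rightarrow> (real \<times> real \<Rightarrow> 'a) \<Rightarrow> bool" where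
  "htpy X f g H \<longleftrightarrow> continuous_map (top_of_set unit_square) X H
     \<and> (\<forall>t\<in>{0..1}. H (0, t) = f t \<and> H (1, t) = g t)
     \<and> (\<forall>s\<in>{0..1}. H (s, 0) = f 0 \<and> H (s, 1) = f 1)"

lemma continuous_map_reindex:
  assumes "continuous_map (top_of_set B) X F" "continuous_on A \<phi>" "\<phi> ` A \<subseteq> B"
  shows "continuous_map (top_of_set A) X (\<lambda>x. F (\<phi> x))"
  using continuous_map_compose[of "top_of_set A" "top_of_set B" \<phi> X F] assms
  by (auto simp: o_def image_subset_iff_funcset)

lemma continuous_map_glue:
  assumes "continuous_on A p"
    and "continuous_map (top_of_set {x \<in> A. p x \<le> c}) X f"
    and "continuous_map (top_of_set {x \<in> A. c \<le> p x}) X g"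
    and "\<And>x. x \<in> A \<Longrightarrow> p x = c \<Longrightarrow> f x = g x"
  shows "continuous_map (top_of_set A) X (\<lambda>x. if p x \<le> (c::real) then f x else g x)"
proof (rule continuous_map_cases_le[where q="\<lambda>_. c"])
  have "A \<inter> {x. x \<in> A \<and> p x \<le> c} = {x \<in> A. p x \<le> c}" "A \<inter> {x. x \<in> A \<and> c \<le> p x} = {x \<in> A. c \<le> p x}"
    by auto
  then show "continuous_map (subtopology (top_of_set A) {x \<in> topspace (top_of_set A). p x \<le> c}) X f"
    "continuous_map (subtopology (top_of_set A) {x \<in> topspace (top_of_set A). c \<le> p x}) X g"
    using assms by (simp_all add: subtopology_subtopology)
qed (use assms in auto)

lemma homotopy_class_iff:
  "K \<in> homotopy_class X H \<longleftrightarrow> K \<in> path_homotopies X \<and>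
     (\<exists>h. continuous_map (top_of_set unit_cube) X h
        \<and> (\<forall>z\<in>unit_square. h (0, z) = H z \<and> h (1, z) = K z)
        \<and> (\<forall>r\<in>{0..1}. \<forall>z \<in> unit_square - {0<..<1} \<times> {0<..<1}. h (r, z) = H z))"
proof -
  have "homotopic_with (\<lambda>L. \<forall>z \<in> unit_square - {0<..<1} \<times> {0<..<1}. L z = H z)
      (top_of_set unit_square) X H K \<longleftrightarrow>
     (\<exists>h. continuous_map (top_of_set unit_cube) X h
        \<and> (\<forall>z\<in>unit_square. h (0, z) = H z) \<and> (\<forall>z\<in>unit_square. h (1, z) = K z)
        \<and> (\<forall>r\<in>{0..1}. \<forall>z \<in> unit_square - {0<..<1} \<times> {0<..<1}. h (r, z) = H z))"
    by (subst homotopic_with) simp_all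
  then show ?thesis
    unfolding homotopy_class_def mem_Collect_eq ball_conj_distrib conj_assoc by (rule conj_cong[OF refl])
qed

lemma homotopy_class_eqI:
  assumes h: "continuous_map (top_of_set unit_cube) X h"
    and 0: "\<And>z. z \<in> unit_square \<Longrightarrow> h (0, z) = H z"
    and 1: "\<And>z. z \<in> unit_square \<Longrightarrow> h (1, z) = K z"
    and b: "\<And>r z. r \<in> {0..1} \<Longrightarrow> z \<in> unit_square - {0<..<1} \<times> {0<..<1} \<Longrightarrow> h (r, z) = H z"
  shows "homotopy_class X H = homotopy_class X K"
proof -
  let ?P = "\<lambda>L. \<forall>z \<in> unit_square - {0<..<1} \<times> {0<..<1}. L z = H z"
  let ?Q = "\<lambda>L. \<forall>z \<in> unit_square - {0<..<1} \<times> {0<..<1}. L z = K z"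
  have "K z = H z" if "z \<in> unit_square - {0<..<1} \<times> {0<..<1}" for z
    using b[OF _ that, of 1] 1[of z] that by simp
  \<comment> \<open>The relative homotopy relation mentions the boundary values of its base
    representative. \<open>H\<close> and \<open>K\<close> agree there, so both classes are defined
    by the same predicate, and symmetry and transitivity of \<open>homotopic_with\<close>
    apply.\<close>
  then have PQ: "?Q = ?P" by (intro ext) auto
  have HK: "homotopic_with ?P (top_of_set unit_square) X H K"
    by (subst homotopic_with, simp, intro exI[of _ h] conjI ballI) (simp_all only: h 0 1 b prod_topology_subtopology_eu topspace_euclidean_subtopology)
  then have KH: "homotopic_with ?P (top_of_set unit_square) X K H"
    by (rule homotopic_with_symD)
  show ?thesis
    unfolding homotopy_class_def PQ
    using HK KH by (auto intro: homotopic_with_trans)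
qed

lemma homotopy_class_cong:
  assumes "continuous_map (top_of_set unit_square) X H" "\<And>z. z \<in> unit_square \<Longrightarrow> H z = K z"
  shows "homotopy_class X H = homotopy_class X K"
proof (rule homotopy_class_eqI[where h="\<lambda>x. H (snd x)"])
  show "continuous_map (top_of_set unit_cube) X (\<lambda>x. H (snd x))"
    by (rule continuous_map_reindex[OF assms(1)]) (auto intro!: continuous_intros)
qed (simp_all add: assms(2))

lemma htpy_cong:
  assumes "htpy X f g H" "\<And>t. t \<in> {0..1} \<Longrightarrow> f t = f' t" "\<And>t. t \<in> {0..1} \<Longrightarrow> g t = g' t"
    "\<And>z. z \<in> unit_square \<Longrightarrow> H z = H' z"
  shows "htpy X f' g' H'"
proof -
  have "continuous_map (top_of_set unit_square) X H'"
    using assms(1,4) by (intro continuous_map_eq[where g=H' and f=H]) (auto simp: htpy_def)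
  then show ?thesis using assms by (auto simp: htpy_def)
qed

lemma htpyD:
  assumes "htpy X f g H"
  shows "continuous_map (top_of_set unit_square) X H"
    and "\<And>t. t \<in> {0..1} \<Longrightarrow> H (0, t) = f t" and "\<And>t. t \<in> {0..1} \<Longrightarrow> H (1, t) = g t"
    and "\<And>s. s \<in> {0..1} \<Longrightarrow> H (s, 0) = f 0" and "\<And>s. s \<in> {0..1} \<Longrightarrow> H (s, 1) = f 1"
  using assms unfolding htpy_def by blast+

lemma htpy_ends:
  assumes "htpy X f g H" shows "g 0 = f 0" "g 1 = f 1"
  using htpyD(3-5)[OF assms, of 0] htpyD(3-5)[OF assms, of 1] by simp_all

lemma path_homotopies_iff:
  "H \<in> path_homotopies X \<longleftrightarrow> H \<in> extensional unit_square \<and> (\<exists>f g. htpy X f g H)"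
proof
  assume "H \<in> path_homotopies X"
  then have "H \<in> extensional unit_square \<and> htpy X (\<lambda>t. H (0, t)) (\<lambda>t. H (1, t)) H"
    unfolding path_homotopies_def htpy_def by blast
  then show "H \<in> extensional unit_square \<and> (\<exists>f g. htpy X f g H)" by blast
next
  assume "H \<in> extensional unit_square \<and> (\<exists>f g. htpy X f g H)"
  then show "H \<in> path_homotopies X"
    unfolding path_homotopies_def htpy_def mem_Collect_eq by (metis atLeastAtMost_iff order_refl zero_le_one)
qed

text \<open>Members of a class are extensional, so \<open>H\<close> itself may fail to belong to its
  class; its restriction does.\<close>

lemma homotopy_class_self:
  assumes "htpy X f g H" shows "restrict H unit_square \<in> homotopy_class X H"
  unfolding homotopy_class_iff
proof (intro conjI exI[of _ "\<lambda>x. H (snd x)"])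
  have "htpy X f g (restrict H unit_square)" by (rule htpy_cong[OF assms]) auto
  then show "restrict H unit_square \<in> path_homotopies X" unfolding path_homotopies_iff by blast
  show "continuous_map (top_of_set unit_cube) X (\<lambda>x. H (snd x))"
    by (rule continuous_map_reindex[of unit_square]) (use assms in \<open>auto simp: htpy_def intro!: continuous_intros\<close>)
qed auto

lemma homotopy_class_mem:
  assumes K: "K \<in> homotopy_class X H" and H: "htpy X f g H"
  shows "homotopy_class X K = homotopy_class X H" "htpy X f g K"
proof -
  obtain h where h: "continuous_map (top_of_set unit_cube) X h"
    "\<And>z. z \<in> unit_square \<Longrightarrow> h (0, z) = H z \<and> h (1, z) = K z"
    "\<And>r z. r \<in> {0..1} \<Longrightarrow> z \<in> unit_square - {0<..<1} \<times> {0<..<1} \<Longrightarrow> h (r, z) = H z"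
    using K unfolding homotopy_class_iff by blast
  show "homotopy_class X K = homotopy_class X H"
    by (rule sym, rule homotopy_class_eqI[OF h(1)]) (use h in auto)
  have "K z = H z" if "z \<in> unit_square - {0<..<1} \<times> {0<..<1}" for z
    using h(3)[OF _ that, of 1] h(2)[of z] that by simp
  moreover have "continuous_map (top_of_set unit_square) X K"
    using K unfolding homotopy_class_iff path_homotopies_def by auto
  ultimately show "htpy X f g K" using H by (auto simp: htpy_def)
qed

text \<open>The same choice that \<open>dom2\<close> and \<open>cod2\<close> make, under a name of
  its own.\<close>

definition rep :: "(real \<times> real \<Rightarrow> 'a) set \<Rightarrow> real \<times> real \<Rightarrow> 'a" where
  "rep \<alpha> = (SOME H. H \<in> \<alpha>)"

lemma rep_in:
  assumes "htpy X f g H" shows "rep (homotopy_class X H) \<in> homotopy_class X H"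
  unfolding rep_def using homotopy_class_self[OF assms] by (metis someI)

lemma htpy_rep: "htpy X f g H \<Longrightarrow> htpy X f g (rep (homotopy_class X H))"
  and class_rep: "htpy X f g H \<Longrightarrow> homotopy_class X (rep (homotopy_class X H)) = homotopy_class X H"
  using homotopy_class_mem[OF rep_in] by blast+

lemma pathsD:
  assumes "htpy X f g H" "f \<in> extensional {0..1}" "g \<in> extensional {0..1}"
  shows "f \<in> paths X" "g \<in> paths X"
proof -
  have "continuous_map Itop X (\<lambda>t. H (c, t))" if "c \<in> {0..1}" for c
    by (rule continuous_map_reindex[of unit_square])
      (use assms(1) that in \<open>auto simp: htpy_def intro!: continuous_intros\<close>)
  then have "continuous_map Itop X (\<lambda>t. H (0, t))" "continuous_map Itop X (\<lambda>t. H (1, t))"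
    by simp_all
  then have "continuous_map Itop X f" "continuous_map Itop X g"
    using htpyD(2)[OF assms(1)] continuous_map_eq[of Itop X "\<lambda>t. H (0, t)" f]
      htpyD(3)[OF assms(1)] continuous_map_eq[of Itop X "\<lambda>t. H (1, t)" g] by simp_all
  then show "f \<in> paths X" "g \<in> paths X" using assms by (auto simp: paths_def pathin_def)
qed

section \<open>Two-cells of the fundamental 2-groupoid\<close>

lemma fundamental_simps [simp]:
  "Ob (\<Pi>\<^sub>2 X) = topspace X" "Arr (\<Pi>\<^sub>2 X) = paths X" "src (\<Pi>\<^sub>2 X) p = p 0" "trg (\<Pi>\<^sub>2 X) p = p 1"
  "id1 (\<Pi>\<^sub>2 X) = const_path" "cmp1 (\<Pi>\<^sub>2 X) = concat_path"
  by (auto simp: fundamental_2groupoid_def)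

lemma hom1_fundamental: "hom1 (\<Pi>\<^sub>2 X) a b = {p \<in> paths X. p 0 = a \<and> p 1 = b}"
  by (simp add: hom1_def)

lemma dom2_class:
  assumes "htpy X f g H" shows "dom2 (\<Pi>\<^sub>2 X) (homotopy_class X H) = restrict f {0..1}"
    "cod2 (\<Pi>\<^sub>2 X) (homotopy_class X H) = restrict g {0..1}"
  using htpy_rep[OF assms] by (auto simp: fundamental_2groupoid_def htpy_def rep_def[symmetric])

lemma class_in_Cell:
  assumes "htpy X f g H" shows "homotopy_class X H \<in> Cell (\<Pi>\<^sub>2 X)"
proof -
  have "htpy X f g (restrict H unit_square)" by (rule htpy_cong[OF assms]) auto
  moreover have "homotopy_class X H = homotopy_class X (restrict H unit_square)"
    by (rule homotopy_class_cong) (use assms in \<open>auto simp: htpy_def\<close>)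
  ultimately have "restrict H unit_square \<in> path_homotopies X"
      "homotopy_class X H = homotopy_class X (restrict H unit_square)"
    unfolding path_homotopies_iff by auto
  then show ?thesis unfolding fundamental_2groupoid_def by (simp add: image_iff) blast
qed

lemma class_hom2:
  assumes "htpy X f g H" "f \<in> extensional {0..1}" "g \<in> extensional {0..1}"
  shows "homotopy_class X H \<in> hom2 (\<Pi>\<^sub>2 X) f g"
  using assms dom2_class[OF assms(1)] class_in_Cell[OF assms(1)]
  by (simp add: hom2_def extensional_restrict)

lemma hom2E:
  assumes "\<alpha> \<in> hom2 (\<Pi>\<^sub>2 X) f g"
  obtains H where "htpy X f g H" "\<alpha> = homotopy_class X H" "f \<in> paths X" "g \<in> paths X"
    "f 0 = g 0" "f 1 = g 1"
proof -
  obtain H f' g' where H: "htpy X f' g' H" "\<alpha> = homotopy_class X H"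
    using assms unfolding hom2_def by (auto simp: fundamental_2groupoid_def path_homotopies_iff)
  with dom2_class[OF H(1)] have fg: "f = restrict f' {0..1}" "g = restrict g' {0..1}"
    using assms by (auto simp: hom2_def)
  have "htpy X f g H" by (rule htpy_cong[OF H(1)]) (auto simp: fg)
  moreover have "f \<in> extensional {0..1}" "g \<in> extensional {0..1}" by (auto simp: fg)
  ultimately show ?thesis using that H(2) pathsD htpy_ends by metis
qed

lemma paths_ext: "p \<in> paths X \<Longrightarrow> p \<in> extensional {0..1}"
  by (simp add: paths_def)

lemma paths_cont: "p \<in> paths X \<Longrightarrow> continuous_map Itop X p"
  by (simp add: paths_def pathin_def)

lemma paths_topspace: "p \<in> paths X \<Longrightarrow> t \<in> {0..1} \<Longrightarrow> p t \<in> topspace X"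
  using paths_cont continuous_map_image_subset_topspace by fastforce

lemma paths_topspace01 [simp]: "p \<in> paths X \<Longrightarrow> p 0 \<in> topspace X" "p \<in> paths X \<Longrightarrow> p 1 \<in> topspace X"
  by (simp_all add: paths_topspace)

lemma path_eqI:
  "f \<in> extensional {0..1::real} \<Longrightarrow> g \<in> extensional {0..1} \<Longrightarrow> (\<And>t. t \<in> {0..1} \<Longrightarrow> f t = g t) \<Longrightarrow> f = g"
  by (rule extensionalityI)

lemma const_path_simps [simp]: "const_path x 0 = x" "const_path x 1 = x"
  by (auto simp: const_path_def)

lemma concat_path_simps [simp]: "concat_path g f 0 = f 0" "concat_path g f 1 = g 1"
  by (auto simp: concat_path_def)

lemma const_path_ext [simp]: "const_path x \<in> extensional {0..1}"
  and concat_path_ext [simp]: "concat_path g f \<in> extensional {0..1}"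
  by (auto simp: const_path_def concat_path_def)

lemma const_path_paths [simp]: "x \<in> topspace X \<Longrightarrow> const_path x \<in> paths X"
  by (auto simp: paths_def pathin_def const_path_def intro: continuous_map_eq[of _ _ "\<lambda>_. x"])

lemma concat_const [simp]: "concat_path (const_path x) (const_path x) = const_path x"
  by (rule path_eqI) (auto simp: const_path_def concat_path_def)

lemma concat_path_paths:
  assumes "f \<in> paths X" "g \<in> paths X" "f 1 = g 0"
  shows "concat_path g f \<in> paths X"
proof -
  have "continuous_map Itop X (\<lambda>t. if t \<le> 1/2 then f (2 * t) else g (2 * t - 1))"
    by (rule continuous_map_glue)
      (use assms in \<open>auto intro!: continuous_intros continuous_map_reindex[OF paths_cont] simp: field_simps\<close>)
  then have "continuous_map Itop X (concat_path g f)"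
    by (rule continuous_map_eq) (auto simp: concat_path_def)
  then show ?thesis by (auto simp: paths_def pathin_def)
qed

lemma htpy_vconcat:
  assumes H: "htpy X f g H" and K: "htpy X g k K"
  shows "htpy X f k (vconcat K H)"
proof -
  have cH: "continuous_map (top_of_set unit_square) X H" and cK: "continuous_map (top_of_set unit_square) X K"
    using assms by (auto simp: htpy_def)
  have "continuous_map (top_of_set unit_square) X
      (\<lambda>z. if fst z \<le> 1/2 then H (2 * fst z, snd z) else K (2 * fst z - 1, snd z))"
    by (rule continuous_map_glue)
      (use assms in \<open>auto simp: htpy_def field_simps intro!: continuous_intros continuous_map_reindex[OF cH] continuous_map_reindex[OF cK]\<close>)
  then have "continuous_map (top_of_set unit_square) X (vconcat K H)"
    by (rule continuous_map_eq) (auto simp: vconcat_def)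
  moreover have "g 0 = f 0" "g 1 = f 1" using htpy_ends[OF H] by auto
  ultimately show ?thesis using assms unfolding htpy_def by (auto simp: vconcat_def)
qed

lemma htpy_hconcat:
  assumes H: "htpy X f f' H" and K: "htpy X g g' K" and fg: "f 1 = g 0"
  shows "htpy X (concat_path g f) (concat_path g' f') (hconcat K H)"
proof -
  have cH: "continuous_map (top_of_set unit_square) X H" and cK: "continuous_map (top_of_set unit_square) X K"
    using assms by (auto simp: htpy_def)
  have "continuous_map (top_of_set unit_square) X
      (\<lambda>z. if snd z \<le> 1/2 then H (fst z, 2 * snd z) else K (fst z, 2 * snd z - 1))"
    by (rule continuous_map_glue)
      (use assms in \<open>auto simp: htpy_def field_simps intro!: continuous_intros continuous_map_reindex[OF cH] continuous_map_reindex[OF cK]\<close>)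
  then have "continuous_map (top_of_set unit_square) X (hconcat K H)"
    by (rule continuous_map_eq) (auto simp: hconcat_def)
  then show ?thesis using assms unfolding htpy_def
    by (auto simp: hconcat_def concat_path_def)
qed

text \<open>The composite is defined as a union over all pairs of representatives. All pairs give
  the same class, because relative homotopies fix the shared edge and can therefore be stacked; both
  classes are nonempty, so the union is that one class.\<close>

lemma vcmp_class:
  assumes H: "htpy X f g H" and K: "htpy X g k K"
  shows "vcmp (\<Pi>\<^sub>2 X) (homotopy_class X K) (homotopy_class X H) = homotopy_class X (vconcat K H)"
proof -
  have eq: "homotopy_class X (vconcat K' H') = homotopy_class X (vconcat K H)"
    if H': "H' \<in> homotopy_class X H" and K': "K' \<in> homotopy_class X K" for H' K'
  proof -
    obtain h where h: "continuous_map (top_of_set unit_cube) X h"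
      "\<And>z. z \<in> unit_square \<Longrightarrow> h (0, z) = H z \<and> h (1, z) = H' z"
      "\<And>r z. r \<in> {0..1} \<Longrightarrow> z \<in> unit_square - {0<..<1} \<times> {0<..<1} \<Longrightarrow> h (r, z) = H z"
      using H' unfolding homotopy_class_iff by blast
    obtain k' where k: "continuous_map (top_of_set unit_cube) X k'"
      "\<And>z. z \<in> unit_square \<Longrightarrow> k' (0, z) = K z \<and> k' (1, z) = K' z"
      "\<And>r z. r \<in> {0..1} \<Longrightarrow> z \<in> unit_square - {0<..<1} \<times> {0<..<1} \<Longrightarrow> k' (r, z) = K z"
      using K' unfolding homotopy_class_iff by blast
    have mid: "h (r, 1, t) = k' (r, 0, t)" if "r \<in> {0..1}" "t \<in> {0..1}" for r t
      using that h(3)[of r "(1,t)"] k(3)[of r "(0,t)"] H K by (auto simp: htpy_def)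
    let ?h = "\<lambda>(r, s, t). if s \<le> 1/2 then h (r, 2 * s, t) else k' (r, 2 * s - 1, t)"
    have "continuous_map (top_of_set unit_cube) X
        (\<lambda>x. if fst (snd x) \<le> 1/2 then h (fst x, 2 * fst (snd x), snd (snd x))
             else k' (fst x, 2 * fst (snd x) - 1, snd (snd x)))"
      by (rule continuous_map_glue)
        (use mid in \<open>auto simp: field_simps intro!: continuous_intros continuous_map_reindex[OF h(1)] continuous_map_reindex[OF k(1)]\<close>)
    then have c: "continuous_map (top_of_set unit_cube) X ?h"
      by (rule continuous_map_eq) auto
    show ?thesis
    proof (rule sym, rule homotopy_class_eqI[OF c])
      fix r z assume "r \<in> {0..1::real}" "z \<in> unit_square - {0<..<1} \<times> {0<..<1::real}"
      then show "?h (r, z) = vconcat K H z"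
        using h(3)[of r "(2 * fst z, snd z)"] k(3)[of r "(2 * fst z - 1, snd z)"] mid[of r "snd z"]
        by (cases z) (auto simp: vconcat_def)
    qed (auto simp: vconcat_def h k)
  qed
  have "vcmp (\<Pi>\<^sub>2 X) (homotopy_class X K) (homotopy_class X H) =
     (\<Union>K'\<in>homotopy_class X K. \<Union>H'\<in>homotopy_class X H. homotopy_class X (vconcat K' H'))"
    by (simp add: fundamental_2groupoid_def)
  also have "\<dots> = (\<Union>K'\<in>homotopy_class X K. \<Union>H'\<in>homotopy_class X H. homotopy_class X (vconcat K H))"
    by (intro SUP_cong refl eq)
  also have "\<dots> = homotopy_class X (vconcat K H)"
    using rep_in[OF H] rep_in[OF K] by auto
  finally show ?thesis .
qed

text \<open>As for vertical composition, with the homotopies glued along the side over the common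
  endpoint, where both are constant.\<close>

lemma hcmp_class:
  assumes H: "htpy X f f' H" and K: "htpy X g g' K" and fg: "f 1 = g 0"
  shows "hcmp (\<Pi>\<^sub>2 X) (homotopy_class X K) (homotopy_class X H) = homotopy_class X (hconcat K H)"
proof -
  have eq: "homotopy_class X (hconcat K' H') = homotopy_class X (hconcat K H)"
    if H': "H' \<in> homotopy_class X H" and K': "K' \<in> homotopy_class X K" for H' K'
  proof -
    obtain h where h: "continuous_map (top_of_set unit_cube) X h"
      "\<And>z. z \<in> unit_square \<Longrightarrow> h (0, z) = H z \<and> h (1, z) = H' z"
      "\<And>r z. r \<in> {0..1} \<Longrightarrow> z \<in> unit_square - {0<..<1} \<times> {0<..<1} \<Longrightarrow> h (r, z) = H z"
      using H' unfolding homotopy_class_iff by blast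
    obtain k' where k: "continuous_map (top_of_set unit_cube) X k'"
      "\<And>z. z \<in> unit_square \<Longrightarrow> k' (0, z) = K z \<and> k' (1, z) = K' z"
      "\<And>r z. r \<in> {0..1} \<Longrightarrow> z \<in> unit_square - {0<..<1} \<times> {0<..<1} \<Longrightarrow> k' (r, z) = K z"
      using K' unfolding homotopy_class_iff by blast
    have mid: "h (r, s, 1) = k' (r, s, 0)" if "r \<in> {0..1}" "s \<in> {0..1}" for r s
      using that h(3)[of r "(s,1)"] k(3)[of r "(s,0)"] H K fg by (auto simp: htpy_def)
    let ?h = "\<lambda>(r, s, t). if t \<le> 1/2 then h (r, s, 2 * t) else k' (r, s, 2 * t - 1)"
    have "continuous_map (top_of_set unit_cube) X
        (\<lambda>x. if snd (snd x) \<le> 1/2 then h (fst x, fst (snd x), 2 * snd (snd x))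
             else k' (fst x, fst (snd x), 2 * snd (snd x) - 1))"
      by (rule continuous_map_glue)
        (use mid in \<open>auto simp: field_simps intro!: continuous_intros continuous_map_reindex[OF h(1)] continuous_map_reindex[OF k(1)]\<close>)
    then have c: "continuous_map (top_of_set unit_cube) X ?h"
      by (rule continuous_map_eq) auto
    show ?thesis
    proof (rule sym, rule homotopy_class_eqI[OF c])
      fix r z assume "r \<in> {0..1::real}" "z \<in> unit_square - {0<..<1} \<times> {0<..<1::real}"
      then show "?h (r, z) = hconcat K H z"
        using h(3)[of r "(fst z, 2 * snd z)"] k(3)[of r "(fst z, 2 * snd z - 1)"] mid[of r "fst z"]
        by (cases z) (auto simp: hconcat_def)
    qed (auto simp: hconcat_def h k)
  qed
  have "hcmp (\<Pi>\<^sub>2 X) (homotopy_class X K) (homotopy_class X H) =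
     (\<Union>K'\<in>homotopy_class X K. \<Union>H'\<in>homotopy_class X H. homotopy_class X (hconcat K' H'))"
    by (simp add: fundamental_2groupoid_def)
  also have "\<dots> = (\<Union>K'\<in>homotopy_class X K. \<Union>H'\<in>homotopy_class X H. homotopy_class X (hconcat K H))"
    by (intro SUP_cong refl eq)
  also have "\<dots> = homotopy_class X (hconcat K H)"
    using rep_in[OF H] rep_in[OF K] by auto
  finally show ?thesis .
qed


section \<open>Cells that lift to an equiconnected space\<close>

definition mixes :: "'s topology \<Rightarrow> (real \<Rightarrow> 's \<Rightarrow> 's \<Rightarrow> 's) \<Rightarrow> bool" where
  "mixes S m \<longleftrightarrow>
     continuous_map (prod_topology Itop (prod_topology S S)) S (\<lambda>x. m (fst x) (fst (snd x)) (snd (snd x)))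
     \<and> (\<forall>a\<in>topspace S. \<forall>b\<in>topspace S. m 0 a b = a \<and> m 1 a b = b)
     \<and> (\<forall>r\<in>{0..1}. \<forall>a\<in>topspace S. m r a a = a)"

definition equiconnected :: "'s topology \<Rightarrow> bool" where
  "equiconnected S \<longleftrightarrow> (\<exists>m. mixes S m)"

lemma mixes_continuous:
  assumes "mixes S m" "continuous_map T Itop r" "continuous_map T S P" "continuous_map T S Q"
  shows "continuous_map T S (\<lambda>z. m (r z) (P z) (Q z))"
proof -
  have "continuous_map T (prod_topology Itop (prod_topology S S)) (\<lambda>z. (r z, P z, Q z))"
    using assms by (simp add: continuous_map_pairwise o_def)
  moreover have "continuous_map (prod_topology Itop (prod_topology S S)) S
      (\<lambda>x. m (fst x) (fst (snd x)) (snd (snd x)))"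
    using assms(1) by (simp add: mixes_def)
  ultimately show ?thesis using continuous_map_compose by (fastforce simp: o_def)
qed

lemma equiconnected_convex:
  fixes C :: "'s::real_normed_vector set"
  assumes "convex C" shows "mixes (top_of_set C) (\<lambda>r a b. (1 - r) *\<^sub>R a + r *\<^sub>R b)"
proof -
  have "continuous_on ({0..1} \<times> C \<times> C) (\<lambda>x. (1 - fst x) *\<^sub>R fst (snd x) + fst x *\<^sub>R snd (snd x))"
    by (intro continuous_intros)
  moreover have "(1 - r) *\<^sub>R a + r *\<^sub>R b \<in> C" if "r \<in> {0..1}" "a \<in> C" "b \<in> C" for r a b
    using assms that by (simp add: convex_alt)
  ultimately show ?thesis
    by (auto simp: mixes_def algebra_simps scaleR_add_left[symmetric])
qed

lemma equiconnected_Itop [simp]: "equiconnected Itop"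
  using equiconnected_convex[of "{0..1::real}"] unfolding equiconnected_def by auto

lemma mixes_prod:
  assumes "mixes S m" "mixes T n"
  shows "mixes (prod_topology S T) (\<lambda>r a b. (m r (fst a) (fst b), n r (snd a) (snd b)))"
proof -
  let ?D = "prod_topology Itop (prod_topology (prod_topology S T) (prod_topology S T))"
  have c: "continuous_map ?D Itop fst" "continuous_map ?D (prod_topology S T) (\<lambda>x. fst (snd x))"
    "continuous_map ?D (prod_topology S T) (\<lambda>x. snd (snd x))"
    using continuous_map_compose[OF continuous_map_snd continuous_map_fst]
      continuous_map_compose[OF continuous_map_snd continuous_map_snd]
    by (auto simp: o_def continuous_map_fst)
  have c': "continuous_map ?D S (\<lambda>x. fst (fst (snd x)))" "continuous_map ?D S (\<lambda>x. fst (snd (snd x)))"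
    "continuous_map ?D T (\<lambda>x. snd (fst (snd x)))" "continuous_map ?D T (\<lambda>x. snd (snd (snd x)))"
    using c(2,3) by (simp_all add: continuous_map_pairwise o_def)
  show ?thesis
    unfolding mixes_def
    using mixes_continuous[OF assms(1) c(1) c'(1,2)] mixes_continuous[OF assms(2) c(1) c'(3,4)] assms
    by (auto simp: continuous_map_pairwise o_def mixes_def)
qed

lemma equiconnected_prod [simp]:
  "equiconnected S \<Longrightarrow> equiconnected T \<Longrightarrow> equiconnected (prod_topology S T)"
  unfolding equiconnected_def using mixes_prod by blast

text \<open>The boundary condition is imposed after applying \<Gamma>, not on \<open>P\<close> and
  \<open>Q\<close> themselves. The extra room matters when the two lifts run through different
  parameters along a side that \<Gamma> collapses, as happens in \<open>sweep\<close> and when a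
  homotopy is reparametrized.\<close>

lemma class_lift_eq:
  assumes m: "mixes S m" and \<Gamma>: "continuous_map S X \<Gamma>"
    and P: "continuous_map (top_of_set unit_square) S P" and Q: "continuous_map (top_of_set unit_square) S Q"
    and b: "\<And>r z. r \<in> {0..1} \<Longrightarrow> z \<in> unit_square - {0<..<1} \<times> {0<..<1} \<Longrightarrow> \<Gamma> (m r (P z) (Q z)) = \<Gamma> (P z)"
  shows "homotopy_class X (\<lambda>z. \<Gamma> (P z)) = homotopy_class X (\<lambda>z. \<Gamma> (Q z))"
proof (rule homotopy_class_eqI[where h="\<lambda>x. \<Gamma> (m (fst x) (P (snd x)) (Q (snd x)))"])
  have "continuous_map (top_of_set unit_cube) S (\<lambda>x. m (fst x) (P (snd x)) (Q (snd x)))"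
  proof (rule mixes_continuous[OF m])
    show "continuous_map (top_of_set unit_cube) S (\<lambda>x. P (snd x))"
      by (rule continuous_map_reindex[OF P]) (auto intro!: continuous_intros)
    show "continuous_map (top_of_set unit_cube) S (\<lambda>x. Q (snd x))"
      by (rule continuous_map_reindex[OF Q]) (auto intro!: continuous_intros)
    show "continuous_map (top_of_set unit_cube) Itop fst"
      by (auto intro!: continuous_intros)
  qed
  then show "continuous_map (top_of_set unit_cube) X (\<lambda>x. \<Gamma> (m (fst x) (P (snd x)) (Q (snd x))))"
    using continuous_map_compose[OF _ \<Gamma>] by (fastforce simp: o_def)
  fix z assume "z \<in> unit_square"
  then have "P z \<in> topspace S" "Q z \<in> topspace S"
    using P Q continuous_map_image_subset_topspace by fastforce+
  then show "\<Gamma> (m (fst (0, z)) (P (snd (0, z))) (Q (snd (0, z)))) = \<Gamma> (P z)"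
    "\<Gamma> (m (fst (1, z)) (P (snd (1, z))) (Q (snd (1, z)))) = \<Gamma> (Q z)"
    using m by (simp_all add: mixes_def)
qed (use b in simp)

definition im_path :: "('s \<Rightarrow> 'a) \<Rightarrow> (real \<Rightarrow> 's) \<Rightarrow> real \<Rightarrow> 'a" where
  "im_path \<Gamma> p = (\<lambda>t\<in>{0..1}. \<Gamma> (p t))"

text \<open>The cell is named by its boundary paths in \<open>S\<close>, since these determine it;
  by \<open>lift_eq\<close> the choice of a filling homotopy is immaterial when \<open>S\<close> is
  equiconnected. Without any filling the value is arbitrary, which is why the rules below ask for
  parallel paths.\<close>

definition lift :: "'a topology \<Rightarrow> 's topology \<Rightarrow> ('s \<Rightarrow> 'a) \<Rightarrow> (real \<Rightarrow> 's) \<Rightarrow> (real \<Rightarrow> 's)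
    \<Rightarrow> (real \<times> real \<Rightarrow> 'a) set" where
  "lift X S \<Gamma> p q = homotopy_class X (\<lambda>z. \<Gamma> ((SOME H. htpy S p q H) z))"

definition parallel :: "'s topology \<Rightarrow> (real \<Rightarrow> 's) \<Rightarrow> (real \<Rightarrow> 's) \<Rightarrow> bool" where
  "parallel S p q \<longleftrightarrow> p \<in> paths S \<and> q \<in> paths S \<and> p 0 = q 0 \<and> p 1 = q 1"

lemma im_path_ext [simp]: "im_path \<Gamma> p \<in> extensional {0..1}"
  by (simp add: im_path_def)

lemma im_path_apply [simp]: "t \<in> {0..1} \<Longrightarrow> im_path \<Gamma> p t = \<Gamma> (p t)"
  by (simp add: im_path_def)

lemma im_path_01 [simp]: "im_path \<Gamma> p 0 = \<Gamma> (p 0)" "im_path \<Gamma> p 1 = \<Gamma> (p 1)"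
  by (simp_all add: im_path_def)

lemma im_concat: "concat_path (im_path \<Gamma> q) (im_path \<Gamma> p) = im_path \<Gamma> (concat_path q p)"
  by (rule path_eqI) (auto simp: im_path_def concat_path_def)

lemma im_const: "im_path \<Gamma> (const_path x) = const_path (\<Gamma> x)"
  by (rule path_eqI) (auto simp: im_path_def const_path_def)

lemma htpy_push:
  assumes "htpy S p q H" "continuous_map S X \<Gamma>"
  shows "htpy X (im_path \<Gamma> p) (im_path \<Gamma> q) (\<lambda>z. \<Gamma> (H z))"
  using assms continuous_map_compose[of "top_of_set unit_square" S H X \<Gamma>] by (auto simp: htpy_def o_def)

lemma mix_htpy:
  assumes "mixes S m" "parallel S p q" shows "htpy S p q (\<lambda>z. m (fst z) (p (snd z)) (q (snd z)))"
proof -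
  have "continuous_map (top_of_set unit_square) S (\<lambda>z. p (snd z))"
    by (rule continuous_map_reindex[OF paths_cont])
      (use assms in \<open>auto simp: parallel_def intro!: continuous_intros\<close>)
  moreover have "continuous_map (top_of_set unit_square) S (\<lambda>z. q (snd z))"
    by (rule continuous_map_reindex[OF paths_cont])
      (use assms in \<open>auto simp: parallel_def intro!: continuous_intros\<close>)
  ultimately have "continuous_map (top_of_set unit_square) S (\<lambda>z. m (fst z) (p (snd z)) (q (snd z)))"
    by (intro mixes_continuous[OF assms(1)]) (auto intro!: continuous_intros)
  moreover have "p t \<in> topspace S" "q t \<in> topspace S" if "t \<in> {0..1}" for t
    using assms that by (auto simp: parallel_def intro: paths_topspace)
  moreover have "p 0 = q 0" "p 1 = q 1" "p 0 \<in> topspace S" "p 1 \<in> topspace S"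
    using assms by (auto simp: parallel_def)
  ultimately show ?thesis using assms(1) by (auto simp: htpy_def mixes_def)
qed

text \<open>The given filling and the chosen one agree on the boundary of the square, and
  \<open>m r a a = a\<close> keeps their pointwise mixture fixed there.\<close>

lemma lift_eq:
  assumes S: "equiconnected S" and \<Gamma>: "continuous_map S X \<Gamma>" and H: "htpy S p q H"
  shows "homotopy_class X (\<lambda>z. \<Gamma> (H z)) = lift X S \<Gamma> p q"
proof -
  obtain m where m: "mixes S m" using S by (auto simp: equiconnected_def)
  let ?K = "SOME H. htpy S p q H"
  have K: "htpy S p q ?K" by (rule someI[of "htpy S p q", OF H])
  have HK: "?K z = H z" if "z \<in> unit_square - {0<..<1} \<times> {0<..<1}" for z
    using that htpyD(2-5)[OF H] htpyD(2-5)[OF K] by (cases z) auto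
  have t: "H z \<in> topspace S" if "z \<in> unit_square" for z
    using htpyD(1)[OF H] that continuous_map_image_subset_topspace by fastforce
  show ?thesis
    unfolding lift_def
    by (rule class_lift_eq[OF m \<Gamma> htpyD(1)[OF H] htpyD(1)[OF K]])
      (use HK t m in \<open>simp add: mixes_def\<close>)
qed

lemma equiconnected_htpy:
  assumes "equiconnected S" "parallel S p q" obtains H where "htpy S p q H"
  using assms mix_htpy unfolding equiconnected_def by blast

lemma parallel_refl [simp]: "parallel S p p \<longleftrightarrow> p \<in> paths S"
  by (auto simp: parallel_def)

lemma parallel_sym: "parallel S p q \<Longrightarrow> parallel S q p"
  by (auto simp: parallel_def)

lemma im_paths: "p \<in> paths S \<Longrightarrow> continuous_map S X \<Gamma> \<Longrightarrow> im_path \<Gamma> p \<in> paths X"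
  using continuous_map_compose[OF paths_cont, of p S X \<Gamma>]
  by (auto simp: paths_def pathin_def im_path_def o_def elim: continuous_map_eq)

lemma id2_class: "id2 (\<Pi>\<^sub>2 X) p = homotopy_class X (\<lambda>z. p (snd z))" if "p \<in> paths X"
proof -
  have "continuous_map (top_of_set unit_square) X (\<lambda>z. p (snd z))"
    by (rule continuous_map_reindex[OF paths_cont[OF that]]) (auto intro!: continuous_intros)
  then have "homotopy_class X (\<lambda>z. p (snd z)) = homotopy_class X (\<lambda>(s, t)\<in>unit_square. p t)"
    by (rule homotopy_class_cong) (auto split: prod.splits)
  then show ?thesis by (simp add: fundamental_2groupoid_def)
qed

lemma htpy_id: "p \<in> paths X \<Longrightarrow> htpy X p p (\<lambda>z. p (snd z))"
  by (auto simp: htpy_def intro!: continuous_map_reindex[OF paths_cont] continuous_intros)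

section \<open>Reparametrization squares: associators and unitors\<close>

lemma reparam_htpy:
  assumes "p \<in> paths X" "continuous_on {0..1} \<phi>" "continuous_on {0..1} \<psi>"
    "\<phi> ` {0..1} \<subseteq> {0..1}" "\<psi> ` {0..1} \<subseteq> {0..1}" "\<phi> 0 = \<psi> 0" "\<phi> 1 = \<psi> 1"
    "\<And>t. t \<in> {0..1} \<Longrightarrow> p (\<phi> t) = f t" "\<And>t. t \<in> {0..1} \<Longrightarrow> p (\<psi> t) = g t"
  shows "htpy X f g (reparam p \<phi> \<psi>)"
proof -
  have c: "(1 - s) * \<phi> t + s * \<psi> t \<in> {0..1}" if "s \<in> {0..1}" "t \<in> {0..1}" for s t
  proof -
    have "\<phi> t \<in> {0..1}" "\<psi> t \<in> {0..1}"
      using that assms(4,5) by (metis image_subset_iff)+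
    then show ?thesis using that convex_bound_le[of "\<phi> t" 1 "\<psi> t" "1 - s" s] by auto
  qed
  have "continuous_map (top_of_set unit_square) X (\<lambda>z. p ((1 - fst z) * \<phi> (snd z) + fst z * \<psi> (snd z)))"
    by (rule continuous_map_reindex[OF paths_cont[OF assms(1)]])
      (use c in \<open>auto intro!: continuous_intros continuous_on_compose2[OF assms(2)] continuous_on_compose2[OF assms(3)]\<close>)
  then have "continuous_map (top_of_set unit_square) X (reparam p \<phi> \<psi>)"
    by (rule continuous_map_eq) (auto simp: reparam_def)
  moreover have "(1 - s) * \<psi> 0 + s * \<psi> 0 = \<psi> 0" "(1 - s) * \<psi> 1 + s * \<psi> 1 = \<psi> 1" for s
    by (simp_all add: algebra_simps)
  moreover have "g 0 = f 0" "g 1 = f 1"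
    using assms(6,7) assms(8,9)[of 0] assms(8,9)[of 1] by simp_all
  ultimately show ?thesis
    by (simp add: htpy_def reparam_def assms(6-))
qed

text \<open>The reparametrization in \<open>asc\<close>, isolated because associativity of vertical
  composition uses it in the other variable of the square.\<close>

definition asc_phi :: "real \<Rightarrow> real" where
  "asc_phi t = (if t \<le> 1/4 then 2 * t else if t \<le> 1/2 then t + 1/4 else (t + 1) / 2)"

text \<open>The three linear pieces have decreasing slopes 2, 1 and 1/2, so the function is concave
  and equals their minimum; continuity then needs no gluing.\<close>

lemma asc_phi_min: "asc_phi t = min (2 * t) (min (t + 1/4) ((t + 1) / 2))"
  by (auto simp: asc_phi_def min_def field_simps)

lemma asc_phi_props:
  "continuous_on A asc_phi" "asc_phi ` {0..1} \<subseteq> {0..1}" "asc_phi 0 = 0" "asc_phi 1 = 1"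
  by (auto simp: asc_phi_min[abs_def] intro!: continuous_intros) (auto simp: min_def)

lemma asc_def': "asc (\<Pi>\<^sub>2 X) h g f = homotopy_class X (reparam (concat_path (concat_path h g) f) (\<lambda>t. t) asc_phi)"
  by (simp add: fundamental_2groupoid_def asc_phi_def[abs_def])

lemma lun_def': "lun (\<Pi>\<^sub>2 X) f = homotopy_class X (reparam f (\<lambda>t. min (2 * t) 1) (\<lambda>t. t))"
  by (simp add: fundamental_2groupoid_def)

lemma run_def': "run (\<Pi>\<^sub>2 X) f = homotopy_class X (reparam f (\<lambda>t. max (2 * t - 1) 0) (\<lambda>t. t))"
  by (simp add: fundamental_2groupoid_def)

text \<open>Stated for arbitrary functions, without continuity or matching endpoints, so that it
  also applies to the slices of a square at a fixed parameter.\<close>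

lemma concat_asc_phi:
  assumes "t \<in> {0..1}"
  shows "concat_path (concat_path h g) f (asc_phi t) = concat_path h (concat_path g f) t"
proof -
  consider "t \<le> 1/4" | "1/4 < t" "t \<le> 1/2" | "1/2 < t" by linarith
  then show ?thesis
  proof cases
    case 2
    have "2 * (2 * (t + 1/4) - 1) = 2 * (2 * t) - 1" by simp
    then show ?thesis using 2 assms by (simp add: concat_path_def asc_phi_def)
  next
    case 3
    have "(2 * t + 2) / 2 - 1 = t" by (simp add: field_simps)
    then show ?thesis using 3 assms by (simp add: concat_path_def asc_phi_def)
  qed (use assms in \<open>simp add: concat_path_def asc_phi_def\<close>)
qed

lemma asc_htpy:
  assumes "f \<in> paths X" "g \<in> paths X" "h \<in> paths X" "f 1 = g 0" "g 1 = h 0"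
  shows "htpy X (concat_path (concat_path h g) f) (concat_path h (concat_path g f))
      (reparam (concat_path (concat_path h g) f) (\<lambda>t. t) asc_phi)"
proof (rule reparam_htpy)
  show "concat_path (concat_path h g) f \<in> paths X"
    using assms by (simp add: concat_path_paths)
qed (simp_all add: asc_phi_props concat_asc_phi)

lemma lun_htpy:
  assumes "f \<in> paths X"
  shows "htpy X (concat_path (const_path (f 1)) f) f (reparam f (\<lambda>t. min (2 * t) 1) (\<lambda>t. t))"
proof (rule reparam_htpy[OF assms])
  show "continuous_on {0..1} (\<lambda>t::real. min (2 * t) 1)" by (intro continuous_intros)
qed (use assms in \<open>auto simp: concat_path_def const_path_def min_def\<close>)

lemma run_htpy:
  assumes "f \<in> paths X"
  shows "htpy X (concat_path f (const_path (f 0))) f (reparam f (\<lambda>t. max (2 * t - 1) 0) (\<lambda>t. t))"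
proof (rule reparam_htpy[OF assms])
  show "continuous_on {0..1} (\<lambda>t::real. max (2 * t - 1) 0)" by (intro continuous_intros)
qed (use assms in \<open>auto simp: concat_path_def const_path_def max_def\<close>)

lemma vconcat_push: "z \<in> unit_square \<Longrightarrow> vconcat (\<lambda>z. \<Gamma> (K z)) (\<lambda>z. \<Gamma> (H z)) z = \<Gamma> (vconcat K H z)"
  by (auto simp: vconcat_def)

lemma hconcat_push: "z \<in> unit_square \<Longrightarrow> hconcat (\<lambda>z. \<Gamma> (K z)) (\<lambda>z. \<Gamma> (H z)) z = \<Gamma> (hconcat K H z)"
  by (auto simp: hconcat_def)

text \<open>Every operation of the 2-groupoid sends cells that lift through \<Gamma> to such cells,
  and the rules of this locale compute the new boundary. Used as rewrite rules, they bring a pasting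
  into the form \<open>lift X S \<Gamma> p q\<close>, so that an equation is settled by comparing
  \<open>p\<close> and \<open>q\<close>.\<close>

locale lifting =
  fixes X :: "'a topology" and S :: "'s topology" and \<Gamma> :: "'s \<Rightarrow> 'a"
  assumes equi: "equiconnected S" and cont: "continuous_map S X \<Gamma>"
begin

lemma im_paths' [simp]: "p \<in> paths S \<Longrightarrow> im_path \<Gamma> p \<in> paths X"
  using im_paths cont by blast

lemma liftI:
  assumes "htpy S p q H" "\<And>z. z \<in> unit_square \<Longrightarrow> K z = \<Gamma> (H z)"
  shows "homotopy_class X K = lift X S \<Gamma> p q"
proof -
  have "homotopy_class X (\<lambda>z. \<Gamma> (H z)) = homotopy_class X K"
    by (rule homotopy_class_cong[OF htpyD(1)[OF htpy_push[OF assms(1) cont]]]) (simp add: assms(2))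
  then show ?thesis using lift_eq[OF equi cont assms(1)] by simp
qed

lemma liftE:
  assumes "parallel S p q"
  obtains H where "htpy S p q H" "lift X S \<Gamma> p q = homotopy_class X (\<lambda>z. \<Gamma> (H z))"
    "htpy X (im_path \<Gamma> p) (im_path \<Gamma> q) (\<lambda>z. \<Gamma> (H z))"
  using equiconnected_htpy[OF equi assms] lift_eq[OF equi cont] htpy_push[OF _ cont] by metis

lemma lift_hom: "parallel S p q \<Longrightarrow> lift X S \<Gamma> p q \<in> hom2 (\<Pi>\<^sub>2 X) (im_path \<Gamma> p) (im_path \<Gamma> q)"
  by (metis liftE class_hom2 im_path_ext)

lemma lift_id: "p \<in> paths S \<Longrightarrow> id2 (\<Pi>\<^sub>2 X) (im_path \<Gamma> p) = lift X S \<Gamma> p p"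
  by (simp add: id2_class, rule liftI[OF htpy_id]) auto

lemma lift_vcmp:
  assumes "parallel S p q" "parallel S q r"
  shows "vcmp (\<Pi>\<^sub>2 X) (lift X S \<Gamma> q r) (lift X S \<Gamma> p q) = lift X S \<Gamma> p r"
proof -
  obtain H where H: "htpy S p q H" "lift X S \<Gamma> p q = homotopy_class X (\<lambda>z. \<Gamma> (H z))"
    "htpy X (im_path \<Gamma> p) (im_path \<Gamma> q) (\<lambda>z. \<Gamma> (H z))" by (rule liftE[OF assms(1)])
  obtain K where K: "htpy S q r K" "lift X S \<Gamma> q r = homotopy_class X (\<lambda>z. \<Gamma> (K z))"
    "htpy X (im_path \<Gamma> q) (im_path \<Gamma> r) (\<lambda>z. \<Gamma> (K z))" by (rule liftE[OF assms(2)])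
  show ?thesis
    unfolding H(2) K(2) vcmp_class[OF H(3) K(3)]
    by (rule liftI[OF htpy_vconcat[OF H(1) K(1)]]) (rule vconcat_push)
qed

lemma lift_hcmp:
  assumes "parallel S p p'" "parallel S q q'" "p 1 = q 0"
  shows "hcmp (\<Pi>\<^sub>2 X) (lift X S \<Gamma> q q') (lift X S \<Gamma> p p')
    = lift X S \<Gamma> (concat_path q p) (concat_path q' p')"
proof -
  obtain H where H: "htpy S p p' H" "lift X S \<Gamma> p p' = homotopy_class X (\<lambda>z. \<Gamma> (H z))"
    "htpy X (im_path \<Gamma> p) (im_path \<Gamma> p') (\<lambda>z. \<Gamma> (H z))" by (rule liftE[OF assms(1)])
  obtain K where K: "htpy S q q' K" "lift X S \<Gamma> q q' = homotopy_class X (\<lambda>z. \<Gamma> (K z))"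
    "htpy X (im_path \<Gamma> q) (im_path \<Gamma> q') (\<lambda>z. \<Gamma> (K z))" by (rule liftE[OF assms(2)])
  have "im_path \<Gamma> p 1 = im_path \<Gamma> q 0" using assms(3) by simp
  then show ?thesis
    unfolding H(2) K(2) using hcmp_class[OF H(3) K(3)]
      liftI[OF htpy_hconcat[OF H(1) K(1) assms(3)], of "hconcat (\<lambda>z. \<Gamma> (K z)) (\<lambda>z. \<Gamma> (H z))"]
    by (simp add: hconcat_push)
qed

lemma lift_asc:
  assumes "p \<in> paths S" "q \<in> paths S" "r \<in> paths S" "p 1 = q 0" "q 1 = r 0"
  shows "asc (\<Pi>\<^sub>2 X) (im_path \<Gamma> r) (im_path \<Gamma> q) (im_path \<Gamma> p)
    = lift X S \<Gamma> (concat_path (concat_path r q) p) (concat_path r (concat_path q p))"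
  unfolding asc_def' im_concat
proof (rule liftI[OF asc_htpy[OF assms]])
  fix z :: "real \<times> real" assume z: "z \<in> unit_square"
  have "asc_phi (snd z) \<in> {0..1}" using asc_phi_props(2) z by auto
  \<comment> \<open>\<open>im_path\<close> is cut off outside the unit interval, so it unfolds to
    \<Gamma> only once the interpolated time is known to lie inside.\<close>
  then have "(1 - fst z) * snd z + fst z * asc_phi (snd z) \<in> {0..1}"
    using z convex_bound_le[of "snd z" 1 "asc_phi (snd z)" "1 - fst z" "fst z"] by auto
  then show "reparam (im_path \<Gamma> (concat_path (concat_path r q) p)) (\<lambda>t. t) asc_phi z =
         \<Gamma> (reparam (concat_path (concat_path r q) p) (\<lambda>t. t) asc_phi z)"
    using z by (cases z) (simp add: reparam_def)
qed

lemma lift_lun: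
  assumes "p \<in> paths S"
  shows "lun (\<Pi>\<^sub>2 X) (im_path \<Gamma> p) = lift X S \<Gamma> (concat_path (const_path (p 1)) p) p"
  unfolding lun_def'
proof (rule liftI[OF lun_htpy[OF assms]])
  fix z :: "real \<times> real" assume z: "z \<in> unit_square"
  then have "(1 - fst z) * min (2 * snd z) 1 + fst z * snd z \<in> {0..1}"
    using convex_bound_le[of "min (2 * snd z) 1" 1 "snd z" "1 - fst z" "fst z"] by auto
  then show "reparam (im_path \<Gamma> p) (\<lambda>t. min (2 * t) 1) (\<lambda>t. t) z =
         \<Gamma> (reparam p (\<lambda>t. min (2 * t) 1) (\<lambda>t. t) z)"
    using z by (cases z) (simp add: reparam_def)
qed

lemma lift_run:
  assumes "p \<in> paths S"
  shows "run (\<Pi>\<^sub>2 X) (im_path \<Gamma> p) = lift X S \<Gamma> (concat_path p (const_path (p 0))) p"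
  unfolding run_def'
proof (rule liftI[OF run_htpy[OF assms]])
  fix z :: "real \<times> real" assume z: "z \<in> unit_square"
  then have "(1 - fst z) * max (2 * snd z - 1) 0 + fst z * snd z \<in> {0..1}"
    using convex_bound_le[of "max (2 * snd z - 1) 0" 1 "snd z" "1 - fst z" "fst z"] by auto
  then show "reparam (im_path \<Gamma> p) (\<lambda>t. max (2 * t - 1) 0) (\<lambda>t. t) z =
         \<Gamma> (reparam p (\<lambda>t. max (2 * t - 1) 0) (\<lambda>t. t) z)"
    using z by (cases z) (simp add: reparam_def)
qed

lemma lift_inverse:
  assumes "parallel S p q"
  shows "inverse2 (\<Pi>\<^sub>2 X) (lift X S \<Gamma> p q) (lift X S \<Gamma> q p)"
proof -
  have "lift X S \<Gamma> p q \<in> hom2 (\<Pi>\<^sub>2 X) (im_path \<Gamma> p) (im_path \<Gamma> q)"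
    "lift X S \<Gamma> q p \<in> hom2 (\<Pi>\<^sub>2 X) (im_path \<Gamma> q) (im_path \<Gamma> p)"
    using lift_hom assms parallel_sym by blast+
  moreover have "p \<in> paths S" "q \<in> paths S" using assms by (auto simp: parallel_def)
  ultimately show ?thesis
    using lift_vcmp[OF assms parallel_sym[OF assms]] lift_vcmp[OF parallel_sym[OF assms] assms]
    by (auto simp: inverse2_def hom2_def lift_id)
qed

lemma lift_iso: "parallel S p q \<Longrightarrow> iso2 (\<Pi>\<^sub>2 X) (lift X S \<Gamma> p q)"
  using lift_inverse unfolding iso2_def by blast

end

text \<open>Changes the parameter space: \<phi> carries a filling in \<open>S\<close> to a filling
  in \<open>T\<close>, and all fillings in \<open>T\<close> give the same cell. Cells that arise
  over different spaces are moved to a common one in this way before they are composed.\<close>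

lemma lift_reindex:
  assumes "equiconnected S" "equiconnected T" "continuous_map S T \<phi>" "continuous_map T X \<Gamma>" "parallel S p q"
    and "\<And>x. x \<in> topspace S \<Longrightarrow> \<Delta> x = \<Gamma> (\<phi> x)"
  shows "lift X S \<Delta> p q = lift X T \<Gamma> (im_path \<phi> p) (im_path \<phi> q)"
proof -
  have "continuous_map S X (\<lambda>x. \<Gamma> (\<phi> x))" using continuous_map_compose[OF assms(3,4)] by (simp add: o_def)
  then have "continuous_map S X \<Delta>" by (rule continuous_map_eq) (simp add: assms(6))
  then interpret A: lifting X S \<Delta> by (simp add: assms lifting_def)
  interpret B: lifting X T \<Gamma> by (simp add: assms lifting_def)
  obtain H where H: "htpy S p q H" "lift X S \<Delta> p q = homotopy_class X (\<lambda>z. \<Delta> (H z))"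
    by (rule A.liftE[OF assms(5)])
  have "H z \<in> topspace S" if "z \<in> unit_square" for z
    using htpyD(1)[OF H(1)] that continuous_map_image_subset_topspace by fastforce
  then show ?thesis unfolding H(2)
    by (intro B.liftI[OF htpy_push[OF H(1) assms(3)]]) (simp add: assms(6))
qed


text \<open>The common source of the naturality equations for arbitrary 2-cells: such a cell enters as the sweep
  parameter.\<close>

lemma sweep:
  assumes S: "equiconnected S" and \<Gamma>: "continuous_map (prod_topology Itop S) X \<Gamma>" and pq: "parallel S p q"
    and e: "\<And>r. r \<in> {0..1} \<Longrightarrow> \<Gamma> (r, p 0) = \<Gamma> (0, p 0)" "\<And>r. r \<in> {0..1} \<Longrightarrow> \<Gamma> (r, p 1) = \<Gamma> (0, p 1)"
  shows "vcmp (\<Pi>\<^sub>2 X) (lift X S (\<lambda>x. \<Gamma> (1, x)) p q) (homotopy_class X (\<lambda>z. \<Gamma> (fst z, p (snd z))))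
    = vcmp (\<Pi>\<^sub>2 X) (homotopy_class X (\<lambda>z. \<Gamma> (fst z, q (snd z)))) (lift X S (\<lambda>x. \<Gamma> (0, x)) p q)"
    (is "_ = ?rhs")
proof -
  let ?S = "prod_topology Itop S"
  have c: "continuous_map S X (\<lambda>x. \<Gamma> (r, x))" if "r \<in> {0..1}" for r
    using continuous_map_compose[OF _ \<Gamma>, of S "\<lambda>x. (r, x)"] that by (simp add: o_def continuous_map_pairwise)
  obtain n where n: "mixes S n" using S by (auto simp: equiconnected_def)
  \<comment> \<open>Mixing is componentwise, so the mixture of two points over \<open>p 0\<close>
    lies again over \<open>p 0\<close>, whatever their sweep parameters are.\<close>
  define m where "m = (\<lambda>r a b. ((1 - r) *\<^sub>R fst a + r *\<^sub>R fst b :: real, n r (snd a) (snd b)))"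
  have m: "mixes ?S m" unfolding m_def by (rule mixes_prod[OF equiconnected_convex n]) simp
  have par: "p \<in> paths S" "q \<in> paths S" "q 0 = p 0" "q 1 = p 1" using pq by (auto simp: parallel_def)
  have sw: "htpy X (im_path (\<lambda>x. \<Gamma> (0, x)) u) (im_path (\<lambda>x. \<Gamma> (1, x)) u) (\<lambda>z. \<Gamma> (fst z, u (snd z)))"
    "continuous_map (top_of_set unit_square) ?S (\<lambda>z. (fst z, u (snd z)))"
    if u: "u \<in> paths S" "u 0 = p 0" "u 1 = p 1" for u
  proof -
    have "continuous_map (top_of_set unit_square) S (\<lambda>z. u (snd z))"
      by (rule continuous_map_reindex[OF paths_cont[OF u(1)]]) (auto intro!: continuous_intros)
    then show *: "continuous_map (top_of_set unit_square) ?S (\<lambda>z. (fst z, u (snd z)))"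
      by (simp add: continuous_map_pairwise o_def) (auto intro!: continuous_intros)
    show "htpy X (im_path (\<lambda>x. \<Gamma> (0, x)) u) (im_path (\<lambda>x. \<Gamma> (1, x)) u) (\<lambda>z. \<Gamma> (fst z, u (snd z)))"
      unfolding htpy_def
    proof (intro conjI ballI)
      fix s :: real assume "s \<in> {0..1}"
      then show "\<Gamma> (fst (s, 0), u (snd (s, 0))) = im_path (\<lambda>x. \<Gamma> (0, x)) u 0"
        "\<Gamma> (fst (s, 1), u (snd (s, 1))) = im_path (\<lambda>x. \<Gamma> (0, x)) u 1"
        using e[of s] u by simp_all
    qed (use continuous_map_compose[OF * \<Gamma>] in \<open>auto simp: o_def\<close>)
  qed
  obtain H where H: "htpy S p q H" using equiconnected_htpy[OF S pq] .
  have Ht: "H z \<in> topspace S" if "z \<in> unit_square" for z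
    using htpyD(1)[OF H] that continuous_map_image_subset_topspace by fastforce
  have 0: "lift X S (\<lambda>x. \<Gamma> (r, x)) p q = homotopy_class X (\<lambda>z. \<Gamma> (r, H z))"
    "htpy X (im_path (\<lambda>x. \<Gamma> (r, x)) p) (im_path (\<lambda>x. \<Gamma> (r, x)) q) (\<lambda>z. \<Gamma> (r, H z))"
    if "r \<in> {0..1}" for r
    using lift_eq[OF S c[OF that] H] htpy_push[OF H c[OF that]] by auto
  have Hc: "continuous_map (top_of_set A) ?S (\<lambda>z. (r, H (\<phi> z)))"
    if "r \<in> {0..1}" "continuous_on A \<phi>" "\<phi> ` A \<subseteq> unit_square" for A \<phi> and r :: real
    using continuous_map_reindex[OF htpyD(1)[OF H] that(2,3)] that(1) by (simp add: continuous_map_pairwise o_def)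
  \<comment> \<open>\<open>P\<close> and \<open>Q\<close> lift the two composites to the product of
    the interval with \<open>S\<close>: \<open>P\<close> sweeps along \<open>p\<close> and then
    fills at sweep parameter 1, while \<open>Q\<close> fills at sweep parameter 0 and then sweeps
    along \<open>q\<close>.\<close>
  define P where "P = (\<lambda>z. if fst z \<le> 1/2 then (2 * fst z, p (snd z)) else (1::real, H (2 * fst z - 1, snd z)))"
  define Q where "Q = (\<lambda>z. if fst z \<le> 1/2 then (0::real, H (2 * fst z, snd z)) else (2 * fst z - 1, q (snd z)))"
  have P: "continuous_map (top_of_set unit_square) ?S P"
    unfolding P_def
  proof (rule continuous_map_glue)
    show "continuous_map (top_of_set {x \<in> unit_square. fst x \<le> 1/2}) ?S (\<lambda>x. (2 * fst x, p (snd x)))"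
      by (rule continuous_map_reindex[OF sw(2)[OF par(1)], where \<phi>="\<lambda>x. (2 * fst x, snd x)", simplified])
        (auto intro!: continuous_intros)
    show "continuous_map (top_of_set {x \<in> unit_square. 1/2 \<le> fst x}) ?S (\<lambda>x. (1, H (2 * fst x - 1, snd x)))"
      by (rule Hc) (auto intro!: continuous_intros)
    show "(2 * fst x, p (snd x)) = (1, H (2 * fst x - 1, snd x))" if "x \<in> unit_square" "fst x = 1/2" for x
    proof -
      have "x = (1/2, snd x)" "snd x \<in> {0..1}" using that by (simp_all add: prod_eq_iff mem_Times_iff)
      then obtain t where "x = (1/2, t)" "t \<in> {0..1}" by blast
      then show ?thesis by (simp add: htpyD[OF H])
    qed
  qed (rule continuous_on_fst[OF continuous_on_id])
  have Q: "continuous_map (top_of_set unit_square) ?S Q"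
    unfolding Q_def
  proof (rule continuous_map_glue)
    show "continuous_map (top_of_set {x \<in> unit_square. 1/2 \<le> fst x}) ?S (\<lambda>x. (2 * fst x - 1, q (snd x)))"
      by (rule continuous_map_reindex[OF sw(2)[OF par(2)], where \<phi>="\<lambda>x. (2 * fst x - 1, snd x)", simplified])
        (use par in \<open>auto intro!: continuous_intros\<close>)
    show "continuous_map (top_of_set {x \<in> unit_square. fst x \<le> 1/2}) ?S (\<lambda>x. (0, H (2 * fst x, snd x)))"
      by (rule Hc) (auto intro!: continuous_intros)
    show "(0, H (2 * fst x, snd x)) = (2 * fst x - 1, q (snd x))" if "x \<in> unit_square" "fst x = 1/2" for x
    proof -
      have "x = (1/2, snd x)" "snd x \<in> {0..1}" using that by (simp_all add: prod_eq_iff mem_Times_iff)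
      then obtain t where "x = (1/2, t)" "t \<in> {0..1}" by blast
      then show ?thesis by (simp add: htpyD[OF H])
    qed
  qed (rule continuous_on_fst[OF continuous_on_id])
  have "homotopy_class X (\<lambda>z. \<Gamma> (P z)) = homotopy_class X (vconcat (\<lambda>z. \<Gamma> (1, H z)) (\<lambda>z. \<Gamma> (fst z, p (snd z))))"
  proof (rule homotopy_class_cong)
    show "continuous_map (top_of_set unit_square) X (\<lambda>z. \<Gamma> (P z))"
      using continuous_map_compose[OF P \<Gamma>] by (simp add: o_def)
    show "\<Gamma> (P z) = vconcat (\<lambda>z. \<Gamma> (1, H z)) (\<lambda>z. \<Gamma> (fst z, p (snd z))) z" if "z \<in> unit_square" for z
      using that by (cases z) (simp add: vconcat_def P_def)
  qed
  then have lhs: "vcmp (\<Pi>\<^sub>2 X) (lift X S (\<lambda>x. \<Gamma> (1, x)) p q) (homotopy_class X (\<lambda>z. \<Gamma> (fst z, p (snd z))))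
      = homotopy_class X (\<lambda>z. \<Gamma> (P z))"
    using vcmp_class[OF sw(1)[OF par(1)] 0(2)[of 1]] 0(1)[of 1] by simp
  have "homotopy_class X (\<lambda>z. \<Gamma> (Q z)) = homotopy_class X (vconcat (\<lambda>z. \<Gamma> (fst z, q (snd z))) (\<lambda>z. \<Gamma> (0, H z)))"
  proof (rule homotopy_class_cong)
    show "continuous_map (top_of_set unit_square) X (\<lambda>z. \<Gamma> (Q z))"
      using continuous_map_compose[OF Q \<Gamma>] by (simp add: o_def)
    show "\<Gamma> (Q z) = vconcat (\<lambda>z. \<Gamma> (fst z, q (snd z))) (\<lambda>z. \<Gamma> (0, H z)) z" if "z \<in> unit_square" for z
      using that by (cases z) (simp add: vconcat_def Q_def)
  qed
  then have rhs: "?rhs = homotopy_class X (\<lambda>z. \<Gamma> (Q z))"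
    using vcmp_class[OF 0(2)[of 0] sw(1)[OF par(2)]] 0(1)[of 0] par by simp
  have "homotopy_class X (\<lambda>z. \<Gamma> (P z)) = homotopy_class X (\<lambda>z. \<Gamma> (Q z))"
  proof (rule class_lift_eq[OF m \<Gamma> P Q])
    fix r :: real and z :: "real \<times> real"
    assume r: "r \<in> {0..1}" and z: "z \<in> unit_square - {0<..<1} \<times> {0<..<1}"
    obtain s t where st: "z = (s, t)" by fastforce
    have c: "(1 - r) * a + r * b \<in> {0..1}" if "a \<in> {0..1}" "b \<in> {0..1}" for a b :: real
      using that r convex_bound_le[of a 1 b "1 - r" r] by auto
    have nn: "n r x x = x" if "x \<in> topspace S" for x using n r that by (simp add: mixes_def)
    \<comment> \<open>On the sides \<open>s = 0\<close> and \<open>s = 1\<close> the two lifts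
      coincide. On the other two sides only their sweep parameters differ, and there
      \<open>e\<close> makes \<Gamma> independent of that parameter.\<close>
    consider "s = 0" "t \<in> {0..1}" | "s = 1" "t \<in> {0..1}" | "t = 0" "s \<in> {0..1}" | "t = 1" "s \<in> {0..1}"
      using z st by auto
    then show "\<Gamma> (m r (P z) (Q z)) = \<Gamma> (P z)"
    proof cases
      case 1 then show ?thesis using htpyD[OF H] paths_topspace[OF par(1), of t]
        by (simp add: st m_def P_def Q_def nn)
    next
      case 2 then show ?thesis using htpyD[OF H] paths_topspace[OF par(2), of t]
        by (simp add: st m_def P_def Q_def nn)
    next
      case 3
      have "snd (P z) = p 0" "snd (Q z) = p 0" "fst (P z) \<in> {0..1}" "fst (Q z) \<in> {0..1}"
        using 3 htpyD[OF H] par by (auto simp: st P_def Q_def)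
      then have "m r (P z) (Q z) = ((1 - r) * fst (P z) + r * fst (Q z), p 0)" "P z = (fst (P z), p 0)"
        "(1 - r) * fst (P z) + r * fst (Q z) \<in> {0..1}"
        using par c[of "fst (P z)" "fst (Q z)"] nn[of "p 0"] by (simp_all add: m_def prod_eq_iff)
      then show ?thesis using e(1) \<open>fst (P z) \<in> {0..1}\<close> by metis
    next
      case 4
      have "snd (P z) = p 1" "snd (Q z) = p 1" "fst (P z) \<in> {0..1}" "fst (Q z) \<in> {0..1}"
        using 4 htpyD[OF H] par by (auto simp: st P_def Q_def)
      then have "m r (P z) (Q z) = ((1 - r) * fst (P z) + r * fst (Q z), p 1)" "P z = (fst (P z), p 1)"
        "(1 - r) * fst (P z) + r * fst (Q z) \<in> {0..1}"
        using par c[of "fst (P z)" "fst (Q z)"] nn[of "p 1"] by (simp_all add: m_def prod_eq_iff)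
      then show ?thesis using e(2) \<open>fst (P z) \<in> {0..1}\<close> by metis
    qed
  qed
  then show ?thesis using lhs rhs by simp
qed


lemma lift_cong:
  assumes "equiconnected S" "continuous_map S X \<Gamma>" "parallel S p q"
    and "\<And>x. x \<in> topspace S \<Longrightarrow> \<Gamma> x = \<Delta> x"
  shows "lift X S \<Gamma> p q = lift X S \<Delta> p q"
proof -
  obtain H where H: "htpy S p q H" using equiconnected_htpy[OF assms(1,3)] .
  have "H z \<in> topspace S" if "z \<in> unit_square" for z
    using htpyD(1)[OF H] that continuous_map_image_subset_topspace by fastforce
  then have "homotopy_class X (\<lambda>z. \<Gamma> (H z)) = homotopy_class X (\<lambda>z. \<Delta> (H z))"
    by (intro homotopy_class_cong[OF htpyD(1)[OF htpy_push[OF H assms(2)]]] assms(4))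
  moreover have "continuous_map S X \<Delta>" using assms(2,4) by (rule continuous_map_eq)
  ultimately show ?thesis using lift_eq[OF assms(1) _ H] assms(2) by metis
qed

section \<open>The fundamental 2-groupoid is a bicategory\<close>

definition edge :: "'s::real_vector \<Rightarrow> 's \<Rightarrow> real \<Rightarrow> 's" where
  "edge a b = (\<lambda>t\<in>{0..1}. (1 - t) *\<^sub>R a + t *\<^sub>R b)"

lemma edge_01 [simp]: "edge a b 0 = a" "edge a b 1 = b"
  by (simp_all add: edge_def)

lemma edge_paths:
  fixes a b :: "'s::real_normed_vector"
  assumes "convex C" "a \<in> C" "b \<in> C" shows "edge a b \<in> paths (top_of_set C)"
proof -
  have "continuous_on {0..1} (\<lambda>t. (1 - t) *\<^sub>R a + t *\<^sub>R b)" by (intro continuous_intros)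
  moreover have "(1 - t) *\<^sub>R a + t *\<^sub>R b \<in> C" if "t \<in> {0..1}" for t
    using assms that by (simp add: convex_alt)
  ultimately have "continuous_map Itop (top_of_set C) (\<lambda>t. (1 - t) *\<^sub>R a + t *\<^sub>R b)" by auto
  then have "continuous_map Itop (top_of_set C) (edge a b)"
    by (rule continuous_map_eq) (auto simp: edge_def)
  then show ?thesis by (auto simp: paths_def pathin_def edge_def)
qed

lemma im_edge_first:
  assumes "f \<in> extensional {0..1}" shows "im_path (concat_path g f) (edge 0 (1/2)) = f"
  by (rule path_eqI[OF _ assms]) (simp, simp add: edge_def concat_path_def)

text \<open>The second factor of a concatenation is traversed during the second half of the time, so
  the piece of \<open>g\<close> between \<open>a\<close> and \<open>b\<close> sits over an affine
  image of that interval. The hypothesis \<open>f 1 = g 0\<close> is for the time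
  \<open>1/2\<close>, at which \<open>concat_path\<close> takes its value from
  \<open>f\<close>.\<close>

lemma im_edge_second:
  assumes "a \<in> {0..1}" "b \<in> {0..1}" "f 1 = g 0"
  shows "im_path (concat_path g f) (edge ((1 + a) / 2) ((1 + b) / 2)) = im_path g (edge a b)"
proof (rule path_eqI)
  fix t :: real assume t: "t \<in> {0..1}"
  let ?u = "(1 - t) * a + t * b"
  have u: "?u \<in> {0..1}" using assms t convex_bound_le[of a 1 b "1 - t" t] by auto
  have "edge ((1 + a) / 2) ((1 + b) / 2) t = (1 + ?u) / 2" "edge a b t = ?u"
    using t by (simp_all add: edge_def field_simps)
  moreover have "concat_path g f ((1 + v) / 2) = g v" if "v \<in> {0..1}" for v
  proof -
    have "2 * ((1 + v) / 2) = 1 + v" by simp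
    then show ?thesis using assms(3) that
      by (cases "v = 0") (simp add: concat_path_def, auto simp: concat_path_def simp del: times_divide_eq_right)
  qed
  ultimately show "im_path (concat_path g f) (edge ((1 + a) / 2) ((1 + b) / 2)) t = im_path g (edge a b) t"
    using t u by (simp only: im_path_apply)
qed simp_all

lemma im_edge_whole: "g \<in> extensional {0..1} \<Longrightarrow> im_path g (edge 0 1) = g"
  by (rule path_eqI) (simp_all add: edge_def)

text \<open>Composable paths are subpaths of a single path, here the left-bracketed concatenation
  \<open>((k h) g) f\<close> with breakpoints \<open>1/2\<close>, \<open>3/4\<close> and
  \<open>7/8\<close>. All coherence cells of the chain thus lift to the unit interval. Four paths
  are what the pentagon needs.\<close>

lemma chain_lift:
  assumes "f \<in> paths X" "g \<in> paths X" "h \<in> paths X" "k \<in> paths X" "f 1 = g 0" "g 1 = h 0" "h 1 = k 0"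
  obtains \<Gamma> p1 p2 p3 p4 where "continuous_map Itop X \<Gamma>"
    "p1 \<in> paths Itop" "p2 \<in> paths Itop" "p3 \<in> paths Itop" "p4 \<in> paths Itop"
    "p1 1 = p2 0" "p2 1 = p3 0" "p3 1 = p4 0"
    "f = im_path \<Gamma> p1" "g = im_path \<Gamma> p2" "h = im_path \<Gamma> p3" "k = im_path \<Gamma> p4"
proof
  let ?G1 = "concat_path k h" let ?G2 = "concat_path ?G1 g" let ?G = "concat_path ?G2 f"
  show "continuous_map Itop X ?G"
    using assms by (simp add: paths_cont concat_path_paths)
  show "f = im_path ?G (edge 0 (1/2))" using assms by (simp add: im_edge_first paths_ext)
  have "im_path ?G (edge ((1 + 0) / 2) ((1 + 1/2) / 2)) = im_path ?G2 (edge 0 (1/2))"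
    by (rule im_edge_second) (use assms in simp_all)
  then show "g = im_path ?G (edge (1/2) (3/4))" using assms by (simp add: im_edge_first paths_ext)
  have "im_path ?G (edge ((1 + 1/2) / 2) ((1 + 3/4) / 2)) = im_path ?G2 (edge (1/2) (3/4))"
    by (rule im_edge_second) (use assms in simp_all)
  moreover have "im_path ?G2 (edge ((1 + 0) / 2) ((1 + 1/2) / 2)) = im_path ?G1 (edge 0 (1/2))"
    by (rule im_edge_second) (use assms in simp_all)
  ultimately show "h = im_path ?G (edge (3/4) (7/8))" using assms by (simp add: im_edge_first paths_ext)
  have "im_path ?G (edge ((1 + 3/4) / 2) ((1 + 1) / 2)) = im_path ?G2 (edge (3/4) 1)"
    by (rule im_edge_second) (use assms in simp_all)
  moreover have "im_path ?G2 (edge ((1 + 1/2) / 2) ((1 + 1) / 2)) = im_path ?G1 (edge (1/2) 1)"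
    by (rule im_edge_second) (use assms in simp_all)
  moreover have "im_path ?G1 (edge ((1 + 0) / 2) ((1 + 1) / 2)) = im_path k (edge 0 1)"
    by (rule im_edge_second) (use assms in simp_all)
  ultimately show "k = im_path ?G (edge (7/8) 1)" using assms by (simp add: im_edge_whole paths_ext)
qed (auto intro!: edge_paths)

lemma restrict_paths:
  assumes "continuous_on {0..1} \<phi>" "\<phi> ` {0..1} \<subseteq> {0..1}"
  shows "restrict \<phi> {0..1} \<in> paths Itop"
proof -
  have "continuous_map Itop Itop \<phi>" using assms by auto
  then have "continuous_map Itop Itop (restrict \<phi> {0..1})" by (rule continuous_map_eq) auto
  then show ?thesis by (simp add: paths_def pathin_def)
qed

text \<open>Presents associators and unitors as lifts through the path itself, the form in which
  \<open>sweep\<close> can be applied to them.\<close>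

lemma reparam_lift:
  assumes "P \<in> paths X" "continuous_on {0..1} \<phi>" "continuous_on {0..1} \<psi>"
    "\<phi> ` {0..1} \<subseteq> {0..1}" "\<psi> ` {0..1} \<subseteq> {0..1}" "\<phi> 0 = \<psi> 0" "\<phi> 1 = \<psi> 1"
  shows "homotopy_class X (reparam P \<phi> \<psi>) = lift X Itop P (restrict \<phi> {0..1}) (restrict \<psi> {0..1})"
proof -
  interpret lifting X Itop P using assms(1) by (simp add: lifting_def paths_cont)
  have b: "\<phi> t \<in> {0..1}" "\<psi> t \<in> {0..1}" if "t \<in> {0..1}" for t
    using that assms(4,5) by (metis image_subset_iff)+
  have "htpy Itop (restrict \<phi> {0..1}) (restrict \<psi> {0..1}) (reparam (\<lambda>t\<in>{0..1}. t) \<phi> \<psi>)"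
    by (rule reparam_htpy) (use assms b in \<open>simp_all add: restrict_paths\<close>)
  then show ?thesis
  proof (rule liftI)
    fix z :: "real \<times> real" assume z: "z \<in> unit_square"
    then have "(1 - fst z) * \<phi> (snd z) + fst z * \<psi> (snd z) \<in> {0..1}"
      using b[of "snd z"] convex_bound_le[of "\<phi> (snd z)" 1 "\<psi> (snd z)" "1 - fst z" "fst z"] by auto
    then show "reparam P \<phi> \<psi> z = P (reparam (\<lambda>t\<in>{0..1}. t) \<phi> \<psi> z)"
      using z by (cases z) (simp add: reparam_def)
  qed
qed

text \<open>The unit square serves as the parameter space and \<open>H\<close> as the map \<Gamma>.
  On the sides over the endpoints the two reparametrizations may differ, but \<open>H\<close> is
  constant there.\<close>

lemma class_reparam:
  assumes H: "htpy X f g H" and "continuous_on {0..1} a" "continuous_on {0..1} b"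
    "a ` {0..1} \<subseteq> {0..1}" "b ` {0..1} \<subseteq> {0..1}" "a 0 = b 0" "a 1 = b 1"
  shows "homotopy_class X (\<lambda>z. H (a (fst z), snd z)) = homotopy_class X (\<lambda>z. H (b (fst z), snd z))"
proof -
  have "convex unit_square" by (intro convex_Times) auto
  note m = equiconnected_convex[OF this]
  have ab: "a t \<in> {0..1}" "b t \<in> {0..1}" if "t \<in> {0..1}" for t
    using that assms(4,5) by (metis image_subset_iff)+
  have c: "continuous_map (top_of_set unit_square) (top_of_set unit_square) (\<lambda>z. (u (fst z), snd z))"
    if u: "continuous_on {0..1} u" "u ` {0..1} \<subseteq> {0..1}" for u
  proof -
    have "continuous_on unit_square (\<lambda>z. (u (fst z), snd z))"
      by (auto intro!: continuous_intros continuous_on_compose2[OF u(1)])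
    then show ?thesis using u(2) by auto
  qed
  show ?thesis
  proof (rule class_lift_eq[OF m htpyD(1)[OF H] c c])
    fix r :: real and z :: "real \<times> real"
    assume r: "r \<in> {0..1}" and z: "z \<in> unit_square - {0<..<1} \<times> {0<..<1}"
    obtain s t where st: "z = (s, t)" by fastforce
    then consider "s = 0" | "s = 1" | "t = 0" "s \<in> {0..1}" | "t = 1" "s \<in> {0..1}"
      using z by auto
    moreover have "(1 - r) * a s + r * b s \<in> {0..1}" if "s \<in> {0..1}"
      using ab[OF that] r convex_bound_le[of "a s" 1 "b s" "1 - r" r] by auto
    moreover have "a s \<in> {0..1}" if "s \<in> {0..1}" using ab[OF that] by simp
    moreover have "(1 - r) * x + r * x = x" for x by (simp add: algebra_simps)
    ultimately show "H ((1 - r) *\<^sub>R (a (fst z), snd z) + r *\<^sub>R (b (fst z), snd z)) = H (a (fst z), snd z)"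
      by cases (simp_all add: st assms(6,7) htpyD(4,5)[OF H] ab)
  qed (use assms in auto)
qed

lemma asc_phi_mem: "t \<in> {0..1} \<Longrightarrow> asc_phi t \<in> {0..1}"
  using asc_phi_props(2) by (metis image_subset_iff)

text \<open>Slicing a square at a fixed value of the other variable reduces identities between
  composite squares to identities between concatenated paths.\<close>

lemma vconcat_as_concat:
  "s \<in> {0..1} \<Longrightarrow> t \<in> {0..1} \<Longrightarrow> vconcat K H (s, t) = concat_path (\<lambda>s. K (s, t)) (\<lambda>s. H (s, t)) s"
  by (simp add: vconcat_def concat_path_def)

lemma hconcat_as_concat:
  "s \<in> {0..1} \<Longrightarrow> t \<in> {0..1} \<Longrightarrow> hconcat K H (s, t) = concat_path (\<lambda>t. K (s, t)) (\<lambda>t. H (s, t)) t"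
  by (simp add: hconcat_def concat_path_def)

lemma concat_path_cong:
  assumes "\<And>t. t \<in> {0..1} \<Longrightarrow> g t = g' t" "\<And>t. t \<in> {0..1} \<Longrightarrow> f t = f' t"
  shows "concat_path g f = concat_path g' f'"
  using assms by (auto simp: concat_path_def restrict_def)

lemma vcmp_id_class:
  assumes "\<alpha> \<in> hom2 (\<Pi>\<^sub>2 X) f g"
  shows "vcmp (\<Pi>\<^sub>2 X) (id2 (\<Pi>\<^sub>2 X) g) \<alpha> = \<alpha>" "vcmp (\<Pi>\<^sub>2 X) \<alpha> (id2 (\<Pi>\<^sub>2 X) f) = \<alpha>"
proof -
  obtain H where H: "htpy X f g H" "\<alpha> = homotopy_class X H" "f \<in> paths X" "g \<in> paths X"
    using assms by (rule hom2E)
  \<comment> \<open>Composition with an identity cell lets the homotopy rest during one half of the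
    time, which is a reparametrization by \<open>?m\<close> or by \<open>?M\<close>.\<close>
  let ?m = "\<lambda>s::real. min (2 * s) 1" let ?M = "\<lambda>s::real. max (2 * s - 1) 0"
  have c: "continuous_on {0..1} ?m" "continuous_on {0..1} ?M" by (intro continuous_intros)+
  have "homotopy_class X (vconcat (\<lambda>z. g (snd z)) H) = homotopy_class X (\<lambda>z. H (?m (fst z), snd z))"
    by (rule homotopy_class_cong[OF htpyD(1)[OF htpy_vconcat[OF H(1) htpy_id[OF H(4)]]]])
      (auto simp: vconcat_def min_def htpyD[OF H(1)])
  also have "\<dots> = homotopy_class X (\<lambda>z. H (fst z, snd z))"
    by (rule class_reparam[OF H(1) c(1)]) (auto simp: min_def intro!: continuous_intros)
  finally show "vcmp (\<Pi>\<^sub>2 X) (id2 (\<Pi>\<^sub>2 X) g) \<alpha> = \<alpha>"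
    using vcmp_class[OF H(1) htpy_id[OF H(4)]] by (simp add: H id2_class)
  have "homotopy_class X (vconcat H (\<lambda>z. f (snd z))) = homotopy_class X (\<lambda>z. H (?M (fst z), snd z))"
    by (rule homotopy_class_cong[OF htpyD(1)[OF htpy_vconcat[OF htpy_id[OF H(3)] H(1)]]])
      (auto simp: vconcat_def max_def htpyD[OF H(1)])
  also have "\<dots> = homotopy_class X (\<lambda>z. H (fst z, snd z))"
    by (rule class_reparam[OF H(1) c(2)]) (auto simp: max_def intro!: continuous_intros)
  finally show "vcmp (\<Pi>\<^sub>2 X) \<alpha> (id2 (\<Pi>\<^sub>2 X) f) = \<alpha>"
    using vcmp_class[OF htpy_id[OF H(3)] H(1)] by (simp add: H id2_class)
qed

text \<open>For each fixed \<open>t\<close> the two bracketings are concatenations of three paths in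
  the homotopy parameter, and these differ by \<open>asc_phi\<close>.\<close>

lemma vcmp_assoc_class:
  assumes "\<alpha> \<in> hom2 (\<Pi>\<^sub>2 X) f g" "\<beta> \<in> hom2 (\<Pi>\<^sub>2 X) g h" "\<gamma> \<in> hom2 (\<Pi>\<^sub>2 X) h k"
  shows "vcmp (\<Pi>\<^sub>2 X) (vcmp (\<Pi>\<^sub>2 X) \<gamma> \<beta>) \<alpha> = vcmp (\<Pi>\<^sub>2 X) \<gamma> (vcmp (\<Pi>\<^sub>2 X) \<beta> \<alpha>)"
proof -
  obtain A where A: "htpy X f g A" "\<alpha> = homotopy_class X A" using assms(1) by (rule hom2E)
  obtain B where B: "htpy X g h B" "\<beta> = homotopy_class X B" using assms(2) by (rule hom2E)
  obtain C where C: "htpy X h k C" "\<gamma> = homotopy_class X C" using assms(3) by (rule hom2E)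
  let ?L = "vconcat (vconcat C B) A" let ?R = "vconcat C (vconcat B A)"
  have L: "htpy X f k ?L" and R: "htpy X f k ?R" using A B C by (blast intro: htpy_vconcat)+
  have eq: "?R z = ?L (asc_phi (fst z), snd z)" if "z \<in> unit_square" for z
  proof -
    obtain s t where z: "z = (s, t)" "s \<in> {0..1}" "t \<in> {0..1}" using \<open>z \<in> unit_square\<close> by auto
    have s: "asc_phi s \<in> {0..1}" using z(2) by (rule asc_phi_mem)
    have "?R (s, t) = concat_path (\<lambda>s. C (s, t)) (concat_path (\<lambda>s. B (s, t)) (\<lambda>s. A (s, t))) s"
      unfolding vconcat_as_concat[OF z(2,3)]
      by (rule fun_cong[OF concat_path_cong]) (use z in \<open>simp_all add: vconcat_as_concat\<close>)
    also have "\<dots> = concat_path (concat_path (\<lambda>s. C (s, t)) (\<lambda>s. B (s, t))) (\<lambda>s. A (s, t)) (asc_phi s)"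
      using z(2) by (simp add: concat_asc_phi)
    also have "\<dots> = ?L (asc_phi s, t)"
      unfolding vconcat_as_concat[OF s z(3)]
      by (rule fun_cong[OF concat_path_cong]) (use z in \<open>simp_all add: vconcat_as_concat\<close>)
    finally show ?thesis by (simp add: z)
  qed
  have "homotopy_class X ?R = homotopy_class X (\<lambda>z. ?L (asc_phi (fst z), snd z))"
    by (rule homotopy_class_cong[OF htpyD(1)[OF R] eq])
  also have "\<dots> = homotopy_class X (\<lambda>z. ?L (fst z, snd z))"
    by (rule class_reparam[OF L]) (simp_all add: asc_phi_props)
  finally have "homotopy_class X ?L = homotopy_class X ?R" by simp
  then show ?thesis
    using vcmp_class[OF A(1) B(1)] vcmp_class[OF B(1) C(1)]
      vcmp_class[OF A(1) htpy_vconcat[OF B(1) C(1)]] vcmp_class[OF htpy_vconcat[OF A(1) B(1)] C(1)]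
    by (simp add: A B C)
qed

lemma interchange_class:
  assumes "\<alpha> \<in> hom2 (\<Pi>\<^sub>2 X) f f'" "\<alpha>' \<in> hom2 (\<Pi>\<^sub>2 X) f' f''" "\<beta> \<in> hom2 (\<Pi>\<^sub>2 X) g g'" "\<beta>' \<in> hom2 (\<Pi>\<^sub>2 X) g' g''"
    and fg: "f 1 = g 0"
  shows "hcmp (\<Pi>\<^sub>2 X) (vcmp (\<Pi>\<^sub>2 X) \<beta>' \<beta>) (vcmp (\<Pi>\<^sub>2 X) \<alpha>' \<alpha>)
    = vcmp (\<Pi>\<^sub>2 X) (hcmp (\<Pi>\<^sub>2 X) \<beta>' \<alpha>') (hcmp (\<Pi>\<^sub>2 X) \<beta> \<alpha>)"
proof -
  obtain A where A: "htpy X f f' A" "\<alpha> = homotopy_class X A" "f 1 = f' 1" using assms(1) by (rule hom2E)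
  obtain A' where A': "htpy X f' f'' A'" "\<alpha>' = homotopy_class X A'" using assms(2) by (rule hom2E)
  obtain B where B: "htpy X g g' B" "\<beta> = homotopy_class X B" "g 0 = g' 0" using assms(3) by (rule hom2E)
  obtain B' where B': "htpy X g' g'' B'" "\<beta>' = homotopy_class X B'" using assms(4) by (rule hom2E)
  have fg': "f' 1 = g' 0" using fg A(3) B(3) by simp
  have "homotopy_class X (hconcat (vconcat B' B) (vconcat A' A)) = homotopy_class X (vconcat (hconcat B' A') (hconcat B A))"
    by (rule homotopy_class_cong[OF htpyD(1)[OF htpy_hconcat[OF htpy_vconcat[OF A(1) A'(1)] htpy_vconcat[OF B(1) B'(1)] fg]]])
      (auto simp: hconcat_def vconcat_def)
  then show ?thesis
    using hcmp_class[OF htpy_vconcat[OF A(1) A'(1)] htpy_vconcat[OF B(1) B'(1)] fg]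
      vcmp_class[OF htpy_hconcat[OF A(1) B(1) fg] htpy_hconcat[OF A'(1) B'(1) fg']]
      vcmp_class[OF A(1) A'(1)] vcmp_class[OF B(1) B'(1)]
      hcmp_class[OF A(1) B(1) fg] hcmp_class[OF A'(1) B'(1) fg']
    by (simp add: A(2) A'(2) B(2) B'(2))
qed

text \<open>The square \<open>(C B) A\<close> is regarded as a family of paths indexed by the
  homotopy parameter. The associators of its two end paths are lifts between the identity and
  \<open>asc_phi\<close>, and sweeping through the family gives naturality: the other bracketing of
  the square is the family precomposed with \<open>asc_phi\<close>.\<close>

lemma asc_natural_class:
  assumes "\<alpha> \<in> hom2 (\<Pi>\<^sub>2 X) f f'" "\<beta> \<in> hom2 (\<Pi>\<^sub>2 X) g g'" "\<gamma> \<in> hom2 (\<Pi>\<^sub>2 X) h h'"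
    and fg: "f 1 = g 0" and gh: "g 1 = h 0"
  shows "vcmp (\<Pi>\<^sub>2 X) (asc (\<Pi>\<^sub>2 X) h' g' f') (hcmp (\<Pi>\<^sub>2 X) (hcmp (\<Pi>\<^sub>2 X) \<gamma> \<beta>) \<alpha>)
    = vcmp (\<Pi>\<^sub>2 X) (hcmp (\<Pi>\<^sub>2 X) \<gamma> (hcmp (\<Pi>\<^sub>2 X) \<beta> \<alpha>)) (asc (\<Pi>\<^sub>2 X) h g f)"
proof -
  obtain A where A: "htpy X f f' A" "\<alpha> = homotopy_class X A" "f \<in> paths X" "f' \<in> paths X" "f 1 = f' 1"
    using assms(1) by (rule hom2E)
  obtain B where B: "htpy X g g' B" "\<beta> = homotopy_class X B" "g \<in> paths X" "g' \<in> paths X" "g 0 = g' 0" "g 1 = g' 1"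
    using assms(2) by (rule hom2E)
  obtain C where C: "htpy X h h' C" "\<gamma> = homotopy_class X C" "h \<in> paths X" "h' \<in> paths X" "h 0 = h' 0"
    using assms(3) by (rule hom2E)
  have e': "f' 1 = g' 0" "g' 1 = h' 0" using fg gh A B C by simp_all
  let ?P = "concat_path (concat_path h g) f" let ?P' = "concat_path (concat_path h' g') f'"
  let ?L = "hconcat (hconcat C B) A" let ?R = "hconcat C (hconcat B A)"
  let ?i = "\<lambda>t\<in>{0..1}. t::real" let ?a = "restrict asc_phi {0..1}"
  have L: "htpy X ?P ?P' ?L" and R: "htpy X (concat_path h (concat_path g f)) (concat_path h' (concat_path g' f')) ?R"
    using A B C fg gh by (auto intro!: htpy_hconcat)
  have par: "parallel Itop ?i ?a"
    by (simp add: parallel_def asc_phi_props restrict_paths)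
  have asc: "asc (\<Pi>\<^sub>2 X) h g f = lift X Itop (\<lambda>x. ?L (0, x)) ?i ?a" "asc (\<Pi>\<^sub>2 X) h' g' f' = lift X Itop (\<lambda>x. ?L (1, x)) ?i ?a"
  proof -
    have P: "?P \<in> paths X" "?P' \<in> paths X"
      using A B C fg gh e' by (auto intro!: concat_path_paths)
    have c: "asc (\<Pi>\<^sub>2 X) h g f = lift X Itop ?P ?i ?a" "asc (\<Pi>\<^sub>2 X) h' g' f' = lift X Itop ?P' ?i ?a"
      unfolding asc_def' by (rule reparam_lift; simp add: P asc_phi_props)+
    have "lift X Itop ?P ?i ?a = lift X Itop (\<lambda>x. ?L (0, x)) ?i ?a"
        "lift X Itop ?P' ?i ?a = lift X Itop (\<lambda>x. ?L (1, x)) ?i ?a"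
      by (rule lift_cong[OF equiconnected_Itop paths_cont par]; use P htpyD(2,3)[OF L] in simp)+
    with c show "asc (\<Pi>\<^sub>2 X) h g f = lift X Itop (\<lambda>x. ?L (0, x)) ?i ?a"
        "asc (\<Pi>\<^sub>2 X) h' g' f' = lift X Itop (\<lambda>x. ?L (1, x)) ?i ?a" by simp_all
  qed
  have "vcmp (\<Pi>\<^sub>2 X) (lift X Itop (\<lambda>x. ?L (1, x)) ?i ?a) (homotopy_class X (\<lambda>z. ?L (fst z, ?i (snd z))))
    = vcmp (\<Pi>\<^sub>2 X) (homotopy_class X (\<lambda>z. ?L (fst z, ?a (snd z)))) (lift X Itop (\<lambda>x. ?L (0, x)) ?i ?a)"
    by (rule sweep[OF equiconnected_Itop _ par]) (use htpyD[OF L] in \<open>simp_all add: asc_phi_props\<close>)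
  moreover have "homotopy_class X (\<lambda>z. ?L (fst z, ?i (snd z))) = homotopy_class X ?L"
    by (rule sym, rule homotopy_class_cong[OF htpyD(1)[OF L]]) auto
  moreover have "homotopy_class X (\<lambda>z. ?L (fst z, ?a (snd z))) = homotopy_class X ?R"
  proof (rule sym, rule homotopy_class_cong[OF htpyD(1)[OF R]])
    fix z :: "real \<times> real" assume "z \<in> unit_square"
    then obtain s t where z: "z = (s, t)" "s \<in> {0..1}" "t \<in> {0..1}" by auto
    have t: "asc_phi t \<in> {0..1}" using z(3) by (rule asc_phi_mem)
    have "?R (s, t) = concat_path (\<lambda>t. C (s, t)) (concat_path (\<lambda>t. B (s, t)) (\<lambda>t. A (s, t))) t"
      unfolding hconcat_as_concat[OF z(2,3)]
      by (rule fun_cong[OF concat_path_cong]) (use z in \<open>simp_all add: hconcat_as_concat\<close>)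
    also have "\<dots> = concat_path (concat_path (\<lambda>t. C (s, t)) (\<lambda>t. B (s, t))) (\<lambda>t. A (s, t)) (asc_phi t)"
      using z(3) by (simp add: concat_asc_phi)
    also have "\<dots> = ?L (s, asc_phi t)"
      unfolding hconcat_as_concat[OF z(2) t]
      by (rule fun_cong[OF concat_path_cong]) (use z in \<open>simp_all add: hconcat_as_concat\<close>)
    finally show "?R z = ?L (fst z, ?a (snd z))" using z by simp
  qed
  ultimately show ?thesis
    using hcmp_class[OF A(1) B(1) fg] hcmp_class[OF B(1) C(1) gh]
      hcmp_class[OF A(1) htpy_hconcat[OF B(1) C(1) gh]] hcmp_class[OF htpy_hconcat[OF A(1) B(1) fg] C(1)] fg gh
    by (simp add: A(2) B(2) C(2) asc)
qed

text \<open>The same sweep, now between \<open>min (2 * t) 1\<close> and the identity: precomposing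
  the family with the former appends the constant path.\<close>

lemma lun_natural_class:
  assumes "\<alpha> \<in> hom2 (\<Pi>\<^sub>2 X) f g" and b: "f 1 = b"
  shows "vcmp (\<Pi>\<^sub>2 X) (lun (\<Pi>\<^sub>2 X) g) (hcmp (\<Pi>\<^sub>2 X) (id2 (\<Pi>\<^sub>2 X) (const_path b)) \<alpha>)
    = vcmp (\<Pi>\<^sub>2 X) \<alpha> (lun (\<Pi>\<^sub>2 X) f)"
proof -
  obtain A where A: "htpy X f g A" "\<alpha> = homotopy_class X A" "f \<in> paths X" "g \<in> paths X"
    using assms(1) by (rule hom2E)
  let ?i = "\<lambda>t\<in>{0..1}. t::real" let ?m = "\<lambda>t\<in>{0..1}. min (2 * t) (1::real)"
  have c: "continuous_on {0..1} (\<lambda>t. min (2 * t) (1::real))" by (intro continuous_intros)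
  have m: "(\<lambda>t. min (2 * t) (1::real)) ` {0..1} \<subseteq> {0..1}" by auto
  have par: "parallel Itop ?m ?i" using restrict_paths[OF c m] restrict_paths[of "\<lambda>t. t"] by (simp add: parallel_def)
  have "lun (\<Pi>\<^sub>2 X) u = lift X Itop u ?m ?i" if "u \<in> paths X" for u
    unfolding lun_def' by (rule reparam_lift[OF that c _ m]) simp_all
  then have lun: "lun (\<Pi>\<^sub>2 X) g = lift X Itop (\<lambda>x. A (1, x)) ?m ?i" "lun (\<Pi>\<^sub>2 X) f = lift X Itop (\<lambda>x. A (0, x)) ?m ?i"
    using lift_cong[OF equiconnected_Itop paths_cont[OF A(4)] par, of "\<lambda>x. A (1, x)"]
      lift_cong[OF equiconnected_Itop paths_cont[OF A(3)] par, of "\<lambda>x. A (0, x)"] htpyD[OF A(1)] A(3,4)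
    by simp_all
  have bX: "const_path b \<in> paths X" using A(3) b by auto
  have "vcmp (\<Pi>\<^sub>2 X) (lift X Itop (\<lambda>x. A (1, x)) ?m ?i) (homotopy_class X (\<lambda>z. A (fst z, ?m (snd z))))
    = vcmp (\<Pi>\<^sub>2 X) (homotopy_class X (\<lambda>z. A (fst z, ?i (snd z)))) (lift X Itop (\<lambda>x. A (0, x)) ?m ?i)"
    by (rule sweep[OF equiconnected_Itop _ par]) (use htpyD[OF A(1)] in simp_all)
  moreover have "homotopy_class X (\<lambda>z. A (fst z, ?i (snd z))) = homotopy_class X A"
    by (rule sym, rule homotopy_class_cong[OF htpyD(1)[OF A(1)]]) auto
  moreover have "homotopy_class X (\<lambda>z. A (fst z, ?m (snd z))) = homotopy_class X (hconcat (\<lambda>z. const_path b (snd z)) A)"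
    by (rule sym, rule homotopy_class_cong[OF htpyD(1)[OF htpy_hconcat[OF A(1) htpy_id[OF bX]]]])
      (auto simp: b hconcat_def const_path_def min_def htpyD[OF A(1)])
  ultimately show ?thesis
    using hcmp_class[OF A(1) htpy_id[OF bX]] b by (simp add: A(2) lun id2_class[OF bX])
qed

lemma run_natural_class:
  assumes "\<alpha> \<in> hom2 (\<Pi>\<^sub>2 X) f g" and b: "f 0 = b"
  shows "vcmp (\<Pi>\<^sub>2 X) (run (\<Pi>\<^sub>2 X) g) (hcmp (\<Pi>\<^sub>2 X) \<alpha> (id2 (\<Pi>\<^sub>2 X) (const_path b)))
    = vcmp (\<Pi>\<^sub>2 X) \<alpha> (run (\<Pi>\<^sub>2 X) f)"
proof -
  obtain A where A: "htpy X f g A" "\<alpha> = homotopy_class X A" "f \<in> paths X" "g \<in> paths X"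
    using assms(1) by (rule hom2E)
  let ?i = "\<lambda>t\<in>{0..1}. t::real" let ?m = "\<lambda>t\<in>{0..1}. max (2 * t - 1) (0::real)"
  have c: "continuous_on {0..1} (\<lambda>t. max (2 * t - 1) (0::real))" by (intro continuous_intros)
  have m: "(\<lambda>t. max (2 * t - 1) (0::real)) ` {0..1} \<subseteq> {0..1}" by auto
  have par: "parallel Itop ?m ?i" using restrict_paths[OF c m] restrict_paths[of "\<lambda>t. t"] by (simp add: parallel_def)
  have "run (\<Pi>\<^sub>2 X) u = lift X Itop u ?m ?i" if "u \<in> paths X" for u
    unfolding run_def' by (rule reparam_lift[OF that c _ m]) simp_all
  then have run: "run (\<Pi>\<^sub>2 X) g = lift X Itop (\<lambda>x. A (1, x)) ?m ?i" "run (\<Pi>\<^sub>2 X) f = lift X Itop (\<lambda>x. A (0, x)) ?m ?i"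
    using lift_cong[OF equiconnected_Itop paths_cont[OF A(4)] par, of "\<lambda>x. A (1, x)"]
      lift_cong[OF equiconnected_Itop paths_cont[OF A(3)] par, of "\<lambda>x. A (0, x)"] htpyD[OF A(1)] A(3,4)
    by simp_all
  have bX: "const_path b \<in> paths X" using A(3) b by auto
  have "vcmp (\<Pi>\<^sub>2 X) (lift X Itop (\<lambda>x. A (1, x)) ?m ?i) (homotopy_class X (\<lambda>z. A (fst z, ?m (snd z))))
    = vcmp (\<Pi>\<^sub>2 X) (homotopy_class X (\<lambda>z. A (fst z, ?i (snd z)))) (lift X Itop (\<lambda>x. A (0, x)) ?m ?i)"
    by (rule sweep[OF equiconnected_Itop _ par]) (use htpyD[OF A(1)] in simp_all)
  moreover have "homotopy_class X (\<lambda>z. A (fst z, ?i (snd z))) = homotopy_class X A"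
    by (rule sym, rule homotopy_class_cong[OF htpyD(1)[OF A(1)]]) auto
  moreover have "homotopy_class X (\<lambda>z. A (fst z, ?m (snd z))) = homotopy_class X (hconcat A (\<lambda>z. const_path b (snd z)))"
    by (rule sym, rule homotopy_class_cong[OF htpyD(1)[OF htpy_hconcat[OF htpy_id[OF bX] A(1)]]])
      (auto simp: b hconcat_def const_path_def max_def htpyD[OF A(1)])
  ultimately show ?thesis
    using hcmp_class[OF htpy_id[OF bX] A(1)] b by (simp add: A(2) run id2_class[OF bX])
qed

lemma const_path_paths01 [simp]:
  assumes "p \<in> paths S" shows "const_path (p 0) \<in> paths S" "const_path (p 1) \<in> paths S"
  using assms by (simp_all add: const_path_paths)

lemma fundamental_bicategory: "bicategory (\<Pi>\<^sub>2 X)"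
proof -
  have chain3: thesis
    if fgh: "f \<in> hom1 (\<Pi>\<^sub>2 X) a b" "g \<in> hom1 (\<Pi>\<^sub>2 X) b c" "h \<in> hom1 (\<Pi>\<^sub>2 X) c d"
      and *: "\<And>\<Gamma> p1 p2 p3. lifting X Itop \<Gamma> \<Longrightarrow> p1 \<in> paths Itop \<Longrightarrow> p2 \<in> paths Itop \<Longrightarrow> p3 \<in> paths Itop
        \<Longrightarrow> p1 1 = p2 0 \<Longrightarrow> p2 1 = p3 0 \<Longrightarrow> f = im_path \<Gamma> p1 \<Longrightarrow> g = im_path \<Gamma> p2 \<Longrightarrow> h = im_path \<Gamma> p3
        \<Longrightarrow> thesis" for f g h a b c d thesis
  proof -
    \<comment> \<open>Shorter chains are padded with constant paths at their end, so that one
      lifting lemma serves all coherence axioms.\<close>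
    obtain \<Gamma> p1 p2 p3 p4 where "continuous_map Itop X \<Gamma>"
      "p1 \<in> paths Itop" "p2 \<in> paths Itop" "p3 \<in> paths Itop" "p4 \<in> paths Itop"
      "p1 1 = p2 0" "p2 1 = p3 0" "p3 1 = p4 0"
      "f = im_path \<Gamma> p1" "g = im_path \<Gamma> p2" "h = im_path \<Gamma> p3" "const_path d = im_path \<Gamma> p4"
      by (rule chain_lift[of f X g h "const_path d"]) (use fgh in \<open>auto simp: hom1_fundamental\<close>)
    then show thesis by (intro *[of \<Gamma> p1 p2 p3]) (simp_all add: lifting_def)
  qed
  have chain2: thesis
    if "f \<in> hom1 (\<Pi>\<^sub>2 X) a b" "g \<in> hom1 (\<Pi>\<^sub>2 X) b c"
      and *: "\<And>\<Gamma> p1 p2. lifting X Itop \<Gamma> \<Longrightarrow> p1 \<in> paths Itop \<Longrightarrow> p2 \<in> paths Itop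
        \<Longrightarrow> p1 1 = p2 0 \<Longrightarrow> f = im_path \<Gamma> p1 \<Longrightarrow> g = im_path \<Gamma> p2 \<Longrightarrow> thesis" for f g a b c thesis
    by (rule chain3[OF that(1,2), of "const_path c" c]) (use that in \<open>auto simp: hom1_fundamental\<close>)
  note lift_simps = lifting.lift_id lifting.lift_asc lifting.lift_lun lifting.lift_run im_concat
    lifting.lift_hcmp lifting.lift_vcmp parallel_def concat_path_paths wl_def wr_def
  show ?thesis
  proof
    fix f a b g c h d
    assume f: "f \<in> hom1 (\<Pi>\<^sub>2 X) a b" and g: "g \<in> hom1 (\<Pi>\<^sub>2 X) b c" and h: "h \<in> hom1 (\<Pi>\<^sub>2 X) c d"
    have "asc (\<Pi>\<^sub>2 X) h g f \<in> hom2 (\<Pi>\<^sub>2 X) (cmp1 (\<Pi>\<^sub>2 X) (cmp1 (\<Pi>\<^sub>2 X) h g) f) (cmp1 (\<Pi>\<^sub>2 X) h (cmp1 (\<Pi>\<^sub>2 X) g f))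
      \<and> iso2 (\<Pi>\<^sub>2 X) (asc (\<Pi>\<^sub>2 X) h g f)"
      by (rule chain3[OF f g h]) (simp add: lift_simps lifting.lift_hom lifting.lift_iso)
    then show "asc (\<Pi>\<^sub>2 X) h g f \<in> hom2 (\<Pi>\<^sub>2 X) (cmp1 (\<Pi>\<^sub>2 X) (cmp1 (\<Pi>\<^sub>2 X) h g) f) (cmp1 (\<Pi>\<^sub>2 X) h (cmp1 (\<Pi>\<^sub>2 X) g f))"
      and "iso2 (\<Pi>\<^sub>2 X) (asc (\<Pi>\<^sub>2 X) h g f)" by blast+
    fix k e assume k: "k \<in> hom1 (\<Pi>\<^sub>2 X) d e"
    show "vcmp (\<Pi>\<^sub>2 X) (asc (\<Pi>\<^sub>2 X) k h (cmp1 (\<Pi>\<^sub>2 X) g f)) (asc (\<Pi>\<^sub>2 X) (cmp1 (\<Pi>\<^sub>2 X) k h) g f) =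
       vcmp (\<Pi>\<^sub>2 X) (vcmp (\<Pi>\<^sub>2 X) (wl (\<Pi>\<^sub>2 X) k (asc (\<Pi>\<^sub>2 X) h g f)) (asc (\<Pi>\<^sub>2 X) k (cmp1 (\<Pi>\<^sub>2 X) h g) f))
         (wr (\<Pi>\<^sub>2 X) (asc (\<Pi>\<^sub>2 X) k h g) f)"
    proof (rule chain_lift[of f X g h k])
      fix \<Gamma> p1 p2 p3 p4 assume *: "continuous_map Itop X \<Gamma>" "p1 \<in> paths Itop" "p2 \<in> paths Itop" "p3 \<in> paths Itop"
        "p4 \<in> paths Itop" "p1 1 = p2 0" "p2 1 = p3 0" "p3 1 = p4 0"
        "f = im_path \<Gamma> p1" "g = im_path \<Gamma> p2" "h = im_path \<Gamma> p3" "k = im_path \<Gamma> p4"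
      then have "lifting X Itop \<Gamma>" by (simp add: lifting_def)
      then show ?thesis using *(2-8) unfolding *(9-) by (simp add: lift_simps)
    qed (use f g h k in \<open>simp_all add: hom1_fundamental\<close>)
  next
    fix f a b g c
    assume f: "f \<in> hom1 (\<Pi>\<^sub>2 X) a b" and g: "g \<in> hom1 (\<Pi>\<^sub>2 X) b c"
    have b: "b = f 1" using f by (simp add: hom1_fundamental)
    show "hcmp (\<Pi>\<^sub>2 X) (id2 (\<Pi>\<^sub>2 X) g) (id2 (\<Pi>\<^sub>2 X) f) = id2 (\<Pi>\<^sub>2 X) (cmp1 (\<Pi>\<^sub>2 X) g f)"
      by (rule chain2[OF f g]) (simp add: lift_simps)
    show "vcmp (\<Pi>\<^sub>2 X) (wl (\<Pi>\<^sub>2 X) g (lun (\<Pi>\<^sub>2 X) f)) (asc (\<Pi>\<^sub>2 X) g (id1 (\<Pi>\<^sub>2 X) b) f) = wr (\<Pi>\<^sub>2 X) (run (\<Pi>\<^sub>2 X) g) f"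
    proof (rule chain2[OF f g])
      fix \<Gamma> p1 p2 assume *: "lifting X Itop \<Gamma>" "p1 \<in> paths Itop" "p2 \<in> paths Itop" "p1 1 = p2 0"
        "f = im_path \<Gamma> p1" "g = im_path \<Gamma> p2"
      then show ?thesis by (simp add: b lift_simps im_const[of \<Gamma>, symmetric])
    qed
  next
    fix f a b assume f: "f \<in> hom1 (\<Pi>\<^sub>2 X) a b"
    then have ab: "a = f 0" "b = f 1" and fX: "f \<in> paths X" by (auto simp: hom1_fundamental)
    show "lun (\<Pi>\<^sub>2 X) f \<in> hom2 (\<Pi>\<^sub>2 X) (cmp1 (\<Pi>\<^sub>2 X) (id1 (\<Pi>\<^sub>2 X) b) f) f"
      unfolding lun_def' fundamental_simps ab by (rule class_hom2[OF lun_htpy[OF fX]]) (simp_all add: paths_ext[OF fX])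
    show "run (\<Pi>\<^sub>2 X) f \<in> hom2 (\<Pi>\<^sub>2 X) (cmp1 (\<Pi>\<^sub>2 X) f (id1 (\<Pi>\<^sub>2 X) a)) f"
      unfolding run_def' fundamental_simps ab by (rule class_hom2[OF run_htpy[OF fX]]) (simp_all add: paths_ext[OF fX])
  next
    fix f assume "f \<in> Arr (\<Pi>\<^sub>2 X)"
    then have f: "f \<in> hom1 (\<Pi>\<^sub>2 X) (f 0) (f 1)" and c: "const_path (f 1) \<in> hom1 (\<Pi>\<^sub>2 X) (f 1) (f 1)"
      by (simp_all add: hom1_fundamental)
    show "iso2 (\<Pi>\<^sub>2 X) (lun (\<Pi>\<^sub>2 X) f)" "iso2 (\<Pi>\<^sub>2 X) (run (\<Pi>\<^sub>2 X) f)"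
      by (rule chain2[OF f c], simp add: lift_simps lifting.lift_iso)+
  next
    fix \<alpha> f f' \<beta> g g'
    assume a: "\<alpha> \<in> hom2 (\<Pi>\<^sub>2 X) f f'" and b: "\<beta> \<in> hom2 (\<Pi>\<^sub>2 X) g g'" and fg: "trg (\<Pi>\<^sub>2 X) f = src (\<Pi>\<^sub>2 X) g"
    obtain A where A: "htpy X f f' A" "\<alpha> = homotopy_class X A" using a by (rule hom2E)
    obtain B where B: "htpy X g g' B" "\<beta> = homotopy_class X B" using b by (rule hom2E)
    show "hcmp (\<Pi>\<^sub>2 X) \<beta> \<alpha> \<in> hom2 (\<Pi>\<^sub>2 X) (cmp1 (\<Pi>\<^sub>2 X) g f) (cmp1 (\<Pi>\<^sub>2 X) g' f')"
      using hcmp_class[OF A(1) B(1)] class_hom2[OF htpy_hconcat[OF A(1) B(1)]] fg by (simp add: A(2) B(2))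
  next
    fix \<alpha> f g \<beta> h
    assume a: "\<alpha> \<in> hom2 (\<Pi>\<^sub>2 X) f g" and b: "\<beta> \<in> hom2 (\<Pi>\<^sub>2 X) g h"
    obtain A where A: "htpy X f g A" "\<alpha> = homotopy_class X A" "f \<in> paths X" using a by (rule hom2E)
    obtain B where B: "htpy X g h B" "\<beta> = homotopy_class X B" "h \<in> paths X" using b by (rule hom2E)
    show "vcmp (\<Pi>\<^sub>2 X) \<beta> \<alpha> \<in> hom2 (\<Pi>\<^sub>2 X) f h"
      using vcmp_class[OF A(1) B(1)] class_hom2[OF htpy_vconcat[OF A(1) B(1)]] by (simp add: A(2) B(2) paths_ext[OF A(3)] paths_ext[OF B(3)])
  next
    fix f assume f: "f \<in> Arr (\<Pi>\<^sub>2 X)"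
    then show "id2 (\<Pi>\<^sub>2 X) f \<in> hom2 (\<Pi>\<^sub>2 X) f f"
      using class_hom2[OF htpy_id[of f X]] by (simp add: id2_class paths_ext[of f X])
  next
    fix \<alpha> assume "\<alpha> \<in> Cell (\<Pi>\<^sub>2 X)"
    then have "\<alpha> \<in> hom2 (\<Pi>\<^sub>2 X) (dom2 (\<Pi>\<^sub>2 X) \<alpha>) (cod2 (\<Pi>\<^sub>2 X) \<alpha>)" by (simp add: hom2_def)
    then show "dom2 (\<Pi>\<^sub>2 X) \<alpha> \<in> Arr (\<Pi>\<^sub>2 X)" "cod2 (\<Pi>\<^sub>2 X) \<alpha> \<in> Arr (\<Pi>\<^sub>2 X)"
      "src (\<Pi>\<^sub>2 X) (dom2 (\<Pi>\<^sub>2 X) \<alpha>) = src (\<Pi>\<^sub>2 X) (cod2 (\<Pi>\<^sub>2 X) \<alpha>)"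
      "trg (\<Pi>\<^sub>2 X) (dom2 (\<Pi>\<^sub>2 X) \<alpha>) = trg (\<Pi>\<^sub>2 X) (cod2 (\<Pi>\<^sub>2 X) \<alpha>)"
      by (auto elim!: hom2E)
  qed (simp_all add: hom1_fundamental concat_path_paths vcmp_id_class vcmp_assoc_class interchange_class
      asc_natural_class lun_natural_class run_natural_class wl_def wr_def)
qed


text \<open>\<open>inv2\<close> is a definite description, so it can be computed only after
  uniqueness of inverses, which follows by associating \<open>\<beta>' \<alpha> \<beta>\<close> in
  two ways.\<close>

lemma (in bicategory) inv2_eqI:
  assumes "inverse2 B \<alpha> \<beta>" shows "inv2 B \<alpha> = \<beta>"
  unfolding inv2_def
proof (rule the_equality[where P="inverse2 B \<alpha>", OF assms])
  fix \<beta>' assume "inverse2 B \<alpha> \<beta>'"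
  then have *: "\<alpha> \<in> hom2 B (dom2 B \<alpha>) (cod2 B \<alpha>)" "\<beta>' \<in> hom2 B (cod2 B \<alpha>) (dom2 B \<alpha>)"
      "\<beta> \<in> hom2 B (cod2 B \<alpha>) (dom2 B \<alpha>)" "vcmp B \<beta>' \<alpha> = id2 B (dom2 B \<alpha>)" "vcmp B \<alpha> \<beta> = id2 B (cod2 B \<alpha>)"
    using assms by (auto simp: inverse2_def hom2_def)
  have "\<beta>' = vcmp B \<beta>' (vcmp B \<alpha> \<beta>)" using vcmp_id_right[OF *(2)] *(5) by simp
  also have "\<dots> = vcmp B (vcmp B \<beta>' \<alpha>) \<beta>" using vcmp_assoc[OF *(3,1,2)] by simp
  also have "\<dots> = \<beta>" using vcmp_id_left[OF *(3)] *(4) by simp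
  finally show "\<beta>' = \<beta>" .
qed

context lifting begin

lemma lift_inv: "parallel S p q \<Longrightarrow> inv2 (\<Pi>\<^sub>2 X) (lift X S \<Gamma> p q) = lift X S \<Gamma> q p"
  by (rule bicategory.inv2_eqI[OF fundamental_bicategory lift_inverse])

text \<open>The rule for constant paths is oriented towards \<open>S\<close>, so that identity
  1-cells are also recognised as images of paths of the parameter space.\<close>

lemmas lift_rules = lift_id lift_asc lift_lun lift_run lift_inv lift_hcmp lift_vcmp im_concat
  parallel_def concat_path_paths wl_def wr_def im_const[of \<Gamma>, symmetric]

end

lemma edge_refl [simp]: "edge a a = const_path a"
  by (rule path_eqI) (auto simp: edge_def const_path_def scaleR_add_left[symmetric])

lemma edge_ext [simp]: "edge a b \<in> extensional {0..1}"
  by (simp add: edge_def)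

text \<open>Cut at its midpoint, a segment is the concatenation of its halves at double speed
  exactly, not merely up to reparametrization.\<close>

lemma concat_edge:
  assumes "a + b = 2 *\<^sub>R m" shows "concat_path (edge m b) (edge a m) = edge a b"
proof (rule path_eqI)
  fix t :: real assume t: "t \<in> {0..1}"
  have m: "m = (1/2) *\<^sub>R a + (1/2) *\<^sub>R b" by (simp add: scaleR_add_right[symmetric] assms)
  show "concat_path (edge m b) (edge a m) t = edge a b t"
  proof (cases "t \<le> 1/2")
    case True
    have "(1 - 2 * t) *\<^sub>R a + (2 * t) *\<^sub>R m = (1 - t) *\<^sub>R a + t *\<^sub>R b"
      by (simp add: m algebra_simps scaleR_add_left[symmetric])
    then show ?thesis using True t by (simp add: concat_path_def edge_def)
  next
    case False
    have "(1 - (2 * t - 1)) *\<^sub>R m + (2 * t - 1) *\<^sub>R b = (1 - t) *\<^sub>R a + t *\<^sub>R b"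
      by (simp add: m algebra_simps scaleR_add_left[symmetric])
    then show ?thesis using False t by (simp add: concat_path_def edge_def)
  qed
qed simp_all

section \<open>The unit square and its two boundary paths\<close>

abbreviation Sq :: "(real \<times> real) topology" where "Sq \<equiv> top_of_set unit_square"

lemma equiconnected_Sq [simp]: "equiconnected Sq"
  using equiconnected_prod[OF equiconnected_Itop equiconnected_Itop] by simp

text \<open>In the square of a transformation at a 1-cell the first coordinate is the time of the
  homotopy and the second the time of the path. \<open>lower\<close> is the component at the source
  object followed by the image under the target functor, hence the source of a naturality cell;
  \<open>upper\<close> gives its target.\<close>

definition lower :: "real \<Rightarrow> real \<times> real" where
  "lower = concat_path (edge (1, 0) (1, 1)) (edge (0, 0) (1, 0))"

definition upper :: "real \<Rightarrow> real \<times> real" where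
  "upper = concat_path (edge (0, 1) (1, 1)) (edge (0, 0) (0, 1))"

lemma edge_Sq: "a \<in> unit_square \<Longrightarrow> b \<in> unit_square \<Longrightarrow> edge a b \<in> paths Sq"
  by (rule edge_paths) (auto intro: convex_Times)

lemma edge_Itop: "a \<in> {0..1} \<Longrightarrow> b \<in> {0..1} \<Longrightarrow> edge a b \<in> paths Itop"
  by (rule edge_paths) auto

lemma lower_upper: "parallel Sq lower upper"
  by (auto simp: parallel_def lower_def upper_def intro!: concat_path_paths edge_Sq)

definition fam :: "(real \<times> 'w \<Rightarrow> 'a) \<Rightarrow> (real \<Rightarrow> 'w) \<Rightarrow> real \<times> real \<Rightarrow> 'a" where
  "fam G k = (\<lambda>z. G (fst z, k (snd z)))"

lemma fam_continuous:
  assumes "continuous_map (prod_topology Itop W) X G" "k \<in> paths W"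
  shows "continuous_map Sq X (fam G k)"
proof -
  have "continuous_map Sq W (\<lambda>z. k (snd z))"
    by (rule continuous_map_reindex[OF paths_cont[OF assms(2)]]) (auto intro!: continuous_intros)
  then have "continuous_map Sq (prod_topology Itop W) (\<lambda>z. (fst z, k (snd z)))"
    by (simp add: continuous_map_pairwise o_def) (auto intro!: continuous_intros)
  from continuous_map_compose[OF this assms(1)] show ?thesis by (simp add: fam_def o_def)
qed

lemma im_edge_affine:
  assumes "\<And>t. t \<in> {0..1} \<Longrightarrow> \<phi> ((1 - t) *\<^sub>R a + t *\<^sub>R b) = (1 - t) *\<^sub>R \<phi> a + t *\<^sub>R \<phi> b"
  shows "im_path \<phi> (edge a b) = edge (\<phi> a) (\<phi> b)"
  by (rule path_eqI) (use assms in \<open>auto simp: edge_def im_path_def\<close>)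

lemma im_path_cong: "(\<And>t. t \<in> {0..1} \<Longrightarrow> \<Gamma> (p t) = \<Delta> (q t)) \<Longrightarrow> im_path \<Gamma> p = im_path \<Delta> q"
  by (rule path_eqI) (auto simp: im_path_def)

lemma continuous_slice:
  assumes "continuous_map (prod_topology Z W) X G" "c \<in> topspace Z"
  shows "continuous_map W X (\<lambda>w. G (c, w))"
  using continuous_map_compose[OF _ assms(1), of W "\<lambda>w. (c, w)"] assms(2)
  by (simp add: o_def continuous_map_pairwise)

text \<open>The bicategory \<open>B'\<close> is mapped into the paths and squares of the parameter space \<open>W\<close>. Functors out of
  \<open>B'\<close> come from continuous maps \<open>W \<rightarrow> X\<close>, and transformations from homotopies of such maps, whose
  naturality cells are the images of the unique 2-cell between the two boundary paths of the square.\<close>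

locale representation =
  fixes B' :: "('o, 'f, 't) bicat" and W :: "'w topology"
    and J0 :: "'o \<Rightarrow> 'w" and J1 :: "'f \<Rightarrow> real \<Rightarrow> 'w" and J2 :: "'t \<Rightarrow> real \<times> real \<Rightarrow> 'w"
    and X :: "'a topology"
  assumes J0_in: "a \<in> Ob B' \<Longrightarrow> J0 a \<in> topspace W"
    and J1_path: "f \<in> hom1 B' a b \<Longrightarrow> J1 f \<in> paths W \<and> J1 f 0 = J0 a \<and> J1 f 1 = J0 b"
    and J1_cmp: "f \<in> hom1 B' a b \<Longrightarrow> g \<in> hom1 B' b c \<Longrightarrow> J1 (cmp1 B' g f) = concat_path (J1 g) (J1 f)"
    and cmp1_hom: "f \<in> hom1 B' a b \<Longrightarrow> g \<in> hom1 B' b c \<Longrightarrow> cmp1 B' g f \<in> hom1 B' a c"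
    and J1_id: "a \<in> Ob B' \<Longrightarrow> J1 (id1 B' a) = const_path (J0 a) \<and> id1 B' a \<in> hom1 B' a a"
    and Arr_Ob: "f \<in> Arr B' \<Longrightarrow> src B' f \<in> Ob B' \<and> trg B' f \<in> Ob B'"
    and Cell_Arr: "\<alpha> \<in> Cell B' \<Longrightarrow> dom2 B' \<alpha> \<in> Arr B'"
    and J2_htpy: "\<alpha> \<in> hom2 B' f g \<Longrightarrow> f \<in> hom1 B' a b \<Longrightarrow> g \<in> hom1 B' a b \<and> htpy W (J1 f) (J1 g) (J2 \<alpha>)"
begin

text \<open>Only values on the carriers are constrained, since the record fields are total
  functions. The constraints are identities because composing with \<open>h\<close> preserves
  concatenations and constant paths strictly.\<close>

definition frep :: "('w \<Rightarrow> 'a) \<Rightarrow> ('o, 'f, 't, 'a, real \<Rightarrow> 'a, (real \<times> real \<Rightarrow> 'a) set) psfun \<Rightarrow> bool" where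
  "frep h F \<longleftrightarrow> continuous_map W X h \<and> (\<forall>a\<in>Ob B'. map0 F a = h (J0 a))
     \<and> (\<forall>f\<in>Arr B'. map1 F f = im_path h (J1 f))
     \<and> (\<forall>\<alpha>\<in>Cell B'. map2 F \<alpha> = homotopy_class X (\<lambda>z. h (J2 \<alpha> z)))
     \<and> (\<forall>a b c f g. f \<in> hom1 B' a b \<longrightarrow> g \<in> hom1 B' b c \<longrightarrow>
          cmpc F g f = id2 (\<Pi>\<^sub>2 X) (concat_path (im_path h (J1 g)) (im_path h (J1 f))))
     \<and> (\<forall>a\<in>Ob B'. unitc F a = id2 (\<Pi>\<^sub>2 X) (const_path (h (J0 a))))"

text \<open>The two functors do not occur here: they correspond to \<open>G\<close> at times 0 and
  1, and the lemmas state this agreement as separate hypotheses on the points of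
  \<open>W\<close>.\<close>

definition trep :: "(real \<times> 'w \<Rightarrow> 'a) \<Rightarrow> ('o, 'f, real \<Rightarrow> 'a, (real \<times> real \<Rightarrow> 'a) set) pstrans \<Rightarrow> bool" where
  "trep G \<sigma> \<longleftrightarrow> continuous_map (prod_topology Itop W) X G
     \<and> (\<forall>a\<in>Ob B'. cpt \<sigma> a = (\<lambda>t\<in>{0..1}. G (t, J0 a)))
     \<and> (\<forall>f\<in>Arr B'. natc \<sigma> f = lift X Sq (fam G (J1 f)) lower upper)"

lemma hom1_Arr: "f \<in> hom1 B' a b \<Longrightarrow> f \<in> Arr B' \<and> src B' f = a \<and> trg B' f = b"
  by (simp add: hom1_def)

lemma Arr_hom1: "f \<in> Arr B' \<Longrightarrow> f \<in> hom1 B' (src B' f) (trg B' f)"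
  by (simp add: hom1_def)

text \<open>Replaces a homotopy produced by the general constructions with a path of configurations
  acting on coordinates, once the two agree pointwise.\<close>

lemma trep_cong:
  assumes "trep G \<sigma>" "\<And>t w. t \<in> {0..1} \<Longrightarrow> w \<in> topspace W \<Longrightarrow> G (t, w) = G' (t, w)"
  shows "trep G' \<sigma>"
proof -
  have c: "continuous_map (prod_topology Itop W) X G" using assms(1) by (simp add: trep_def)
  then have "continuous_map (prod_topology Itop W) X G'"
    by (rule continuous_map_eq) (use assms(2) in auto)
  moreover have "lift X Sq (fam G (J1 f)) lower upper = lift X Sq (fam G' (J1 f)) lower upper" if "f \<in> Arr B'" for f
    using J1_path[OF Arr_hom1[OF that]]
    by (intro lift_cong[OF equiconnected_Sq fam_continuous[OF c] lower_upper])
      (auto simp: fam_def intro!: assms(2) paths_topspace)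
  moreover have "(\<lambda>t\<in>{0..1}. G (t, J0 a)) = (\<lambda>t\<in>{0..1}. G' (t, J0 a))" if "a \<in> Ob B'" for a
    using assms(2) J0_in[OF that] by (auto simp: restrict_def)
  ultimately show ?thesis using assms(1) by (simp add: trep_def)
qed

lemma frepD:
  assumes "frep h F"
  shows "continuous_map W X h" "a \<in> Ob B' \<Longrightarrow> map0 F a = h (J0 a)"
    "f \<in> Arr B' \<Longrightarrow> map1 F f = im_path h (J1 f)"
    "\<alpha> \<in> Cell B' \<Longrightarrow> map2 F \<alpha> = homotopy_class X (\<lambda>z. h (J2 \<alpha> z))"
    "f \<in> hom1 B' a b \<Longrightarrow> g \<in> hom1 B' b c \<Longrightarrow>
       cmpc F g f = id2 (\<Pi>\<^sub>2 X) (concat_path (im_path h (J1 g)) (im_path h (J1 f)))"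
    "a \<in> Ob B' \<Longrightarrow> unitc F a = id2 (\<Pi>\<^sub>2 X) (const_path (h (J0 a)))"
  using assms unfolding frep_def by blast+

lemma trepD:
  assumes "trep G \<sigma>"
  shows "continuous_map (prod_topology Itop W) X G" "a \<in> Ob B' \<Longrightarrow> cpt \<sigma> a = im_path (\<lambda>t. G (t, J0 a)) (edge 0 1)"
    "f \<in> Arr B' \<Longrightarrow> natc \<sigma> f = lift X Sq (fam G (J1 f)) lower upper"
  using assms unfolding trep_def by (auto simp: im_path_def edge_def)

lemma cpt_fam:
  assumes "trep G \<sigma>" "f \<in> hom1 B' a b" "a \<in> Ob B'" "b \<in> Ob B'"
  shows "cpt \<sigma> a = im_path (fam G (J1 f)) (edge (0, 0) (1, 0))"
    "cpt \<sigma> b = im_path (fam G (J1 f)) (edge (0, 1) (1, 1))"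
  using trepD(2)[OF assms(1,3)] trepD(2)[OF assms(1,4)] J1_path[OF assms(2)]
  by (auto simp: fam_def edge_def scaleR_add_left[symmetric] intro!: im_path_cong)

text \<open>Stated for an arbitrary time \<open>c\<close> because the middle functor of a composite
  transformation sits at time \<open>1/2\<close>.\<close>

lemma map1_fam:
  assumes "frep h F" "f \<in> hom1 B' a b" "c \<in> {0..1}" "\<And>w. w \<in> topspace W \<Longrightarrow> G (c, w) = h w"
  shows "map1 F f = im_path (fam G (J1 f)) (edge (c, 0) (c, 1))"
proof -
  have "map1 F f = im_path h (J1 f)" using frepD(3)[OF assms(1)] hom1_Arr[OF assms(2)] by blast
  also have "\<dots> = im_path (fam G (J1 f)) (edge (c, 0) (c, 1))"
  proof (rule im_path_cong)
    fix t :: real assume t: "t \<in> {0..1}"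
    have "edge (c, 0) (c, 1::real) t = (c, t)" using t by (simp add: edge_def algebra_simps)
    then show "h (J1 f t) = fam G (J1 f) (edge (c, 0) (c, 1) t)"
      using J1_path[OF assms(2)] t by (simp add: fam_def assms(4) paths_topspace)
  qed
  finally show ?thesis .
qed

lemma lifting_fam:
  assumes "continuous_map (prod_topology Itop W) X G" "f \<in> hom1 B' a b"
  shows "lifting X Sq (fam G (J1 f))"
  using fam_continuous[OF assms(1), of "J1 f"] J1_path[OF assms(2)] by (simp add: lifting_def)

text \<open>Regards a naturality cell as the filling of a rectangle inside a larger square.
  Rectangles stacked in the second coordinate belong to composable 1-cells, and rectangles side by
  side in the first to composable transformations; their pasting is then a lift over the large
  square.\<close>

lemma natc_rescale:
  assumes G: "continuous_map (prod_topology Itop W) X G" and f: "f \<in> hom1 B' a b"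
    and L: "lifting X Sq \<Delta>"
    and eq: "\<And>t u. t \<in> {0..1} \<Longrightarrow> u \<in> {0..1} \<Longrightarrow> G (t, J1 f u) = \<Delta> (x0 + t * dx, y0 + u * dy)"
    and sq: "(x0, y0) \<in> unit_square" "(x0 + dx, y0 + dy) \<in> unit_square"
  shows "lift X Sq (fam G (J1 f)) lower upper = lift X Sq \<Delta>
      (concat_path (edge (x0 + dx, y0) (x0 + dx, y0 + dy)) (edge (x0, y0) (x0 + dx, y0)))
      (concat_path (edge (x0, y0 + dy) (x0 + dx, y0 + dy)) (edge (x0, y0) (x0, y0 + dy)))"
proof -
  let ?\<phi> = "\<lambda>z::real \<times> real. (x0 + fst z * dx, y0 + snd z * dy)"
  have c: "a + t * d \<in> {0..1}" if "a \<in> {0..1}" "a + d \<in> {0..1}" "t \<in> {0..1}" for a t d :: real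
  proof -
    have "a + t * d = (1 - t) * a + t * (a + d)" by (simp add: algebra_simps)
    then show ?thesis using that convex_bound_le[of a 1 "a + d" "1 - t" t] by auto
  qed
  have "continuous_map Sq Sq ?\<phi>"
    using c sq by (auto intro!: continuous_intros)
  then have "lift X Sq (fam G (J1 f)) lower upper = lift X Sq \<Delta> (im_path ?\<phi> lower) (im_path ?\<phi> upper)"
    using L by (intro lift_reindex[OF _ _ _ _ lower_upper]) (auto simp: lifting_def fam_def eq)
  then show ?thesis
    unfolding lower_def upper_def im_concat[symmetric]
    by (simp add: im_edge_affine algebra_simps)
qed

text \<open>Naturality in 2-cells is a sweep of the square, compatibility with composition cuts the
  square of a composite 1-cell in two, and compatibility with identities concerns a degenerate
  square.\<close>

lemma trep_pseudonatural:
  assumes F: "frep h F" and F': "frep h' F'" and \<sigma>: "trep G \<sigma>"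
    and 0: "\<And>w. w \<in> topspace W \<Longrightarrow> G (0, w) = h w" and 1: "\<And>w. w \<in> topspace W \<Longrightarrow> G (1, w) = h' w"
  shows "pseudonatural B' (\<Pi>\<^sub>2 X) F F' \<sigma>"
proof -
  have ob: "a \<in> Ob B'" "b \<in> Ob B'" if "f \<in> hom1 B' a b" for f a b
    using that Arr_Ob by (auto simp: hom1_def)
  note G = trepD(1)[OF \<sigma>]
  show ?thesis
  proof
    fix a assume a: "a \<in> Ob B'"
    have c: "continuous_map Itop X (\<lambda>t. G (t, J0 a))"
      using continuous_map_compose[OF _ G, of Itop "\<lambda>t. (t, J0 a)"] J0_in[OF a]
      by (simp add: o_def continuous_map_pairwise)
    have "edge 0 1 \<in> paths Itop" by (rule edge_Itop) auto
    then show "cpt \<sigma> a \<in> hom1 (\<Pi>\<^sub>2 X) (map0 F a) (map0 F' a)"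
      using im_paths[OF _ c] frepD(2)[OF F a] frepD(2)[OF F' a] trepD(2)[OF \<sigma> a] 0 1 J0_in[OF a]
      by (simp add: hom1_fundamental)
    interpret L: lifting X Itop "\<lambda>t. G (t, J0 a)" using c by (simp add: lifting_def)
    have k: "const_path (J0 a) \<in> paths W" using J0_in[OF a] by simp
    have "natc \<sigma> (id1 B' a) = lift X Sq (fam G (const_path (J0 a))) lower upper"
      using trepD(3)[OF \<sigma>] J1_id[OF a] hom1_Arr by fastforce
    \<comment> \<open>Over an identity 1-cell the square does not depend on its second coordinate,
      so it factors through the projection to the interval.\<close>
    also have "\<dots> = lift X Itop (\<lambda>t. G (t, J0 a)) (im_path fst lower) (im_path fst upper)"
      by (rule lift_reindex[OF _ _ _ c lower_upper]) (auto intro!: continuous_intros simp: fam_def const_path_def)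
    also have "\<dots> = lift X Itop (\<lambda>t. G (t, J0 a)) (concat_path (const_path 1) (edge 0 1)) (concat_path (edge 0 1) (const_path 0))"
      unfolding lower_def upper_def im_concat[symmetric] by (simp add: im_edge_affine)
    finally have n: "natc \<sigma> (id1 B' a) = \<dots>" .
    have u: "unitc F a = id2 (\<Pi>\<^sub>2 X) (const_path (G (0, J0 a)))" "unitc F' a = id2 (\<Pi>\<^sub>2 X) (const_path (G (1, J0 a)))"
      using frepD(6)[OF F a] frepD(6)[OF F' a] 0 1 J0_in[OF a] by simp_all
    have [simp]: "edge 0 1 \<in> paths Itop" "const_path (0::real) \<in> paths Itop" "const_path (1::real) \<in> paths Itop"
      by (auto intro!: edge_Itop)
    show "vcmp (\<Pi>\<^sub>2 X) (natc \<sigma> (id1 B' a)) (wr (\<Pi>\<^sub>2 X) (unitc F' a) (cpt \<sigma> a)) =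
         vcmp (\<Pi>\<^sub>2 X) (vcmp (\<Pi>\<^sub>2 X) (wl (\<Pi>\<^sub>2 X) (cpt \<sigma> a) (unitc F a)) (inv2 (\<Pi>\<^sub>2 X) (run (\<Pi>\<^sub>2 X) (cpt \<sigma> a))))
          (lun (\<Pi>\<^sub>2 X) (cpt \<sigma> a))"
      unfolding n u trepD(2)[OF \<sigma> a] by (simp add: L.lift_rules)
  next
    fix f a b assume f: "f \<in> hom1 B' a b"
    note ab = ob[OF f]
    interpret L: lifting X Sq "fam G (J1 f)" using lifting_fam[OF G f] .
    have n: "natc \<sigma> f = lift X Sq (fam G (J1 f)) lower upper" using trepD(3)[OF \<sigma>] hom1_Arr[OF f] by blast
    have F1: "map1 F f = im_path (fam G (J1 f)) (edge (0, 0) (0, 1))" "map1 F' f = im_path (fam G (J1 f)) (edge (1, 0) (1, 1))"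
      using map1_fam[OF F f _ 0] map1_fam[OF F' f _ 1] by simp_all
    show "natc \<sigma> f \<in> hom2 (\<Pi>\<^sub>2 X) (cmp1 (\<Pi>\<^sub>2 X) (map1 F' f) (cpt \<sigma> a)) (cmp1 (\<Pi>\<^sub>2 X) (cpt \<sigma> b) (map1 F f))"
      unfolding n cpt_fam[OF \<sigma> f ab] F1 using L.lift_hom[OF lower_upper]
      by (simp add: im_concat lower_def upper_def)
    fix g \<alpha> assume \<alpha>: "\<alpha> \<in> hom2 B' f g"
    note A = conjunct2[OF J2_htpy[OF \<alpha> f]] and g = conjunct1[OF J2_htpy[OF \<alpha> f]]
    interpret L': lifting X Sq "fam G (J1 g)" using lifting_fam[OF G g] .
    have n': "natc \<sigma> g = lift X Sq (fam G (J1 g)) lower upper" using trepD(3)[OF \<sigma>] hom1_Arr[OF g] by blast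
    let ?A = "J2 \<alpha>"
    have At: "?A z \<in> topspace W" if "z \<in> unit_square" for z
      using htpyD(1)[OF A] that continuous_map_image_subset_topspace by fastforce
    have \<alpha>': "\<alpha> \<in> Cell B'" using \<alpha> by (simp add: hom2_def)
    have cls: "homotopy_class X (\<lambda>z. k (?A z)) = homotopy_class X (\<lambda>z. G (c, ?A z))"
      "htpy X (im_path (\<lambda>w. G (c, w)) (J1 f)) (im_path (\<lambda>w. G (c, w)) (J1 g)) (\<lambda>z. G (c, ?A z))"
      if k: "continuous_map W X k" "\<And>w. w \<in> topspace W \<Longrightarrow> G (c, w) = k w" and c: "c \<in> {0..1}" for k c
    proof -
      show "homotopy_class X (\<lambda>z. k (?A z)) = homotopy_class X (\<lambda>z. G (c, ?A z))"
        by (rule homotopy_class_cong[OF htpyD(1)[OF htpy_push[OF A k(1)]]]) (simp add: k(2) At)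
      show "htpy X (im_path (\<lambda>w. G (c, w)) (J1 f)) (im_path (\<lambda>w. G (c, w)) (J1 g)) (\<lambda>z. G (c, ?A z))"
        using htpy_push[OF A continuous_slice[OF G]] c by simp
    qed
    have F2: "map2 F \<alpha> = homotopy_class X (\<lambda>z. G (0, ?A z))" "map2 F' \<alpha> = homotopy_class X (\<lambda>z. G (1, ?A z))"
      using frepD(4)[OF F \<alpha>'] frepD(4)[OF F' \<alpha>'] cls(1)[OF frepD(1)[OF F] 0] cls(1)[OF frepD(1)[OF F'] 1] by simp_all
    have H: "htpy X (im_path (\<lambda>w. G (0, w)) (J1 f)) (im_path (\<lambda>w. G (0, w)) (J1 g)) (\<lambda>z. G (0, ?A z))"
      "htpy X (im_path (\<lambda>w. G (1, w)) (J1 f)) (im_path (\<lambda>w. G (1, w)) (J1 g)) (\<lambda>z. G (1, ?A z))"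
      using cls(2)[OF frepD(1)[OF F] 0] cls(2)[OF frepD(1)[OF F'] 1] by simp_all
    have cp: "cpt \<sigma> a \<in> paths X" "cpt \<sigma> b \<in> paths X"
      using L.im_paths' edge_Sq by (simp_all add: cpt_fam[OF \<sigma> f ab])
    have ends: "cpt \<sigma> a 1 = im_path (\<lambda>w. G (1, w)) (J1 f) 0" "im_path (\<lambda>w. G (0, w)) (J1 f) 1 = cpt \<sigma> b 0"
      using J1_path[OF f] by (simp_all add: trepD(2)[OF \<sigma> ab(1)] trepD(2)[OF \<sigma> ab(2)])
    \<comment> \<open>The homotopy parameter \<open>r\<close> of the 2-cell becomes the sweep
      parameter and carries the square of \<open>f\<close> to that of \<open>g\<close>. The corners
      stay fixed, as \<open>sweep\<close> requires, because the 2-cell fixes endpoints.\<close>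
    let ?\<Gamma> = "\<lambda>(r, t, u). G (t, ?A (r, u))"
    have \<Gamma>: "continuous_map (prod_topology Itop Sq) X ?\<Gamma>"
    proof -
      have "continuous_map (top_of_set unit_cube) W (\<lambda>x. ?A (fst x, snd (snd x)))"
        by (rule continuous_map_reindex[OF htpyD(1)[OF A]]) (auto intro!: continuous_intros)
      then have "continuous_map (top_of_set unit_cube) (prod_topology Itop W) (\<lambda>x. (fst (snd x), ?A (fst x, snd (snd x))))"
        by (simp add: continuous_map_pairwise o_def) (auto intro!: continuous_intros)
      from continuous_map_compose[OF this G] show ?thesis by (simp add: o_def case_prod_unfold)
    qed
    have "vcmp (\<Pi>\<^sub>2 X) (lift X Sq (\<lambda>x. ?\<Gamma> (1, x)) lower upper) (homotopy_class X (\<lambda>z. ?\<Gamma> (fst z, lower (snd z))))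
        = vcmp (\<Pi>\<^sub>2 X) (homotopy_class X (\<lambda>z. ?\<Gamma> (fst z, upper (snd z)))) (lift X Sq (\<lambda>x. ?\<Gamma> (0, x)) lower upper)"
      by (rule sweep[OF equiconnected_Sq \<Gamma> lower_upper]) (simp_all add: lower_def htpyD(4,5)[OF A])
    moreover have "lift X Sq (\<lambda>x. ?\<Gamma> (0, x)) lower upper = natc \<sigma> f" "lift X Sq (\<lambda>x. ?\<Gamma> (1, x)) lower upper = natc \<sigma> g"
      unfolding n n'
      by (rule sym, rule lift_cong[OF equiconnected_Sq _ lower_upper];
          use L.cont L'.cont htpyD(2,3)[OF A] in \<open>auto simp: fam_def\<close>)+
    moreover have "homotopy_class X (\<lambda>z. ?\<Gamma> (fst z, lower (snd z))) = wr (\<Pi>\<^sub>2 X) (map2 F' \<alpha>) (cpt \<sigma> a)"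
    proof -
      have "homotopy_class X (hconcat (\<lambda>z. G (1, ?A z)) (\<lambda>z. cpt \<sigma> a (snd z))) = homotopy_class X (\<lambda>z. ?\<Gamma> (fst z, lower (snd z)))"
        by (rule homotopy_class_cong[OF htpyD(1)[OF htpy_hconcat[OF htpy_id[OF cp(1)] H(2) ends(1)]]])
          (auto simp: hconcat_def lower_def concat_path_def edge_def trepD(2)[OF \<sigma> ab(1)] htpyD(4)[OF A] J1_path[OF f])
      then show ?thesis
        unfolding wr_def F2 id2_class[OF cp(1)] hcmp_class[OF htpy_id[OF cp(1)] H(2) ends(1)] by simp
    qed
    moreover have "homotopy_class X (\<lambda>z. ?\<Gamma> (fst z, upper (snd z))) = wl (\<Pi>\<^sub>2 X) (cpt \<sigma> b) (map2 F \<alpha>)"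
    proof -
      have "homotopy_class X (hconcat (\<lambda>z. cpt \<sigma> b (snd z)) (\<lambda>z. G (0, ?A z))) = homotopy_class X (\<lambda>z. ?\<Gamma> (fst z, upper (snd z)))"
        by (rule homotopy_class_cong[OF htpyD(1)[OF htpy_hconcat[OF H(1) htpy_id[OF cp(2)] ends(2)]]])
          (auto simp: hconcat_def upper_def concat_path_def edge_def trepD(2)[OF \<sigma> ab(2)] htpyD(5)[OF A] J1_path[OF f])
      then show ?thesis
        unfolding wl_def F2 id2_class[OF cp(2)] hcmp_class[OF H(1) htpy_id[OF cp(2)] ends(2)] by simp
    qed
    ultimately show "vcmp (\<Pi>\<^sub>2 X) (wl (\<Pi>\<^sub>2 X) (cpt \<sigma> b) (map2 F \<alpha>)) (natc \<sigma> f)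
        = vcmp (\<Pi>\<^sub>2 X) (natc \<sigma> g) (wr (\<Pi>\<^sub>2 X) (map2 F' \<alpha>) (cpt \<sigma> a))" by simp
  next
    fix f assume "f \<in> Arr B'"
    then have f: "f \<in> hom1 B' (src B' f) (trg B' f)" and n: "natc \<sigma> f = lift X Sq (fam G (J1 f)) lower upper"
      using Arr_hom1 trepD(3)[OF \<sigma>] by auto
    interpret L: lifting X Sq "fam G (J1 f)" using lifting_fam[OF G f] .
    show "iso2 (\<Pi>\<^sub>2 X) (natc \<sigma> f)" unfolding n by (rule L.lift_iso[OF lower_upper])
  next
    fix f a b g c assume f: "f \<in> hom1 B' a b" and g: "g \<in> hom1 B' b c"
    note gf = cmp1_hom[OF f g] and ab = ob[OF f] and bc = ob[OF g]
    have k: "J1 (cmp1 B' g f) = concat_path (J1 g) (J1 f)" by (rule J1_cmp[OF f g])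
    let ?\<Gamma> = "fam G (J1 (cmp1 B' g f))"
    interpret L: lifting X Sq ?\<Gamma> using lifting_fam[OF G gf] .
    have kf: "J1 f u = J1 (cmp1 B' g f) (u / 2)" if "u \<in> {0..1}" for u
      using that by (simp add: k concat_path_def)
    have kg: "J1 g u = J1 (cmp1 B' g f) (1/2 + u / 2)" if "u \<in> {0..1}" for u
    proof (cases "u = 0")
      case True then show ?thesis using J1_path[OF f] J1_path[OF g] by (simp add: k concat_path_def)
    next
      case False
      have "2 * (1/2 + u / 2) - 1 = u" by simp
      then show ?thesis using False that by (simp add: k concat_path_def)
    qed
    \<comment> \<open>The square of the composite contains that of \<open>f\<close> where the second
      coordinate is at most \<open>1/2\<close>, and that of \<open>g\<close> in the other
      half.\<close>
    have nf: "natc \<sigma> f = lift X Sq ?\<Gamma> (concat_path (edge (1, 0) (1, 1/2)) (edge (0, 0) (1, 0)))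
        (concat_path (edge (0, 1/2) (1, 1/2)) (edge (0, 0) (0, 1/2)))"
      using natc_rescale[OF G f L.lifting_axioms, of 0 1 0 "1/2"] trepD(3)[OF \<sigma>] hom1_Arr[OF f] kf
      by (simp add: fam_def)
    have ng: "natc \<sigma> g = lift X Sq ?\<Gamma> (concat_path (edge (1, 1/2) (1, 1)) (edge (0, 1/2) (1, 1/2)))
        (concat_path (edge (0, 1) (1, 1)) (edge (0, 1/2) (0, 1)))"
      using natc_rescale[OF G g L.lifting_axioms, of 0 1 "1/2" "1/2"] trepD(3)[OF \<sigma>] hom1_Arr[OF g] kg
      by (simp add: fam_def)
    have ngf: "natc \<sigma> (cmp1 B' g f) = lift X Sq ?\<Gamma> lower upper" using trepD(3)[OF \<sigma>] hom1_Arr[OF gf] by blast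
    have half: "im_path (fam G (J1 f)) (edge (x, 0) (x, 1)) = im_path ?\<Gamma> (edge (x, 0) (x, 1/2))"
      "im_path (fam G (J1 g)) (edge (x, 0) (x, 1)) = im_path ?\<Gamma> (edge (x, 1/2) (x, 1))" for x
      by (rule im_path_cong, auto simp: fam_def edge_def kf kg field_simps)+
    have F1: "im_path h (J1 f) = im_path ?\<Gamma> (edge (0, 0) (0, 1/2))" "im_path h (J1 g) = im_path ?\<Gamma> (edge (0, 1/2) (0, 1))"
        "im_path h' (J1 f) = im_path ?\<Gamma> (edge (1, 0) (1, 1/2))" "im_path h' (J1 g) = im_path ?\<Gamma> (edge (1, 1/2) (1, 1))"
      using map1_fam[OF F f _ 0] map1_fam[OF F' f _ 1] map1_fam[OF F g _ 0] map1_fam[OF F' g _ 1]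
        frepD(3)[OF F] frepD(3)[OF F'] hom1_Arr[OF f] hom1_Arr[OF g] half by simp_all
    have cp: "cpt \<sigma> a = im_path ?\<Gamma> (edge (0, 0) (1, 0))" "cpt \<sigma> c = im_path ?\<Gamma> (edge (0, 1) (1, 1))"
      using cpt_fam[OF \<sigma> gf] ab bc by auto
    have cb: "cpt \<sigma> b = im_path ?\<Gamma> (edge (0, 1/2) (1, 1/2))"
      unfolding trepD(2)[OF \<sigma> ab(2)]
    proof (rule im_path_cong)
      fix t :: real assume t: "t \<in> {0..1}"
      then have "edge (0, 1/2) (1, 1/2) t = (t, 1/2::real)" "edge 0 1 t = t" by (simp_all add: edge_def field_simps)
      then show "G (edge 0 1 t, J0 b) = ?\<Gamma> (edge (0, 1/2) (1, 1/2) t)"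
        using J1_path[OF f] by (simp add: fam_def k concat_path_def)
    qed
    have [simp]: "concat_path (edge (x, 1/2) (x, 1)) (edge (x, 0) (x, 1/2)) = edge (x, 0) (x, 1::real)" for x :: real
      by (rule concat_edge) simp
    have P: "edge (x, y) (x', y') \<in> paths Sq" if "x \<in> {0..1}" "y \<in> {0..1}" "x' \<in> {0..1}" "y' \<in> {0..1}" for x y x' y'
      using that by (simp add: edge_Sq)
    have fF: "map1 F f = im_path h (J1 f)" "map1 F g = im_path h (J1 g)" "map1 F' f = im_path h' (J1 f)" "map1 F' g = im_path h' (J1 g)"
      using frepD(3)[OF F] frepD(3)[OF F'] hom1_Arr[OF f] hom1_Arr[OF g] by simp_all
    show "vcmp (\<Pi>\<^sub>2 X) (natc \<sigma> (cmp1 B' g f)) (wr (\<Pi>\<^sub>2 X) (cmpc F' g f) (cpt \<sigma> a)) =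
       vcmp (\<Pi>\<^sub>2 X) (vcmp (\<Pi>\<^sub>2 X) (vcmp (\<Pi>\<^sub>2 X) (vcmp (\<Pi>\<^sub>2 X) (vcmp (\<Pi>\<^sub>2 X)
         (wl (\<Pi>\<^sub>2 X) (cpt \<sigma> c) (cmpc F g f)) (asc (\<Pi>\<^sub>2 X) (cpt \<sigma> c) (map1 F g) (map1 F f)))
         (wr (\<Pi>\<^sub>2 X) (natc \<sigma> g) (map1 F f))) (inv2 (\<Pi>\<^sub>2 X) (asc (\<Pi>\<^sub>2 X) (map1 F' g) (cpt \<sigma> b) (map1 F f))))
         (wl (\<Pi>\<^sub>2 X) (map1 F' g) (natc \<sigma> f))) (asc (\<Pi>\<^sub>2 X) (map1 F' g) (map1 F' f) (cpt \<sigma> a))"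
      unfolding nf ng ngf frepD(5)[OF F f g] frepD(5)[OF F' f g] fF F1 cp cb
      by (simp add: L.lift_rules P lower_def upper_def)
  qed
qed

end


section \<open>Operations on represented transformations\<close>

definition pairp :: "(real \<Rightarrow> 's) \<Rightarrow> (real \<Rightarrow> real) \<Rightarrow> real \<Rightarrow> 's \<times> real" where
  "pairp p q = (\<lambda>t\<in>{0..1}. (p t, q t))"

lemma pairp_simps [simp]: "pairp p q 0 = (p 0, q 0)" "pairp p q 1 = (p 1, q 1)"
  by (simp_all add: pairp_def)

lemma pairp_paths: "p \<in> paths S \<Longrightarrow> q \<in> paths Itop \<Longrightarrow> pairp p q \<in> paths (prod_topology S Itop)"
proof -
  assume p: "p \<in> paths S" and q: "q \<in> paths Itop"
  have "continuous_map Itop (prod_topology S Itop) (\<lambda>t. (p t, q t))"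
    using paths_cont[OF p] paths_cont[OF q] by (simp only: continuous_map_pairwise o_def fst_conv snd_conv simp_thms)
  then have "continuous_map Itop (prod_topology S Itop) (pairp p q)"
    by (rule continuous_map_eq) (simp add: pairp_def)
  then show ?thesis by (simp add: paths_def pathin_def pairp_def)
qed

definition rev_path :: "(real \<Rightarrow> 'z) \<Rightarrow> real \<Rightarrow> 'z" where
  "rev_path P = (\<lambda>t\<in>{0..1}. P (1 - t))"

lemma rev_path_01 [simp]: "rev_path P 0 = P 1" "rev_path P 1 = P 0"
  by (simp_all add: rev_path_def)

lemma rev_path_paths: "P \<in> paths Z \<Longrightarrow> rev_path P \<in> paths Z"
proof -
  assume "P \<in> paths Z"
  then have "continuous_map Itop Z (\<lambda>t. P (1 - t))"
    by (intro continuous_map_reindex[OF paths_cont]) (auto intro!: continuous_intros)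
  then have "continuous_map Itop Z (rev_path P)"
    by (rule continuous_map_eq) (auto simp: rev_path_def)
  then show ?thesis by (simp add: paths_def pathin_def rev_path_def)
qed

context representation begin

text \<open>For the constant homotopy the square factors through its second coordinate. There
  \<open>lower\<close> and \<open>upper\<close> become the path padded with a constant piece before
  and after, and the cell between these is the right unitor followed by the inverse of the left
  one.\<close>

lemma trep_id:
  assumes F: "frep h F" shows "trep (\<lambda>x. h (snd x)) (id_pstrans (\<Pi>\<^sub>2 X) F)"
  unfolding trep_def
proof (intro conjI ballI)
  note h = frepD(1)[OF F]
  show G: "continuous_map (prod_topology Itop W) X (\<lambda>x. h (snd x))"
    using continuous_map_compose[OF continuous_map_snd h] by (simp add: o_def)
  show "cpt (id_pstrans (\<Pi>\<^sub>2 X) F) a = (\<lambda>t\<in>{0..1}. h (snd (t, J0 a)))" if "a \<in> Ob B'" for a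
    using frepD(2)[OF F that] by (simp add: id_pstrans_def const_path_def)
  fix f assume "f \<in> Arr B'"
  note f = Arr_hom1[OF this] and fF = frepD(3)[OF F this]
  have k: "J1 f \<in> paths W" using J1_path[OF f] by blast
  have c: "continuous_map Itop X (\<lambda>u. h (J1 f u))"
    using continuous_map_compose[OF paths_cont[OF k] h] by (simp add: o_def)
  then interpret L: lifting X Itop "\<lambda>u. h (J1 f u)" by (simp add: lifting_def)
  have e: "map1 F f = im_path (\<lambda>u. h (J1 f u)) (edge 0 1)"
    unfolding fF by (rule im_path_cong) (simp add: edge_def)
  have "lift X Sq (fam (\<lambda>x. h (snd x)) (J1 f)) lower upper
      = lift X Itop (\<lambda>u. h (J1 f u)) (im_path snd lower) (im_path snd upper)"
    by (rule lift_reindex[OF _ _ _ c lower_upper]) (auto intro!: continuous_intros simp: fam_def)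
  also have "\<dots> = lift X Itop (\<lambda>u. h (J1 f u)) (concat_path (edge 0 1) (const_path 0)) (concat_path (const_path 1) (edge 0 1))"
    unfolding lower_def upper_def im_concat[symmetric] by (simp add: im_edge_affine)
  finally show "natc (id_pstrans (\<Pi>\<^sub>2 X) F) f = lift X Sq (fam (\<lambda>x. h (snd x)) (J1 f)) lower upper"
    by (simp add: id_pstrans_def e L.lift_rules edge_Itop)
qed

text \<open>The homotopies run one after the other at double speed. In the resulting square the
  cells of \<sigma> and \<tau> fill the halves before and after time \<open>1/2\<close>, and their
  pasting is the unique filling of the whole.\<close>

lemma trep_comp:
  assumes F: "frep h F" and F': "frep h' F'" and F'': "frep h'' F''" and \<sigma>: "trep G \<sigma>" and \<tau>: "trep G' \<tau>"
    and 0: "\<And>w. w \<in> topspace W \<Longrightarrow> G (0, w) = h w" and 1: "\<And>w. w \<in> topspace W \<Longrightarrow> G (1, w) = h' w"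
    and 2: "\<And>w. w \<in> topspace W \<Longrightarrow> G' (0, w) = h' w" and 3: "\<And>w. w \<in> topspace W \<Longrightarrow> G' (1, w) = h'' w"
  shows "trep (\<lambda>x. if fst x \<le> 1/2 then G (2 * fst x, snd x) else G' (2 * fst x - 1, snd x))
    (comp_pstrans B' (\<Pi>\<^sub>2 X) F F' F'' \<tau> \<sigma>)" (is "trep ?G _")
  unfolding trep_def
proof (intro conjI ballI)
  have c1: "continuous_map (prod_topology Itop W) euclideanreal fst"
    using continuous_map_into_fulltopology[OF continuous_map_fst] by blast
  \<comment> \<open>\<open>W\<close> is an arbitrary topology, so
    \<open>continuous_map_glue\<close>, which concerns subsets of a topological type, does not
    apply; time is rescaled affinely on each closed half instead.\<close>
  have r: "continuous_map (subtopology (prod_topology Itop W) {x \<in> topspace (prod_topology Itop W). fst x \<in> A}) (prod_topology Itop W) (\<lambda>x. (a * fst x + b, snd x))"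
    if "\<And>t. t \<in> {0..1} \<Longrightarrow> t \<in> A \<Longrightarrow> a * t + b \<in> {0..1}" for a b :: real and A
  proof -
    have "continuous_map (subtopology (prod_topology Itop W) {x \<in> topspace (prod_topology Itop W). fst x \<in> A}) euclideanreal (\<lambda>x. a * fst x + b)"
      by (intro continuous_intros continuous_map_from_subtopology c1)
    moreover have "continuous_map (subtopology (prod_topology Itop W) {x \<in> topspace (prod_topology Itop W). fst x \<in> A}) W snd"
      by (intro continuous_map_from_subtopology continuous_map_snd)
    ultimately show ?thesis using that
      by (auto simp: continuous_map_pairwise o_def continuous_map_in_subtopology image_subset_iff_funcset)
  qed
  show G: "continuous_map (prod_topology Itop W) X ?G"
  proof (rule continuous_map_cases_le[where q="\<lambda>_. 1/2"])
    show "continuous_map (subtopology (prod_topology Itop W) {x \<in> topspace (prod_topology Itop W). fst x \<le> 1/2}) X (\<lambda>x. G (2 * fst x, snd x))"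
      using continuous_map_compose[OF r[of "{..1/2}" 2 0] trepD(1)[OF \<sigma>]] by (simp add: o_def)
    show "continuous_map (subtopology (prod_topology Itop W) {x \<in> topspace (prod_topology Itop W). 1/2 \<le> fst x}) X (\<lambda>x. G' (2 * fst x - 1, snd x))"
      using continuous_map_compose[OF r[of "{1/2..}" 2 "-1"] trepD(1)[OF \<tau>]] by (simp add: o_def)
    show "G (2 * fst x, snd x) = G' (2 * fst x - 1, snd x)" if "x \<in> topspace (prod_topology Itop W)" "fst x = 1/2" for x
      using that 1[of "snd x"] 2[of "snd x"] by (auto simp: that(2))
  qed (use c1 in auto)
  have cp: "cpt (comp_pstrans B' (\<Pi>\<^sub>2 X) F F' F'' \<tau> \<sigma>) a = concat_path (cpt \<tau> a) (cpt \<sigma> a)" for a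
    by (simp add: comp_pstrans_def)
  show "cpt (comp_pstrans B' (\<Pi>\<^sub>2 X) F F' F'' \<tau> \<sigma>) a = (\<lambda>t\<in>{0..1}. ?G (t, J0 a))" if "a \<in> Ob B'" for a
    unfolding cp trepD(2)[OF \<tau> that] trepD(2)[OF \<sigma> that]
    by (rule path_eqI) (auto simp: concat_path_def edge_def)
  fix f assume fA: "f \<in> Arr B'"
  note f = Arr_hom1[OF fA]
  let ?a = "src B' f" and ?b = "trg B' f"
  have ab: "?a \<in> Ob B'" "?b \<in> Ob B'" using Arr_Ob[OF fA] by auto
  define \<Delta> where "\<Delta> = fam ?G (J1 f)"
  interpret L: lifting X Sq \<Delta> unfolding \<Delta>_def using lifting_fam[OF G f] .
  have k: "J1 f u \<in> topspace W" if "u \<in> {0..1}" for u using J1_path[OF f] that by (auto intro: paths_topspace)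
  have half: "fam G (J1 f) (t, u) = \<Delta> (t / 2, u)" if "t \<in> {0..1}" for t u
    using that by (simp add: \<Delta>_def fam_def)
  have half': "fam G' (J1 f) (t, u) = \<Delta> (1/2 + t / 2, u)" if "t \<in> {0..1}" "u \<in> {0..1}" for t u
  proof (cases "t = 0")
    case True then show ?thesis using 1[OF k[OF that(2)]] 2[OF k[OF that(2)]] by (simp add: \<Delta>_def fam_def)
  next
    case False
    have "2 * (1/2 + t / 2) - 1 = t" by simp
    then show ?thesis using False that by (simp add: \<Delta>_def fam_def)
  qed
  have n: "natc \<sigma> f = lift X Sq \<Delta> (concat_path (edge (1/2, 0) (1/2, 1)) (edge (0, 0) (1/2, 0)))
      (concat_path (edge (0, 1) (1/2, 1)) (edge (0, 0) (0, 1)))"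
    unfolding trepD(3)[OF \<sigma> fA]
    using natc_rescale[OF trepD(1)[OF \<sigma>] f L.lifting_axioms, of 0 "1/2" 0 1] half by (simp add: fam_def)
  have n': "natc \<tau> f = lift X Sq \<Delta> (concat_path (edge (1, 0) (1, 1)) (edge (1/2, 0) (1, 0)))
      (concat_path (edge (1/2, 1) (1, 1)) (edge (1/2, 0) (1/2, 1)))"
    unfolding trepD(3)[OF \<tau> fA]
    using natc_rescale[OF trepD(1)[OF \<tau>] f L.lifting_axioms, of "1/2" "1/2" 0 1] half' by (simp add: fam_def)
  have ev: "edge (0, x) (1, x) t = (t, x)" "edge (0, x) (1/2, x) t = (t / 2, x)" "edge (1/2, x) (1, x) t = (1/2 + t / 2, x)"
    if "t \<in> {0..1}" for x t :: real
    using that by (simp_all add: edge_def algebra_simps) (simp_all add: field_simps)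
  have "im_path (fam G (J1 f)) (edge (0, x) (1, x)) = im_path \<Delta> (edge (0, x) (1/2, x))"
    "im_path (fam G' (J1 f)) (edge (0, x) (1, x)) = im_path \<Delta> (edge (1/2, x) (1, x))" if "x \<in> {0..1}" for x
    by (rule im_path_cong; use that in \<open>simp add: ev half half' del: atLeastAtMost_iff\<close>)+
  then have cps: "cpt \<sigma> ?a = im_path \<Delta> (edge (0, 0) (1/2, 0))" "cpt \<sigma> ?b = im_path \<Delta> (edge (0, 1) (1/2, 1))"
    "cpt \<tau> ?a = im_path \<Delta> (edge (1/2, 0) (1, 0))" "cpt \<tau> ?b = im_path \<Delta> (edge (1/2, 1) (1, 1))"
    unfolding cpt_fam[OF \<sigma> f ab] cpt_fam[OF \<tau> f ab] by simp_all
  have F1: "map1 F f = im_path \<Delta> (edge (0, 0) (0, 1))" "map1 F' f = im_path \<Delta> (edge (1/2, 0) (1/2, 1))"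
      "map1 F'' f = im_path \<Delta> (edge (1, 0) (1, 1))"
    using map1_fam[OF F f, of 0 ?G] map1_fam[OF F' f, of "1/2" ?G] map1_fam[OF F'' f, of 1 ?G] 0 1 2 3 by (simp_all add: \<Delta>_def)
  have [simp]: "concat_path (edge (1/2::real, x) (1, x)) (edge (0, x) (1/2, x)) = edge (0, x) (1, x)" for x :: real
    by (rule concat_edge) simp
  have P: "edge (x, y) (x', y') \<in> paths Sq" if "x \<in> {0..1}" "y \<in> {0..1}" "x' \<in> {0..1}" "y' \<in> {0..1}" for x y x' y'
    using that by (simp add: edge_Sq)
  show "natc (comp_pstrans B' (\<Pi>\<^sub>2 X) F F' F'' \<tau> \<sigma>) f = lift X Sq (fam ?G (J1 f)) lower upper"
    unfolding \<Delta>_def[symmetric]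
    by (simp add: comp_pstrans_def n n' cps F1 L.lift_rules P lower_def upper_def)
qed

text \<open>Whiskering reads off objects and 1-cells of \<open>K\<close>; on parameter spaces it is
  substitution of \<phi> into the homotopy.\<close>

lemma trep_pre_whisker:
  fixes B'' :: "('o2, 'f2, 't2) bicat" and W' :: "'w2 topology"
  assumes R: "representation B'' W' I0 I1 I2"
    and \<sigma>: "representation.trep B'' W' I0 I1 X G \<sigma>"
    and \<phi>: "continuous_map W W' \<phi>"
    and K0: "\<And>a. a \<in> Ob B' \<Longrightarrow> map0 K a \<in> Ob B'' \<and> I0 (map0 K a) = \<phi> (J0 a)"
    and K1: "\<And>f. f \<in> Arr B' \<Longrightarrow> map1 K f \<in> Arr B'' \<and> I1 (map1 K f) = im_path \<phi> (J1 f)"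
  shows "trep (\<lambda>x. G (fst x, \<phi> (snd x))) (pre_whisker \<sigma> K)"
  unfolding trep_def
proof (intro conjI ballI)
  note D = representation.trepD[OF R \<sigma>]
  have "continuous_map (prod_topology Itop W) (prod_topology Itop W') (\<lambda>x. (fst x, \<phi> (snd x)))"
    using continuous_map_compose[OF continuous_map_snd \<phi>]
    by (simp add: continuous_map_pairwise o_def continuous_map_fst)
  from continuous_map_compose[OF this D(1)]
  show G: "continuous_map (prod_topology Itop W) X (\<lambda>x. G (fst x, \<phi> (snd x)))" by (simp add: o_def)
  show "cpt (pre_whisker \<sigma> K) a = (\<lambda>t\<in>{0..1}. G (fst (t, J0 a), \<phi> (snd (t, J0 a))))" if "a \<in> Ob B'" for a
    using D(2)[of "map0 K a"] K0[OF that] by (simp add: pre_whisker_def im_path_def edge_def cong: restrict_cong)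
  fix f assume f: "f \<in> Arr B'"
  interpret L: lifting X Sq "fam (\<lambda>x. G (fst x, \<phi> (snd x))) (J1 f)" using lifting_fam[OF G Arr_hom1[OF f]] .
  have "natc (pre_whisker \<sigma> K) f = lift X Sq (fam G (im_path \<phi> (J1 f))) lower upper"
    using D(3)[of "map1 K f"] K1[OF f] by (simp add: pre_whisker_def)
  also have "\<dots> = lift X Sq (fam (\<lambda>x. G (fst x, \<phi> (snd x))) (J1 f)) lower upper"
    by (rule sym, rule lift_cong[OF equiconnected_Sq L.cont lower_upper]) (auto simp: fam_def)
  finally show "natc (pre_whisker \<sigma> K) f = lift X Sq (fam (\<lambda>x. G (fst x, \<phi> (snd x))) (J1 f)) lower upper" .
qed

section \<open>Modifications and adjoint equivalences\<close>

text \<open>Both transformations come from paths in one equiconnected space \<open>Z\<close> through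
  the same map \<open>g\<close>. A component is the image of the filling between the two paths, and
  the axiom at \<open>f\<close> becomes an equation of lifts over the product of \<open>Z\<close>
  with the interval on which the path of \<open>f\<close> is parametrized.\<close>

lemma trep_modification:
  fixes Z :: "'z topology"
  assumes Z: "equiconnected Z" and g: "continuous_map (prod_topology Z W) X g" and PQ: "parallel Z P Q"
    and F: "frep h F" and F': "frep h' F'"
    and \<sigma>: "trep (\<lambda>x. g (P (fst x), snd x)) \<sigma>" and \<tau>: "trep (\<lambda>x. g (Q (fst x), snd x)) \<tau>"
    and h: "\<And>w. w \<in> topspace W \<Longrightarrow> g (P 0, w) = h w" and h': "\<And>w. w \<in> topspace W \<Longrightarrow> g (P 1, w) = h' w"
    and m: "\<And>a. a \<in> Ob B' \<Longrightarrow> m a = lift X Z (\<lambda>c. g (c, J0 a)) P Q"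
  shows "invertible_modification B' (\<Pi>\<^sub>2 X) F F' \<sigma> \<tau> m"
proof
  have gc: "continuous_map Z X (\<lambda>c. g (c, w))" if "w \<in> topspace W" for w
    using continuous_map_compose[OF _ g, of Z "\<lambda>c. (c, w)"] that by (simp add: o_def continuous_map_pairwise)
  have par: "P \<in> paths Z" "Q \<in> paths Z" "Q 0 = P 0" "Q 1 = P 1" using PQ by (auto simp: parallel_def)
  show "m a \<in> hom2 (\<Pi>\<^sub>2 X) (cpt \<sigma> a) (cpt \<tau> a)" "iso2 (\<Pi>\<^sub>2 X) (m a)" if a: "a \<in> Ob B'" for a
  proof -
    interpret L: lifting X Z "\<lambda>c. g (c, J0 a)" using gc[OF J0_in[OF a]] Z by (simp add: lifting_def)
    have "cpt \<sigma> a = im_path (\<lambda>c. g (c, J0 a)) P" "cpt \<tau> a = im_path (\<lambda>c. g (c, J0 a)) Q"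
      unfolding trepD(2)[OF \<sigma> a] trepD(2)[OF \<tau> a] by (rule im_path_cong, simp add: edge_def)+
    then show "m a \<in> hom2 (\<Pi>\<^sub>2 X) (cpt \<sigma> a) (cpt \<tau> a)" "iso2 (\<Pi>\<^sub>2 X) (m a)"
      using L.lift_hom[OF PQ] L.lift_iso[OF PQ] m[OF a] by simp_all
  qed
  fix f a b assume f: "f \<in> hom1 B' a b"
  then have ab: "a \<in> Ob B'" "b \<in> Ob B'" and fA: "f \<in> Arr B'" using Arr_Ob by (auto simp: hom1_def)
  note J = J1_path[OF f]
  let ?S = "prod_topology Z Itop" and ?\<Gamma> = "\<lambda>x. g (fst x, J1 f (snd x))"
  have "continuous_map ?S W (\<lambda>x. J1 f (snd x))"
    using continuous_map_compose[OF continuous_map_snd paths_cont] J by (fastforce simp: o_def)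
  then have "continuous_map ?S (prod_topology Z W) (\<lambda>x. (fst x, J1 f (snd x)))"
    by (simp add: continuous_map_pairwise o_def continuous_map_fst)
  from continuous_map_compose[OF this g] have \<Gamma>: "continuous_map ?S X ?\<Gamma>" by (simp add: o_def)
  interpret L: lifting X ?S ?\<Gamma> using Z \<Gamma> by (simp add: lifting_def)
  \<comment> \<open>The components at the two ends of \<open>f\<close> are the same filling in
    \<open>Z\<close>, placed at path times 0 and 1.\<close>
  have mm: "m x = lift X ?S ?\<Gamma> (pairp P (const_path c)) (pairp Q (const_path c))"
    if "x \<in> Ob B'" "J1 f c = J0 x" "c \<in> {0..1}" for x c
  proof -
    have "m x = lift X ?S ?\<Gamma> (im_path (\<lambda>z. (z, c)) P) (im_path (\<lambda>z. (z, c)) Q)"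
      unfolding m[OF that(1)]
      by (rule lift_reindex[OF Z _ _ \<Gamma> PQ]) (use that Z in \<open>simp_all add: continuous_map_pairwise o_def\<close>)
    moreover have "im_path (\<lambda>z. (z, c)) p = pairp p (const_path c)" for p :: "real \<Rightarrow> 'z"
      by (rule path_eqI) (auto simp: pairp_def im_path_def const_path_def)
    ultimately show ?thesis by simp
  qed
  have nn: "natc \<upsilon> f = lift X ?S ?\<Gamma>
      (concat_path (pairp (const_path (P 1)) (edge 0 1)) (pairp R (const_path 0)))
      (concat_path (pairp R (const_path 1)) (pairp (const_path (P 0)) (edge 0 1)))"
    if \<upsilon>: "trep (\<lambda>x. g (R (fst x), snd x)) \<upsilon>" and R: "R \<in> paths Z" "R 0 = P 0" "R 1 = P 1" for \<upsilon> R
  proof -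
    let ?\<phi> = "\<lambda>z. (R (fst z), snd z :: real)"
    have "continuous_map Sq Z (\<lambda>z. R (fst z))"
      by (rule continuous_map_reindex[OF paths_cont[OF R(1)]]) (auto intro!: continuous_intros)
    then have "continuous_map Sq ?S ?\<phi>"
      by (simp add: continuous_map_pairwise o_def) (auto intro!: continuous_intros)
    then have "natc \<upsilon> f = lift X ?S ?\<Gamma> (im_path ?\<phi> lower) (im_path ?\<phi> upper)"
      unfolding trepD(3)[OF \<upsilon> fA] using Z by (intro lift_reindex[OF _ _ _ \<Gamma> lower_upper]) (auto simp: fam_def)
    moreover have "im_path ?\<phi> (edge (0, c) (1, c)) = pairp R (const_path c)"
        "im_path ?\<phi> (edge (0, 0) (0, 1)) = pairp (const_path (P 0)) (edge 0 1)"
        "im_path ?\<phi> (edge (1, 0) (1, 1)) = pairp (const_path (P 1)) (edge 0 1)" for c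
      by (rule path_eqI; auto simp: pairp_def im_path_def edge_def const_path_def R algebra_simps)+
    ultimately show ?thesis unfolding lower_def upper_def im_concat[symmetric] by simp
  qed
  have F1: "map1 F f = im_path ?\<Gamma> (pairp (const_path (P 0)) (edge 0 1))" "map1 F' f = im_path ?\<Gamma> (pairp (const_path (P 1)) (edge 0 1))"
    unfolding frepD(3)[OF F fA] frepD(3)[OF F' fA]
    by (rule im_path_cong; use J in \<open>simp add: pairp_def const_path_def edge_def h h' paths_topspace\<close>)+
  show "vcmp (\<Pi>\<^sub>2 X) (wr (\<Pi>\<^sub>2 X) (m b) (map1 F f)) (natc \<sigma> f) = vcmp (\<Pi>\<^sub>2 X) (natc \<tau> f) (wl (\<Pi>\<^sub>2 X) (map1 F' f) (m a))"
    using mm[OF ab(1), of 0] mm[OF ab(2), of 1] J nn[OF \<sigma> par(1)] nn[OF \<tau> par(2-4)] par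
    by (simp add: F1 L.lift_rules pairp_paths edge_Itop)
qed

definition path_trans :: "('z \<times> 'w \<Rightarrow> 'a) \<Rightarrow> (real \<Rightarrow> 'z) \<Rightarrow> ('o, 'f, real \<Rightarrow> 'a, (real \<times> real \<Rightarrow> 'a) set) pstrans" where
  "path_trans g P = \<lparr> cpt = (\<lambda>a. im_path (\<lambda>c. g (c, J0 a)) P),
     natc = (\<lambda>f. lift X Sq (fam (\<lambda>x. g (P (fst x), snd x)) (J1 f)) lower upper) \<rparr>"

text \<open>The adjoint runs the path backwards, and unit and counit connect the there-and-back
  paths with constant ones. The triangle identities need no adjustment of these cells, because both
  sides lift to \<open>Z\<close> with equal boundaries.\<close>

definition path_adjeq :: "'z topology \<Rightarrow> ('z \<times> 'w \<Rightarrow> 'a) \<Rightarrow> (real \<Rightarrow> 'z)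
    \<Rightarrow> ('o, 'f, real \<Rightarrow> 'a, (real \<times> real \<Rightarrow> 'a) set) adjeq" where
  "path_adjeq Z g P = \<lparr> fwd = path_trans g P, bwd = path_trans g (rev_path P),
     aun = (\<lambda>a. lift X Z (\<lambda>c. g (c, J0 a)) (const_path (P 0)) (concat_path (rev_path P) P)),
     acu = (\<lambda>a. lift X Z (\<lambda>c. g (c, J0 a)) (concat_path P (rev_path P)) (const_path (P 1))) \<rparr>"

lemma path_trans_simps [simp]:
  "cpt (path_trans g P) a = im_path (\<lambda>c. g (c, J0 a)) P"
  by (simp add: path_trans_def)

lemma path_adjeq_simps [simp]:
  "fwd (path_adjeq Z g P) = path_trans g P" "bwd (path_adjeq Z g P) = path_trans g (rev_path P)"
  by (simp_all add: path_adjeq_def)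

lemma trep_path_trans:
  assumes "continuous_map (prod_topology Z W) X g" "P \<in> paths Z"
  shows "trep (\<lambda>x. g (P (fst x), snd x)) (path_trans g P)"
proof -
  have "continuous_map (prod_topology Itop W) (prod_topology Z W) (\<lambda>x. (P (fst x), snd x))"
    using continuous_map_compose[OF continuous_map_fst paths_cont[OF assms(2)]]
    by (simp add: continuous_map_pairwise o_def continuous_map_snd)
  from continuous_map_compose[OF this assms(1)] show ?thesis
    by (simp add: path_trans_def trep_def o_def im_path_def)
qed

lemma path_adjoint_equivalence:
  assumes Z: "equiconnected Z" and g: "continuous_map (prod_topology Z W) X g" and P: "P \<in> paths Z"
    and F: "frep h F" and F': "frep h' F'"
    and h: "\<And>w. w \<in> topspace W \<Longrightarrow> g (P 0, w) = h w" and h': "\<And>w. w \<in> topspace W \<Longrightarrow> g (P 1, w) = h' w"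
  shows "adjoint_equivalence B' (\<Pi>\<^sub>2 X) F F' (path_adjeq Z g P)"
proof (rule adjoint_equivalence.intro)
  note P' = rev_path_paths[OF P]
  note t = trep_path_trans[OF g P] and t' = trep_path_trans[OF g P']
  have PP: "concat_path (rev_path P) P \<in> paths Z" "concat_path P (rev_path P) \<in> paths Z"
    using P P' by (auto intro!: concat_path_paths)
  have cc: "const_path (P 0) \<in> paths Z" "const_path (P 1) \<in> paths Z" using P by simp_all
  show "pseudonatural B' (\<Pi>\<^sub>2 X) F F' (fwd (path_adjeq Z g P))"
    using trep_pseudonatural[OF F F' t] h h' by simp
  show "pseudonatural B' (\<Pi>\<^sub>2 X) F' F (bwd (path_adjeq Z g P))"
    using trep_pseudonatural[OF F' F t'] h h' by simp
  \<comment> \<open>The composite transformation is itself induced by a path in \<open>Z\<close>,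
    the path followed by its reverse.\<close>
  have c1: "trep (\<lambda>x. g (concat_path (rev_path P) P (fst x), snd x)) (comp_pstrans B' (\<Pi>\<^sub>2 X) F F' F (path_trans g (rev_path P)) (path_trans g P))"
    by (rule trep_cong[OF trep_comp[OF F F' F t t']]) (use h h' in \<open>simp_all add: concat_path_def\<close>)
  have c2: "trep (\<lambda>x. g (concat_path P (rev_path P) (fst x), snd x)) (comp_pstrans B' (\<Pi>\<^sub>2 X) F' F F' (path_trans g P) (path_trans g (rev_path P)))"
    by (rule trep_cong[OF trep_comp[OF F' F F' t' t]]) (use h h' in \<open>simp_all add: concat_path_def\<close>)
  have i1: "trep (\<lambda>x. g (const_path (P 0) (fst x), snd x)) (id_pstrans (\<Pi>\<^sub>2 X) F)"
    by (rule trep_cong[OF trep_id[OF F]]) (simp add: const_path_def h)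
  have i2: "trep (\<lambda>x. g (const_path (P 1) (fst x), snd x)) (id_pstrans (\<Pi>\<^sub>2 X) F')"
    by (rule trep_cong[OF trep_id[OF F']]) (simp add: const_path_def h')
  show "invertible_modification B' (\<Pi>\<^sub>2 X) F F (id_pstrans (\<Pi>\<^sub>2 X) F)
     (comp_pstrans B' (\<Pi>\<^sub>2 X) F F' F (bwd (path_adjeq Z g P)) (fwd (path_adjeq Z g P))) (aun (path_adjeq Z g P))"
    unfolding path_adjeq_simps
    by (rule trep_modification[OF Z g _ F F i1 c1]) (use PP cc h in \<open>simp_all add: parallel_def path_adjeq_def\<close>)
  show "invertible_modification B' (\<Pi>\<^sub>2 X) F' F'
     (comp_pstrans B' (\<Pi>\<^sub>2 X) F' F F' (fwd (path_adjeq Z g P)) (bwd (path_adjeq Z g P)))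
     (id_pstrans (\<Pi>\<^sub>2 X) F') (acu (path_adjeq Z g P))"
    unfolding path_adjeq_simps
    by (rule trep_modification[OF Z g _ F' F' c2 i2]) (use PP cc h' in \<open>simp_all add: parallel_def path_adjeq_def\<close>)
  fix a assume a: "a \<in> Ob B'"
  have "continuous_map Z X (\<lambda>c. g (c, J0 a))"
    using continuous_map_compose[OF _ g, of Z "\<lambda>c. (c, J0 a)"] J0_in[OF a] by (simp add: o_def continuous_map_pairwise)
  then interpret L: lifting X Z "\<lambda>c. g (c, J0 a)" using Z by (simp add: lifting_def)
  show "vcmp (\<Pi>\<^sub>2 X) (vcmp (\<Pi>\<^sub>2 X) (vcmp (\<Pi>\<^sub>2 X) (vcmp (\<Pi>\<^sub>2 X)
      (lun (\<Pi>\<^sub>2 X) (cpt (fwd (path_adjeq Z g P)) a))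
      (wr (\<Pi>\<^sub>2 X) (acu (path_adjeq Z g P) a) (cpt (fwd (path_adjeq Z g P)) a)))
      (inv2 (\<Pi>\<^sub>2 X) (asc (\<Pi>\<^sub>2 X) (cpt (fwd (path_adjeq Z g P)) a) (cpt (bwd (path_adjeq Z g P)) a) (cpt (fwd (path_adjeq Z g P)) a))))
      (wl (\<Pi>\<^sub>2 X) (cpt (fwd (path_adjeq Z g P)) a) (aun (path_adjeq Z g P) a)))
      (inv2 (\<Pi>\<^sub>2 X) (run (\<Pi>\<^sub>2 X) (cpt (fwd (path_adjeq Z g P)) a))) = id2 (\<Pi>\<^sub>2 X) (cpt (fwd (path_adjeq Z g P)) a)"
    unfolding path_adjeq_simps path_trans_simps
    by (simp add: path_adjeq_def L.lift_rules P P' PP cc)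
  show "vcmp (\<Pi>\<^sub>2 X) (vcmp (\<Pi>\<^sub>2 X) (vcmp (\<Pi>\<^sub>2 X) (vcmp (\<Pi>\<^sub>2 X)
      (run (\<Pi>\<^sub>2 X) (cpt (bwd (path_adjeq Z g P)) a))
      (wl (\<Pi>\<^sub>2 X) (cpt (bwd (path_adjeq Z g P)) a) (acu (path_adjeq Z g P) a)))
      (asc (\<Pi>\<^sub>2 X) (cpt (bwd (path_adjeq Z g P)) a) (cpt (fwd (path_adjeq Z g P)) a) (cpt (bwd (path_adjeq Z g P)) a)))
      (wr (\<Pi>\<^sub>2 X) (aun (path_adjeq Z g P) a) (cpt (bwd (path_adjeq Z g P)) a)))
      (inv2 (\<Pi>\<^sub>2 X) (lun (\<Pi>\<^sub>2 X) (cpt (bwd (path_adjeq Z g P)) a))) = id2 (\<Pi>\<^sub>2 X) (cpt (bwd (path_adjeq Z g P)) a)"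
    unfolding path_adjeq_simps path_trans_simps
    by (simp add: path_adjeq_def L.lift_rules P P' PP cc)
qed

lemma frep_strict:
  assumes "continuous_map W X h" "\<And>a. a \<in> Ob B' \<Longrightarrow> o0 a = h (J0 a)" "\<And>f. f \<in> Arr B' \<Longrightarrow> k f = im_path h (J1 f)"
    "\<And>\<alpha>. \<alpha> \<in> Cell B' \<Longrightarrow> t \<alpha> = homotopy_class X (\<lambda>z. h (J2 \<alpha> z))"
  shows "frep h (strict_psfun (\<Pi>\<^sub>2 X) o0 k t)"
  using assms by (auto simp: frep_def strict_psfun_def hom1_def)

lemma frep_const:
  assumes c: "c \<in> topspace X" shows "frep (\<lambda>w. c) (const_psfun (\<Pi>\<^sub>2 X) c)"
proof -
  interpret L: lifting X Itop "\<lambda>_. c" using c by (simp add: lifting_def)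
  have cp: "const_path c = im_path (\<lambda>_. c) (const_path (0::real))" by (simp add: im_const)
  \<comment> \<open>By definition the composition constraint of a constant functor is a unitor. At a
    constant path this unitor lifts with equal source and target, hence is an identity.\<close>
  have "lun (\<Pi>\<^sub>2 X) (const_path c) = id2 (\<Pi>\<^sub>2 X) (const_path c)"
    unfolding cp by (simp add: L.lift_lun L.lift_id)
  moreover have "im_path (\<lambda>w. c) p = const_path c" for p :: "real \<Rightarrow> 'w"
    by (simp add: im_path_def const_path_def)
  moreover have "id2 (\<Pi>\<^sub>2 X) (const_path c) = homotopy_class X (\<lambda>z. c)"
    unfolding id2_class[OF const_path_paths[OF c]]
    by (rule sym, rule homotopy_class_cong) (use c in \<open>auto simp: const_path_def\<close>)
  ultimately show ?thesis using c by (auto simp: frep_def const_psfun_def)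
qed

end


section \<open>Tensor products\<close>

lemma hom1_prod: "p \<in> hom1 (B \<times>\<^sub>B C) a b \<longleftrightarrow> fst p \<in> hom1 B (fst a) (fst b) \<and> snd p \<in> hom1 C (snd a) (snd b)"
  by (cases p; cases a; cases b) (auto simp: hom1_def prod_bicat_def)

lemma hom2_prod: "p \<in> hom2 (B \<times>\<^sub>B C) f g \<longleftrightarrow> fst p \<in> hom2 B (fst f) (fst g) \<and> snd p \<in> hom2 C (snd f) (snd g)"
  by (cases p; cases f; cases g) (auto simp: hom2_def prod_bicat_def)

lemma prod_bicat_simps [simp]:
  "Ob (B \<times>\<^sub>B C) = Ob B \<times> Ob C" "Arr (B \<times>\<^sub>B C) = Arr B \<times> Arr C" "Cell (B \<times>\<^sub>B C) = Cell B \<times> Cell C"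
  "src (B \<times>\<^sub>B C) p = (src B (fst p), src C (snd p))" "trg (B \<times>\<^sub>B C) p = (trg B (fst p), trg C (snd p))"
  "dom2 (B \<times>\<^sub>B C) \<alpha> = (dom2 B (fst \<alpha>), dom2 C (snd \<alpha>))" "cod2 (B \<times>\<^sub>B C) \<alpha> = (cod2 B (fst \<alpha>), cod2 C (snd \<alpha>))"
  "id1 (B \<times>\<^sub>B C) x = (id1 B (fst x), id1 C (snd x))"
  "cmp1 (B \<times>\<^sub>B C) q p = (cmp1 B (fst q) (fst p), cmp1 C (snd q) (snd p))"
  "id2 (B \<times>\<^sub>B C) p = (id2 B (fst p), id2 C (snd p))"
  "vcmp (B \<times>\<^sub>B C) \<beta> \<alpha> = (vcmp B (fst \<beta>) (fst \<alpha>), vcmp C (snd \<beta>) (snd \<alpha>))"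
  "hcmp (B \<times>\<^sub>B C) \<beta> \<alpha> = (hcmp B (fst \<beta>) (fst \<alpha>), hcmp C (snd \<beta>) (snd \<alpha>))"
  "asc (B \<times>\<^sub>B C) r q p = (asc B (fst r) (fst q) (fst p), asc C (snd r) (snd q) (snd p))"
  "lun (B \<times>\<^sub>B C) p = (lun B (fst p), lun C (snd p))" "run (B \<times>\<^sub>B C) p = (run B (fst p), run C (snd p))"
  by (auto simp: prod_bicat_def map_prod_def case_prod_unfold)

text \<open>Continuity alone makes the pointwise product a strict functor; associativity and units
  enter later, through configurations.\<close>

locale tensor =
  fixes X :: "'a topology" and T :: "'a \<Rightarrow> 'a \<Rightarrow> 'a"
  assumes T_continuous: "continuous_map (prod_topology X X) X (\<lambda>x. T (fst x) (snd x))"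
begin

definition tens1 :: "(real \<Rightarrow> 'a) \<Rightarrow> (real \<Rightarrow> 'a) \<Rightarrow> real \<Rightarrow> 'a" where
  "tens1 f g = (\<lambda>t\<in>{0..1}. T (f t) (g t))"

text \<open>Chosen representatives are multiplied pointwise; \<open>tens2_class\<close> removes the
  dependence on the choice.\<close>

definition tens2 :: "(real \<times> real \<Rightarrow> 'a) set \<Rightarrow> (real \<times> real \<Rightarrow> 'a) set \<Rightarrow> (real \<times> real \<Rightarrow> 'a) set" where
  "tens2 \<alpha> \<beta> = homotopy_class X (\<lambda>z. T (rep \<alpha> z) (rep \<beta> z))"

definition ten_psfun :: "('a \<times> 'a, (real \<Rightarrow> 'a) \<times> (real \<Rightarrow> 'a), (real \<times> real \<Rightarrow> 'a) set \<times> (real \<times> real \<Rightarrow> 'a) set,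
    'a, real \<Rightarrow> 'a, (real \<times> real \<Rightarrow> 'a) set) psfun" where
  "ten_psfun = strict_psfun (\<Pi>\<^sub>2 X) (\<lambda>p. T (fst p) (snd p)) (\<lambda>p. tens1 (fst p) (snd p)) (\<lambda>p. tens2 (fst p) (snd p))"

lemma ten_psfun_simps [simp]:
  "map0 ten_psfun p = T (fst p) (snd p)" "map1 ten_psfun q = tens1 (fst q) (snd q)"
  "map2 ten_psfun \<alpha> = tens2 (fst \<alpha>) (snd \<alpha>)"
  "cmpc ten_psfun r q = id2 (\<Pi>\<^sub>2 X) (concat_path (tens1 (fst r) (snd r)) (tens1 (fst q) (snd q)))"
  "unitc ten_psfun p = id2 (\<Pi>\<^sub>2 X) (const_path (T (fst p) (snd p)))"
  by (simp_all add: ten_psfun_def strict_psfun_def)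

lemma T_comp:
  assumes "continuous_map S X f" "continuous_map S X g"
  shows "continuous_map S X (\<lambda>x. T (f x) (g x))"
  using continuous_map_compose[OF _ T_continuous, of S "\<lambda>x. (f x, g x)"] assms
  by (simp add: o_def continuous_map_pairwise)

lemma T_in: "x \<in> topspace X \<Longrightarrow> y \<in> topspace X \<Longrightarrow> T x y \<in> topspace X"
  using continuous_map_image_subset_topspace[OF T_continuous] by fastforce

lemma tens1_01 [simp]: "tens1 f g 0 = T (f 0) (g 0)" "tens1 f g 1 = T (f 1) (g 1)"
  by (simp_all add: tens1_def)

lemma tens1_paths: "f \<in> paths X \<Longrightarrow> g \<in> paths X \<Longrightarrow> tens1 f g \<in> paths X"
proof -
  assume "f \<in> paths X" "g \<in> paths X"
  from T_comp[OF this[THEN paths_cont]] have "continuous_map Itop X (tens1 f g)"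
    by (rule continuous_map_eq) (simp add: tens1_def)
  then show ?thesis by (simp add: paths_def pathin_def tens1_def)
qed

lemma tens1_concat: "tens1 (concat_path g f) (concat_path g' f') = concat_path (tens1 g g') (tens1 f f')"
  by (rule path_eqI) (auto simp: tens1_def concat_path_def)

lemma tens1_const: "tens1 (const_path a) (const_path b) = const_path (T a b)"
  by (rule path_eqI) (auto simp: tens1_def const_path_def)

lemma tens1_im: "tens1 (im_path \<Gamma> p) (im_path \<Delta> p) = im_path (\<lambda>z. T (\<Gamma> z) (\<Delta> z)) p"
  by (rule path_eqI) (auto simp: tens1_def im_path_def)

lemma tens_htpy:
  assumes "htpy X f g H" "htpy X f' g' K"
  shows "htpy X (tens1 f f') (tens1 g g') (\<lambda>z. T (H z) (K z))"
  using assms T_comp[OF htpyD(1)[OF assms(1)] htpyD(1)[OF assms(2)]] by (simp add: htpy_def tens1_def)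

lemma tens2_class:
  assumes H: "htpy X f g H" and K: "htpy X f' g' K"
  shows "tens2 (homotopy_class X H) (homotopy_class X K) = homotopy_class X (\<lambda>z. T (H z) (K z))"
proof -
  obtain h where h: "continuous_map (top_of_set unit_cube) X h"
    "\<And>z. z \<in> unit_square \<Longrightarrow> h (0, z) = H z \<and> h (1, z) = rep (homotopy_class X H) z"
    "\<And>r z. r \<in> {0..1} \<Longrightarrow> z \<in> unit_square - {0<..<1} \<times> {0<..<1} \<Longrightarrow> h (r, z) = H z"
    using rep_in[OF H] unfolding homotopy_class_iff by blast
  obtain k where k: "continuous_map (top_of_set unit_cube) X k"
    "\<And>z. z \<in> unit_square \<Longrightarrow> k (0, z) = K z \<and> k (1, z) = rep (homotopy_class X K) z"
    "\<And>r z. r \<in> {0..1} \<Longrightarrow> z \<in> unit_square - {0<..<1} \<times> {0<..<1} \<Longrightarrow> k (r, z) = K z"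
    using rep_in[OF K] unfolding homotopy_class_iff by blast
  show ?thesis unfolding tens2_def
    by (rule sym, rule homotopy_class_eqI[OF T_comp[OF h(1) k(1)]]) (simp_all add: h(2,3) k(2,3) del: atLeastAtMost_iff)
qed

text \<open>Both factors lift over the same space with the same boundary, so one filling serves for
  both and the product can be taken in the map to \<open>X\<close>.\<close>

lemma tens2_lift:
  assumes "lifting X S \<Gamma>" "lifting X S \<Delta>" "parallel S p q"
  shows "tens2 (lift X S \<Gamma> p q) (lift X S \<Delta> p q) = lift X S (\<lambda>z. T (\<Gamma> z) (\<Delta> z)) p q"
proof -
  interpret A: lifting X S \<Gamma> by fact
  interpret B: lifting X S \<Delta> by fact
  have c: "continuous_map S X (\<lambda>z. T (\<Gamma> z) (\<Delta> z))" by (rule T_comp[OF A.cont B.cont])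
  obtain H where H: "htpy S p q H" using equiconnected_htpy[OF A.equi assms(3)] .
  show ?thesis
    using tens2_class[OF htpy_push[OF H A.cont] htpy_push[OF H B.cont]]
      lift_eq[OF A.equi A.cont H] lift_eq[OF A.equi B.cont H] lift_eq[OF A.equi c H] by simp
qed

lemma lifting_T: "lifting X S \<Gamma> \<Longrightarrow> lifting X S \<Delta> \<Longrightarrow> lifting X S (\<lambda>z. T (\<Gamma> z) (\<Delta> z))"
  by (simp add: lifting_def T_comp)

lemma tens2_hom:
  assumes "\<alpha> \<in> hom2 (\<Pi>\<^sub>2 X) f g" "\<beta> \<in> hom2 (\<Pi>\<^sub>2 X) f' g'"
  shows "tens2 \<alpha> \<beta> \<in> hom2 (\<Pi>\<^sub>2 X) (tens1 f f') (tens1 g g')"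
proof -
  obtain A where A: "htpy X f g A" "\<alpha> = homotopy_class X A" using assms(1) by (rule hom2E)
  obtain B where B: "htpy X f' g' B" "\<beta> = homotopy_class X B" using assms(2) by (rule hom2E)
  show ?thesis unfolding A(2) B(2) tens2_class[OF A(1) B(1)]
    by (rule class_hom2[OF tens_htpy[OF A(1) B(1)]]) (simp_all add: tens1_def)
qed

lemma tens2_id:
  assumes "f \<in> paths X" "g \<in> paths X"
  shows "tens2 (id2 (\<Pi>\<^sub>2 X) f) (id2 (\<Pi>\<^sub>2 X) g) = id2 (\<Pi>\<^sub>2 X) (tens1 f g)"
  unfolding id2_class[OF assms(1)] id2_class[OF assms(2)] id2_class[OF tens1_paths[OF assms]]
    tens2_class[OF htpy_id[OF assms(1)] htpy_id[OF assms(2)]]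
  by (rule homotopy_class_cong[OF htpyD(1)[OF tens_htpy[OF htpy_id[OF assms(1)] htpy_id[OF assms(2)]]]])
    (auto simp: tens1_def)

lemma tens2_vcmp:
  assumes "\<alpha> \<in> hom2 (\<Pi>\<^sub>2 X) f g" "\<beta> \<in> hom2 (\<Pi>\<^sub>2 X) g h" "\<alpha>' \<in> hom2 (\<Pi>\<^sub>2 X) f' g'" "\<beta>' \<in> hom2 (\<Pi>\<^sub>2 X) g' h'"
  shows "tens2 (vcmp (\<Pi>\<^sub>2 X) \<beta> \<alpha>) (vcmp (\<Pi>\<^sub>2 X) \<beta>' \<alpha>') = vcmp (\<Pi>\<^sub>2 X) (tens2 \<beta> \<beta>') (tens2 \<alpha> \<alpha>')"
proof -
  obtain A where A: "htpy X f g A" "\<alpha> = homotopy_class X A" using assms(1) by (rule hom2E)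
  obtain B where B: "htpy X g h B" "\<beta> = homotopy_class X B" using assms(2) by (rule hom2E)
  obtain A' where A': "htpy X f' g' A'" "\<alpha>' = homotopy_class X A'" using assms(3) by (rule hom2E)
  obtain B' where B': "htpy X g' h' B'" "\<beta>' = homotopy_class X B'" using assms(4) by (rule hom2E)
  show ?thesis
    unfolding A(2) B(2) A'(2) B'(2) vcmp_class[OF A(1) B(1)] vcmp_class[OF A'(1) B'(1)]
      tens2_class[OF A(1) A'(1)] tens2_class[OF B(1) B'(1)]
      tens2_class[OF htpy_vconcat[OF A(1) B(1)] htpy_vconcat[OF A'(1) B'(1)]]
      vcmp_class[OF tens_htpy[OF A(1) A'(1)] tens_htpy[OF B(1) B'(1)]]
    by (rule homotopy_class_cong[OF htpyD(1)[OF tens_htpy[OF htpy_vconcat[OF A(1) B(1)] htpy_vconcat[OF A'(1) B'(1)]]]])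
      (auto simp: vconcat_def)
qed

lemma tens2_hcmp:
  assumes "\<alpha> \<in> hom2 (\<Pi>\<^sub>2 X) f f1" "\<beta> \<in> hom2 (\<Pi>\<^sub>2 X) g g1" "\<alpha>' \<in> hom2 (\<Pi>\<^sub>2 X) f' f1'" "\<beta>' \<in> hom2 (\<Pi>\<^sub>2 X) g' g1'"
    and c: "f 1 = g 0" "f' 1 = g' 0"
  shows "tens2 (hcmp (\<Pi>\<^sub>2 X) \<beta> \<alpha>) (hcmp (\<Pi>\<^sub>2 X) \<beta>' \<alpha>') = hcmp (\<Pi>\<^sub>2 X) (tens2 \<beta> \<beta>') (tens2 \<alpha> \<alpha>')"
proof -
  obtain A where A: "htpy X f f1 A" "\<alpha> = homotopy_class X A" using assms(1) by (rule hom2E)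
  obtain B where B: "htpy X g g1 B" "\<beta> = homotopy_class X B" using assms(2) by (rule hom2E)
  obtain A' where A': "htpy X f' f1' A'" "\<alpha>' = homotopy_class X A'" using assms(3) by (rule hom2E)
  obtain B' where B': "htpy X g' g1' B'" "\<beta>' = homotopy_class X B'" using assms(4) by (rule hom2E)
  have cc: "tens1 f f' 1 = tens1 g g' 0" using c by simp
  show ?thesis
    unfolding A(2) B(2) A'(2) B'(2) hcmp_class[OF A(1) B(1) c(1)] hcmp_class[OF A'(1) B'(1) c(2)]
      tens2_class[OF A(1) A'(1)] tens2_class[OF B(1) B'(1)]
      tens2_class[OF htpy_hconcat[OF A(1) B(1) c(1)] htpy_hconcat[OF A'(1) B'(1) c(2)]]
      hcmp_class[OF tens_htpy[OF A(1) A'(1)] tens_htpy[OF B(1) B'(1)] cc]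
    by (rule homotopy_class_cong[OF htpyD(1)[OF tens_htpy[OF htpy_hconcat[OF A(1) B(1) c(1)] htpy_hconcat[OF A'(1) B'(1) c(2)]]]])
      (auto simp: hconcat_def)
qed

text \<open>Associators and unitors use reparametrizations that do not depend on the paths. The two
  factors are therefore reparametrized alike, and the pointwise product preserves these cells
  strictly.\<close>

lemma tens2_reparam:
  assumes "htpy X f g (reparam p \<phi> \<psi>)" "htpy X f' g' (reparam q \<phi> \<psi>)" "\<phi> ` {0..1} \<subseteq> {0..1}" "\<psi> ` {0..1} \<subseteq> {0..1}"
  shows "tens2 (homotopy_class X (reparam p \<phi> \<psi>)) (homotopy_class X (reparam q \<phi> \<psi>)) = homotopy_class X (reparam (tens1 p q) \<phi> \<psi>)"
  unfolding tens2_class[OF assms(1,2)]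
proof (rule homotopy_class_cong[OF htpyD(1)[OF tens_htpy[OF assms(1,2)]]])
  fix z :: "real \<times> real" assume z: "z \<in> unit_square"
  then have "\<phi> (snd z) \<in> {0..1}" "\<psi> (snd z) \<in> {0..1}" using assms(3,4) by (metis image_subset_iff mem_Times_iff)+
  then have "(1 - fst z) * \<phi> (snd z) + fst z * \<psi> (snd z) \<in> {0..1}"
    using z convex_bound_le[of "\<phi> (snd z)" 1 "\<psi> (snd z)" "1 - fst z" "fst z"] by auto
  then show "T (reparam p \<phi> \<psi> z) (reparam q \<phi> \<psi> z) = reparam (tens1 p q) \<phi> \<psi> z"
    using z by (cases z) (simp add: reparam_def tens1_def)
qed

lemma tens2_asc:
  assumes "f \<in> paths X" "g \<in> paths X" "h \<in> paths X" "f 1 = g 0" "g 1 = h 0"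
    "f' \<in> paths X" "g' \<in> paths X" "h' \<in> paths X" "f' 1 = g' 0" "g' 1 = h' 0"
  shows "tens2 (asc (\<Pi>\<^sub>2 X) h g f) (asc (\<Pi>\<^sub>2 X) h' g' f') = asc (\<Pi>\<^sub>2 X) (tens1 h h') (tens1 g g') (tens1 f f')"
  unfolding asc_def' tens2_reparam[OF asc_htpy[OF assms(1-5)] asc_htpy[OF assms(6-)], simplified asc_phi_props, simplified]
  by (simp add: tens1_concat)

lemma tens2_lun:
  assumes "f \<in> paths X" "f' \<in> paths X"
  shows "tens2 (lun (\<Pi>\<^sub>2 X) f) (lun (\<Pi>\<^sub>2 X) f') = lun (\<Pi>\<^sub>2 X) (tens1 f f')"
  unfolding lun_def' by (rule tens2_reparam[OF lun_htpy[OF assms(1)] lun_htpy[OF assms(2)]]) auto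

lemma tens2_run:
  assumes "f \<in> paths X" "f' \<in> paths X"
  shows "tens2 (run (\<Pi>\<^sub>2 X) f) (run (\<Pi>\<^sub>2 X) f') = run (\<Pi>\<^sub>2 X) (tens1 f f')"
  unfolding run_def' by (rule tens2_reparam[OF run_htpy[OF assms(1)] run_htpy[OF assms(2)]]) auto

text \<open>A pointwise product commutes with both compositions and with the constraint cells, so
  the axioms reduce to unit laws for composition with identity cells.\<close>

lemma ten_pseudofunctor: "pseudofunctor (\<Pi>\<^sub>2 X \<times>\<^sub>B \<Pi>\<^sub>2 X) (\<Pi>\<^sub>2 X) ten_psfun"
proof -
  interpret P: bicategory "\<Pi>\<^sub>2 X" by (rule fundamental_bicategory)
  have pp: "f \<in> paths X" "f 0 = a" "f 1 = b" if "f \<in> hom1 (\<Pi>\<^sub>2 X) a b" for f a b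
    using that by (auto simp: hom1_fundamental)
  have idh: "id2 (\<Pi>\<^sub>2 X) f \<in> hom2 (\<Pi>\<^sub>2 X) f f" if "f \<in> paths X" for f
    using P.id2_hom that by simp
  have idi: "iso2 (\<Pi>\<^sub>2 X) (id2 (\<Pi>\<^sub>2 X) f)" if "f \<in> paths X" for f
    unfolding iso2_def inverse2_def using idh[OF that] P.vcmp_id_left[OF idh[OF that]] by (auto simp: hom2_def)
  have hid: "hcmp (\<Pi>\<^sub>2 X) (id2 (\<Pi>\<^sub>2 X) g) (id2 (\<Pi>\<^sub>2 X) f) = id2 (\<Pi>\<^sub>2 X) (concat_path g f)"
    if "f \<in> paths X" "g \<in> paths X" "f 1 = g 0" for f g
    using P.hcmp_id[of f "f 0" "f 1" g "g 1"] that by (simp add: hom1_fundamental)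
  show ?thesis
  proof (rule pseudofunctor.intro)
    fix f a b g c h d
    assume f: "f \<in> hom1 (\<Pi>\<^sub>2 X \<times>\<^sub>B \<Pi>\<^sub>2 X) a b" and g: "g \<in> hom1 (\<Pi>\<^sub>2 X \<times>\<^sub>B \<Pi>\<^sub>2 X) b c"
      and h: "h \<in> hom1 (\<Pi>\<^sub>2 X \<times>\<^sub>B \<Pi>\<^sub>2 X) c d"
    note F = f[unfolded hom1_prod, THEN conjunct1, THEN pp(1)] f[unfolded hom1_prod, THEN conjunct2, THEN pp(1)]
      g[unfolded hom1_prod, THEN conjunct1, THEN pp(1)] g[unfolded hom1_prod, THEN conjunct2, THEN pp(1)]
      h[unfolded hom1_prod, THEN conjunct1, THEN pp(1)] h[unfolded hom1_prod, THEN conjunct2, THEN pp(1)]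
    have e: "fst f 1 = fst g 0" "snd f 1 = snd g 0" "fst g 1 = fst h 0" "snd g 1 = snd h 0"
      using f g h by (auto simp: hom1_prod hom1_fundamental)
    note pt = tens1_paths[OF F(1,2)] tens1_paths[OF F(3,4)] tens1_paths[OF F(5,6)]
    have a: "asc (\<Pi>\<^sub>2 X) (tens1 (fst h) (snd h)) (tens1 (fst g) (snd g)) (tens1 (fst f) (snd f)) \<in> hom2 (\<Pi>\<^sub>2 X)
       (concat_path (concat_path (tens1 (fst h) (snd h)) (tens1 (fst g) (snd g))) (tens1 (fst f) (snd f)))
       (concat_path (tens1 (fst h) (snd h)) (concat_path (tens1 (fst g) (snd g)) (tens1 (fst f) (snd f))))"
      using P.asc_hom[of "tens1 (fst f) (snd f)" "tens1 (fst f) (snd f) 0" "tens1 (fst f) (snd f) 1"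
          "tens1 (fst g) (snd g)" "tens1 (fst g) (snd g) 1" "tens1 (fst h) (snd h)" "tens1 (fst h) (snd h) 1"] pt e
      by (simp add: hom1_fundamental)
    show "vcmp (\<Pi>\<^sub>2 X) (vcmp (\<Pi>\<^sub>2 X) (map2 ten_psfun (asc (\<Pi>\<^sub>2 X \<times>\<^sub>B \<Pi>\<^sub>2 X) h g f))
          (cmpc ten_psfun (cmp1 (\<Pi>\<^sub>2 X \<times>\<^sub>B \<Pi>\<^sub>2 X) h g) f)) (wr (\<Pi>\<^sub>2 X) (cmpc ten_psfun h g) (map1 ten_psfun f)) =
       vcmp (\<Pi>\<^sub>2 X) (vcmp (\<Pi>\<^sub>2 X) (cmpc ten_psfun h (cmp1 (\<Pi>\<^sub>2 X \<times>\<^sub>B \<Pi>\<^sub>2 X) g f))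
         (wl (\<Pi>\<^sub>2 X) (map1 ten_psfun h) (cmpc ten_psfun g f)))
       (asc (\<Pi>\<^sub>2 X) (map1 ten_psfun h) (map1 ten_psfun g) (map1 ten_psfun f))"
      using pt e P.vcmp_id_right[OF a] P.vcmp_id_left[OF a]
        P.vcmp_id_left[OF idh[of "concat_path (tens1 (fst h) (snd h)) (concat_path (tens1 (fst g) (snd g)) (tens1 (fst f) (snd f)))"]]
      by (simp add: tens2_asc F tens1_concat hid wl_def wr_def concat_path_paths)
  next
    fix f a b g c
    assume f: "f \<in> hom1 (\<Pi>\<^sub>2 X \<times>\<^sub>B \<Pi>\<^sub>2 X) a b" and g: "g \<in> hom1 (\<Pi>\<^sub>2 X \<times>\<^sub>B \<Pi>\<^sub>2 X) b c"
    then show "cmpc ten_psfun g f \<in> hom2 (\<Pi>\<^sub>2 X) (cmp1 (\<Pi>\<^sub>2 X) (map1 ten_psfun g) (map1 ten_psfun f))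
        (map1 ten_psfun (cmp1 (\<Pi>\<^sub>2 X \<times>\<^sub>B \<Pi>\<^sub>2 X) g f))" "iso2 (\<Pi>\<^sub>2 X) (cmpc ten_psfun g f)"
      by (auto simp: tens1_concat hom1_prod hom1_fundamental intro!: idh idi concat_path_paths tens1_paths)
  next
    fix f a b assume f: "f \<in> hom1 (\<Pi>\<^sub>2 X \<times>\<^sub>B \<Pi>\<^sub>2 X) a b"
    then have F: "fst f \<in> paths X" "snd f \<in> paths X" "fst f 0 = fst a" "snd f 0 = snd a" "fst f 1 = fst b" "snd f 1 = snd b"
      by (auto simp: hom1_prod hom1_fundamental)
    note pt = tens1_paths[OF F(1,2)]
    show "map1 ten_psfun f \<in> hom1 (\<Pi>\<^sub>2 X) (map0 ten_psfun a) (map0 ten_psfun b)"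
      using pt F by (simp add: hom1_fundamental)
    have l: "lun (\<Pi>\<^sub>2 X) (tens1 (fst f) (snd f)) \<in> hom2 (\<Pi>\<^sub>2 X) (concat_path (const_path (T (fst b) (snd b))) (tens1 (fst f) (snd f))) (tens1 (fst f) (snd f))"
      using P.lun_hom[of "tens1 (fst f) (snd f)" "T (fst a) (snd a)" "T (fst b) (snd b)"] pt F by (simp add: hom1_fundamental)
    have r: "run (\<Pi>\<^sub>2 X) (tens1 (fst f) (snd f)) \<in> hom2 (\<Pi>\<^sub>2 X) (concat_path (tens1 (fst f) (snd f)) (const_path (T (fst a) (snd a)))) (tens1 (fst f) (snd f))"
      using P.run_hom[of "tens1 (fst f) (snd f)" "T (fst a) (snd a)" "T (fst b) (snd b)"] pt F by (simp add: hom1_fundamental)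
    have ab: "T (fst a) (snd a) \<in> topspace X" "T (fst b) (snd b) \<in> topspace X"
      using paths_topspace01[OF pt] F by simp_all
    show "vcmp (\<Pi>\<^sub>2 X) (vcmp (\<Pi>\<^sub>2 X) (map2 ten_psfun (lun (\<Pi>\<^sub>2 X \<times>\<^sub>B \<Pi>\<^sub>2 X) f)) (cmpc ten_psfun (id1 (\<Pi>\<^sub>2 X \<times>\<^sub>B \<Pi>\<^sub>2 X) b) f))
        (wr (\<Pi>\<^sub>2 X) (unitc ten_psfun b) (map1 ten_psfun f)) = lun (\<Pi>\<^sub>2 X) (map1 ten_psfun f)"
      using pt F ab P.vcmp_id_right[OF l] by (simp add: tens2_lun tens1_const hid wr_def)
    show "vcmp (\<Pi>\<^sub>2 X) (vcmp (\<Pi>\<^sub>2 X) (map2 ten_psfun (run (\<Pi>\<^sub>2 X \<times>\<^sub>B \<Pi>\<^sub>2 X) f)) (cmpc ten_psfun f (id1 (\<Pi>\<^sub>2 X \<times>\<^sub>B \<Pi>\<^sub>2 X) a)))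
        (wl (\<Pi>\<^sub>2 X) (map1 ten_psfun f) (unitc ten_psfun a)) = run (\<Pi>\<^sub>2 X) (map1 ten_psfun f)"
      using pt F ab P.vcmp_id_right[OF r] by (simp add: tens2_run tens1_const hid wl_def)
  next
    fix \<alpha> f f' \<beta> g g'
    assume \<alpha>: "\<alpha> \<in> hom2 (\<Pi>\<^sub>2 X \<times>\<^sub>B \<Pi>\<^sub>2 X) f f'" and \<beta>: "\<beta> \<in> hom2 (\<Pi>\<^sub>2 X \<times>\<^sub>B \<Pi>\<^sub>2 X) g g'"
      and e: "trg (\<Pi>\<^sub>2 X \<times>\<^sub>B \<Pi>\<^sub>2 X) f = src (\<Pi>\<^sub>2 X \<times>\<^sub>B \<Pi>\<^sub>2 X) g"
    note \<alpha>' = \<alpha>[unfolded hom2_prod, THEN conjunct1] \<alpha>[unfolded hom2_prod, THEN conjunct2]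
    note \<beta>' = \<beta>[unfolded hom2_prod, THEN conjunct1] \<beta>[unfolded hom2_prod, THEN conjunct2]
    have e': "fst f 1 = fst g 0" "snd f 1 = snd g 0" using e by auto
    have "tens1 (fst f) (snd f) 1 = tens1 (fst g) (snd g) 0" using e' by simp
    then have h: "hcmp (\<Pi>\<^sub>2 X) (tens2 (fst \<beta>) (snd \<beta>)) (tens2 (fst \<alpha>) (snd \<alpha>)) \<in> hom2 (\<Pi>\<^sub>2 X)
        (concat_path (tens1 (fst g) (snd g)) (tens1 (fst f) (snd f))) (concat_path (tens1 (fst g') (snd g')) (tens1 (fst f') (snd f')))"
      using P.hcmp_hom[OF tens2_hom[OF \<alpha>'] tens2_hom[OF \<beta>']] by simp
    show "vcmp (\<Pi>\<^sub>2 X) (map2 ten_psfun (hcmp (\<Pi>\<^sub>2 X \<times>\<^sub>B \<Pi>\<^sub>2 X) \<beta> \<alpha>)) (cmpc ten_psfun g f) =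
         vcmp (\<Pi>\<^sub>2 X) (cmpc ten_psfun g' f') (hcmp (\<Pi>\<^sub>2 X) (map2 ten_psfun \<beta>) (map2 ten_psfun \<alpha>))"
      using P.vcmp_id_right[OF h] P.vcmp_id_left[OF h] tens2_hcmp[OF \<alpha>'(1) \<beta>'(1) \<alpha>'(2) \<beta>'(2) e'] by simp
  next
    fix \<alpha> f g \<beta> h
    assume \<alpha>: "\<alpha> \<in> hom2 (\<Pi>\<^sub>2 X \<times>\<^sub>B \<Pi>\<^sub>2 X) f g" and \<beta>: "\<beta> \<in> hom2 (\<Pi>\<^sub>2 X \<times>\<^sub>B \<Pi>\<^sub>2 X) g h"
    then show "map2 ten_psfun (vcmp (\<Pi>\<^sub>2 X \<times>\<^sub>B \<Pi>\<^sub>2 X) \<beta> \<alpha>) = vcmp (\<Pi>\<^sub>2 X) (map2 ten_psfun \<beta>) (map2 ten_psfun \<alpha>)"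
      using tens2_vcmp[of "fst \<alpha>" "fst f" "fst g" "fst \<beta>" "fst h" "snd \<alpha>" "snd f" "snd g" "snd \<beta>" "snd h"]
      by (simp add: hom2_prod)
  qed (auto simp: hom2_prod T_in tens2_hom tens2_id tens1_const idh idi)
qed

text \<open>The constraints of the composite functor are products of identity cells composed with
  identity cells, hence identities again.\<close>

lemma frep_tensor:
  assumes R: "representation B' W J0 J1 J2"
    and F: "representation.frep B' W J0 J1 J2 X h F" and F': "representation.frep B' W J0 J1 J2 X h' F'"
  shows "representation.frep B' W J0 J1 J2 X (\<lambda>w. T (h w) (h' w)) (comp_psfun (\<Pi>\<^sub>2 X) ten_psfun (pair_psfun F F'))"
proof -
  interpret representation B' W J0 J1 J2 X by (rule R)
  interpret P: bicategory "\<Pi>\<^sub>2 X" by (rule fundamental_bicategory)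
  have idd: "vcmp (\<Pi>\<^sub>2 X) (id2 (\<Pi>\<^sub>2 X) f) (id2 (\<Pi>\<^sub>2 X) f) = id2 (\<Pi>\<^sub>2 X) f" if "f \<in> paths X" for f
    using P.vcmp_id_left[OF P.id2_hom] that by simp
  note h = frepD(1)[OF F] and h' = frepD(1)[OF F']
  have "map2 (comp_psfun (\<Pi>\<^sub>2 X) ten_psfun (pair_psfun F F')) \<alpha> = homotopy_class X (\<lambda>z. T (h (J2 \<alpha> z)) (h' (J2 \<alpha> z)))"
    if \<alpha>: "\<alpha> \<in> Cell B'" for \<alpha>
  proof -
    have "\<alpha> \<in> hom2 B' (dom2 B' \<alpha>) (cod2 B' \<alpha>)" using \<alpha> by (simp add: hom2_def)
    from J2_htpy[OF this Arr_hom1[OF Cell_Arr[OF \<alpha>]]]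
    have H: "htpy W (J1 (dom2 B' \<alpha>)) (J1 (cod2 B' \<alpha>)) (J2 \<alpha>)" by blast
    show ?thesis using frepD(4)[OF F \<alpha>] frepD(4)[OF F' \<alpha>] tens2_class[OF htpy_push[OF H h] htpy_push[OF H h']]
      by (simp add: comp_psfun_def pair_psfun_def)
  qed
  moreover have "cmpc (comp_psfun (\<Pi>\<^sub>2 X) ten_psfun (pair_psfun F F')) g f =
     id2 (\<Pi>\<^sub>2 X) (concat_path (im_path (\<lambda>w. T (h w) (h' w)) (J1 g)) (im_path (\<lambda>w. T (h w) (h' w)) (J1 f)))"
    if f: "f \<in> hom1 B' a b" and g: "g \<in> hom1 B' b c" for f g a b c
  proof -
    note p = J1_path[OF f] J1_path[OF g]
    have q: "im_path h (J1 f) \<in> paths X" "im_path h' (J1 f) \<in> paths X" "im_path h (J1 g) \<in> paths X" "im_path h' (J1 g) \<in> paths X"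
      using p im_paths h h' by blast+
    have "concat_path (im_path h (J1 g)) (im_path h (J1 f)) \<in> paths X" "concat_path (im_path h' (J1 g)) (im_path h' (J1 f)) \<in> paths X"
      using q p by (auto intro!: concat_path_paths)
    moreover from this have "tens1 (concat_path (im_path h (J1 g)) (im_path h (J1 f))) (concat_path (im_path h' (J1 g)) (im_path h' (J1 f))) \<in> paths X"
      by (rule tens1_paths)
    ultimately show ?thesis
      using frepD(3)[OF F] frepD(3)[OF F'] hom1_Arr[OF f] hom1_Arr[OF g]
      by (simp add: comp_psfun_def pair_psfun_def frepD(5)[OF F f g] frepD(5)[OF F' f g] tens2_id tens1_concat tens1_im idd)
  qed
  moreover have "unitc (comp_psfun (\<Pi>\<^sub>2 X) ten_psfun (pair_psfun F F')) a = id2 (\<Pi>\<^sub>2 X) (const_path (T (h (J0 a)) (h' (J0 a))))"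
    if a: "a \<in> Ob B'" for a
  proof -
    have "h (J0 a) \<in> topspace X" "h' (J0 a) \<in> topspace X"
      using J0_in[OF a] h h' continuous_map_image_subset_topspace by fastforce+
    then show ?thesis
      by (simp add: comp_psfun_def pair_psfun_def frepD(2,6)[OF F a] frepD(2,6)[OF F' a] tens2_id tens1_const idd T_in)
  qed
  ultimately show ?thesis unfolding frep_def
    using T_comp[OF h h'] frepD(2,3)[OF F] frepD(2,3)[OF F']
    by (auto simp: comp_psfun_def pair_psfun_def tens1_im)
qed

text \<open>Post-whiskering surrounds the product of the naturality cells with constraints of the
  tensor functor, which are identities. Both factors are fillings of the same square, so the result
  is the cell of the pointwise product of the homotopies.\<close>

lemma trep_tensor:
  assumes R: "representation B' W J0 J1 J2"
    and F: "representation.frep B' W J0 J1 J2 X h0 F" and F': "representation.frep B' W J0 J1 J2 X h1 F'"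
    and K: "representation.frep B' W J0 J1 J2 X k0 K" and K': "representation.frep B' W J0 J1 J2 X k1 K'"
    and \<sigma>: "representation.trep B' W J0 J1 X G \<sigma>" and \<tau>: "representation.trep B' W J0 J1 X G' \<tau>"
    and G: "\<And>w. w \<in> topspace W \<Longrightarrow> G (0, w) = h0 w \<and> G (1, w) = h1 w"
    and G': "\<And>w. w \<in> topspace W \<Longrightarrow> G' (0, w) = k0 w \<and> G' (1, w) = k1 w"
  shows "representation.trep B' W J0 J1 X (\<lambda>x. T (G x) (G' x))
    (post_whisker B' (\<Pi>\<^sub>2 X) (pair_psfun F K) (pair_psfun F' K') ten_psfun (pair_pstrans \<sigma> \<tau>))"
proof -
  interpret representation B' W J0 J1 J2 X by (rule R)
  show ?thesis unfolding trep_def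
  proof (intro conjI ballI)
    note c = T_comp[OF trepD(1)[OF \<sigma>] trepD(1)[OF \<tau>]]
    show "continuous_map (prod_topology Itop W) X (\<lambda>x. T (G x) (G' x))" by (rule c)
    show "cpt (post_whisker B' (\<Pi>\<^sub>2 X) (pair_psfun F K) (pair_psfun F' K') ten_psfun (pair_pstrans \<sigma> \<tau>)) a =
        (\<lambda>t\<in>{0..1}. T (G (t, J0 a)) (G' (t, J0 a)))" if "a \<in> Ob B'" for a
      unfolding post_whisker_def pair_pstrans_def using trepD(2)[OF \<sigma> that] trepD(2)[OF \<tau> that]
      by (auto simp: tens1_def edge_def im_path_def)
    fix f assume fA: "f \<in> Arr B'"
    note f = Arr_hom1[OF fA]
    have ab: "src B' f \<in> Ob B'" "trg B' f \<in> Ob B'" using Arr_Ob[OF fA] by auto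
    note L1 = lifting_fam[OF trepD(1)[OF \<sigma>] f] and L2 = lifting_fam[OF trepD(1)[OF \<tau>] f]
    define \<Gamma> where "\<Gamma> = (\<lambda>z. T (fam G (J1 f) z) (fam G' (J1 f) z))"
    interpret L: lifting X Sq \<Gamma> unfolding \<Gamma>_def by (rule lifting_T[OF L1 L2])
    have P: "edge (x, y) (x', y') \<in> paths Sq" if "x \<in> {0..1}" "y \<in> {0..1}" "x' \<in> {0..1}" "y' \<in> {0..1}" for x y x' y'
      using that by (simp add: edge_Sq)
    have m: "map1 F f = im_path (fam G (J1 f)) (edge (0, 0) (0, 1))" "map1 F' f = im_path (fam G (J1 f)) (edge (1, 0) (1, 1))"
      "map1 K f = im_path (fam G' (J1 f)) (edge (0, 0) (0, 1))" "map1 K' f = im_path (fam G' (J1 f)) (edge (1, 0) (1, 1))"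
      using map1_fam[OF F f, of 0 G] map1_fam[OF F' f, of 1 G] map1_fam[OF K f, of 0 G'] map1_fam[OF K' f, of 1 G'] G G'
      by simp_all
    have t: "tens1 (im_path (fam G (J1 f)) p) (im_path (fam G' (J1 f)) p) = im_path \<Gamma> p" for p :: "real \<Rightarrow> real \<times> real"
      by (simp add: tens1_im \<Gamma>_def)
    have n: "tens2 (natc \<sigma> f) (natc \<tau> f) = lift X Sq \<Gamma> lower upper"
      unfolding trepD(3)[OF \<sigma> fA] trepD(3)[OF \<tau> fA] \<Gamma>_def by (rule tens2_lift[OF L1 L2 lower_upper])
    have "natc (post_whisker B' (\<Pi>\<^sub>2 X) (pair_psfun F K) (pair_psfun F' K') ten_psfun (pair_pstrans \<sigma> \<tau>)) f = lift X Sq \<Gamma> lower upper"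
      by (simp add: post_whisker_def pair_pstrans_def pair_psfun_def m t n cpt_fam[OF \<sigma> f ab] cpt_fam[OF \<tau> f ab]
        L.lift_rules P lower_def upper_def)
    then show "natc (post_whisker B' (\<Pi>\<^sub>2 X) (pair_psfun F K) (pair_psfun F' K') ten_psfun (pair_pstrans \<sigma> \<tau>)) f =
        lift X Sq (fam (\<lambda>x. T (G x) (G' x)) (J1 f)) lower upper"
      by (simp add: \<Gamma>_def fam_def)
  qed
qed

end


section \<open>Topologies on lists of fixed length\<close>

text \<open>Lists put tuples of every length into one type, so that tuples of points and of
  intervals can be appended. The topology is pulled back from the product topology, whose points are
  extensional functions.\<close>

definition list_top :: "nat \<Rightarrow> 'a topology \<Rightarrow> 'a list topology" where
  "list_top n X = pullback_topology {xs. length xs = n} (\<lambda>xs. \<lambda>i\<in>{..<n}. xs ! i) (product_topology (\<lambda>_. X) {..<n})"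

lemma topspace_list_top: "topspace (list_top n X) = {xs. length xs = n \<and> set xs \<subseteq> topspace X}"
proof (rule set_eqI)
  fix xs :: "'a list"
  have "set xs \<subseteq> topspace X \<longleftrightarrow> (\<forall>i<length xs. xs ! i \<in> topspace X)"
    unfolding subset_code(1) all_set_conv_all_nth ..
  then show "xs \<in> topspace (list_top n X) \<longleftrightarrow> xs \<in> {xs. length xs = n \<and> set xs \<subseteq> topspace X}"
    unfolding list_top_def topspace_pullback_topology by (auto simp: PiE_iff)
qed

lemma continuous_map_list_top:
  "continuous_map Z (list_top n X) f \<longleftrightarrow>
     (\<forall>z\<in>topspace Z. length (f z) = n) \<and> (\<forall>i<n. continuous_map Z X (\<lambda>z. f z ! i))"
proof
  assume f: "continuous_map Z (list_top n X) f"
  then have l: "length (f z) = n" if "z \<in> topspace Z" for z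
    using that continuous_map_image_subset_topspace[OF f] by (auto simp: topspace_list_top)
  have "continuous_map (list_top n X) X (\<lambda>xs. xs ! i)" if "i < n" for i
  proof -
    have "continuous_map (product_topology (\<lambda>_. X) {..<n}) X (\<lambda>x. x i)"
      using that by (intro continuous_map_product_projection) simp
    from continuous_map_pullback[OF this, of "{xs. length xs = n}" "\<lambda>xs. \<lambda>i\<in>{..<n}. xs ! i"] show ?thesis
      using that by (simp add: list_top_def o_def)
  qed
  then show "(\<forall>z\<in>topspace Z. length (f z) = n) \<and> (\<forall>i<n. continuous_map Z X (\<lambda>z. f z ! i))"
    using l continuous_map_compose[OF f, of X "\<lambda>xs. xs ! i" for i] by (simp add: o_def)
next
  assume f: "(\<forall>z\<in>topspace Z. length (f z) = n) \<and> (\<forall>i<n. continuous_map Z X (\<lambda>z. f z ! i))"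
  then have "continuous_map Z (product_topology (\<lambda>_. X) {..<n}) ((\<lambda>xs. \<lambda>i\<in>{..<n}. xs ! i) \<circ> f)"
    unfolding continuous_map_componentwise by (auto simp: o_def)
  then show "continuous_map Z (list_top n X) f"
    unfolding list_top_def by (rule continuous_map_pullback') (use f in auto)
qed

lemma continuous_map_nth: "i < n \<Longrightarrow> continuous_map (list_top n X) X (\<lambda>xs. xs ! i)"
  using iffD1[OF continuous_map_list_top continuous_map_id[unfolded id_def], of n X] by blast

section \<open>Coordinates on products\<close>

text \<open>The closure properties that a representation asks of its source. They pass to products
  at once, whereas the full bicategory axioms would need a separate verification for each
  product.\<close>

locale precategory2 =
  fixes B :: "('o, 'f, 't) bicat"
  assumes pArr: "f \<in> Arr B \<Longrightarrow> src B f \<in> Ob B \<and> trg B f \<in> Ob B"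
    and pCell: "\<alpha> \<in> Cell B \<Longrightarrow> dom2 B \<alpha> \<in> Arr B"
    and pcmp: "f \<in> hom1 B a b \<Longrightarrow> g \<in> hom1 B b c \<Longrightarrow> cmp1 B g f \<in> hom1 B a c"
    and pid: "a \<in> Ob B \<Longrightarrow> id1 B a \<in> hom1 B a a"
    and ppar: "\<alpha> \<in> hom2 B f g \<Longrightarrow> f \<in> hom1 B a b \<Longrightarrow> g \<in> hom1 B a b"

lemma precategory2_fundamental: "precategory2 (\<Pi>\<^sub>2 X)"
proof -
  interpret P: bicategory "\<Pi>\<^sub>2 X" by (rule fundamental_bicategory)
  show ?thesis
  proof
    show "g \<in> hom1 (\<Pi>\<^sub>2 X) a b" if "\<alpha> \<in> hom2 (\<Pi>\<^sub>2 X) f g" "f \<in> hom1 (\<Pi>\<^sub>2 X) a b" for \<alpha> f g a b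
      by (rule hom2E[OF that(1)]) (use that(2) in \<open>simp add: hom1_fundamental\<close>)
  qed (use P.dom2_Arr in \<open>auto simp: hom1_fundamental concat_path_paths\<close>)
qed

lemma precategory2_prod:
  assumes "precategory2 B" "precategory2 C" shows "precategory2 (B \<times>\<^sub>B C)"
proof -
  interpret B: precategory2 B by fact
  interpret C: precategory2 C by fact
  show ?thesis
  proof
    show "g \<in> hom1 (B \<times>\<^sub>B C) a b" if "\<alpha> \<in> hom2 (B \<times>\<^sub>B C) f g" "f \<in> hom1 (B \<times>\<^sub>B C) a b" for \<alpha> f g a b
      using that B.ppar[of "fst \<alpha>" "fst f" "fst g" "fst a" "fst b"] C.ppar[of "snd \<alpha>" "snd f" "snd g" "snd a" "snd b"]
      by (simp add: hom1_prod hom2_prod)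
    show "cmp1 (B \<times>\<^sub>B C) g f \<in> hom1 (B \<times>\<^sub>B C) a c" if "f \<in> hom1 (B \<times>\<^sub>B C) a b" "g \<in> hom1 (B \<times>\<^sub>B C) b c" for f a b g c
      using that B.pcmp[of "fst f" "fst a" "fst b" "fst g" "fst c"] C.pcmp[of "snd f" "snd a" "snd b" "snd g" "snd c"]
      by (simp add: hom1_prod)
  qed (auto simp: hom1_prod B.pArr C.pArr B.pCell C.pCell B.pid C.pid)
qed

locale coordinate =
  fixes B :: "('o, 'f, 't) bicat" and X :: "'a topology"
    and c0 :: "'o \<Rightarrow> 'a" and c1 :: "'f \<Rightarrow> real \<Rightarrow> 'a" and c2 :: "'t \<Rightarrow> (real \<times> real \<Rightarrow> 'a) set"
  assumes c0_in: "a \<in> Ob B \<Longrightarrow> c0 a \<in> topspace X"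
    and c1_hom: "f \<in> hom1 B a b \<Longrightarrow> c1 f \<in> hom1 (\<Pi>\<^sub>2 X) (c0 a) (c0 b)"
    and c1_cmp: "f \<in> hom1 B a b \<Longrightarrow> g \<in> hom1 B b c \<Longrightarrow> c1 (cmp1 B g f) = concat_path (c1 g) (c1 f)"
    and c1_id: "a \<in> Ob B \<Longrightarrow> c1 (id1 B a) = const_path (c0 a)"
    and c2_hom: "\<alpha> \<in> hom2 B f g \<Longrightarrow> c2 \<alpha> \<in> hom2 (\<Pi>\<^sub>2 X) (c1 f) (c1 g)"

lemma coordinate_id: "coordinate (\<Pi>\<^sub>2 X) X (\<lambda>x. x) (\<lambda>x. x) (\<lambda>x. x)"
  by standard auto

lemma coordinate_fst:
  assumes "coordinate B X c0 c1 c2" shows "coordinate (B \<times>\<^sub>B C) X (c0 \<circ> fst) (c1 \<circ> fst) (c2 \<circ> fst)"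
proof -
  interpret coordinate B X c0 c1 c2 by fact
  show ?thesis by standard (auto simp: hom1_prod hom2_prod c0_in c1_hom c1_cmp c1_id c2_hom)
qed

lemma coordinate_snd:
  assumes "coordinate C X c0 c1 c2" shows "coordinate (B \<times>\<^sub>B C) X (c0 \<circ> snd) (c1 \<circ> snd) (c2 \<circ> snd)"
proof -
  interpret coordinate C X c0 c1 c2 by fact
  show ?thesis by standard (auto simp: hom1_prod hom2_prod c0_in c1_hom c1_cmp c1_id c2_hom)
qed

type_synonym ('o, 'f, 't, 'a) coord = "('o \<Rightarrow> 'a) \<times> ('f \<Rightarrow> real \<Rightarrow> 'a) \<times> ('t \<Rightarrow> (real \<times> real \<Rightarrow> 'a) set)"

definition coords0 :: "('o, 'f, 't, 'a) coord list \<Rightarrow> 'o \<Rightarrow> 'a list" where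
  "coords0 cs a = map (\<lambda>c. fst c a) cs"

definition coords1 :: "('o, 'f, 't, 'a) coord list \<Rightarrow> 'f \<Rightarrow> real \<Rightarrow> 'a list" where
  "coords1 cs f = (\<lambda>t\<in>{0..1}. map (\<lambda>c. fst (snd c) f t) cs)"

text \<open>A class has to become a single map of the square, so a representative is chosen;
  functors induced from it return to classes, where the choice disappears.\<close>

definition coords2 :: "('o, 'f, 't, 'a) coord list \<Rightarrow> 't \<Rightarrow> real \<times> real \<Rightarrow> 'a list" where
  "coords2 cs \<alpha> = (\<lambda>z. map (\<lambda>c. rep (snd (snd c) \<alpha>) z) cs)"

locale coordinates = precategory2 B for B :: "('o, 'f, 't) bicat" +
  fixes X :: "'a topology" and cs :: "('o, 'f, 't, 'a) coord list"
  assumes cs: "\<And>c. c \<in> set cs \<Longrightarrow> coordinate B X (fst c) (fst (snd c)) (snd (snd c))"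
begin

abbreviation "n \<equiv> length cs"
abbreviation "J0 \<equiv> coords0 cs"
abbreviation "J1 \<equiv> coords1 cs"
abbreviation "J2 \<equiv> coords2 cs"

lemma nth_hom: "i < n \<Longrightarrow> f \<in> hom1 B a b \<Longrightarrow>
  fst (snd (cs ! i)) f \<in> paths X \<and> fst (snd (cs ! i)) f 0 = fst (cs ! i) a \<and> fst (snd (cs ! i)) f 1 = fst (cs ! i) b"
  using coordinate.c1_hom[OF cs[OF nth_mem]] by (simp add: hom1_fundamental)

lemma nth_hom2:
  assumes "i < n" "\<alpha> \<in> hom2 B f g"
  shows "htpy X (fst (snd (cs ! i)) f) (fst (snd (cs ! i)) g) (rep (snd (snd (cs ! i)) \<alpha>))"
    "homotopy_class X (rep (snd (snd (cs ! i)) \<alpha>)) = snd (snd (cs ! i)) \<alpha>"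
proof -
  have "snd (snd (cs ! i)) \<alpha> \<in> hom2 (\<Pi>\<^sub>2 X) (fst (snd (cs ! i)) f) (fst (snd (cs ! i)) g)"
    using coordinate.c2_hom[OF cs[OF nth_mem]] assms by simp
  then obtain H where H: "htpy X (fst (snd (cs ! i)) f) (fst (snd (cs ! i)) g) H" "snd (snd (cs ! i)) \<alpha> = homotopy_class X H"
    by (rule hom2E)
  show "htpy X (fst (snd (cs ! i)) f) (fst (snd (cs ! i)) g) (rep (snd (snd (cs ! i)) \<alpha>))"
    "homotopy_class X (rep (snd (snd (cs ! i)) \<alpha>)) = snd (snd (cs ! i)) \<alpha>"
    using htpy_rep[OF H(1)] class_rep[OF H(1)] by (simp_all add: H(2))
qed

lemma coords_representation: "representation B (list_top n X) J0 J1 J2"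
proof
  show "J0 a \<in> topspace (list_top n X)" if "a \<in> Ob B" for a
    using coordinate.c0_in[OF cs that] by (auto simp: topspace_list_top coords0_def)
  show "J1 f \<in> paths (list_top n X) \<and> J1 f 0 = J0 a \<and> J1 f 1 = J0 b" if f: "f \<in> hom1 B a b" for f a b
  proof -
    have "continuous_map Itop X (\<lambda>t. J1 f t ! i)" if "i < n" for i
    proof (rule continuous_map_eq)
      show "continuous_map Itop X (fst (snd (cs ! i)) f)" using nth_hom[OF that f] by (simp add: paths_cont)
    qed (simp add: coords1_def that)
    then have "continuous_map Itop (list_top n X) (J1 f)"
      by (simp add: continuous_map_list_top) (simp add: coords1_def)
    moreover have "J1 f 0 = J0 a" "J1 f 1 = J0 b"
      using nth_hom[OF _ f] by (auto simp: coords1_def coords0_def list_eq_iff_nth_eq)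
    ultimately show ?thesis by (simp add: paths_def pathin_def) (simp add: coords1_def)
  qed
  show "J1 (cmp1 B g f) = concat_path (J1 g) (J1 f)" if "f \<in> hom1 B a b" "g \<in> hom1 B b c" for f g a b c
    by (rule path_eqI) (auto simp: coords1_def concat_path_def coordinate.c1_cmp[OF cs that])
  show "J1 (id1 B a) = const_path (J0 a) \<and> id1 B a \<in> hom1 B a a" if "a \<in> Ob B" for a
    using pid[OF that] by (auto simp: coords1_def coords0_def const_path_def coordinate.c1_id[OF cs that] restrict_def)
  show "g \<in> hom1 B a b \<and> htpy (list_top n X) (J1 f) (J1 g) (J2 \<alpha>)" if \<alpha>: "\<alpha> \<in> hom2 B f g" and f: "f \<in> hom1 B a b" for \<alpha> f g a b
  proof
    show "g \<in> hom1 B a b" by (rule ppar[OF that])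
    note H = nth_hom2(1)[OF _ \<alpha>]
    have "continuous_map Sq (list_top n X) (J2 \<alpha>)"
      unfolding continuous_map_list_top using htpyD(1)[OF H] by (simp add: coords2_def)
    then show "htpy (list_top n X) (J1 f) (J1 g) (J2 \<alpha>)"
      using htpyD(2-)[OF H] by (auto simp: htpy_def coords1_def coords2_def list_eq_iff_nth_eq)
  qed
qed (use pArr pCell pcmp in auto)

text \<open>Projections from a product are induced by the entries of the list. All functors of the
  monoidal structure are built from these, constant functors and tensor products.\<close>

lemma frep_coord:
  assumes "i < n" "cs ! i = (c0, c1, c2)"
  shows "representation.frep B (list_top n X) J0 J1 J2 X (\<lambda>w. w ! i) (strict_psfun (\<Pi>\<^sub>2 X) c0 c1 c2)"
proof (rule representation.frep_strict[OF coords_representation])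
  show "continuous_map (list_top n X) X (\<lambda>w. w ! i)" by (rule continuous_map_nth[OF assms(1)])
  show "c0 a = J0 a ! i" for a using assms by (simp add: coords0_def)
  show "c1 f = im_path (\<lambda>w. w ! i) (J1 f)" if "f \<in> Arr B" for f
    using nth_hom[OF assms(1), of f "src B f" "trg B f"] that assms
    by (intro path_eqI) (auto simp: coords1_def hom1_def paths_ext)
  show "c2 \<alpha> = homotopy_class X (\<lambda>z. J2 \<alpha> z ! i)" if "\<alpha> \<in> Cell B" for \<alpha>
    using nth_hom2(2)[OF assms(1), of \<alpha> "dom2 B \<alpha>" "cod2 B \<alpha>"] that assms by (simp add: hom2_def coords2_def)
qed

end

section \<open>Ordered configurations\<close>

type_synonym conf = "(real \<times> real) list"

text \<open>A configuration is listed from left to right, so that the configurations of a given length form a convex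
  set.\<close>

definition valid :: "conf \<Rightarrow> bool" where
  "valid cs \<longleftrightarrow> (\<forall>c\<in>set cs. 0 \<le> fst c \<and> fst c < snd c \<and> snd c \<le> 1) \<and> sorted_wrt (\<lambda>c d. snd c \<le> fst d) cs"

definition Conf :: "nat \<Rightarrow> conf topology" where
  "Conf n = subtopology (list_top n euclidean) {cs. valid cs}"

definition mixc :: "real \<Rightarrow> conf \<Rightarrow> conf \<Rightarrow> conf" where
  "mixc r cs ds = map (\<lambda>(c, d). (1 - r) *\<^sub>R c + r *\<^sub>R d) (zip cs ds)"

definition scale :: "real \<times> real \<Rightarrow> conf \<Rightarrow> conf" where
  "scale c ds = map (lc_comp c) ds"

text \<open>The operadic composite of the two halves \<open>(0, 1/2)\<close> and
  \<open>(1/2, 1)\<close> with \<open>cs\<close> and \<open>ds\<close>. Reading from left to right,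
  its intervals belong to the entries of the appended lists of points.\<close>

definition cten :: "conf \<Rightarrow> conf \<Rightarrow> conf"  (infixr "\<uplus>" 80) where
  "cs \<uplus> ds = scale (0, 1/2) cs @ scale (1/2, 1) ds"

lemma topspace_Conf [simp]: "cs \<in> topspace (Conf n) \<longleftrightarrow> length cs = n \<and> valid cs"
  by (auto simp: Conf_def topspace_list_top)

lemma length_cten [simp]: "length (cs \<uplus> ds) = length cs + length ds"
  by (simp add: cten_def scale_def)

lemma length_scale [simp]: "length (scale c ds) = length ds"
  by (simp add: scale_def)

lemma valid_Nil [simp]: "valid []" and valid_unit [simp]: "valid [(0, 1)]"
  by (simp_all add: valid_def)

lemma valid_cten [simp]:
  assumes "valid cs" "valid ds" shows "valid (cs \<uplus> ds)"
proof -
  have c: "0 \<le> fst c / 2 \<and> fst c / 2 < snd c / 2 \<and> snd c / 2 \<le> 1/2" if "c \<in> set cs" for c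
    using assms(1) that by (auto simp: valid_def)
  have d: "1/2 \<le> fst c / 2 + 1/2 \<and> fst c / 2 + 1/2 < snd c / 2 + 1/2 \<and> snd c / 2 + 1/2 \<le> 1" if "c \<in> set ds" for c
    using assms(2) that by (auto simp: valid_def)
  have s: "lc_comp (0, 1/2) c = (fst c / 2, snd c / 2)" "lc_comp (1/2, 1) c = (fst c / 2 + 1/2, snd c / 2 + 1/2)" for c
    by (simp_all add: lc_comp_def lc_map_def)
  have "sorted_wrt (\<lambda>c d. snd c / 2 \<le> fst d / 2) cs" "sorted_wrt (\<lambda>c d. snd c / 2 + 1/2 \<le> fst d / 2 + 1/2) ds"
    using assms by (auto simp: valid_def elim!: sorted_wrt_mono_rel[rotated])
  then show ?thesis
    using c d by (fastforce simp: valid_def cten_def scale_def s sorted_wrt_append sorted_wrt_map)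
qed

lemma length_mixc [simp]: "length (mixc r cs ds) = min (length cs) (length ds)"
  by (simp add: mixc_def)

lemma nth_mixc: "i < length cs \<Longrightarrow> i < length ds \<Longrightarrow> mixc r cs ds ! i = (1 - r) *\<^sub>R (cs ! i) + r *\<^sub>R (ds ! i)"
  by (simp add: mixc_def)

lemma valid_mixc:
  assumes "valid cs" "valid ds" "length cs = length ds" "r \<in> {0..1}"
  shows "valid (mixc r cs ds)"
proof -
  have r: "(1 - r) * a + r * b \<le> (1 - r) * c + r * d" if "a \<le> c" "b \<le> d" for a b c d
    using that assms(4) by (intro add_mono mult_left_mono) auto
  \<comment> \<open>Strictness has to come from a term with nonzero weight: the second if
    \<open>r = 1\<close>, otherwise the first.\<close>
  have r': "(1 - r) * a + r * b < (1 - r) * c + r * d" if "a < c" "b < d" for a b c d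
    using that assms(4) by (cases "r = 1") (auto intro!: add_less_le_mono mult_strict_left_mono mult_left_mono)
  have v: "0 \<le> fst (es ! i)" "fst (es ! i) < snd (es ! i)" "snd (es ! i) \<le> 1" if "valid es" "i < length es" for es i
    using that by (auto simp: valid_def)
  have o: "snd (es ! i) \<le> fst (es ! j)" if "valid es" "i < j" "j < length es" for es i j
    using that by (auto simp: valid_def sorted_wrt_iff_nth_less)
  have "0 \<le> fst (mixc r cs ds ! i) \<and> fst (mixc r cs ds ! i) < snd (mixc r cs ds ! i) \<and> snd (mixc r cs ds ! i) \<le> 1"
    if "i < length cs" for i
    using r[of 0 "fst (cs ! i)" 0 "fst (ds ! i)"] r'[of "fst (cs ! i)" "snd (cs ! i)" "fst (ds ! i)" "snd (ds ! i)"]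
      r[of "snd (cs ! i)" 1 "snd (ds ! i)" 1] v[OF assms(1), of i] v[OF assms(2), of i] that assms(3)
    by (simp add: nth_mixc)
  moreover have "snd (mixc r cs ds ! i) \<le> fst (mixc r cs ds ! j)" if "i < j" "j < length cs" for i j
    using r[OF o[OF assms(1) that] o[OF assms(2) that(1)]] that assms(3) by (simp add: nth_mixc)
  ultimately show ?thesis
    using assms(3) by (simp add: valid_def sorted_wrt_iff_nth_less all_set_conv_all_nth)
qed

lemma continuous_map_Conf:
  "continuous_map Z (Conf n) f \<longleftrightarrow>
     (\<forall>z\<in>topspace Z. length (f z) = n \<and> valid (f z)) \<and> (\<forall>i<n. continuous_map Z euclidean (\<lambda>z. f z ! i))"
  by (auto simp: Conf_def continuous_map_in_subtopology continuous_map_list_top)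

lemma continuous_map_nth_Conf: "i < n \<Longrightarrow> continuous_map (Conf n) euclidean (\<lambda>xs. xs ! i)"
  using iffD1[OF continuous_map_Conf continuous_map_id[unfolded id_def], of n] by blast

lemma mixes_Conf: "mixes (Conf n) mixc"
  unfolding mixes_def
proof (intro conjI ballI)
  let ?D = "prod_topology Itop (prod_topology (Conf n) (Conf n))"
  have c: "continuous_map ?D euclideanreal fst" "continuous_map ?D (Conf n) (\<lambda>x. fst (snd x))"
    "continuous_map ?D (Conf n) (\<lambda>x. snd (snd x))"
    using continuous_map_compose[OF continuous_map_snd continuous_map_fst]
      continuous_map_compose[OF continuous_map_snd continuous_map_snd]
      continuous_map_into_fulltopology[OF continuous_map_fst]
    by (auto simp: o_def)
  show "continuous_map ?D (Conf n) (\<lambda>x. mixc (fst x) (fst (snd x)) (snd (snd x)))"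
    unfolding continuous_map_Conf
  proof (intro conjI allI impI ballI)
    fix i assume i: "i < n"
    have "continuous_map ?D euclidean (\<lambda>x. (1 - fst x) *\<^sub>R (fst (snd x) ! i) + fst x *\<^sub>R (snd (snd x) ! i))"
    proof -
      have 1: "continuous_map ?D (prod_topology euclideanreal (prod_topology euclidean euclidean))
          (\<lambda>x. (fst x, fst (snd x) ! i, snd (snd x) ! i))"
        using continuous_map_compose[OF c(2) continuous_map_nth_Conf[OF i]]
          continuous_map_compose[OF c(3) continuous_map_nth_Conf[OF i]] c(1)
        by (simp only: continuous_map_pairwise o_def fst_conv snd_conv simp_thms)
      have 2: "continuous_map (prod_topology euclideanreal (prod_topology euclidean euclidean)) euclidean
          (\<lambda>y :: real \<times> (real \<times> real) \<times> (real \<times> real). (1 - fst y) *\<^sub>R fst (snd y) + fst y *\<^sub>R snd (snd y))"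
        by (simp add: euclidean_product_topology) (intro continuous_intros)
      show ?thesis using continuous_map_compose[OF 1 2] by (simp add: o_def)
    qed
    then show "continuous_map ?D euclidean (\<lambda>x. mixc (fst x) (fst (snd x)) (snd (snd x)) ! i)"
      by (rule continuous_map_eq) (use i in \<open>auto simp: nth_mixc\<close>)
  qed (auto simp: valid_mixc)
  show "mixc 0 a b = a" "mixc 1 a b = b" if "a \<in> topspace (Conf n)" "b \<in> topspace (Conf n)" for a b
    using that by (auto simp: list_eq_iff_nth_eq nth_mixc)
  show "mixc r a a = a" for r a
    by (auto simp: list_eq_iff_nth_eq nth_mixc scaleR_add_left[symmetric])
qed

lemma equiconnected_Conf [simp]: "equiconnected (Conf n)"
  using mixes_Conf by (auto simp: equiconnected_def)

text \<open>Lists do not form a vector space, so straight paths of configurations are built from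
  \<open>mixc\<close> and not from \<open>edge\<close>.\<close>

definition cedge :: "conf \<Rightarrow> conf \<Rightarrow> real \<Rightarrow> conf" where
  "cedge cs ds = (\<lambda>t\<in>{0..1}. mixc t cs ds)"

lemma cedge_01 [simp]:
  "length cs = length ds \<Longrightarrow> cedge cs ds 0 = cs" "length cs = length ds \<Longrightarrow> cedge cs ds 1 = ds"
  by (auto simp: cedge_def list_eq_iff_nth_eq nth_mixc)

lemma cedge_paths:
  assumes "valid cs" "valid ds" "length cs = n" "length ds = n" shows "cedge cs ds \<in> paths (Conf n)"
proof -
  have "continuous_map Itop (Conf n) (\<lambda>t. mixc t cs ds)"
    by (rule mixes_continuous[OF mixes_Conf]) (use assms in \<open>auto intro: continuous_map_id[unfolded id_def]\<close>)
  then have "continuous_map Itop (Conf n) (cedge cs ds)"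
    by (rule continuous_map_eq) (simp add: cedge_def)
  then show ?thesis by (simp add: paths_def pathin_def cedge_def)
qed

lemma cedge_refl [simp]: "cedge cs cs = const_path cs"
  by (rule path_eqI)
    (auto simp: cedge_def const_path_def list_eq_iff_nth_eq nth_mixc scaleR_add_left[symmetric])

lemma mixc_append:
  "length cs = length ds \<Longrightarrow> mixc r (cs @ cs') (ds @ ds') = mixc r cs ds @ mixc r cs' ds'"
  by (simp add: mixc_def)

lemma scale_mixc: "length cs = length ds \<Longrightarrow> scale c (mixc r cs ds) = mixc r (scale c cs) (scale c ds)"
  by (auto simp: scale_def list_eq_iff_nth_eq nth_mixc lc_comp_def lc_map_def case_prod_unfold prod_eq_iff algebra_simps)

text \<open>Rescaling to a half is affine. Hence the tensor of two straight paths is straight with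
  the same parametrization.\<close>

lemma cten_mixc:
  "length cs = length ds \<Longrightarrow> length cs' = length ds' \<Longrightarrow>
    mixc r cs ds \<uplus> mixc r cs' ds' = mixc r (cs \<uplus> cs') (ds \<uplus> ds')"
  by (simp add: cten_def scale_mixc mixc_append)


section \<open>The action on ordered configurations\<close>

lemma sum_decompose:
  "m < sum (n :: nat \<Rightarrow> nat) {..<k} \<Longrightarrow> \<exists>i<k. \<exists>r<n i. m = sum n {..<i} + r"
proof (induction k)
  case (Suc k)
  show ?case
  proof (cases "m < sum n {..<k}")
    case True then show ?thesis using Suc.IH by (meson less_SucI)
  next
    case False
    then have "m = sum n {..<k} + (m - sum n {..<k})" "m - sum n {..<k} < n k" using Suc.prems by auto
    then show ?thesis by blast
  qed
qed simp

lemma block_offset: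
  assumes "r < n i" shows "block n (sum n {..<i} + r) = i" "offset n (sum n {..<i} + r) = r"
proof -
  show b: "block n (sum n {..<i} + r) = i"
    unfolding block_def
  proof (rule Least_equality)
    show "sum n {..<i} + r < sum n {..i}" using assms by (simp add: lessThan_Suc_atMost[symmetric])
    fix j assume j: "sum n {..<i} + r < sum n {..j}"
    show "i \<le> j"
    proof (rule ccontr)
      assume "\<not> i \<le> j"
      then have "sum n {..j} \<le> sum n {..<i}" by (intro sum_mono2) auto
      then show False using j by simp
    qed
  qed
  show "offset n (sum n {..<i} + r) = r" by (simp add: offset_def b)
qed

lemma nth_concat_sum:
  "i < length xss \<Longrightarrow> r < length (xss ! i) \<Longrightarrow>
    concat xss ! (sum (\<lambda>j. length (xss ! j)) {..<i} + r) = xss ! i ! r"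
proof (induction xss arbitrary: i)
  case (Cons xs xss)
  show ?case
  proof (cases i)
    case 0 then show ?thesis using Cons.prems by (simp add: nth_append)
  next
    case (Suc j)
    then have "sum (\<lambda>j. length ((xs # xss) ! j)) {..<i} = length xs + sum (\<lambda>j. length (xss ! j)) {..<j}"
      by (simp only: sum.lessThan_Suc_shift) simp
    then show ?thesis using Cons Suc by (simp add: nth_append)
  qed
qed simp

lemma length_concat_sum: "length (concat xss) = sum (\<lambda>j. length (xss ! j)) {..<length xss}"
  by (simp add: length_concat sum_list_sum_nth atLeast0LessThan)

text \<open>Translates the block and offset bookkeeping of the operad into concatenation of lists;
  afterwards positions in a composite need not be computed.\<close>

lemma concat_tuple_concat:
  assumes "\<And>i r. i < length xss \<Longrightarrow> r < length (xss ! i) \<Longrightarrow> x i r = xss ! i ! r"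
    and "\<And>i. i < length xss \<Longrightarrow> n i = length (xss ! i)"
  shows "concat_tuple (length xss) n x = (\<lambda>m\<in>{..<length (concat xss)}. concat xss ! m)"
proof -
  have s: "sum n {..<i} = sum (\<lambda>j. length (xss ! j)) {..<i}" if "i \<le> length xss" for i
    using that assms(2) by (intro sum.cong) auto
  have "x (block n m) (offset n m) = concat xss ! m" if m: "m < sum n {..<length xss}" for m
  proof -
    obtain i r where ir: "i < length xss" "r < n i" "m = sum n {..<i} + r" using sum_decompose[OF m] by blast
    have "x i r = concat xss ! m"
      using ir assms nth_concat_sum[of i xss r] s[of i] by simp
    then show ?thesis using block_offset[of r n i] ir by simp
  qed
  then show ?thesis by (auto simp: concat_tuple_def length_concat_sum s restrict_def)
qed

text \<open>Operad multiplication in list form; its agreement with \<open>C1_mult\<close> is shown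
  inside \<open>act_csub\<close>.\<close>

definition csub :: "conf \<Rightarrow> conf list \<Rightarrow> conf" where
  "csub cs dss = concat (map (\<lambda>(c, ds). scale c ds) (zip cs dss))"

abbreviation unit_conf :: conf  ("\<one>\<^sub>c") where "\<one>\<^sub>c \<equiv> [(0, 1)]"

lemma lc_comp_unit [simp]: "lc_comp c (0, 1) = c" "lc_comp (0, 1) c = c"
  by (cases c; simp add: lc_comp_def lc_map_def)+

lemma scale_lc_comp: "scale (lc_comp c d) es = scale c (scale d es)"
  by (auto simp: scale_def lc_comp_def lc_map_def case_prod_unfold algebra_simps)

lemma scale_Nil [simp]: "scale c [] = []"
  by (simp add: scale_def)

lemma scale_unit [simp]: "scale (0, 1) ds = ds"
  by (simp add: scale_def map_idI)

lemma csub_Nil [simp]: "csub [] dss = []"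
  by (simp add: csub_def)

lemma csub_unit [simp]: "csub \<one>\<^sub>c (ds # dss) = ds"
  by (simp add: csub_def)

lemma csub_scale: "csub (scale c cs) dss = scale c (csub cs dss)"
  unfolding csub_def scale_def
  by (induction cs arbitrary: dss) (auto simp: zip_Cons1 scale_def scale_lc_comp[unfolded scale_def] split: list.split)

text \<open>A bracketing of unit configurations is a formula in \<open>\<uplus>\<close>, and
  substitution replaces each unit by its entry: \<open>(\<one>\<^sub>c \<uplus> \<one>\<^sub>c)
  \<uplus> \<one>\<^sub>c\<close> becomes \<open>(c \<uplus> d) \<uplus> e\<close>.\<close>

lemma csub_cten: "csub (cs \<uplus> ds) ess = csub cs (take (length cs) ess) \<uplus> csub ds (drop (length cs) ess)"
proof -
  have "csub (as @ bs) ess = csub as (take (length as) ess) @ csub bs (drop (length as) ess)" for as bs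
    unfolding csub_def by (simp add: zip_append1)
  then show ?thesis by (simp add: cten_def csub_scale)
qed

lemma scale_mix: "scale ((1 - t) *\<^sub>R c + t *\<^sub>R d) es = mixc t (scale c es) (scale d es)"
  by (auto simp: scale_def list_eq_iff_nth_eq nth_mixc lc_comp_def lc_map_def case_prod_unfold prod_eq_iff algebra_simps)

text \<open>Substitution is affine in the outer configuration while the inner ones are held fixed,
  so it maps straight paths to straight paths.\<close>

lemma csub_mixc: "length cs = length ds \<Longrightarrow> csub (mixc t cs ds) ess = mixc t (csub cs ess) (csub ds ess)"
proof (induction cs ds arbitrary: ess rule: list_induct2)
  case Nil then show ?case by (simp add: mixc_def)
next
  case (Cons c cs d ds)
  have m: "mixc t (c # cs) (d # ds) = ((1 - t) *\<^sub>R c + t *\<^sub>R d) # mixc t cs ds" by (simp add: mixc_def)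
  show ?case
  proof (cases ess)
    case Nil then show ?thesis by (simp add: csub_def mixc_def)
  next
    case (Cons es ess')
    have "csub (c # cs) ess = scale c es @ csub cs ess'" for c cs by (simp add: csub_def Cons)
    then show ?thesis unfolding m by (simp add: Cons.IH scale_mix mixc_append)
  qed
qed

lemma length_csub: "length cs = length dss \<Longrightarrow> length (csub cs dss) = sum_list (map length dss)"
  unfolding csub_def by (induction cs dss rule: list_induct2) auto

lemma valid_scale_bounds:
  assumes "valid ds" "fst c < snd c" "d \<in> set (scale c ds)"
  shows "fst c \<le> fst d \<and> fst d < snd d \<and> snd d \<le> snd c"
proof -
  obtain e where e: "e \<in> set ds" "d = lc_comp c e" using assms(3) by (auto simp: scale_def)
  have b: "0 \<le> fst e" "fst e < snd e" "snd e \<le> 1" using assms(1) e(1) by (auto simp: valid_def)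
  have "(snd c - fst c) * fst e < (snd c - fst c) * snd e" using b assms(2) by simp
  moreover have "(snd c - fst c) * snd e \<le> (snd c - fst c) * 1" using b assms(2) by (intro mult_left_mono) auto
  moreover have "0 \<le> (snd c - fst c) * fst e" using b assms(2) by simp
  ultimately show ?thesis by (simp add: e(2) lc_comp_def lc_map_def case_prod_unfold)
qed

text \<open>The second conjunct strengthens the induction: intervals coming from the tail lie inside
  intervals of the tail of \<open>cs\<close>, hence to the right of everything placed inside the
  head.\<close>

lemma valid_csub:
  "length cs = length dss \<Longrightarrow> valid cs \<Longrightarrow> (\<And>ds. ds \<in> set dss \<Longrightarrow> valid ds) \<Longrightarrow>
    valid (csub cs dss) \<and> (\<forall>d\<in>set (csub cs dss). \<exists>c\<in>set cs. fst c \<le> fst d \<and> snd d \<le> snd c)"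
proof (induction cs dss rule: list_induct2)
  case (Cons c cs ds dss)
  have cs: "csub (c # cs) (ds # dss) = scale c ds @ csub cs dss" by (simp add: csub_def)
  have c: "0 \<le> fst c" "fst c < snd c" "snd c \<le> 1" and v: "valid cs"
    and o: "\<And>d. d \<in> set cs \<Longrightarrow> snd c \<le> fst d" using Cons.prems(1) by (auto simp: valid_def)
  have IH: "valid (csub cs dss)" "\<And>d. d \<in> set (csub cs dss) \<Longrightarrow> \<exists>c\<in>set cs. fst c \<le> fst d \<and> snd d \<le> snd c"
    using Cons.IH[OF v] Cons.prems(2) by auto
  have ds: "valid ds" using Cons.prems(2) by simp
  note b = valid_scale_bounds[OF ds c(2)]
  have "sorted_wrt (\<lambda>c d. snd c \<le> fst d) (scale c ds)"
  proof -
    have "sorted_wrt (\<lambda>x y. snd x \<le> fst y) ds" using ds by (simp add: valid_def)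
    then have "sorted_wrt (\<lambda>x y. snd (lc_comp c x) \<le> fst (lc_comp c y)) ds"
      by (rule sorted_wrt_mono_rel[rotated]) (use c in \<open>auto simp: lc_comp_def lc_map_def case_prod_unfold intro!: mult_left_mono\<close>)
    then show ?thesis by (simp add: scale_def sorted_wrt_map)
  qed
  moreover have "snd x \<le> fst y" if x: "x \<in> set (scale c ds)" and y: "y \<in> set (csub cs dss)" for x y
  proof -
    obtain c' where "c' \<in> set cs" "fst c' \<le> fst y" using IH(2)[OF y] by blast
    then show ?thesis using b[OF x] o[of c'] by linarith
  qed
  moreover have "0 \<le> fst x \<and> fst x < snd x \<and> snd x \<le> 1" if "x \<in> set (scale c ds)" for x
    using b[OF that] c by linarith
  ultimately have "valid (csub (c # cs) (ds # dss))"
    using IH(1) unfolding cs valid_def sorted_wrt_append set_append by blast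
  moreover have "\<exists>c'\<in>set (c # cs). fst c' \<le> fst x \<and> snd x \<le> snd c'" if "x \<in> set (csub (c # cs) (ds # dss))" for x
  proof -
    have "x \<in> set (scale c ds) \<or> x \<in> set (csub cs dss)" using that by (simp add: cs)
    then show ?thesis
    proof
      assume "x \<in> set (scale c ds)"
      then show ?thesis using b by (intro bexI[of _ c]) auto
    next
      assume "x \<in> set (csub cs dss)"
      then show ?thesis using IH(2) by (meson list.set_intros(2))
    qed
  qed
  ultimately show ?case by blast
qed (simp add: csub_def)

definition tuple :: "'b list \<Rightarrow> nat \<Rightarrow> 'b" where
  "tuple xs = (\<lambda>i\<in>{..<length xs}. xs ! i)"

lemma lc_map_image:
  assumes "x < y" shows "lc_map (x, y) ` {0<..<1} \<subseteq> {x<..<y}"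
proof clarify
  fix t :: real assume t: "t \<in> {0<..<1}"
  then have "0 < (y - x) * t" "(y - x) * t < (y - x) * 1" using assms by (auto simp del: mult_1_right)
  then show "lc_map (x, y) t \<in> {x<..<y}" by (simp add: lc_map_def)
qed

text \<open>Ordered intervals can meet only at endpoints, and \<open>lc_map\<close> sends the open
  unit interval into the interior.\<close>

lemma tuple_C1: assumes "valid cs" shows "tuple cs \<in> C1 (length cs)"
proof -
  have v: "0 \<le> fst (cs ! i)" "fst (cs ! i) < snd (cs ! i)" "snd (cs ! i) \<le> 1" if "i < length cs" for i
    using assms that by (auto simp: valid_def)
  have o: "snd (cs ! i) \<le> fst (cs ! j)" if "i < j" "j < length cs" for i j
    using assms that by (auto simp: valid_def sorted_wrt_iff_nth_less)
  have im: "lc_map (cs ! i) ` {0<..<1} \<subseteq> {fst (cs ! i)<..<snd (cs ! i)}" if "i < length cs" for i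
    using lc_map_image[OF v(2)[OF that]] by simp
  have "lc_map (cs ! i) ` {0<..<1} \<inter> lc_map (cs ! j) ` {0<..<1} = {}"
    if "i < length cs" "j < length cs" "i \<noteq> j" for i j
  proof -
    have "{fst (cs ! i)<..<snd (cs ! i)} \<inter> {fst (cs ! j)<..<snd (cs ! j)} = {}"
      using o[of i j] o[of j i] that by (cases "i < j") auto
    then show ?thesis using im[OF that(1)] im[OF that(2)] by blast
  qed
  then show ?thesis using v by (simp add: C1_def tuple_def)
qed

section \<open>The algebra action in list form\<close>

context C1_algebra begin

definition act :: "conf \<Rightarrow> 'a list \<Rightarrow> 'a" where
  "act cs xs = \<theta> (length xs) (tuple cs) (tuple xs)"

lemma act_continuous: "continuous_map (prod_topology (Conf n) (list_top n X)) X (\<lambda>p. act (fst p) (snd p))"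
proof -
  let ?D = "prod_topology (Conf n) (list_top n X)"
  have l: "length (fst p) = n" "valid (fst p)" "length (snd p) = n" if "p \<in> topspace ?D" for p
    using that by (auto simp: topspace_list_top mem_Times_iff)
  have n1: "continuous_map ?D euclidean (\<lambda>p. fst p ! i)" "continuous_map ?D X (\<lambda>p. snd p ! i)" if "i < n" for i
    using continuous_map_compose[OF continuous_map_fst continuous_map_nth_Conf[OF that]]
      continuous_map_compose[OF continuous_map_snd continuous_map_nth[OF that]] by (simp_all add: o_def)
  have "continuous_map ?D (product_topology (\<lambda>_. euclidean) {..<n}) (\<lambda>p. \<lambda>i\<in>{..<n}. fst p ! i)"
    "continuous_map ?D (product_topology (\<lambda>_. X) {..<n}) (\<lambda>p. \<lambda>i\<in>{..<n}. snd p ! i)"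
    using n1 by (auto simp: continuous_map_componentwise)
  moreover have "(\<lambda>i\<in>{..<n}. fst p ! i) \<in> C1 n" if "p \<in> topspace ?D" for p
    using tuple_C1[OF l(2)[OF that]] l(1)[OF that] by (simp add: tuple_def)
  ultimately have "continuous_map ?D (prod_topology (C1_top n) (product_topology (\<lambda>_. X) {..<n}))
      (\<lambda>p. (\<lambda>i\<in>{..<n}. fst p ! i, \<lambda>i\<in>{..<n}. snd p ! i))"
    by (simp add: continuous_map_pairwise o_def C1_top_def continuous_map_in_subtopology image_subset_iff_funcset Pi_iff)
  from continuous_map_compose[OF this action_continuous]
  show ?thesis
    by (rule continuous_map_eq) (use l in \<open>simp add: act_def tuple_def\<close>)
qed

lemma act_unit: "x \<in> topspace X \<Longrightarrow> act \<one>\<^sub>c [x] = x"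
proof -
  assume x: "x \<in> topspace X"
  have "tuple \<one>\<^sub>c = C1_unit" "tuple [x] = (\<lambda>i\<in>{..<1}. x)" by (auto simp: tuple_def C1_unit_def restrict_def)
  then show ?thesis using action_unit[OF x] by (simp add: act_def)
qed

lemma act_csub:
  assumes cs: "valid cs" "length cs = length xss" and dss: "length dss = length xss"
    "\<And>i. i < length xss \<Longrightarrow> valid (dss ! i) \<and> length (dss ! i) = length (xss ! i) \<and> set (xss ! i) \<subseteq> topspace X"
  shows "act cs (map (\<lambda>(ds, xs). act ds xs) (zip dss xss)) = act (csub cs dss) (concat xss)"
proof -
  let ?k = "length xss" and ?n = "\<lambda>i. length (xss ! i)"
  let ?d = "\<lambda>i. tuple (dss ! i)" and ?x = "\<lambda>i. tuple (xss ! i)"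
  have "\<theta> (sum ?n {..<?k}) (C1_mult ?k ?n (tuple cs) ?d) (concat_tuple ?k ?n ?x)
      = \<theta> ?k (tuple cs) (\<lambda>i\<in>{..<?k}. \<theta> (?n i) (?d i) (?x i))"
  proof (rule action_mult)
    show "tuple cs \<in> C1 ?k" using tuple_C1[OF cs(1)] cs(2) by simp
    show "?d i \<in> C1 (?n i)" if "i < ?k" for i using tuple_C1[of "dss ! i"] dss(2)[OF that] by simp
    show "?x i \<in> {..<?n i} \<rightarrow>\<^sub>E topspace X" if "i < ?k" for i
      using dss(2)[OF that] by (auto simp: tuple_def subset_iff)
  qed
  moreover have "concat_tuple ?k ?n ?x = tuple (concat xss)"
    unfolding tuple_def by (rule concat_tuple_concat) simp_all
  moreover have "C1_mult ?k ?n (tuple cs) ?d = tuple (csub cs dss)"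
  proof -
    let ?ess = "map (\<lambda>(c, ds). scale c ds) (zip cs dss)"
    have l: "length ?ess = ?k" using cs dss by simp
    have e: "?ess ! i = scale (cs ! i) (dss ! i)" if "i < ?k" for i using that cs dss by simp
    have "concat_tuple (length ?ess) ?n (\<lambda>i r. lc_comp (tuple cs i) (?d i r)) = (\<lambda>m\<in>{..<length (concat ?ess)}. concat ?ess ! m)"
      by (rule concat_tuple_concat) (use cs dss in \<open>simp_all add: tuple_def scale_def\<close>)
    then show ?thesis unfolding l by (simp add: C1_mult_def tuple_def csub_def)
  qed
  moreover have "(\<lambda>i\<in>{..<?k}. \<theta> (?n i) (?d i) (?x i)) = tuple (map (\<lambda>(ds, xs). act ds xs) (zip dss xss))"
    using dss by (auto simp: tuple_def act_def restrict_def)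
  ultimately show ?thesis
    using cs dss by (simp add: act_def length_concat_sum)
qed

definition ok :: "conf \<Rightarrow> 'a list \<Rightarrow> bool" where
  "ok cs xs \<longleftrightarrow> valid cs \<and> length cs = length xs \<and> set xs \<subseteq> topspace X"

lemma ok_unit [simp]: "ok \<one>\<^sub>c [x] \<longleftrightarrow> x \<in> topspace X"
  by (simp add: ok_def)

lemma ok_Nil [simp]: "ok [] []"
  by (simp add: ok_def)

lemma ok_cten [simp]: "ok cs xs \<Longrightarrow> ok ds ys \<Longrightarrow> ok (cs \<uplus> ds) (xs @ ys)"
  by (simp add: ok_def)

lemma ok_mixc: "ok cs xs \<Longrightarrow> ok ds xs \<Longrightarrow> t \<in> {0..1} \<Longrightarrow> ok (mixc t cs ds) xs"
  by (simp add: ok_def valid_mixc)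

lemma act_in: "ok cs xs \<Longrightarrow> act cs xs \<in> topspace X"
  using continuous_map_image_subset_topspace[OF act_continuous[of "length xs"]]
  by (force simp: ok_def topspace_list_top)

lemma act_substitute:
  assumes "valid cs" "length cs = length xss" "list_all2 ok dss xss"
  shows "act cs (map (\<lambda>(ds, xs). act ds xs) (zip dss xss)) = act (csub cs dss) (concat xss)"
  by (rule act_csub) (use assms in \<open>auto simp: list_all2_conv_all_nth ok_def\<close>)

definition T :: "'a \<Rightarrow> 'a \<Rightarrow> 'a" where "T x y = act (\<one>\<^sub>c \<uplus> \<one>\<^sub>c) [x, y]"

text \<open>A product of two values of the action becomes one action on all the factors, and the
  bracketing is visible only in the configuration. The objects in the coherence axioms are brought
  to this form.\<close>

lemma T_act: "ok cs xs \<Longrightarrow> ok ds ys \<Longrightarrow> T (act cs xs) (act ds ys) = act (cs \<uplus> ds) (xs @ ys)"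
  using act_substitute[of "\<one>\<^sub>c \<uplus> \<one>\<^sub>c" "[xs, ys]" "[cs, ds]"] by (simp add: T_def csub_cten)

sublocale tensor X T
proof
  have "continuous_map (prod_topology X X) (prod_topology (Conf 2) (list_top 2 X)) (\<lambda>p. (\<one>\<^sub>c \<uplus> \<one>\<^sub>c, [fst p, snd p]))"
    by (auto simp: continuous_map_pairwise o_def continuous_map_list_top less_Suc_eq numeral_2_eq_2 continuous_map_fst continuous_map_snd)
  from continuous_map_compose[OF this act_continuous]
  show "continuous_map (prod_topology X X) X (\<lambda>x. T (fst x) (snd x))" by (simp add: T_def o_def)
qed

end


section \<open>Continuity of tensor and substitution of configurations\<close>

lemma continuous_map_euclidean_compose:
  fixes F :: "'b::topological_space \<Rightarrow> 'c::topological_space"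
  assumes "continuous_map Z euclidean f" "continuous_on UNIV F"
  shows "continuous_map Z euclidean (\<lambda>z. F (f z))"
  using continuous_map_compose[OF assms(1), of euclidean F] assms(2) by (simp add: o_def)

lemma lc_comp_expand: "lc_comp c d = ((snd c - fst c) * fst d + fst c, (snd c - fst c) * snd d + fst c)"
  by (simp add: lc_comp_def lc_map_def case_prod_unfold)

lemma lc_comp_continuous: "continuous_on UNIV (lc_comp c)" "continuous_on UNIV (\<lambda>c. lc_comp c d)"
  unfolding lc_comp_expand
  by (rule continuous_on_Pair; rule continuous_on_add; auto intro!: continuous_on_mult continuous_on_diff
      continuous_on_fst continuous_on_snd continuous_on_id continuous_on_const)+

lemma cten_continuous:
  assumes "continuous_map Z (Conf n) f" "continuous_map Z (Conf m) g"
  shows "continuous_map Z (Conf (n + m)) (\<lambda>z. f z \<uplus> g z)"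
  unfolding continuous_map_Conf
proof (intro conjI ballI allI impI)
  have l: "length (f z) = n" "valid (f z)" "length (g z) = m" "valid (g z)" if "z \<in> topspace Z" for z
    using iffD1[OF continuous_map_Conf assms(1)] iffD1[OF continuous_map_Conf assms(2)] that by blast+
  then show "length (f z \<uplus> g z) = n + m" "valid (f z \<uplus> g z)" if "z \<in> topspace Z" for z
    using that by simp_all
  fix i assume i: "i < n + m"
  show "continuous_map Z euclidean (\<lambda>z. (f z \<uplus> g z) ! i)"
  proof (cases "i < n")
    case True
    have "continuous_map Z euclidean (\<lambda>z. lc_comp (0, 1/2) (f z ! i))"
      using assms(1) True by (intro continuous_map_euclidean_compose[OF _ lc_comp_continuous(1)]) (simp add: continuous_map_Conf)
    then show ?thesis
      by (rule continuous_map_eq) (use l True in \<open>simp add: cten_def nth_append scale_def\<close>)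
  next
    case False
    have "continuous_map Z euclidean (\<lambda>z. lc_comp (1/2, 1) (g z ! (i - n)))"
      using assms(2) i False by (intro continuous_map_euclidean_compose[OF _ lc_comp_continuous(1)]) (simp add: continuous_map_Conf)
    then show ?thesis
      by (rule continuous_map_eq) (use l i False in \<open>simp add: cten_def nth_append scale_def\<close>)
  qed
qed

text \<open>Only the length and the entrywise continuity are carried through the induction on the
  substituted list; validity is added in \<open>csub_continuous\<close>.\<close>

lemma csub_nth_continuous:
  assumes "\<And>z. z \<in> topspace Z \<Longrightarrow> length (f z) = length dss"
    and "\<And>i. i < length dss \<Longrightarrow> continuous_map Z euclidean (\<lambda>z. f z ! i)"
    and "i < sum_list (map length dss)"
  shows "continuous_map Z euclidean (\<lambda>z. csub (f z) dss ! i)"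
  using assms
proof (induction dss arbitrary: f i)
  case (Cons ds dss)
  have e: "csub (f z) (ds # dss) = scale (f z ! 0) ds @ csub (tl (f z)) dss" if "z \<in> topspace Z" for z
    using Cons.prems(1)[OF that] by (cases "f z") (simp_all add: csub_def)
  show ?case
  proof (cases "i < length ds")
    case True
    have "continuous_map Z euclidean (\<lambda>z. lc_comp (f z ! 0) (ds ! i))"
      using Cons.prems(2)[of 0] by (intro continuous_map_euclidean_compose[OF _ lc_comp_continuous(2)]) simp
    then show ?thesis
      by (rule continuous_map_eq) (use True in \<open>simp add: e nth_append scale_def\<close>)
  next
    case False
    have "continuous_map Z euclidean (\<lambda>z. csub (tl (f z)) dss ! (i - length ds))"
    proof (rule Cons.IH)
      show "length (tl (f z)) = length dss" if "z \<in> topspace Z" for z using Cons.prems(1)[OF that] by simp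
      show "continuous_map Z euclidean (\<lambda>z. tl (f z) ! j)" if j: "j < length dss" for j
        by (rule continuous_map_eq[of _ _ "\<lambda>z. f z ! Suc j"])
          (use Cons.prems(1) Cons.prems(2)[of "Suc j"] j in \<open>simp_all add: nth_tl\<close>)
    qed (use False Cons.prems(3) in simp)
    then show ?thesis
      by (rule continuous_map_eq) (use False in \<open>simp add: e nth_append\<close>)
  qed
qed simp

lemma csub_continuous:
  assumes "\<And>ds. ds \<in> set dss \<Longrightarrow> valid ds"
  shows "continuous_map (Conf (length dss)) (Conf (sum_list (map length dss))) (\<lambda>c. csub c dss)"
  unfolding continuous_map_Conf
proof (intro conjI ballI allI impI)
  fix c assume "c \<in> topspace (Conf (length dss))"
  then show "length (csub c dss) = sum_list (map length dss)" "valid (csub c dss)"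
    using valid_csub[of c dss] assms by (simp_all add: length_csub)
next
  fix i assume "i < sum_list (map length dss)"
  then show "continuous_map (Conf (length dss)) euclidean (\<lambda>c. csub c dss ! i)"
    by (intro csub_nth_continuous) (simp_all add: continuous_map_nth_Conf)
qed

text \<open>The lift of the pointwise product \<open>tens1\<close> to paths of configurations, as
  \<open>tens1_K\<close> shows.\<close>

definition ctp :: "(real \<Rightarrow> conf) \<Rightarrow> (real \<Rightarrow> conf) \<Rightarrow> real \<Rightarrow> conf" where
  "ctp p q = (\<lambda>t\<in>{0..1}. p t \<uplus> q t)"

lemma ctp_01 [simp]: "ctp p q 0 = p 0 \<uplus> q 0" "ctp p q 1 = p 1 \<uplus> q 1"
  by (simp_all add: ctp_def)

lemma ctp_concat: "ctp (concat_path p q) (concat_path p' q') = concat_path (ctp p p') (ctp q q')"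
  by (rule path_eqI) (auto simp: ctp_def concat_path_def)

lemma ctp_const_concat:
  "ctp (const_path c) (concat_path p q) = concat_path (ctp (const_path c) p) (ctp (const_path c) q)"
  "ctp (concat_path p q) (const_path c) = concat_path (ctp p (const_path c)) (ctp q (const_path c))"
  by (rule path_eqI; auto simp: ctp_def concat_path_def const_path_def)+

lemma mixc_refl [simp]: "mixc t c c = c"
  by (auto simp: list_eq_iff_nth_eq nth_mixc scaleR_add_left[symmetric])

lemma ctp_cedge:
  "length a = length b \<Longrightarrow> length c = length d \<Longrightarrow> ctp (cedge a b) (cedge c d) = cedge (a \<uplus> c) (b \<uplus> d)"
  "length a = length b \<Longrightarrow> ctp (cedge a b) (const_path c) = cedge (a \<uplus> c) (b \<uplus> c)"
  "length a = length b \<Longrightarrow> ctp (const_path c) (cedge a b) = cedge (c \<uplus> a) (c \<uplus> b)"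
  "ctp (const_path c) (const_path d) = const_path (c \<uplus> d)"
  by (rule path_eqI; auto simp: ctp_def cedge_def const_path_def cten_mixc cten_mixc[of a b c c, simplified]
      cten_mixc[of c c a b, simplified])+

lemma ctp_paths:
  "p \<in> paths (Conf n) \<Longrightarrow> q \<in> paths (Conf m) \<Longrightarrow> ctp p q \<in> paths (Conf (n + m))"
proof -
  assume "p \<in> paths (Conf n)" "q \<in> paths (Conf m)"
  from cten_continuous[OF this[THEN paths_cont]] have "continuous_map Itop (Conf (n + m)) (ctp p q)"
    by (rule continuous_map_eq) (simp add: ctp_def)
  then show ?thesis by (simp add: paths_def pathin_def ctp_def)
qed

lemma htpy_cten:
  assumes H: "htpy (Conf n) p q H" and K: "htpy (Conf m) p' q' K"
  shows "htpy (Conf (n + m)) (ctp p p') (ctp q q') (\<lambda>z. H z \<uplus> K z)"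
  using cten_continuous[OF htpyD(1)[OF H] htpyD(1)[OF K]] htpyD(2-)[OF H] htpyD(2-)[OF K]
  by (simp add: htpy_def ctp_def)

section \<open>Two-cells named by paths of configurations\<close>

context C1_algebra begin

definition imK :: "'a list \<Rightarrow> (real \<Rightarrow> conf) \<Rightarrow> real \<Rightarrow> 'a" where
  "imK xs p = im_path (\<lambda>c. act c xs) p"

text \<open>The list of points is an explicit argument, so that the tensor of two such cells is
  again one, over the appended list.\<close>

definition K :: "'a list \<Rightarrow> (real \<Rightarrow> conf) \<Rightarrow> (real \<Rightarrow> conf) \<Rightarrow> (real \<times> real \<Rightarrow> 'a) set" where
  "K xs p q = lift X (Conf (length xs)) (\<lambda>c. act c xs) p q"

text \<open>The side condition of the rules for \<open>K\<close> and \<open>imK\<close>. It holds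
  for constant and straight paths and is preserved by concatenation and tensor, so rewriting can
  discharge it.\<close>

definition kp :: "'a list \<Rightarrow> (real \<Rightarrow> conf) \<Rightarrow> bool" where
  "kp xs p \<longleftrightarrow> p \<in> paths (Conf (length xs)) \<and> set xs \<subseteq> topspace X"

lemma K_lifting:
  assumes "set xs \<subseteq> topspace X" shows "lifting X (Conf (length xs)) (\<lambda>c. act c xs)"
proof
  show "continuous_map (Conf (length xs)) X (\<lambda>c. act c xs)"
    using continuous_map_compose[OF _ act_continuous[of "length xs"], of "Conf (length xs)" "\<lambda>c. (c, xs)"] assms
    by (simp add: o_def continuous_map_pairwise topspace_list_top)
qed simp

lemma kp_cedge: "valid a \<Longrightarrow> valid b \<Longrightarrow> length a = length xs \<Longrightarrow> length b = length xs \<Longrightarrow> set xs \<subseteq> topspace X \<Longrightarrow> kp xs (cedge a b)"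
  by (simp add: kp_def cedge_paths)

lemma kp_const: "valid a \<Longrightarrow> length a = length xs \<Longrightarrow> set xs \<subseteq> topspace X \<Longrightarrow> kp xs (const_path a)"
  by (simp add: kp_def)

lemma kp_concat: "kp xs p \<Longrightarrow> kp xs q \<Longrightarrow> p 1 = q 0 \<Longrightarrow> kp xs (concat_path q p)"
  by (simp add: kp_def concat_path_paths)

lemma kp_ctp: "kp xs p \<Longrightarrow> kp ys q \<Longrightarrow> kp (xs @ ys) (ctp p q)"
  by (simp add: kp_def ctp_paths)

lemma imK_01 [simp]: "imK xs p 0 = act (p 0) xs" "imK xs p 1 = act (p 1) xs"
  by (simp_all add: imK_def)

lemma K_vcmp:
  "kp xs p \<Longrightarrow> kp xs q \<Longrightarrow> kp xs r \<Longrightarrow> p 0 = q 0 \<Longrightarrow> p 1 = q 1 \<Longrightarrow> q 0 = r 0 \<Longrightarrow> q 1 = r 1 \<Longrightarrow>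
    vcmp (\<Pi>\<^sub>2 X) (K xs q r) (K xs p q) = K xs p r"
  unfolding K_def imK_def by (rule lifting.lift_vcmp[OF K_lifting]) (simp_all add: kp_def parallel_def)

lemma K_hcmp:
  "kp xs p \<Longrightarrow> kp xs p' \<Longrightarrow> kp xs q \<Longrightarrow> kp xs q' \<Longrightarrow> p 0 = p' 0 \<Longrightarrow> p 1 = p' 1 \<Longrightarrow> q 0 = q' 0 \<Longrightarrow> q 1 = q' 1 \<Longrightarrow> p 1 = q 0 \<Longrightarrow>
    hcmp (\<Pi>\<^sub>2 X) (K xs q q') (K xs p p') = K xs (concat_path q p) (concat_path q' p')"
  unfolding K_def imK_def by (rule lifting.lift_hcmp[OF K_lifting]) (simp_all add: kp_def parallel_def)

lemma K_inv: "kp xs p \<Longrightarrow> kp xs q \<Longrightarrow> p 0 = q 0 \<Longrightarrow> p 1 = q 1 \<Longrightarrow> inv2 (\<Pi>\<^sub>2 X) (K xs p q) = K xs q p"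
  unfolding K_def imK_def by (rule lifting.lift_inv[OF K_lifting]) (simp_all add: kp_def parallel_def)

lemma K_id: "kp xs p \<Longrightarrow> id2 (\<Pi>\<^sub>2 X) (imK xs p) = K xs p p"
  unfolding K_def imK_def by (rule lifting.lift_id[OF K_lifting]) (simp_all add: kp_def parallel_def)

lemma K_asc:
  "kp xs p \<Longrightarrow> kp xs q \<Longrightarrow> kp xs r \<Longrightarrow> p 1 = q 0 \<Longrightarrow> q 1 = r 0 \<Longrightarrow>
    asc (\<Pi>\<^sub>2 X) (imK xs r) (imK xs q) (imK xs p) = K xs (concat_path (concat_path r q) p) (concat_path r (concat_path q p))"
  unfolding K_def imK_def by (rule lifting.lift_asc[OF K_lifting]) (simp_all add: kp_def parallel_def)

lemma K_lun: "kp xs p \<Longrightarrow> lun (\<Pi>\<^sub>2 X) (imK xs p) = K xs (concat_path (const_path (p 1)) p) p"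
  unfolding K_def imK_def by (rule lifting.lift_lun[OF K_lifting]) (simp_all add: kp_def parallel_def)

lemma K_run: "kp xs p \<Longrightarrow> run (\<Pi>\<^sub>2 X) (imK xs p) = K xs (concat_path p (const_path (p 0))) p"
  unfolding K_def imK_def by (rule lifting.lift_run[OF K_lifting]) (simp_all add: kp_def parallel_def)

lemma imK_concat: "concat_path (imK xs q) (imK xs p) = imK xs (concat_path q p)"
  by (simp add: imK_def im_concat)

lemma imK_const: "const_path (act c xs) = imK xs (const_path c)"
  by (simp add: imK_def im_const)

lemma tens1_K:
  assumes "kp xs p" "kp ys q" shows "tens1 (imK xs p) (imK ys q) = imK (xs @ ys) (ctp p q)"
proof (rule path_eqI)
  fix t :: real assume t: "t \<in> {0..1}"
  have "ok (p t) xs" "ok (q t) ys"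
    using assms paths_topspace[OF _ t, of p "Conf (length xs)"] paths_topspace[OF _ t, of q "Conf (length ys)"]
    by (simp_all add: kp_def ok_def)
  then show "tens1 (imK xs p) (imK ys q) t = imK (xs @ ys) (ctp p q) t"
    using t by (simp add: tens1_def imK_def ctp_def T_act)
qed (simp_all add: tens1_def imK_def)

text \<open>The factors lift to different configuration spaces; joining their fillings by
  \<open>\<uplus>\<close> gives a filling in the space for the appended list.\<close>

lemma tens2_K:
  assumes "kp xs p" "kp xs q" "p 0 = q 0" "p 1 = q 1" "kp ys p'" "kp ys q'" "p' 0 = q' 0" "p' 1 = q' 1"
  shows "tens2 (K xs p q) (K ys p' q') = K (xs @ ys) (ctp p p') (ctp q q')"
proof -
  have xs: "set xs \<subseteq> topspace X" and ys: "set ys \<subseteq> topspace X" using assms by (auto simp: kp_def)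
  interpret A: lifting X "Conf (length xs)" "\<lambda>c. act c xs" by (rule K_lifting[OF xs])
  interpret B: lifting X "Conf (length ys)" "\<lambda>c. act c ys" by (rule K_lifting[OF ys])
  interpret C: lifting X "Conf (length (xs @ ys))" "\<lambda>c. act c (xs @ ys)" by (rule K_lifting) (use xs ys in simp)
  have par: "parallel (Conf (length xs)) p q" "parallel (Conf (length ys)) p' q'"
    using assms by (auto simp: kp_def parallel_def)
  obtain H where H: "htpy (Conf (length xs)) p q H" "K xs p q = homotopy_class X (\<lambda>z. act (H z) xs)"
      "htpy X (im_path (\<lambda>c. act c xs) p) (im_path (\<lambda>c. act c xs) q) (\<lambda>z. act (H z) xs)"
    unfolding K_def by (rule A.liftE[OF par(1)])
  obtain L where L: "htpy (Conf (length ys)) p' q' L" "K ys p' q' = homotopy_class X (\<lambda>z. act (L z) ys)"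
      "htpy X (im_path (\<lambda>c. act c ys) p') (im_path (\<lambda>c. act c ys) q') (\<lambda>z. act (L z) ys)"
    unfolding K_def by (rule B.liftE[OF par(2)])
  have "homotopy_class X (\<lambda>z. T (act (H z) xs) (act (L z) ys)) = K (xs @ ys) (ctp p p') (ctp q q')"
    unfolding K_def
  proof (rule C.liftI)
    show "htpy (Conf (length (xs @ ys))) (ctp p p') (ctp q q') (\<lambda>z. H z \<uplus> L z)"
      using htpy_cten[OF H(1) L(1)] by simp
    fix z assume z: "z \<in> unit_square"
    then have "H z \<in> topspace (Conf (length xs))" "L z \<in> topspace (Conf (length ys))"
      using continuous_map_image_subset_topspace[OF htpyD(1)[OF H(1)]]
        continuous_map_image_subset_topspace[OF htpyD(1)[OF L(1)]] by (auto simp del: topspace_Conf)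
    then show "T (act (H z) xs) (act (L z) ys) = act (H z \<uplus> L z) (xs @ ys)"
      using xs ys by (intro T_act) (auto simp: ok_def)
  qed
  then show ?thesis unfolding H(2) L(2) tens2_class[OF H(3) L(3)] .
qed

lemma list_all2_ok:
  "list_all2 ok dss xss \<Longrightarrow>
    (\<forall>ds\<in>set dss. valid ds) \<and> map length dss = map length xss \<and> set (concat xss) \<subseteq> topspace X"
proof (induction dss xss rule: list_all2_induct)
  case (Cons ds dss xs xss)
  then have "valid ds" "length ds = length xs" "set xs \<subseteq> topspace X" by (simp_all add: ok_def)
  then show ?case using Cons.IH by simp
qed simp

text \<open>Replacing each point by a value of the action amounts to substituting into the paths of
  configurations. Structural cells at compound objects are thereby lifted to the configuration space
  of all elementary factors.\<close>

lemma K_substitute: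
  assumes "list_all2 ok dss xss" "kp ys p" "kp ys q" "p 0 = q 0" "p 1 = q 1"
    and ys: "ys = map (\<lambda>(ds, xs). act ds xs) (zip dss xss)"
  shows "K ys p q = K (concat xss) (im_path (\<lambda>c. csub c dss) p) (im_path (\<lambda>c. csub c dss) q)"
  unfolding K_def
proof (rule lift_reindex)
  have l: "length dss = length xss" using assms(1) by (rule list_all2_lengthD)
  have L: "length ys = length xss" using l ys by simp
  note o = list_all2_ok[OF assms(1)]
  then show "continuous_map (Conf (length ys)) (Conf (length (concat xss))) (\<lambda>c. csub c dss)"
    using csub_continuous[of dss] l L by (simp add: length_concat)
  from lifting.cont[OF K_lifting[OF o[THEN conjunct2, THEN conjunct2]]]
  show "continuous_map (Conf (length (concat xss))) X (\<lambda>c. act c (concat xss))" .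
  show "parallel (Conf (length ys)) p q" using assms by (simp add: kp_def parallel_def)
  show "act c ys = act (csub c dss) (concat xss)" if "c \<in> topspace (Conf (length ys))" for c
    using act_substitute[OF _ _ assms(1), of c] that L by (simp add: ys)
qed simp_all

lemma imK_substitute:
  assumes "list_all2 ok dss xss" "kp ys p" and ys: "ys = map (\<lambda>(ds, xs). act ds xs) (zip dss xss)"
  shows "imK ys p = imK (concat xss) (im_path (\<lambda>c. csub c dss) p)"
  unfolding imK_def
proof (rule path_eqI)
  fix t :: real assume t: "t \<in> {0..1}"
  have "length ys = length xss" using list_all2_lengthD[OF assms(1)] ys by simp
  then show "im_path (\<lambda>c. act c ys) p t = im_path (\<lambda>c. act c (concat xss)) (im_path (\<lambda>c. csub c dss) p) t"
    using act_substitute[OF _ _ assms(1), of "p t"] paths_topspace[of p "Conf (length ys)" t] assms(2) t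
    by (simp add: ys kp_def)
qed simp_all

end

lemma im_csub_cedge: "length a = length b \<Longrightarrow> im_path (\<lambda>c. csub c dss) (cedge a b) = cedge (csub a dss) (csub b dss)"
  by (rule path_eqI) (auto simp: im_path_def cedge_def csub_mixc)


section \<open>The monoidal structure\<close>

context C1_algebra begin

abbreviation "B \<equiv> \<Pi>\<^sub>2 X"

definition cs1 :: "('a, real \<Rightarrow> 'a, (real \<times> real \<Rightarrow> 'a) set, 'a) coord list" where
  "cs1 = [(\<lambda>x. x, \<lambda>x. x, \<lambda>x. x)]"

definition cs2 :: "('a \<times> 'a, (real \<Rightarrow> 'a) \<times> (real \<Rightarrow> 'a), (real \<times> real \<Rightarrow> 'a) set \<times> (real \<times> real \<Rightarrow> 'a) set, 'a) coord list" where
  "cs2 = [(fst, fst, fst), (snd, snd, snd)]"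

definition cs3 :: "('a \<times> 'a \<times> 'a, (real \<Rightarrow> 'a) \<times> (real \<Rightarrow> 'a) \<times> (real \<Rightarrow> 'a),
    (real \<times> real \<Rightarrow> 'a) set \<times> (real \<times> real \<Rightarrow> 'a) set \<times> (real \<times> real \<Rightarrow> 'a) set, 'a) coord list" where
  "cs3 = [(fst, fst, fst), (fst \<circ> snd, fst \<circ> snd, fst \<circ> snd), (snd \<circ> snd, snd \<circ> snd, snd \<circ> snd)]"

definition cs4 :: "('a \<times> 'a \<times> 'a \<times> 'a, (real \<Rightarrow> 'a) \<times> (real \<Rightarrow> 'a) \<times> (real \<Rightarrow> 'a) \<times> (real \<Rightarrow> 'a),
    (real \<times> real \<Rightarrow> 'a) set \<times> (real \<times> real \<Rightarrow> 'a) set \<times> (real \<times> real \<Rightarrow> 'a) set \<times> (real \<times> real \<Rightarrow> 'a) set, 'a) coord list" where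
  "cs4 = [(fst, fst, fst), (fst \<circ> snd, fst \<circ> snd, fst \<circ> snd), (fst \<circ> snd \<circ> snd, fst \<circ> snd \<circ> snd, fst \<circ> snd \<circ> snd),
     (snd \<circ> snd \<circ> snd, snd \<circ> snd \<circ> snd, snd \<circ> snd \<circ> snd)]"

lemma cd: "coordinate (B \<times>\<^sub>B C) X fst fst fst" "coordinate (C' \<times>\<^sub>B B) X snd snd snd"
  using coordinate_fst[OF coordinate_id] coordinate_snd[OF coordinate_id] by (simp_all add: comp_def)

lemma coordinates1: "coordinates B X cs1"
  by (simp add: coordinates_def coordinates_axioms_def precategory2_fundamental cs1_def coordinate_id)

lemma coordinates2: "coordinates (B \<times>\<^sub>B B) X cs2"
  by (simp add: coordinates_def coordinates_axioms_def precategory2_fundamental precategory2_prod cs2_def cd)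

lemma coordinates3: "coordinates (B \<times>\<^sub>B B \<times>\<^sub>B B) X cs3"
  by (simp add: coordinates_def coordinates_axioms_def precategory2_fundamental precategory2_prod cs3_def cd coordinate_snd[OF cd(1)] coordinate_snd[OF cd(2)])

lemma coordinates4: "coordinates (B \<times>\<^sub>B B \<times>\<^sub>B B \<times>\<^sub>B B) X cs4"
  by (simp add: coordinates_def coordinates_axioms_def precategory2_fundamental precategory2_prod cs4_def cd
      coordinate_snd[OF cd(1)] coordinate_snd[OF coordinate_snd[OF cd(1)]] coordinate_snd[OF coordinate_snd[OF cd(2)]])

lemma len_cs [simp]: "length cs1 = 1" "length cs2 = 2" "length cs3 = 3" "length cs4 = 4"
  by (simp_all add: cs1_def cs2_def cs3_def cs4_def)

lemmas rep1 = coordinates.coords_representation[OF coordinates1, unfolded len_cs]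
lemmas rep2 = coordinates.coords_representation[OF coordinates2, unfolded len_cs]
lemmas rep3 = coordinates.coords_representation[OF coordinates3, unfolded len_cs]
lemmas rep4 = coordinates.coords_representation[OF coordinates4, unfolded len_cs]

definition act' :: "conf \<times> 'a list \<Rightarrow> 'a" where "act' p = act (fst p) (snd p)"

text \<open>The straight path from \<open>[(0, 1/4), (1/4, 1/2), (1/2, 1)]\<close> to
  \<open>[(0, 1/2), (1/2, 3/4), (3/4, 1)]\<close>, the intervals of the two bracketings of a triple
  product.\<close>

definition assoc_path :: "real \<Rightarrow> conf" where
  "assoc_path = cedge ((\<one>\<^sub>c \<uplus> \<one>\<^sub>c) \<uplus> \<one>\<^sub>c) (\<one>\<^sub>c \<uplus> (\<one>\<^sub>c \<uplus> \<one>\<^sub>c))"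

definition asq0 where
  "asq0 = representation.path_adjeq (coords0 cs3) (coords1 cs3) X (Conf 3) act' assoc_path"

text \<open>The unit object is the action of the empty configuration, so the unit times
  \<open>x\<close> is the action of the single interval \<open>(1/2, 1)\<close> on \<open>x\<close>,
  which expands to \<open>(0, 1)\<close>. For the right unit the interval is
  \<open>(0, 1/2)\<close>.\<close>

definition luq0 where
  "luq0 = representation.path_adjeq (coords0 cs1) (coords1 cs1) X (Conf 1) act' (cedge ([] \<uplus> \<one>\<^sub>c) \<one>\<^sub>c)"

definition ruq0 where
  "ruq0 = representation.path_adjeq (coords0 cs1) (coords1 cs1) X (Conf 1) act' (cedge (\<one>\<^sub>c \<uplus> []) \<one>\<^sub>c)"

text \<open>These paths take configurations as arguments although \<open>M\<close> uses them at
  \<open>\<one>\<^sub>c\<close> only: substituting into the path at units gives the path at the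
  substituted configurations, so components at compound objects keep the same shape.\<close>

definition pi_src :: "conf \<Rightarrow> conf \<Rightarrow> conf \<Rightarrow> conf \<Rightarrow> real \<Rightarrow> conf" where
  "pi_src a b c d = concat_path (cedge (a \<uplus> ((b \<uplus> c) \<uplus> d)) (a \<uplus> (b \<uplus> (c \<uplus> d))))
     (concat_path (cedge ((a \<uplus> (b \<uplus> c)) \<uplus> d) (a \<uplus> ((b \<uplus> c) \<uplus> d)))
        (cedge (((a \<uplus> b) \<uplus> c) \<uplus> d) ((a \<uplus> (b \<uplus> c)) \<uplus> d)))"

definition pi_trg :: "conf \<Rightarrow> conf \<Rightarrow> conf \<Rightarrow> conf \<Rightarrow> real \<Rightarrow> conf" where
  "pi_trg a b c d = concat_path (cedge ((a \<uplus> b) \<uplus> (c \<uplus> d)) (a \<uplus> (b \<uplus> (c \<uplus> d))))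
     (cedge (((a \<uplus> b) \<uplus> c) \<uplus> d) ((a \<uplus> b) \<uplus> (c \<uplus> d)))"

definition mu_src :: "conf \<Rightarrow> conf \<Rightarrow> real \<Rightarrow> conf" where
  "mu_src a b = concat_path (cedge (a \<uplus> ([] \<uplus> b)) (a \<uplus> b))
     (concat_path (cedge ((a \<uplus> []) \<uplus> b) (a \<uplus> ([] \<uplus> b))) (cedge (a \<uplus> b) ((a \<uplus> []) \<uplus> b)))"

definition lam_src :: "conf \<Rightarrow> conf \<Rightarrow> real \<Rightarrow> conf" where
  "lam_src a b = cedge (([] \<uplus> a) \<uplus> b) (a \<uplus> b)"

definition lam_trg :: "conf \<Rightarrow> conf \<Rightarrow> real \<Rightarrow> conf" where
  "lam_trg a b = concat_path (cedge ([] \<uplus> (a \<uplus> b)) (a \<uplus> b)) (cedge (([] \<uplus> a) \<uplus> b) ([] \<uplus> (a \<uplus> b)))"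

definition rho_src :: "conf \<Rightarrow> conf \<Rightarrow> real \<Rightarrow> conf" where
  "rho_src a b = cedge (a \<uplus> b) (a \<uplus> (b \<uplus> []))"

definition rho_trg :: "conf \<Rightarrow> conf \<Rightarrow> real \<Rightarrow> conf" where
  "rho_trg a b = concat_path (cedge ((a \<uplus> b) \<uplus> []) (a \<uplus> (b \<uplus> []))) (cedge (a \<uplus> b) ((a \<uplus> b) \<uplus> []))"

definition M :: "('a, real \<Rightarrow> 'a, (real \<times> real \<Rightarrow> 'a) set) monoidal_structure" where
  "M = \<lparr> ten = ten_psfun, one = act [] [], asq = asq0, luq = luq0, ruq = ruq0,
     pim = (\<lambda>(w, x, y, z). K [w, x, y, z] (pi_src \<one>\<^sub>c \<one>\<^sub>c \<one>\<^sub>c \<one>\<^sub>c) (pi_trg \<one>\<^sub>c \<one>\<^sub>c \<one>\<^sub>c \<one>\<^sub>c)),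
     mum = (\<lambda>(x, y). K [x, y] (mu_src \<one>\<^sub>c \<one>\<^sub>c) (const_path (\<one>\<^sub>c \<uplus> \<one>\<^sub>c))),
     lam = (\<lambda>(x, y). K [x, y] (lam_src \<one>\<^sub>c \<one>\<^sub>c) (lam_trg \<one>\<^sub>c \<one>\<^sub>c)),
     rhm = (\<lambda>(x, y). K [x, y] (rho_src \<one>\<^sub>c \<one>\<^sub>c) (rho_trg \<one>\<^sub>c \<one>\<^sub>c)) \<rparr>"

lemma M_simps [simp]:
  "ten M = ten_psfun" "one M = act [] []" "asq M = asq0" "luq M = luq0" "ruq M = ruq0"
  by (simp_all add: M_def)

lemma assoc_path_paths: "assoc_path \<in> paths (Conf 3)"
  by (simp add: assoc_path_def cedge_paths)

lemma unit_paths: "cedge ([] \<uplus> \<one>\<^sub>c) \<one>\<^sub>c \<in> paths (Conf 1)" "cedge (\<one>\<^sub>c \<uplus> []) \<one>\<^sub>c \<in> paths (Conf 1)"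
  by (simp_all add: cedge_paths)

text \<open>Reversal only exchanges the weights of the mixture, so the right adjoint of the right
  unit is a straight path too.\<close>

lemma rev_cedge: "length a = length b \<Longrightarrow> rev_path (cedge a b) = cedge b a"
  by (rule path_eqI) (auto simp: rev_path_def cedge_def list_eq_iff_nth_eq nth_mixc add.commute)

lemma asq_at: "cpt (fwd asq0) (x, y, z) = imK [x, y, z] assoc_path"
  unfolding asq0_def representation.path_adjeq_simps[OF rep3] representation.path_trans_simps[OF rep3]
  by (simp add: imK_def act'_def coords0_def cs3_def)

lemma luq_at: "cpt (fwd luq0) x = imK [x] (cedge ([] \<uplus> \<one>\<^sub>c) \<one>\<^sub>c)"
  unfolding luq0_def representation.path_adjeq_simps[OF rep1] representation.path_trans_simps[OF rep1]
  by (simp add: imK_def act'_def coords0_def cs1_def)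

lemma ruq_at: "cpt (bwd ruq0) x = imK [x] (cedge \<one>\<^sub>c (\<one>\<^sub>c \<uplus> []))"
  unfolding ruq0_def representation.path_adjeq_simps[OF rep1] representation.path_trans_simps[OF rep1]
  by (simp add: rev_cedge imK_def act'_def coords0_def cs1_def)

lemma okD: "ok cs xs \<Longrightarrow> valid cs \<and> length cs = length xs \<and> set xs \<subseteq> topspace X"
  by (simp add: ok_def)

lemmas kp_rules = kp_cedge kp_const kp_concat kp_ctp

text \<open>By substitution, the associator at compound objects is again one straight path between
  two bracketings.\<close>

lemma a_act:
  assumes "ok cs xs" "ok ds ys" "ok es zs"
  shows "cpt (fwd asq0) (act cs xs, act ds ys, act es zs) = imK (xs @ ys @ zs) (cedge ((cs \<uplus> ds) \<uplus> es) (cs \<uplus> (ds \<uplus> es)))"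
proof -
  have "imK [act cs xs, act ds ys, act es zs] assoc_path = imK (concat [xs, ys, zs]) (im_path (\<lambda>c. csub c [cs, ds, es]) assoc_path)"
    by (rule imK_substitute) (use assms in \<open>simp_all add: assoc_path_def kp_cedge act_in\<close>)
  then show ?thesis
    unfolding asq_at by (simp add: assoc_path_def im_csub_cedge csub_cten)
qed

lemma l_act:
  assumes "ok cs xs" shows "cpt (fwd luq0) (act cs xs) = imK xs (cedge ([] \<uplus> cs) cs)"
proof -
  have "imK [act cs xs] (cedge ([] \<uplus> \<one>\<^sub>c) \<one>\<^sub>c) = imK (concat [xs]) (im_path (\<lambda>c. csub c [cs]) (cedge ([] \<uplus> \<one>\<^sub>c) \<one>\<^sub>c))"
    by (rule imK_substitute) (use assms in \<open>simp_all add: kp_cedge act_in\<close>)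
  then show ?thesis
    unfolding luq_at by (simp add: im_csub_cedge csub_cten)
qed

lemma r_act:
  assumes "ok cs xs" shows "cpt (bwd ruq0) (act cs xs) = imK xs (cedge cs (cs \<uplus> []))"
proof -
  have "imK [act cs xs] (cedge \<one>\<^sub>c (\<one>\<^sub>c \<uplus> [])) = imK (concat [xs]) (im_path (\<lambda>c. csub c [cs]) (cedge \<one>\<^sub>c (\<one>\<^sub>c \<uplus> [])))"
    by (rule imK_substitute) (use assms in \<open>simp_all add: kp_cedge act_in\<close>)
  then show ?thesis
    unfolding ruq_at by (simp add: im_csub_cedge csub_cten)
qed

lemma pim_act:
  assumes "ok cs xs" "ok ds ys" "ok es zs" "ok gs ws"
  shows "pim M (act cs xs, act ds ys, act es zs, act gs ws) = K (xs @ ys @ zs @ ws) (pi_src cs ds es gs) (pi_trg cs ds es gs)"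
proof -
  have "K [act cs xs, act ds ys, act es zs, act gs ws] (pi_src \<one>\<^sub>c \<one>\<^sub>c \<one>\<^sub>c \<one>\<^sub>c) (pi_trg \<one>\<^sub>c \<one>\<^sub>c \<one>\<^sub>c \<one>\<^sub>c)
      = K (concat [xs, ys, zs, ws]) (im_path (\<lambda>c. csub c [cs, ds, es, gs]) (pi_src \<one>\<^sub>c \<one>\<^sub>c \<one>\<^sub>c \<one>\<^sub>c)) (im_path (\<lambda>c. csub c [cs, ds, es, gs]) (pi_trg \<one>\<^sub>c \<one>\<^sub>c \<one>\<^sub>c \<one>\<^sub>c))"
    by (rule K_substitute) (use assms in \<open>simp_all add: pi_src_def pi_trg_def kp_rules act_in\<close>)
  then show ?thesis
    by (simp add: M_def pi_src_def pi_trg_def im_concat[symmetric] im_csub_cedge csub_cten im_const)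
qed

lemma mum_act:
  assumes "ok cs xs" "ok ds ys"
  shows "mum M (act cs xs, act ds ys) = K (xs @ ys) (mu_src cs ds) (const_path (cs \<uplus> ds))"
proof -
  have "K [act cs xs, act ds ys] (mu_src \<one>\<^sub>c \<one>\<^sub>c) (const_path (\<one>\<^sub>c \<uplus> \<one>\<^sub>c))
      = K (concat [xs, ys]) (im_path (\<lambda>c. csub c [cs, ds]) (mu_src \<one>\<^sub>c \<one>\<^sub>c)) (im_path (\<lambda>c. csub c [cs, ds]) (const_path (\<one>\<^sub>c \<uplus> \<one>\<^sub>c)))"
    by (rule K_substitute) (use assms in \<open>simp_all add: mu_src_def kp_rules act_in\<close>)
  then show ?thesis
    by (simp add: M_def mu_src_def im_concat[symmetric] im_csub_cedge csub_cten im_const)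
qed

lemma lam_act:
  assumes "ok cs xs" "ok ds ys"
  shows "lam M (act cs xs, act ds ys) = K (xs @ ys) (lam_src cs ds) (lam_trg cs ds)"
proof -
  have "K [act cs xs, act ds ys] (lam_src \<one>\<^sub>c \<one>\<^sub>c) (lam_trg \<one>\<^sub>c \<one>\<^sub>c)
      = K (concat [xs, ys]) (im_path (\<lambda>c. csub c [cs, ds]) (lam_src \<one>\<^sub>c \<one>\<^sub>c)) (im_path (\<lambda>c. csub c [cs, ds]) (lam_trg \<one>\<^sub>c \<one>\<^sub>c))"
    by (rule K_substitute) (use assms in \<open>simp_all add: lam_src_def lam_trg_def kp_rules act_in\<close>)
  then show ?thesis
    by (simp add: M_def lam_src_def lam_trg_def im_concat[symmetric] im_csub_cedge csub_cten im_const)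
qed

lemma rhm_act:
  assumes "ok cs xs" "ok ds ys"
  shows "rhm M (act cs xs, act ds ys) = K (xs @ ys) (rho_src cs ds) (rho_trg cs ds)"
proof -
  have "K [act cs xs, act ds ys] (rho_src \<one>\<^sub>c \<one>\<^sub>c) (rho_trg \<one>\<^sub>c \<one>\<^sub>c)
      = K (concat [xs, ys]) (im_path (\<lambda>c. csub c [cs, ds]) (rho_src \<one>\<^sub>c \<one>\<^sub>c)) (im_path (\<lambda>c. csub c [cs, ds]) (rho_trg \<one>\<^sub>c \<one>\<^sub>c))"
    by (rule K_substitute) (use assms in \<open>simp_all add: rho_src_def rho_trg_def kp_rules act_in\<close>)
  then show ?thesis
    by (simp add: M_def rho_src_def rho_trg_def im_concat[symmetric] im_csub_cedge csub_cten im_const)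
qed

text \<open>Needed for the slide cells of the axioms, whose 1-cells are themselves structural. The
  square of the naturality cell maps to one configuration space by mixing the two bracketings of the
  moving configurations.\<close>

lemma natc_K:
  assumes p: "kp xs p" and q: "kp ys q" and r: "kp zs r"
  shows "natc (fwd asq0) (imK xs p, imK ys q, imK zs r) = K (xs @ ys @ zs)
    (concat_path (ctp p (ctp q r)) (cedge ((p 0 \<uplus> q 0) \<uplus> r 0) (p 0 \<uplus> (q 0 \<uplus> r 0))))
    (concat_path (cedge ((p 1 \<uplus> q 1) \<uplus> r 1) (p 1 \<uplus> (q 1 \<uplus> r 1))) (ctp (ctp p q) r))"
proof -
  have P: "p \<in> paths (Conf (length xs))" "q \<in> paths (Conf (length ys))" "r \<in> paths (Conf (length zs))"
    and X: "set xs \<subseteq> topspace X" "set ys \<subseteq> topspace X" "set zs \<subseteq> topspace X" using p q r by (auto simp: kp_def)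
  have at: "length (p t) = length xs" "valid (p t)" "length (q t) = length ys" "valid (q t)" "length (r t) = length zs" "valid (r t)"
    if "t \<in> {0..1}" for t
    using paths_topspace[OF P(1) that] paths_topspace[OF P(2) that] paths_topspace[OF P(3) that] by simp_all
  let ?J = "coords1 cs3 (imK xs p, imK ys q, imK zs r)" and ?n = "length (xs @ ys @ zs)"
  let ?\<phi> = "\<lambda>z. mixc (fst z) ((p (snd z) \<uplus> q (snd z)) \<uplus> r (snd z)) (p (snd z) \<uplus> (q (snd z) \<uplus> r (snd z)))"
  have "natc (fwd asq0) (imK xs p, imK ys q, imK zs r) = lift X Sq (fam (\<lambda>x. act' (assoc_path (fst x), snd x)) ?J) lower upper"
    unfolding asq0_def representation.path_adjeq_simps[OF rep3] representation.path_trans_def[OF rep3] by simp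
  also have "\<dots> = lift X (Conf ?n) (\<lambda>c. act c (xs @ ys @ zs)) (im_path ?\<phi> lower) (im_path ?\<phi> upper)"
  proof (rule lift_reindex[OF equiconnected_Sq equiconnected_Conf _ _ lower_upper])
    have c: "continuous_map Sq (Conf (length xs)) (\<lambda>z. p (snd z))" "continuous_map Sq (Conf (length ys)) (\<lambda>z. q (snd z))"
        "continuous_map Sq (Conf (length zs)) (\<lambda>z. r (snd z))"
      by (rule continuous_map_reindex[OF paths_cont[OF P(1)]], auto intro!: continuous_intros)
        (rule continuous_map_reindex[OF paths_cont[OF P(2)]], auto intro!: continuous_intros,
         rule continuous_map_reindex[OF paths_cont[OF P(3)]], auto intro!: continuous_intros)
    show "continuous_map Sq (Conf ?n) ?\<phi>"
    proof (rule mixes_continuous[OF mixes_Conf])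
      show "continuous_map Sq Itop fst" by (auto intro!: continuous_intros)
      show "continuous_map Sq (Conf ?n) (\<lambda>z. (p (snd z) \<uplus> q (snd z)) \<uplus> r (snd z))"
        using cten_continuous[OF cten_continuous[OF c(1,2)] c(3)] by (simp add: add.assoc)
      show "continuous_map Sq (Conf ?n) (\<lambda>z. p (snd z) \<uplus> (q (snd z) \<uplus> r (snd z)))"
        using cten_continuous[OF c(1) cten_continuous[OF c(2,3)]] by simp
    qed
    show "continuous_map (Conf ?n) X (\<lambda>c. act c (xs @ ys @ zs))"
      by (rule lifting.cont[OF K_lifting]) (use X in simp)
    fix z assume "z \<in> topspace Sq"
    then obtain t u where z: "z = (t, u)" "t \<in> {0..1}" "u \<in> {0..1}" by auto
    have oks: "ok (p u) xs" "ok (q u) ys" "ok (r u) zs" using at[OF z(3)] X by (simp_all add: ok_def)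
    have "imK [act (p u) xs, act (q u) ys, act (r u) zs] assoc_path t
        = imK (xs @ ys @ zs) (cedge ((p u \<uplus> q u) \<uplus> r u) (p u \<uplus> (q u \<uplus> r u))) t"
      using a_act[OF oks] by (simp add: asq_at)
    then show "fam (\<lambda>x. act' (assoc_path (fst x), snd x)) ?J z = act (?\<phi> z) (xs @ ys @ zs)"
      using z by (simp add: fam_def act'_def coords1_def cs3_def imK_def cedge_def)
  qed
  also have "im_path ?\<phi> lower = concat_path (ctp p (ctp q r)) (cedge ((p 0 \<uplus> q 0) \<uplus> r 0) (p 0 \<uplus> (q 0 \<uplus> r 0)))"
    unfolding lower_def im_concat[symmetric]
  proof (rule arg_cong2[where f=concat_path])
    show "im_path ?\<phi> (edge (1, 0) (1, 1)) = ctp p (ctp q r)"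
      by (rule path_eqI) (use at in \<open>auto simp: im_path_def edge_def ctp_def list_eq_iff_nth_eq nth_mixc\<close>)
    show "im_path ?\<phi> (edge (0, 0) (1, 0)) = cedge ((p 0 \<uplus> q 0) \<uplus> r 0) (p 0 \<uplus> (q 0 \<uplus> r 0))"
      by (rule path_eqI) (auto simp: im_path_def edge_def cedge_def)
  qed
  also have "im_path ?\<phi> upper = concat_path (cedge ((p 1 \<uplus> q 1) \<uplus> r 1) (p 1 \<uplus> (q 1 \<uplus> r 1))) (ctp (ctp p q) r)"
    unfolding upper_def im_concat[symmetric]
  proof (rule arg_cong2[where f=concat_path])
    show "im_path ?\<phi> (edge (0, 0) (0, 1)) = ctp (ctp p q) r"
      by (rule path_eqI) (use at in \<open>auto simp: im_path_def edge_def ctp_def list_eq_iff_nth_eq nth_mixc\<close>)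
    have "edge (0, 1) (1, 1) t = (t, 1::real)" if "t \<in> {0..1}" for t :: real
      using that by (simp add: edge_def)
    then show "im_path ?\<phi> (edge (0, 1) (1, 1)) = cedge ((p 1 \<uplus> q 1) \<uplus> r 1) (p 1 \<uplus> (q 1 \<uplus> r 1))"
      by (intro path_eqI) (auto simp: im_path_def cedge_def)
  qed
  finally show ?thesis unfolding K_def .
qed


section \<open>The unit axioms and the five-fold associativity axiom\<close>

lemma L_simps:
  "map1 (monoidal_data.\<L> B M k) f = tens1 (const_path k) f"
  "map2 (monoidal_data.\<L> B M k) \<alpha> = tens2 (id2 B (const_path k)) \<alpha>"
  "cmpc (monoidal_data.\<L> B M k) g f = vcmp B (tens2 (lun B (const_path k)) (id2 B (concat_path g f)))
     (id2 B (concat_path (tens1 (const_path k) g) (tens1 (const_path k) f)))"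
  "unitc (monoidal_data.\<L> B M k) x = vcmp B (tens2 (id2 B (const_path k)) (id2 B (const_path x))) (id2 B (const_path (T k x)))"
  by (simp_all add: monoidal_data.\<L>_def monoidal_data.tensor_psfun_def comp_psfun_def pair_psfun_def
      const_psfun_def id_psfun_def strict_psfun_def)

lemma R_simps:
  "map1 (monoidal_data.\<R> B M k) f = tens1 f (const_path k)"
  "map2 (monoidal_data.\<R> B M k) \<alpha> = tens2 \<alpha> (id2 B (const_path k))"
  "cmpc (monoidal_data.\<R> B M k) g f = vcmp B (tens2 (id2 B (concat_path g f)) (lun B (const_path k)))
     (id2 B (concat_path (tens1 g (const_path k)) (tens1 f (const_path k))))"
  "unitc (monoidal_data.\<R> B M k) x = vcmp B (tens2 (id2 B (const_path x)) (id2 B (const_path k))) (id2 B (const_path (T x k)))"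
  by (simp_all add: monoidal_data.\<R>_def monoidal_data.tensor_psfun_def comp_psfun_def pair_psfun_def
      const_psfun_def id_psfun_def strict_psfun_def)

text \<open>Rewriting with these rules turns objects into \<open>act\<close>, 1-cells into
  \<open>imK\<close> and 2-cells into \<open>K\<close>, and then composes the cells. The pasting
  operations are unfolded along the way.\<close>

lemmas K_rules = K_vcmp K_hcmp K_inv K_id K_asc K_lun K_run imK_concat imK_const tens1_K tens2_K natc_K
  a_act l_act r_act pim_act mum_act lam_act rhm_act T_act kp_rules ctp_concat ctp_const_concat ctp_cedge
  L_simps R_simps wl_def wr_def paste2_def paste3_def unbracket3_def collapse_left_def collapse_right_def
  image32_def image12_def image30_def
  monoidal_data.slide_left_def monoidal_data.slide_right_def monoidal_data.slide_mid_def
  pi_src_def pi_trg_def mu_src_def lam_src_def lam_trg_def rho_src_def rho_trg_def ok_def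

text \<open>Both sides reduce to one cell \<open>K\<close> with the same pair of paths. The objects
  are given as values of the action because a product of bare points would not match
  \<open>T_act\<close>.\<close>

lemma unit_axiom1_act:
  assumes "ok c1 x1" "ok c2 x2" "ok c3 x3"
  shows "monoidal_data.unit_axiom1_left B M (act c1 x1) (act c2 x2) (act c3 x3)
    = monoidal_data.unit_axiom1_right B M (act c1 x1) (act c2 x2) (act c3 x3)"
  using okD[OF assms(1)] okD[OF assms(2)] okD[OF assms(3)]
  by (simp add: monoidal_data.unit_axiom1_left_def monoidal_data.unit_axiom1_right_def Let_def K_rules)

lemma unit_axiom2_act:
  assumes "ok c1 x1" "ok c2 x2" "ok c3 x3"
  shows "monoidal_data.unit_axiom2_left B M (act c1 x1) (act c2 x2) (act c3 x3)
    = monoidal_data.unit_axiom2_right B M (act c1 x1) (act c2 x2) (act c3 x3)"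
  using okD[OF assms(1)] okD[OF assms(2)] okD[OF assms(3)]
  by (simp add: monoidal_data.unit_axiom2_left_def monoidal_data.unit_axiom2_right_def Let_def K_rules)

text \<open>Both sides reduce to the cell from the six-step to the three-step path of bracketings,
  which is determined by these paths in the configuration space of the appended list.\<close>

lemma cocycle_act:
  assumes "ok c1 x1" "ok c2 x2" "ok c3 x3" "ok c4 x4" "ok c5 x5"
  shows "monoidal_data.cocycle_left B M (act c1 x1) (act c2 x2) (act c3 x3) (act c4 x4) (act c5 x5)
    = monoidal_data.cocycle_right B M (act c1 x1) (act c2 x2) (act c3 x3) (act c4 x4) (act c5 x5)"
  using okD[OF assms(1)] okD[OF assms(2)] okD[OF assms(3)] okD[OF assms(4)] okD[OF assms(5)]
  by (simp add: monoidal_data.cocycle_left_def monoidal_data.cocycle_right_def Let_def K_rules)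


section \<open>The modifications\<close>

lemma imK_at: "t \<in> {0..1} \<Longrightarrow> imK xs p t = act (p t) xs"
  by (simp add: imK_def)

lemma T_left: "a \<in> topspace X \<Longrightarrow> ok ds ys \<Longrightarrow> T a (act ds ys) = act (\<one>\<^sub>c \<uplus> ds) (a # ys)"
  using T_act[of "\<one>\<^sub>c" "[a]" ds ys] by (simp add: act_unit)

lemma T_right: "b \<in> topspace X \<Longrightarrow> ok cs xs \<Longrightarrow> T (act cs xs) b = act (cs \<uplus> \<one>\<^sub>c) (xs @ [b])"
  using T_act[of cs xs "\<one>\<^sub>c" "[b]"] by (simp add: act_unit)

lemma ok_cedge:
  assumes "ok a xs" "ok b xs" "t \<in> {0..1}" shows "ok (cedge a b t) xs"
  using assms ok_mixc by (simp add: cedge_def)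

lemma cedge_cten:
  assumes "t \<in> {0..1}" "length a = length b"
  shows "cedge a b t \<uplus> c = cedge (a \<uplus> c) (b \<uplus> c) t" "c \<uplus> cedge a b t = cedge (c \<uplus> a) (c \<uplus> b) t"
  using assms cten_mixc[of a b c c t] cten_mixc[of c c a b t] by (simp_all add: cedge_def)

lemma assoc_act:
  assumes "t \<in> {0..1}" "ok cs xs" "ok ds ys" "ok es zs"
  shows "act (assoc_path t) [act cs xs, act ds ys, act es zs] = act (cedge ((cs \<uplus> ds) \<uplus> es) (cs \<uplus> (ds \<uplus> es)) t) (xs @ ys @ zs)"
  using fun_cong[OF a_act[OF assms(2-)], of t] assms(1) by (simp add: asq_at imK_at)

lemma left_act:
  assumes "t \<in> {0..1}" "ok cs xs"
  shows "act (cedge ([] \<uplus> \<one>\<^sub>c) \<one>\<^sub>c t) [act cs xs] = act (cedge ([] \<uplus> cs) cs t) xs"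
  using fun_cong[OF l_act[OF assms(2)], of t] assms(1) by (simp add: luq_at imK_at)

lemma right_act:
  assumes "t \<in> {0..1}" "ok cs xs"
  shows "act (cedge \<one>\<^sub>c (\<one>\<^sub>c \<uplus> []) t) [act cs xs] = act (cedge cs (cs \<uplus> []) t) xs"
  using fun_cong[OF r_act[OF assms(2)], of t] assms(1) by (simp add: ruq_at imK_at)

lemma act'_continuous: "continuous_map (prod_topology (Conf n) (list_top n X)) X act'"
  using act_continuous[of n] by (simp add: act'_def[abs_def])

lemma ends:
  assumes "a \<in> topspace X" "b \<in> topspace X" "c \<in> topspace X"
  shows "act (assoc_path 0) [a, b, c] = T (T a b) c" "act (assoc_path 1) [a, b, c] = T a (T b c)"
    "act (cedge ([] \<uplus> \<one>\<^sub>c) \<one>\<^sub>c 0) [a] = T (act [] []) a" "act (cedge ([] \<uplus> \<one>\<^sub>c) \<one>\<^sub>c 1) [a] = a"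
    "act (cedge \<one>\<^sub>c (\<one>\<^sub>c \<uplus> []) 1) [a] = T a (act [] [])" "act (cedge \<one>\<^sub>c (\<one>\<^sub>c \<uplus> []) 0) [a] = a"
    "act (cedge (\<one>\<^sub>c \<uplus> []) \<one>\<^sub>c 0) [a] = T a (act [] [])" "act (cedge (\<one>\<^sub>c \<uplus> []) \<one>\<^sub>c 1) [a] = a"
  using assms T_left[of a "[]" "[]"] T_right[of a "[]" "[]"]
    T_right[of c "\<one>\<^sub>c \<uplus> \<one>\<^sub>c" "[a, b]"] T_left[of a "\<one>\<^sub>c \<uplus> \<one>\<^sub>c" "[b, c]"]
  by (simp_all add: assoc_path_def T_def[of a b] T_def[of b c] act_unit ok_def)

text \<open>The associator whiskered with three functors is induced by the same path of
  configurations, acting on the values of the three maps.\<close>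

lemma trep_a_at:
  assumes R: "representation B' W J0 J1 J2"
    and F: "representation.frep B' W J0 J1 J2 X hF F" and G: "representation.frep B' W J0 J1 J2 X hG G"
    and H: "representation.frep B' W J0 J1 J2 X hH H"
  shows "representation.trep B' W J0 J1 X (\<lambda>x. act (assoc_path (fst x)) [hF (snd x), hG (snd x), hH (snd x)])
     (pre_whisker (fwd asq0) (pair_psfun F (pair_psfun G H)))"
proof -
  interpret representation B' W J0 J1 J2 X by (rule R)
  have s: "representation.trep (B \<times>\<^sub>B B \<times>\<^sub>B B) (list_top 3 X) (coords0 cs3) (coords1 cs3) X (\<lambda>x. act' (assoc_path (fst x), snd x)) (fwd asq0)"
    unfolding asq0_def representation.path_adjeq_simps[OF rep3]
    by (rule representation.trep_path_trans[OF rep3 act'_continuous assoc_path_paths])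
  have "trep (\<lambda>x. act' (assoc_path (fst (fst x, [hF (snd x), hG (snd x), hH (snd x)])), snd (fst x, [hF (snd x), hG (snd x), hH (snd x)])))
      (pre_whisker (fwd asq0) (pair_psfun F (pair_psfun G H)))"
  proof (rule trep_pre_whisker[OF rep3 s])
    note h = frepD(1)[OF F] frepD(1)[OF G] frepD(1)[OF H]
    show "continuous_map W (list_top 3 X) (\<lambda>w. [hF w, hG w, hH w])"
      using h by (auto simp: continuous_map_list_top numeral_3_eq_3 less_Suc_eq)
    show "map0 (pair_psfun F (pair_psfun G H)) a \<in> Ob (B \<times>\<^sub>B B \<times>\<^sub>B B) \<and>
        coords0 cs3 (map0 (pair_psfun F (pair_psfun G H)) a) = [hF (J0 a), hG (J0 a), hH (J0 a)]" if a: "a \<in> Ob B'" for a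
      using frepD(2)[OF F a] frepD(2)[OF G a] frepD(2)[OF H a] J0_in[OF a] h[THEN continuous_map_image_subset_topspace]
      by (auto simp: pair_psfun_def coords0_def cs3_def)
    show "map1 (pair_psfun F (pair_psfun G H)) f \<in> Arr (B \<times>\<^sub>B B \<times>\<^sub>B B) \<and>
        coords1 cs3 (map1 (pair_psfun F (pair_psfun G H)) f) = im_path (\<lambda>w. [hF w, hG w, hH w]) (J1 f)" if f: "f \<in> Arr B'" for f
    proof -
      have "J1 f \<in> paths W" using J1_path[OF Arr_hom1[OF f]] by blast
      then show ?thesis
        using frepD(3)[OF F f] frepD(3)[OF G f] frepD(3)[OF H f] im_paths h
        by (auto simp: pair_psfun_def coords1_def cs3_def im_path_def restrict_def)
    qed
  qed
  then show ?thesis by (simp add: act'_def)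
qed

lemma trep_unit_at:
  assumes R: "representation B' W J0 J1 J2" and F: "representation.frep B' W J0 J1 J2 X hF F"
    and s: "representation.trep B (list_top 1 X) (coords0 cs1) (coords1 cs1) X (\<lambda>x. act' (P (fst x), snd x)) \<sigma>"
  shows "representation.trep B' W J0 J1 X (\<lambda>x. act (P (fst x)) [hF (snd x)]) (pre_whisker \<sigma> F)"
proof -
  interpret representation B' W J0 J1 J2 X by (rule R)
  have "trep (\<lambda>x. act' (P (fst (fst x, [hF (snd x)])), snd (fst x, [hF (snd x)]))) (pre_whisker \<sigma> F)"
  proof (rule trep_pre_whisker[OF rep1 s])
    note h = frepD(1)[OF F]
    show "continuous_map W (list_top 1 X) (\<lambda>w. [hF w])" using h by (simp add: continuous_map_list_top)
    show "map0 F a \<in> Ob B \<and> coords0 cs1 (map0 F a) = [hF (J0 a)]" if a: "a \<in> Ob B'" for a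
      using frepD(2)[OF F a] J0_in[OF a] h[THEN continuous_map_image_subset_topspace] by (auto simp: coords0_def cs1_def)
    show "map1 F f \<in> Arr B \<and> coords1 cs1 (map1 F f) = im_path (\<lambda>w. [hF w]) (J1 f)" if f: "f \<in> Arr B'" for f
    proof -
      have "J1 f \<in> paths W" using J1_path[OF Arr_hom1[OF f]] by blast
      then show ?thesis using frepD(3)[OF F f] im_paths[OF _ h] by (auto simp: coords1_def cs1_def im_path_def restrict_def)
    qed
  qed
  then show ?thesis by (simp add: act'_def)
qed

lemma trep_l: "representation.trep B (list_top 1 X) (coords0 cs1) (coords1 cs1) X (\<lambda>x. act' (cedge ([] \<uplus> \<one>\<^sub>c) \<one>\<^sub>c (fst x), snd x)) (fwd luq0)"
  unfolding luq0_def representation.path_adjeq_simps[OF rep1]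
  by (rule representation.trep_path_trans[OF rep1 act'_continuous unit_paths(1)])

lemma trep_r: "representation.trep B (list_top 1 X) (coords0 cs1) (coords1 cs1) X (\<lambda>x. act' (cedge \<one>\<^sub>c (\<one>\<^sub>c \<uplus> []) (fst x), snd x)) (bwd ruq0)"
  unfolding ruq0_def representation.path_adjeq_simps[OF rep1]
  using representation.trep_path_trans[OF rep1 act'_continuous, of "cedge \<one>\<^sub>c (\<one>\<^sub>c \<uplus> [])"] by (simp add: rev_cedge cedge_paths)

sublocale MD: monoidal_data "\<Pi>\<^sub>2 X" M .

lemma frep_box:
  assumes "representation B' W J0 J1 J2"
    "representation.frep B' W J0 J1 J2 X h F" "representation.frep B' W J0 J1 J2 X h' F'"
  shows "representation.frep B' W J0 J1 J2 X (\<lambda>w. T (h w) (h' w)) (MD.tensor_psfun F F')"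
  unfolding MD.tensor_psfun_def M_simps by (rule frep_tensor[OF assms])

lemma trep_box:
  assumes "representation B' W J0 J1 J2"
    "representation.frep B' W J0 J1 J2 X h0 F" "representation.frep B' W J0 J1 J2 X h1 F'"
    "representation.frep B' W J0 J1 J2 X k0 H" "representation.frep B' W J0 J1 J2 X k1 H'"
    "representation.trep B' W J0 J1 X G \<sigma>" "representation.trep B' W J0 J1 X G' \<tau>"
    "\<And>w. w \<in> topspace W \<Longrightarrow> G (0, w) = h0 w \<and> G (1, w) = h1 w"
    "\<And>w. w \<in> topspace W \<Longrightarrow> G' (0, w) = k0 w \<and> G' (1, w) = k1 w"
  shows "representation.trep B' W J0 J1 X (\<lambda>x. T (G x) (G' x)) (MD.tensor_pstrans B' F F' H H' \<sigma> \<tau>)"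
  unfolding MD.tensor_pstrans_def M_simps by (rule trep_tensor[OF assms])

lemma I_in: "act [] [] \<in> topspace X"
  by (simp add: act_in)

lemma list2: "w \<in> topspace (list_top 2 X) \<Longrightarrow> \<exists>a b. w = [a, b] \<and> a \<in> topspace X \<and> b \<in> topspace X"
  by (auto simp: topspace_list_top numeral_2_eq_2 length_Suc_conv)

lemma list3: "w \<in> topspace (list_top 3 X) \<Longrightarrow> \<exists>a b c. w = [a, b, c] \<and> a \<in> topspace X \<and> b \<in> topspace X \<and> c \<in> topspace X"
  by (auto simp: topspace_list_top numeral_3_eq_3 length_Suc_conv)

lemma list4: "w \<in> topspace (list_top 4 X) \<Longrightarrow> \<exists>a b c d. w = [a, b, c, d] \<and> a \<in> topspace X \<and> b \<in> topspace X \<and> c \<in> topspace X \<and> d \<in> topspace X"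
  by (auto simp: topspace_list_top numeral_eq_Suc length_Suc_conv)

lemmas frep2 = coordinates.frep_coord[OF coordinates2, unfolded len_cs]
lemmas frep3 = coordinates.frep_coord[OF coordinates3, unfolded len_cs]
lemmas frep4 = coordinates.frep_coord[OF coordinates4, unfolded len_cs]

lemma f21: "representation.frep MD.B2 (list_top 2 X) (coords0 cs2) (coords1 cs2) (coords2 cs2) X (\<lambda>w. w ! 0) MD.P21"
  and f22: "representation.frep MD.B2 (list_top 2 X) (coords0 cs2) (coords1 cs2) (coords2 cs2) X (\<lambda>w. w ! 1) MD.P22"
  unfolding MD.P21_def MD.P22_def by (rule frep2; simp add: cs2_def)+

lemma f31: "representation.frep MD.B3 (list_top 3 X) (coords0 cs3) (coords1 cs3) (coords2 cs3) X (\<lambda>w. w ! 0) MD.P31"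
  and f32: "representation.frep MD.B3 (list_top 3 X) (coords0 cs3) (coords1 cs3) (coords2 cs3) X (\<lambda>w. w ! 1) MD.P32"
  and f33: "representation.frep MD.B3 (list_top 3 X) (coords0 cs3) (coords1 cs3) (coords2 cs3) X (\<lambda>w. w ! 2) MD.P33"
  unfolding MD.P31_def MD.P32_def MD.P33_def by (rule frep3; simp add: cs3_def)+

lemma f41: "representation.frep MD.B4 (list_top 4 X) (coords0 cs4) (coords1 cs4) (coords2 cs4) X (\<lambda>w. w ! 0) MD.P41"
  and f42: "representation.frep MD.B4 (list_top 4 X) (coords0 cs4) (coords1 cs4) (coords2 cs4) X (\<lambda>w. w ! 1) MD.P42"
  and f43: "representation.frep MD.B4 (list_top 4 X) (coords0 cs4) (coords1 cs4) (coords2 cs4) X (\<lambda>w. w ! 2) MD.P43"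
  and f44: "representation.frep MD.B4 (list_top 4 X) (coords0 cs4) (coords1 cs4) (coords2 cs4) X (\<lambda>w. w ! 3) MD.P44"
  unfolding MD.P41_def MD.P42_def MD.P43_def MD.P44_def by (rule frep4; simp add: cs4_def)+

lemma f1: "representation.frep B (list_top 1 X) (coords0 cs1) (coords1 cs1) (coords2 cs1) X (\<lambda>w. w ! 0) (id_psfun B)"
  unfolding id_psfun_def by (rule coordinates.frep_coord[OF coordinates1, unfolded len_cs]) (simp_all add: cs1_def)

lemma associativity_equivalence:
  "adjoint_equivalence MD.B3 B (MD.tensor_psfun (MD.tensor_psfun MD.P31 MD.P32) MD.P33)
     (MD.tensor_psfun MD.P31 (MD.tensor_psfun MD.P32 MD.P33)) asq0"
  unfolding asq0_def
  by (rule representation.path_adjoint_equivalence[OF rep3 equiconnected_Conf act'_continuous assoc_path_paths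
        frep_box[OF rep3 frep_box[OF rep3 f31 f32] f33] frep_box[OF rep3 f31 frep_box[OF rep3 f32 f33]]])
    (auto dest!: list3 simp: act'_def ends)

lemma left_unit_equivalence: "adjoint_equivalence B B (MD.\<L> (act [] [])) (id_psfun B) luq0"
  unfolding luq0_def MD.\<L>_def
  by (rule representation.path_adjoint_equivalence[OF rep1 equiconnected_Conf act'_continuous unit_paths(1)
        frep_box[OF rep1 representation.frep_const[OF rep1 I_in] f1] f1])
    (auto simp: topspace_list_top length_Suc_conv act'_def T_left T_right act_unit)

lemma right_unit_equivalence: "adjoint_equivalence B B (MD.\<R> (act [] [])) (id_psfun B) ruq0"
  unfolding ruq0_def MD.\<R>_def
  by (rule representation.path_adjoint_equivalence[OF rep1 equiconnected_Conf act'_continuous unit_paths(2)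
        frep_box[OF rep1 f1 representation.frep_const[OF rep1 I_in]] f1])
    (auto simp: topspace_list_top length_Suc_conv act'_def T_left T_right act_unit)

text \<open>The first three equations are the legs of the source of \<open>pim\<close>, the last two
  those of its target. Each leg becomes a straight path of four intervals acting on fixed
  points.\<close>

lemma pieces:
  assumes t: "t \<in> {0..1}" and X: "a \<in> topspace X" "b \<in> topspace X" "c \<in> topspace X" "d \<in> topspace X"
  shows "T (act (assoc_path t) [a, b, c]) d = act (cedge (((\<one>\<^sub>c \<uplus> \<one>\<^sub>c) \<uplus> \<one>\<^sub>c) \<uplus> \<one>\<^sub>c) ((\<one>\<^sub>c \<uplus> (\<one>\<^sub>c \<uplus> \<one>\<^sub>c)) \<uplus> \<one>\<^sub>c) t) [a, b, c, d]"
    "act (assoc_path t) [a, T b c, d] = act (cedge ((\<one>\<^sub>c \<uplus> (\<one>\<^sub>c \<uplus> \<one>\<^sub>c)) \<uplus> \<one>\<^sub>c) (\<one>\<^sub>c \<uplus> ((\<one>\<^sub>c \<uplus> \<one>\<^sub>c) \<uplus> \<one>\<^sub>c)) t) [a, b, c, d]"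
    "T a (act (assoc_path t) [b, c, d]) = act (cedge (\<one>\<^sub>c \<uplus> ((\<one>\<^sub>c \<uplus> \<one>\<^sub>c) \<uplus> \<one>\<^sub>c)) (\<one>\<^sub>c \<uplus> (\<one>\<^sub>c \<uplus> (\<one>\<^sub>c \<uplus> \<one>\<^sub>c))) t) [a, b, c, d]"
    "act (assoc_path t) [T a b, c, d] = act (cedge (((\<one>\<^sub>c \<uplus> \<one>\<^sub>c) \<uplus> \<one>\<^sub>c) \<uplus> \<one>\<^sub>c) ((\<one>\<^sub>c \<uplus> \<one>\<^sub>c) \<uplus> (\<one>\<^sub>c \<uplus> \<one>\<^sub>c)) t) [a, b, c, d]"
    "act (assoc_path t) [a, b, T c d] = act (cedge ((\<one>\<^sub>c \<uplus> \<one>\<^sub>c) \<uplus> (\<one>\<^sub>c \<uplus> \<one>\<^sub>c)) (\<one>\<^sub>c \<uplus> (\<one>\<^sub>c \<uplus> (\<one>\<^sub>c \<uplus> \<one>\<^sub>c))) t) [a, b, c, d]"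
proof -
  have o: "ok (assoc_path t) [x, y, z]" if "x \<in> topspace X" "y \<in> topspace X" "z \<in> topspace X" for x y z
    unfolding assoc_path_def by (rule ok_cedge) (use t that in \<open>simp_all add: ok_def\<close>)
  show "T (act (assoc_path t) [a, b, c]) d = act (cedge (((\<one>\<^sub>c \<uplus> \<one>\<^sub>c) \<uplus> \<one>\<^sub>c) \<uplus> \<one>\<^sub>c) ((\<one>\<^sub>c \<uplus> (\<one>\<^sub>c \<uplus> \<one>\<^sub>c)) \<uplus> \<one>\<^sub>c) t) [a, b, c, d]"
    using T_right[OF X(4) o[OF X(1-3)]] t by (simp add: assoc_path_def cedge_cten)
  show "T a (act (assoc_path t) [b, c, d]) = act (cedge (\<one>\<^sub>c \<uplus> ((\<one>\<^sub>c \<uplus> \<one>\<^sub>c) \<uplus> \<one>\<^sub>c)) (\<one>\<^sub>c \<uplus> (\<one>\<^sub>c \<uplus> (\<one>\<^sub>c \<uplus> \<one>\<^sub>c))) t) [a, b, c, d]"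
    using T_left[OF X(1) o[OF X(2-4)]] t by (simp add: assoc_path_def cedge_cten)
  show "act (assoc_path t) [a, T b c, d] = act (cedge ((\<one>\<^sub>c \<uplus> (\<one>\<^sub>c \<uplus> \<one>\<^sub>c)) \<uplus> \<one>\<^sub>c) (\<one>\<^sub>c \<uplus> ((\<one>\<^sub>c \<uplus> \<one>\<^sub>c) \<uplus> \<one>\<^sub>c)) t) [a, b, c, d]"
    using assoc_act[OF t, of "\<one>\<^sub>c" "[a]" "\<one>\<^sub>c \<uplus> \<one>\<^sub>c" "[b, c]" "\<one>\<^sub>c" "[d]"] X by (simp add: act_unit T_def[of b c] ok_def)
  show "act (assoc_path t) [T a b, c, d] = act (cedge (((\<one>\<^sub>c \<uplus> \<one>\<^sub>c) \<uplus> \<one>\<^sub>c) \<uplus> \<one>\<^sub>c) ((\<one>\<^sub>c \<uplus> \<one>\<^sub>c) \<uplus> (\<one>\<^sub>c \<uplus> \<one>\<^sub>c)) t) [a, b, c, d]"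
    using assoc_act[OF t, of "\<one>\<^sub>c \<uplus> \<one>\<^sub>c" "[a, b]" "\<one>\<^sub>c" "[c]" "\<one>\<^sub>c" "[d]"] X by (simp add: act_unit T_def[of a b] ok_def)
  show "act (assoc_path t) [a, b, T c d] = act (cedge ((\<one>\<^sub>c \<uplus> \<one>\<^sub>c) \<uplus> (\<one>\<^sub>c \<uplus> \<one>\<^sub>c)) (\<one>\<^sub>c \<uplus> (\<one>\<^sub>c \<uplus> (\<one>\<^sub>c \<uplus> \<one>\<^sub>c))) t) [a, b, c, d]"
    using assoc_act[OF t, of "\<one>\<^sub>c" "[a]" "\<one>\<^sub>c" "[b]" "\<one>\<^sub>c \<uplus> \<one>\<^sub>c" "[c, d]"] X by (simp add: act_unit T_def[of c d] ok_def)
qed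

text \<open>The first three equations are for \<open>mum\<close>, the next three for
  \<open>lam\<close> and the rest for \<open>rhm\<close>. Putting the unit object into a slot
  deletes an interval.\<close>

lemma unit_pieces:
  assumes t: "t \<in> {0..1}" and X: "a \<in> topspace X" "b \<in> topspace X"
  shows "T (act (cedge \<one>\<^sub>c (\<one>\<^sub>c \<uplus> []) t) [a]) b = act (cedge (\<one>\<^sub>c \<uplus> \<one>\<^sub>c) ((\<one>\<^sub>c \<uplus> []) \<uplus> \<one>\<^sub>c) t) [a, b]"
    "act (assoc_path t) [a, act [] [], b] = act (cedge ((\<one>\<^sub>c \<uplus> []) \<uplus> \<one>\<^sub>c) (\<one>\<^sub>c \<uplus> ([] \<uplus> \<one>\<^sub>c)) t) [a, b]"
    "T a (act (cedge ([] \<uplus> \<one>\<^sub>c) \<one>\<^sub>c t) [b]) = act (cedge (\<one>\<^sub>c \<uplus> ([] \<uplus> \<one>\<^sub>c)) (\<one>\<^sub>c \<uplus> \<one>\<^sub>c) t) [a, b]"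
    "T (act (cedge ([] \<uplus> \<one>\<^sub>c) \<one>\<^sub>c t) [a]) b = act (cedge (([] \<uplus> \<one>\<^sub>c) \<uplus> \<one>\<^sub>c) (\<one>\<^sub>c \<uplus> \<one>\<^sub>c) t) [a, b]"
    "act (assoc_path t) [act [] [], a, b] = act (cedge (([] \<uplus> \<one>\<^sub>c) \<uplus> \<one>\<^sub>c) ([] \<uplus> (\<one>\<^sub>c \<uplus> \<one>\<^sub>c)) t) [a, b]"
    "act (cedge ([] \<uplus> \<one>\<^sub>c) \<one>\<^sub>c t) [T a b] = act (cedge ([] \<uplus> (\<one>\<^sub>c \<uplus> \<one>\<^sub>c)) (\<one>\<^sub>c \<uplus> \<one>\<^sub>c) t) [a, b]"
    "T a (act (cedge \<one>\<^sub>c (\<one>\<^sub>c \<uplus> []) t) [b]) = act (cedge (\<one>\<^sub>c \<uplus> \<one>\<^sub>c) (\<one>\<^sub>c \<uplus> (\<one>\<^sub>c \<uplus> [])) t) [a, b]"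
    "act (assoc_path t) [a, b, act [] []] = act (cedge ((\<one>\<^sub>c \<uplus> \<one>\<^sub>c) \<uplus> []) (\<one>\<^sub>c \<uplus> (\<one>\<^sub>c \<uplus> [])) t) [a, b]"
    "act (cedge \<one>\<^sub>c (\<one>\<^sub>c \<uplus> []) t) [T a b] = act (cedge (\<one>\<^sub>c \<uplus> \<one>\<^sub>c) ((\<one>\<^sub>c \<uplus> \<one>\<^sub>c) \<uplus> []) t) [a, b]"
proof -
  have o: "ok (cedge \<one>\<^sub>c (\<one>\<^sub>c \<uplus> []) t) [x]" "ok (cedge ([] \<uplus> \<one>\<^sub>c) \<one>\<^sub>c t) [x]" if "x \<in> topspace X" for x
    by (rule ok_cedge; use t that in \<open>simp add: ok_def\<close>)+
  show "T (act (cedge \<one>\<^sub>c (\<one>\<^sub>c \<uplus> []) t) [a]) b = act (cedge (\<one>\<^sub>c \<uplus> \<one>\<^sub>c) ((\<one>\<^sub>c \<uplus> []) \<uplus> \<one>\<^sub>c) t) [a, b]"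
    "T a (act (cedge ([] \<uplus> \<one>\<^sub>c) \<one>\<^sub>c t) [b]) = act (cedge (\<one>\<^sub>c \<uplus> ([] \<uplus> \<one>\<^sub>c)) (\<one>\<^sub>c \<uplus> \<one>\<^sub>c) t) [a, b]"
    "T (act (cedge ([] \<uplus> \<one>\<^sub>c) \<one>\<^sub>c t) [a]) b = act (cedge (([] \<uplus> \<one>\<^sub>c) \<uplus> \<one>\<^sub>c) (\<one>\<^sub>c \<uplus> \<one>\<^sub>c) t) [a, b]"
    "T a (act (cedge \<one>\<^sub>c (\<one>\<^sub>c \<uplus> []) t) [b]) = act (cedge (\<one>\<^sub>c \<uplus> \<one>\<^sub>c) (\<one>\<^sub>c \<uplus> (\<one>\<^sub>c \<uplus> [])) t) [a, b]"
    using T_right[OF X(2) o(1)[OF X(1)]] T_left[OF X(1) o(2)[OF X(2)]] T_right[OF X(2) o(2)[OF X(1)]] T_left[OF X(1) o(1)[OF X(2)]] t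
    by (simp_all add: cedge_cten)
  show "act (assoc_path t) [a, act [] [], b] = act (cedge ((\<one>\<^sub>c \<uplus> []) \<uplus> \<one>\<^sub>c) (\<one>\<^sub>c \<uplus> ([] \<uplus> \<one>\<^sub>c)) t) [a, b]"
    "act (assoc_path t) [act [] [], a, b] = act (cedge (([] \<uplus> \<one>\<^sub>c) \<uplus> \<one>\<^sub>c) ([] \<uplus> (\<one>\<^sub>c \<uplus> \<one>\<^sub>c)) t) [a, b]"
    "act (assoc_path t) [a, b, act [] []] = act (cedge ((\<one>\<^sub>c \<uplus> \<one>\<^sub>c) \<uplus> []) (\<one>\<^sub>c \<uplus> (\<one>\<^sub>c \<uplus> [])) t) [a, b]"
    using assoc_act[OF t, of "\<one>\<^sub>c" "[a]" "[]" "[]" "\<one>\<^sub>c" "[b]"] assoc_act[OF t, of "[]" "[]" "\<one>\<^sub>c" "[a]" "\<one>\<^sub>c" "[b]"]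
      assoc_act[OF t, of "\<one>\<^sub>c" "[a]" "\<one>\<^sub>c" "[b]" "[]" "[]"] X by (simp_all add: act_unit)
  show "act (cedge ([] \<uplus> \<one>\<^sub>c) \<one>\<^sub>c t) [T a b] = act (cedge ([] \<uplus> (\<one>\<^sub>c \<uplus> \<one>\<^sub>c)) (\<one>\<^sub>c \<uplus> \<one>\<^sub>c) t) [a, b]"
    "act (cedge \<one>\<^sub>c (\<one>\<^sub>c \<uplus> []) t) [T a b] = act (cedge (\<one>\<^sub>c \<uplus> \<one>\<^sub>c) ((\<one>\<^sub>c \<uplus> \<one>\<^sub>c) \<uplus> []) t) [a, b]"
    using left_act[OF t, of "\<one>\<^sub>c \<uplus> \<one>\<^sub>c" "[a, b]"] right_act[OF t, of "\<one>\<^sub>c \<uplus> \<one>\<^sub>c" "[a, b]"] X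
    by (simp_all add: T_def[of a b] ok_def)
qed


section \<open>Sources and targets of the modifications as paths of configurations\<close>

abbreviation "frep2 \<equiv> representation.frep MD.B2 (list_top 2 X) (coords0 cs2) (coords1 cs2) (coords2 cs2) X"
abbreviation "trep2 \<equiv> representation.trep MD.B2 (list_top 2 X) (coords0 cs2) (coords1 cs2) X"
abbreviation "frep4 \<equiv> representation.frep MD.B4 (list_top 4 X) (coords0 cs4) (coords1 cs4) (coords2 cs4) X"
abbreviation "trep4 \<equiv> representation.trep MD.B4 (list_top 4 X) (coords0 cs4) (coords1 cs4) X"

lemmas comp2 = representation.trep_comp[OF rep2]
lemmas comp4 = representation.trep_comp[OF rep4]
lemmas id2rep = representation.trep_id[OF rep2]
lemmas id4rep = representation.trep_id[OF rep4]
lemmas box2 = frep_box[OF rep2]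
lemmas box4 = frep_box[OF rep4]
lemmas fI = representation.frep_const[OF rep2 I_in]

lemma configuration_points1:
  assumes "a \<in> topspace X"
  shows "act (\<one>\<^sub>c \<uplus> []) [a] = T a (act [] [])" "act ([] \<uplus> \<one>\<^sub>c) [a] = T (act [] []) a"
  using assms by (simp_all add: T_left T_right)

lemma configuration_points:
  assumes "a \<in> topspace X" "b \<in> topspace X"
  shows "act (\<one>\<^sub>c \<uplus> \<one>\<^sub>c) [a, b] = T a b"
    "act (([] \<uplus> \<one>\<^sub>c) \<uplus> \<one>\<^sub>c) [a, b] = T (T (act [] []) a) b" "act ([] \<uplus> \<one>\<^sub>c \<uplus> \<one>\<^sub>c) [a, b] = T (act [] []) (T a b)"
    "act ((\<one>\<^sub>c \<uplus> []) \<uplus> \<one>\<^sub>c) [a, b] = T (T a (act [] [])) b" "act (\<one>\<^sub>c \<uplus> [] \<uplus> \<one>\<^sub>c) [a, b] = T a (T (act [] []) b)"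
    "act ((\<one>\<^sub>c \<uplus> \<one>\<^sub>c) \<uplus> []) [a, b] = T (T a b) (act [] [])" "act (\<one>\<^sub>c \<uplus> \<one>\<^sub>c \<uplus> []) [a, b] = T a (T b (act [] []))"
  using assms by (simp_all add: T_def[of a b] T_left T_right T_act ok_def)

lemma configuration_points4:
  assumes "a \<in> topspace X" "b \<in> topspace X" "c \<in> topspace X" "d \<in> topspace X"
  shows "act (((\<one>\<^sub>c \<uplus> \<one>\<^sub>c) \<uplus> \<one>\<^sub>c) \<uplus> \<one>\<^sub>c) [a, b, c, d] = T (T (T a b) c) d"
    "act ((\<one>\<^sub>c \<uplus> \<one>\<^sub>c \<uplus> \<one>\<^sub>c) \<uplus> \<one>\<^sub>c) [a, b, c, d] = T (T a (T b c)) d"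
    "act (\<one>\<^sub>c \<uplus> (\<one>\<^sub>c \<uplus> \<one>\<^sub>c) \<uplus> \<one>\<^sub>c) [a, b, c, d] = T a (T (T b c) d)"
    "act ((\<one>\<^sub>c \<uplus> \<one>\<^sub>c) \<uplus> \<one>\<^sub>c \<uplus> \<one>\<^sub>c) [a, b, c, d] = T (T a b) (T c d)"
    "act (\<one>\<^sub>c \<uplus> \<one>\<^sub>c \<uplus> \<one>\<^sub>c \<uplus> \<one>\<^sub>c) [a, b, c, d] = T a (T b (T c d))"
  using assms by (simp_all add: T_def[of a b] T_def[of b c] T_def[of c d] T_left T_right T_act ok_def)

text \<open>The general operations produce a nested case distinction on time. It agrees with the
  concatenation of the three legs because composition of transformations and concatenation use
  double speed with the same bracketing.\<close>

lemma trep_pi_source: "trep4 (\<lambda>x. act' (pi_src \<one>\<^sub>c \<one>\<^sub>c \<one>\<^sub>c \<one>\<^sub>c (fst x), snd x)) MD.pi_source"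
proof -
  note a1 = trep_a_at[OF rep4 f41 f42 f43] and a2 = trep_a_at[OF rep4 f41 box4[OF f42 f43] f44]
    and a3 = trep_a_at[OF rep4 f42 f43 f44]
  note s1 = trep_box[OF rep4 box4[OF box4[OF f41 f42] f43] box4[OF f41 box4[OF f42 f43]] f44 f44 a1 id4rep[OF f44]]
  note s3 = trep_box[OF rep4 f41 f41 box4[OF box4[OF f42 f43] f44] box4[OF f42 box4[OF f43 f44]] id4rep[OF f41] a3]
  note F0 = box4[OF box4[OF box4[OF f41 f42] f43] f44] and F1 = box4[OF box4[OF f41 box4[OF f42 f43]] f44]
    and F2 = box4[OF f41 box4[OF box4[OF f42 f43] f44]] and F3 = box4[OF f41 box4[OF f42 box4[OF f43 f44]]]
  note c1 = comp4[OF F0 F1 F2 s1 a2]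
  note c2 = comp4[OF F0 F2 F3 c1 s3]
  show ?thesis unfolding MD.pi_source_def M_simps
    by (rule representation.trep_cong[OF rep4 c2])
      (auto dest!: list4 simp: ends T_in pieces configuration_points4 act'_def pi_src_def concat_path_def)
qed

lemma trep_pi_target: "trep4 (\<lambda>x. act' (pi_trg \<one>\<^sub>c \<one>\<^sub>c \<one>\<^sub>c \<one>\<^sub>c (fst x), snd x)) MD.pi_target"
proof -
  note a1 = trep_a_at[OF rep4 box4[OF f41 f42] f43 f44] and a2 = trep_a_at[OF rep4 f41 f42 box4[OF f43 f44]]
  note F0 = box4[OF box4[OF box4[OF f41 f42] f43] f44] and F1 = box4[OF box4[OF f41 f42] box4[OF f43 f44]]
    and F3 = box4[OF f41 box4[OF f42 box4[OF f43 f44]]]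
  note c1 = comp4[OF F0 F1 F3 a1 a2]
  show ?thesis unfolding MD.pi_target_def M_simps
    by (rule representation.trep_cong[OF rep4 c1])
      (auto dest!: list4 simp: ends T_in pieces configuration_points4 act'_def pi_trg_def concat_path_def)
qed

lemma trep_mu_source: "trep2 (\<lambda>x. act' (mu_src \<one>\<^sub>c \<one>\<^sub>c (fst x), snd x)) MD.mu_source"
proof -
  note r = trep_unit_at[OF rep2 f21 trep_r] and l = trep_unit_at[OF rep2 f22 trep_l]
    and a = trep_a_at[OF rep2 f21 fI f22]
  note s1 = trep_box[OF rep2 f21 box2[OF f21 fI] f22 f22 r id2rep[OF f22]]
  note s3 = trep_box[OF rep2 f21 f21 box2[OF fI f22] f22 id2rep[OF f21] l]
  note F0 = box2[OF f21 f22] and F1 = box2[OF box2[OF f21 fI] f22] and F2 = box2[OF f21 box2[OF fI f22]]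
  note c1 = comp2[OF F0 F1 F2 s1 a]
  note c2 = comp2[OF F0 F2 F0 c1 s3]
  show ?thesis unfolding MD.mu_source_def M_simps Let_def
    by (rule representation.trep_cong[OF rep2 c2])
      (auto dest!: list2 simp: ends T_in act_unit configuration_points1 configuration_points I_in unit_pieces act'_def mu_src_def concat_path_def)
qed

lemma trep_mu_target: "trep2 (\<lambda>x. act' (const_path (\<one>\<^sub>c \<uplus> \<one>\<^sub>c) (fst x), snd x)) (id_pstrans B (MD.tensor_psfun MD.P21 MD.P22))"
  by (rule representation.trep_cong[OF rep2 id2rep[OF box2[OF f21 f22]]])
    (auto dest!: list2 simp: act'_def const_path_def T_def)

lemma trep_lambda_source: "trep2 (\<lambda>x. act' (lam_src \<one>\<^sub>c \<one>\<^sub>c (fst x), snd x)) MD.lambda_source"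
proof -
  note l = trep_unit_at[OF rep2 f21 trep_l]
  note s1 = trep_box[OF rep2 box2[OF fI f21] f21 f22 f22 l id2rep[OF f22]]
  show ?thesis unfolding MD.lambda_source_def M_simps
    by (rule representation.trep_cong[OF rep2 s1])
      (auto dest!: list2 simp: ends T_in act_unit configuration_points1 configuration_points I_in unit_pieces act'_def lam_src_def)
qed

lemma trep_lambda_target: "trep2 (\<lambda>x. act' (lam_trg \<one>\<^sub>c \<one>\<^sub>c (fst x), snd x)) MD.lambda_target"
proof -
  note l = trep_unit_at[OF rep2 box2[OF f21 f22] trep_l] and a = trep_a_at[OF rep2 fI f21 f22]
  note c1 = comp2[OF box2[OF box2[OF fI f21] f22] box2[OF fI box2[OF f21 f22]] box2[OF f21 f22] a l]
  show ?thesis unfolding MD.lambda_target_def M_simps Let_def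
    by (rule representation.trep_cong[OF rep2 c1])
      (auto dest!: list2 simp: ends T_in act_unit configuration_points1 configuration_points I_in unit_pieces act'_def lam_trg_def concat_path_def)
qed

lemma trep_rho_source: "trep2 (\<lambda>x. act' (rho_src \<one>\<^sub>c \<one>\<^sub>c (fst x), snd x)) MD.rho_source"
proof -
  note r = trep_unit_at[OF rep2 f22 trep_r]
  note s1 = trep_box[OF rep2 f21 f21 f22 box2[OF f22 fI] id2rep[OF f21] r]
  show ?thesis unfolding MD.rho_source_def M_simps
    by (rule representation.trep_cong[OF rep2 s1])
      (auto dest!: list2 simp: ends T_in act_unit configuration_points1 configuration_points I_in unit_pieces act'_def rho_src_def)
qed

lemma trep_rho_target: "trep2 (\<lambda>x. act' (rho_trg \<one>\<^sub>c \<one>\<^sub>c (fst x), snd x)) MD.rho_target"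
proof -
  note r = trep_unit_at[OF rep2 box2[OF f21 f22] trep_r] and a = trep_a_at[OF rep2 f21 f22 fI]
  note c1 = comp2[OF box2[OF f21 f22] box2[OF box2[OF f21 f22] fI] box2[OF f21 box2[OF f22 fI]] r a]
  show ?thesis unfolding MD.rho_target_def M_simps Let_def
    by (rule representation.trep_cong[OF rep2 c1])
      (auto dest!: list2 simp: ends T_in act_unit configuration_points1 configuration_points I_in unit_pieces act'_def rho_trg_def concat_path_def)
qed

text \<open>Source and target are now induced by two parallel paths in one configuration space,
  which is the situation of \<open>trep_modification\<close>.\<close>

lemma pi_modification: "invertible_modification MD.B4 B
    (MD.tensor_psfun (MD.tensor_psfun (MD.tensor_psfun MD.P41 MD.P42) MD.P43) MD.P44)
    (MD.tensor_psfun MD.P41 (MD.tensor_psfun MD.P42 (MD.tensor_psfun MD.P43 MD.P44))) MD.pi_source MD.pi_target (pim M)"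
proof (rule representation.trep_modification[OF rep4 equiconnected_Conf act'_continuous _
        box4[OF box4[OF box4[OF f41 f42] f43] f44] box4[OF f41 box4[OF f42 box4[OF f43 f44]]] trep_pi_source trep_pi_target])
  show "pim M a = lift X (Conf 4) (\<lambda>c. act' (c, coords0 cs4 a)) (pi_src \<one>\<^sub>c \<one>\<^sub>c \<one>\<^sub>c \<one>\<^sub>c) (pi_trg \<one>\<^sub>c \<one>\<^sub>c \<one>\<^sub>c \<one>\<^sub>c)" for a
    by (cases a) (simp add: M_def K_def act'_def coords0_def cs4_def numeral_eq_Suc)
qed (auto dest!: list4 simp: configuration_points4 pi_src_def pi_trg_def act'_def parallel_def concat_path_paths cedge_paths)

lemma mu_modification: "invertible_modification MD.B2 B (MD.tensor_psfun MD.P21 MD.P22) (MD.tensor_psfun MD.P21 MD.P22)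
    MD.mu_source (id_pstrans B (MD.tensor_psfun MD.P21 MD.P22)) (mum M)"
proof (rule representation.trep_modification[OF rep2 equiconnected_Conf act'_continuous _
        box2[OF f21 f22] box2[OF f21 f22] trep_mu_source trep_mu_target])
  show "mum M a = lift X (Conf 2) (\<lambda>c. act' (c, coords0 cs2 a)) (mu_src \<one>\<^sub>c \<one>\<^sub>c) (const_path (\<one>\<^sub>c \<uplus> \<one>\<^sub>c))" for a
    by (cases a) (simp add: M_def K_def act'_def coords0_def cs2_def numeral_eq_Suc)
qed (auto dest!: list2 simp: configuration_points mu_src_def act'_def parallel_def concat_path_paths cedge_paths)

lemma lambda_modification: "invertible_modification MD.B2 B
    (MD.tensor_psfun (MD.tensor_psfun (const_psfun B (act [] [])) MD.P21) MD.P22) (MD.tensor_psfun MD.P21 MD.P22)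
    MD.lambda_source MD.lambda_target (lam M)"
proof (rule representation.trep_modification[OF rep2 equiconnected_Conf act'_continuous _
        box2[OF box2[OF fI f21] f22] box2[OF f21 f22] trep_lambda_source trep_lambda_target])
  show "lam M a = lift X (Conf 2) (\<lambda>c. act' (c, coords0 cs2 a)) (lam_src \<one>\<^sub>c \<one>\<^sub>c) (lam_trg \<one>\<^sub>c \<one>\<^sub>c)" for a
    by (cases a) (simp add: M_def K_def act'_def coords0_def cs2_def numeral_eq_Suc)
qed (auto dest!: list2 simp: configuration_points lam_src_def lam_trg_def act'_def parallel_def concat_path_paths cedge_paths)

lemma rho_modification: "invertible_modification MD.B2 B (MD.tensor_psfun MD.P21 MD.P22)
    (MD.tensor_psfun MD.P21 (MD.tensor_psfun MD.P22 (const_psfun B (act [] []))))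
    MD.rho_source MD.rho_target (rhm M)"
proof (rule representation.trep_modification[OF rep2 equiconnected_Conf act'_continuous _
        box2[OF f21 f22] box2[OF f21 box2[OF f22 fI]] trep_rho_source trep_rho_target])
  show "rhm M a = lift X (Conf 2) (\<lambda>c. act' (c, coords0 cs2 a)) (rho_src \<one>\<^sub>c \<one>\<^sub>c) (rho_trg \<one>\<^sub>c \<one>\<^sub>c)" for a
    by (cases a) (simp add: M_def K_def act'_def coords0_def cs2_def numeral_eq_Suc)
qed (auto dest!: list2 simp: configuration_points rho_src_def rho_trg_def act'_def parallel_def concat_path_paths cedge_paths)

lemma monoidal: "monoidal_bicategory (\<Pi>\<^sub>2 X) M"
proof (intro monoidal_bicategory.intro fundamental_bicategory monoidal_bicategory_axioms.intro, unfold M_simps)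
  fix k j h g f assume "k \<in> Ob B" "j \<in> Ob B" "h \<in> Ob B" "g \<in> Ob B" "f \<in> Ob B"
  \<comment> \<open>By \<open>act_unit\<close> each object is a value of the action at the unit
    configuration.\<close>
  then show "MD.cocycle_left k j h g f = MD.cocycle_right k j h g f"
    using cocycle_act[of "\<one>\<^sub>c" "[k]" "\<one>\<^sub>c" "[j]" "\<one>\<^sub>c" "[h]" "\<one>\<^sub>c" "[g]" "\<one>\<^sub>c" "[f]"] by (simp add: act_unit)
next
  fix h g f assume "h \<in> Ob B" "g \<in> Ob B" "f \<in> Ob B"
  then show "MD.unit_axiom1_left h g f = MD.unit_axiom1_right h g f" "MD.unit_axiom2_left h g f = MD.unit_axiom2_right h g f"
    using unit_axiom1_act[of "\<one>\<^sub>c" "[h]" "\<one>\<^sub>c" "[g]" "\<one>\<^sub>c" "[f]"] unit_axiom2_act[of "\<one>\<^sub>c" "[h]" "\<one>\<^sub>c" "[g]" "\<one>\<^sub>c" "[f]"]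
    by (simp_all add: act_unit)
qed (use ten_pseudofunctor I_in associativity_equivalence left_unit_equivalence right_unit_equivalence
    pi_modification mu_modification lambda_modification rho_modification in simp_all)

end

theorem theorem14:
  fixes X :: "'a topology"
    and \<theta> :: "nat \<Rightarrow> (nat \<Rightarrow> real \<times> real) \<Rightarrow> (nat \<Rightarrow> 'a) \<Rightarrow> 'a"
  assumes "C1_algebra X \<theta>"
  shows "\<exists>M. monoidal_bicategory (\<Pi>\<^sub>2 X) M"
  using C1_algebra.monoidal[OF assms] by blast

end
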